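(* Let $F$ be a local field of characteristic zero, let $\mathsf d\ge 1$ and $\mathsf m\ge 1$ be integers, and let $\Phi=\Phi_0\otimes F^{\mathsf m}$, where $\Phi_0$ is the $(\mathsf d+1)$-dimensional irreducible representation of $\mathrm{SL}_2(F)$; let $\pi^+:\Phi\to\Phi^{\mathrm{hw}}$ be the projection onto the highest weight space, and let $u_r$ act on $\Phi$, as described in the context. Let $0<\alpha<\mathsf m(\mathsf d+1)$ and $0<\delta<1$. Let $\Theta\subset B_1^{\Phi}$ satisfy $$\mathcal N_\delta(\Theta)\ge\delta^{-\alpha}.$$ Then for all small enough $\epsilon>0$ and all large enough $C$ (the thresholds not depending on $\delta$ or $\Theta$), at least one of the following holds. (1) There exists a subset $\mathsf B\subset B_1^{F}$ with $|B_1^{F}\setminus\mathsf B|\le\delta^{\epsilon}$ such that $$\mathcal N_\delta\bigl(\pi^+(u_r\Theta)\bigr)\ge\delta^{-\frac{\alpha}{\mathsf d+1}-\epsilon}\qquad\text{for all } r\in\mathsf B.$$ (2) There is a representation box $v+V$ in $\Phi$ satisfying $$\delta^{-\alpha+C\epsilon}\ll\mathcal N_\delta(V)\ll\delta^{-\alpha-C\epsilon},$$ $$\mathcal N_\delta\bigl(\Theta\cap\mathrm{Nhd}_{C\delta}(v+V)\bigr)\gg\delta^{-\alpha+C\epsilon}.$$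
   Context: $B_1^{F}=\{r\in F:|r|\le1\}$, $|E|$ denotes the Haar measure of a measurable $E\subset F$, and $B_1^{\Phi}$ is the unit ball in $\Phi$ centered at $0$. $\mathcal N_\delta(E)$ denotes the $\delta$-covering number of $E$ (the least number of balls of radius $\delta$ needed to cover $E$), and $\mathrm{Nhd}_{\rho}(E)$ denotes the $\rho$-neighborhood of $E$. The implied constants in $\ll,\gg$ do not depend on $\delta$ or $\Theta$. $\Phi_0$ is the $(\mathsf d+1)$-dimensional irreducible representation of $\mathrm{SL}_2(F)$, and $\Phi=\bigoplus_{i=1}^{\mathsf m}\Phi_0$, identified with $\Phi_0\otimes F^{\mathsf m}$ and also with $\mathrm{Mat}_{(\mathsf d+1)\times\mathsf m}(F)$, on which $\mathrm{SL}_2(F)$ acts by left matrix multiplication through the representation $\Phi_0$. For $r\in F$, $u_r$ is the action of $\begin{pmatrix}1&r\\0&1\end{pmatrix}$. Let $e_0,\dots,e_{\mathsf d}\in\Phi_0$ be unit pure weight vectors, $e_i$ having weight $\mathsf d-2i$ for the diagonal torus (so $\mathrm{diag}(\lambda,\lambda^{-1})e_i=\lambda^{\mathsf d-2i}e_i$). Put $\Phi_0^{\mathrm{hw}}=F e_0$ and $\Phi^{\mathrm{hw}}=\bigoplus_{i=1}^{\mathsf m}\Phi_0^{\mathrm{hw}}=F e_0\otimes F^{\mathsf m}$. The map $\pi^+:\Phi\to\Phi^{\mathrm{hw}}$ is the projection parallel to $(Fe_1\oplus\cdots\oplus Fe_{\mathsf d})\otimes F^{\mathsf m}$. A representation box in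 $\Phi$ is a set $v+V$ with $v\in\Phi$ and $$V=\Bigl\{\sum_{i,j} r_{ij}\,e_i\otimes w_j:\ 0\le i\le\mathsf d,\ 0\le j\le k,\ r_{ij}\in B_1^{F}\Bigr\},$$ where $\{w_0,\dots,w_k\}\subset F^{\mathsf m}$ is an orthogonal set (vectors of arbitrary lengths; when $F$ is non-archimedean, orthogonal means $\|\sum c_jw_j\|=\max_j|c_j|\|w_j\|$ for all $c_j\in F$). *)

theory Defs
  imports "HOL-Analysis.Analysis" "Jordan_Normal_Form.VS_Connect"
begin

section \<open>Local fields of characteristic zero\<close>

class absval_field = field_char_0 +
  fixes absval :: "'a \<Rightarrow> real"
  assumes absval_mult: "absval (x * y) = absval x * absval y"
begin

definition isometric_embedding :: "('a \<Rightarrow> complex) \<Rightarrow> bool" where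
  "isometric_embedding \<phi> \<longleftrightarrow>
     (\<forall>x y. \<phi> (x + y) = \<phi> x + \<phi> y) \<and> (\<forall>x y. \<phi> (x * y) = \<phi> x * \<phi> y) \<and> \<phi> 1 = 1 \<and>
     (\<forall>x. cmod (\<phi> x) = absval x)"

definition nonarchimedean :: "'a itself \<Rightarrow> bool" where
  "nonarchimedean _ \<longleftrightarrow> (\<forall>x y::'a. absval (x + y) \<le> max (absval x) (absval y))"

end

text \<open>
  A local field is a non-discrete locally compact field whose topology comes from an absolute
  value, written \<^const>\<open>absval\<close> here.  A non-archimedean absolute value is not normalised (any choice
  within its equivalence class is allowed); an archimedean one is the usual one: since a local
  field is complete, an isometric embedding into the complex numbers has image the real line or
  the whole plane.
\<close>

class local_field_char_0 = absval_field + metric_space +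
  assumes dist_absval: "dist x y = absval (x - y)"
    and absval_nontrivial: "\<exists>x. absval x \<noteq> 0 \<and> absval x \<noteq> 1"
    and absval_locally_compact: "\<exists>e>0. compact {x. dist 0 x \<le> e}"
    and absval_ultrametric_or_usual:
      "nonarchimedean TYPE('a) \<or> (\<exists>\<phi>. isometric_embedding \<phi>)"

instantiation real :: absval_field
begin

definition absval_real :: "real \<Rightarrow> real" where
  "absval_real = norm"

instance
  by standard (simp add: absval_real_def abs_mult)

end

instance real :: local_field_char_0
proof
  show "dist x y = absval (x - y)" for x y :: real
    by (simp add: absval_real_def dist_norm)
  show "\<exists>x::real. absval x \<noteq> 0 \<and> absval x \<noteq> 1"
    by (rule exI[of _ 2]) (simp add: absval_real_def)
  show "\<exists>e>0. compact {x::real. dist 0 x \<le> e}"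
    using compact_cball[of "0::real" 1] unfolding cball_def by (intro exI[of _ 1]) simp
  have "isometric_embedding (of_real :: real \<Rightarrow> complex)"
    by (simp add: isometric_embedding_def absval_real_def)
  then show "nonarchimedean TYPE(real) \<or> (\<exists>\<phi>::real \<Rightarrow> complex. isometric_embedding \<phi>)"
    by blast
qed

instantiation complex :: absval_field
begin

definition absval_complex :: "complex \<Rightarrow> real" where
  "absval_complex = norm"

instance
  by standard (simp add: absval_complex_def norm_mult)

end

instance complex :: local_field_char_0
proof
  show "dist x y = absval (x - y)" for x y :: complex
    by (simp add: absval_complex_def dist_norm)
  show "\<exists>x::complex. absval x \<noteq> 0 \<and> absval x \<noteq> 1"
    by (rule exI[of _ 2]) (simp add: absval_complex_def)
  show "\<exists>e>0. compact {x::complex. dist 0 x \<le> e}"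
    using compact_cball[of "0::complex" 1] unfolding cball_def by (intro exI[of _ 1]) simp
  have "isometric_embedding ((\<lambda>z. z) :: complex \<Rightarrow> complex)"
    by (simp add: isometric_embedding_def absval_complex_def)
  then show "nonarchimedean TYPE(complex) \<or> (\<exists>\<phi>::complex \<Rightarrow> complex. isometric_embedding \<phi>)"
    by blast
qed

text \<open>Regularity is automatic, as local fields are sigma-compact metric spaces.\<close>

definition haar_measure :: "'a::{t2_space,plus} measure \<Rightarrow> bool" where
  "haar_measure \<mu> \<longleftrightarrow>
     sets \<mu> = sets borel \<and>
     (\<forall>x. \<forall>A\<in>sets borel. emeasure \<mu> ((\<lambda>y. x + y) ` A) = emeasure \<mu> A) \<and>
     (\<forall>K. compact K \<longrightarrow> emeasure \<mu> K < \<infinity>) \<and>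
     emeasure \<mu> UNIV \<noteq> 0"

definition unit_ball_F :: "'a::local_field_char_0 set" where
  "unit_ball_F = {r. absval r \<le> 1}"


section \<open>Norms and orthogonality\<close>

text \<open>Euclidean or Hermitian norm over an archimedean field, maximum norm otherwise.\<close>

definition coord_norm :: "('i \<Rightarrow> 'a::local_field_char_0) \<Rightarrow> 'i set \<Rightarrow> real" where
  "coord_norm x I =
     (if nonarchimedean TYPE('a) then Max ((\<lambda>i. absval (x i)) ` I)
      else L2_set (\<lambda>i. absval (x i)) I)"

definition vec_norm :: "'a::local_field_char_0 vec \<Rightarrow> real" where
  "vec_norm v = coord_norm (\<lambda>i. v $ i) {..<dim_vec v}"

definition mat_norm :: "'a::local_field_char_0 mat \<Rightarrow> real" where
  "mat_norm A = coord_norm (\<lambda>ij. A $$ ij) ({..<dim_row A} \<times> {..<dim_col A})"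

text \<open>
  In the archimedean case the embedding realises the field as the real or complex numbers, and is
  unique up to complex conjugation, so that orthogonality does not depend on its choice.
\<close>

definition orthogonal_family ::
    "nat \<Rightarrow> nat \<Rightarrow> (nat \<Rightarrow> 'a::local_field_char_0 vec) \<Rightarrow> bool" where
  "orthogonal_family m k w \<longleftrightarrow>
     (if nonarchimedean TYPE('a) then
        \<forall>c::nat \<Rightarrow> 'a. vec_norm (vec m (\<lambda>l. \<Sum>j\<le>k. c j * w j $ l)) =
          Max ((\<lambda>j. absval (c j) * vec_norm (w j)) ` {..k})
      else
        \<exists>\<phi>::'a \<Rightarrow> complex. isometric_embedding \<phi> \<and>
          (\<forall>i\<le>k. \<forall>j\<le>k. i \<noteq> j \<longrightarrow> (\<Sum>l<m. \<phi> (w i $ l) * cnj (\<phi> (w j $ l))) = 0))"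


section \<open>Representations of SL(2)\<close>

definition SL2 :: "'a::field mat set" where
  "SL2 = {g \<in> carrier_mat 2 2. Determinant.det g = 1}"

definition upper_unip :: "'a::field \<Rightarrow> 'a mat" where
  "upper_unip r = mat_of_rows_list 2 [[1, r], [0, 1]]"

definition torus_elt :: "'a::field \<Rightarrow> 'a mat" where
  "torus_elt t = mat_of_rows_list 2 [[t, 0], [0, inverse t]]"

definition SL2_representation :: "nat \<Rightarrow> ('a::field mat \<Rightarrow> 'a mat) \<Rightarrow> bool" where
  "SL2_representation n \<rho> \<longleftrightarrow>
     (\<forall>g\<in>SL2. \<rho> g \<in> carrier_mat n n) \<and> \<rho> (1\<^sub>m 2) = 1\<^sub>m n \<and>
     (\<forall>g\<in>SL2. \<forall>h\<in>SL2. \<rho> (g * h) = \<rho> g * \<rho> h)"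

definition irreducible_SL2_representation :: "nat \<Rightarrow> ('a::field mat \<Rightarrow> 'a mat) \<Rightarrow> bool" where
  "irreducible_SL2_representation n \<rho> \<longleftrightarrow>
     SL2_representation n \<rho> \<and> 0 < n \<and>
     (\<forall>W. VectorSpace.subspace class_ring W (module_vec TYPE('a) n) \<and>
          (\<forall>g\<in>SL2. \<forall>x\<in>W. \<rho> g *\<^sub>v x \<in> W) \<longrightarrow>
          W = {0\<^sub>v n} \<or> W = carrier_vec n)"

text \<open>
  The irreducible representation of dimension \<open>d + 1\<close>, written in a basis
  \<open>e\<^sub>0, \<dots>, e\<^sub>d\<close> of unit weight vectors, which becomes the standard basis.  The weights and
  irreducibility force \<open>\<rho>\<close> to be the algebraic representation \<open>Sym\<^sup>d\<close> up to rescaling the basis,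
  so no continuity or algebraicity needs to be assumed.
\<close>

definition standard_irrep :: "nat \<Rightarrow> ('a::field mat \<Rightarrow> 'a mat) \<Rightarrow> bool" where
  "standard_irrep d \<rho> \<longleftrightarrow>
     irreducible_SL2_representation (d + 1) \<rho> \<and>
     (\<forall>t i. t \<noteq> 0 \<longrightarrow> i \<le> d \<longrightarrow>
        \<rho> (torus_elt t) *\<^sub>v unit_vec (d + 1) i =
          (t powi (int d - 2 * int i)) \<cdot>\<^sub>v unit_vec (d + 1) i)"


section \<open>The space \<open>\<Phi>\<close>\<close>

definition Phi :: "nat \<Rightarrow> nat \<Rightarrow> 'a::local_field_char_0 mat set" where
  "Phi d m = carrier_mat (d + 1) m"

definition unit_ball_Phi :: "nat \<Rightarrow> nat \<Rightarrow> 'a::local_field_char_0 mat set" where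
  "unit_ball_Phi d m = {x \<in> Phi d m. mat_norm x \<le> 1}"

definition u_act :: "('a::local_field_char_0 mat \<Rightarrow> 'a mat) \<Rightarrow> 'a \<Rightarrow> 'a mat \<Rightarrow> 'a mat" where
  "u_act \<rho> r x = \<rho> (upper_unip r) * x"

text \<open>The highest weight space consists of the matrices supported in row \<open>0\<close>.\<close>

definition pi_plus :: "nat \<Rightarrow> nat \<Rightarrow> 'a::local_field_char_0 mat \<Rightarrow> 'a mat" where
  "pi_plus d m x = mat (d + 1) m (\<lambda>(i, l). if i = 0 then x $$ (i, l) else 0)"

text \<open>
  For subsets of the highest weight space it makes no difference whether the centres are taken
  there or in \<open>\<Phi>\<close>, as \<^const>\<open>pi_plus\<close> does not increase norms.  Only bounded sets, which have
  finite covers, are relevant.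
\<close>

definition covering_number ::
    "nat \<Rightarrow> nat \<Rightarrow> real \<Rightarrow> 'a::local_field_char_0 mat set \<Rightarrow> nat" where
  "covering_number d m \<delta> E =
     (LEAST n. \<exists>P \<subseteq> Phi d m. finite P \<and> card P = n \<and>
        E \<subseteq> (\<Union>c\<in>P. {x \<in> Phi d m. mat_norm (x - c) \<le> \<delta>}))"

definition Nhd :: "nat \<Rightarrow> nat \<Rightarrow> real \<Rightarrow> 'a::local_field_char_0 mat set \<Rightarrow> 'a mat set" where
  "Nhd d m \<eta> E = {x \<in> Phi d m. \<exists>y\<in>E. mat_norm (x - y) < \<eta>}"

definition tensor :: "'a::semiring_1 vec \<Rightarrow> 'a vec \<Rightarrow> 'a mat" where
  "tensor v w = mat (dim_vec v) (dim_vec w) (\<lambda>(i, l). v $ i * w $ l)"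

definition box_at_zero ::
    "nat \<Rightarrow> nat \<Rightarrow> nat \<Rightarrow> (nat \<Rightarrow> 'a::local_field_char_0 vec) \<Rightarrow> 'a mat set" where
  "box_at_zero d m k w =
     {mat (d + 1) m (\<lambda>pq. \<Sum>i\<le>d. \<Sum>j\<le>k. r i j * tensor (unit_vec (d + 1) i) (w j) $$ pq) | r.
        \<forall>i\<le>d. \<forall>j\<le>k. r i j \<in> unit_ball_F}"

definition representation_box ::
    "nat \<Rightarrow> nat \<Rightarrow> 'a::local_field_char_0 mat \<Rightarrow> 'a mat set \<Rightarrow> bool" where
  "representation_box d m v V \<longleftrightarrow>
     v \<in> Phi d m \<and>
     (\<exists>k w. (\<forall>j\<le>k. w j \<in> carrier_vec m) \<and> orthogonal_family m k w \<and> V = box_at_zero d m k w)"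

end

theory Submission
  imports Defs
begin

text \<open>
  In coordinates, \<open>\<pi>\<^sup>+ (u\<^sub>r \<theta>)\<close> is the point \<open>\<Sum>p\<le>d. c\<^sub>p r\<^sup>p \<theta>\<^sub>p\<close> of a moment curve in \<open>F\<^sup>m\<close>, where no \<open>c\<^sub>p\<close>
  vanishes.  If the conclusion about projections fails, many separated parameters \<open>r\<close> have small
  projections, and \<open>d + 1\<close> of them determine \<open>\<theta>\<close>; so \<open>\<Theta>\<close> is, up to powers of \<open>L = \<delta> powr (- 2 * \<epsilon>)\<close>, a
  product of \<open>d + 1\<close> copies of one projection, and that projection is forced to look like an
  approximate module in \<open>F\<^sup>m\<close>.  An induction on the dimension \<open>m\<close> identifies it with a box; an
  orthogonal basis for the box comes from the Gram-Schmidt process.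
\<close>

section \<open>Absolute values\<close>

text \<open>If the projection bound fails, the bad parameters have measure more than
  \<open>\<delta> powr \<epsilon>\<close>, and the proof exploits that such a set has almost full
  dimension: up to powers of \<open>L\<close> it contains \<open>\<delta> powr (- D)\<close>
  separated parameters. Two points of \<open>\<Theta>\<close> that agree at \<open>d\<close>
  parameters, \<open>r\<close> among them, differ by a polynomial with \<open>d\<close> known
  approximate zeros; so their differences at further parameters \<open>s\<close> and
  \<open>t\<close> are proportional, with a factor \<open>lam r s\<close> that moves with
  \<open>r\<close>. With the other \<open>d - 1\<close> zeros fixed, one difference vector at
  \<open>t\<close> yields differences at \<open>s\<close> along a whole line, and almost full
  dimension of the set of \<open>r\<close> fills a segment of that line. Dividing out the segment
  reduces the size of every projection by the size of the segment; this is the induction step. The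
  obstacle is that the quotient must have small projections at every parameter of \<open>R\<close>,
  not only at the few chosen ones; therefore only quotient points with full fibres are kept.
  \<open>D\<close> is a real exponent read off from the growth of the Haar measure, as the absolute
  value is not normalised.\<close>

lemma absval_eq_dist: "absval x = dist x (0::'a::local_field_char_0)"
  by (simp add: dist_absval)

lemma absval_nonneg [simp]: "0 \<le> absval (x::'a::local_field_char_0)"
  by (simp add: absval_eq_dist)

lemma absval_eq_0_iff [simp]: "absval (x::'a::local_field_char_0) = 0 \<longleftrightarrow> x = 0"
  by (simp add: absval_eq_dist)

lemma absval_0 [simp]: "absval (0::'a::local_field_char_0) = 0"
  by simp

lemma absval_pos_iff [simp]: "0 < absval (x::'a::local_field_char_0) \<longleftrightarrow> x \<noteq> 0"
  by (metis absval_nonneg absval_eq_0_iff order_less_le)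

lemma absval_1 [simp]: "absval (1::'a::local_field_char_0) = 1"
proof -
  have "absval (1::'a) * absval (1::'a) = absval (1::'a)"
    using absval_mult[of "1::'a" 1] by simp
  then show ?thesis
    using absval_eq_0_iff[of "1::'a"] by simp
qed

lemma absval_minus [simp]: "absval (- x) = absval (x::'a::local_field_char_0)"
  using dist_commute[of x 0] by (simp add: dist_absval)

lemma absval_minus_commute: "absval (x - y) = absval (y - (x::'a::local_field_char_0))"
  using dist_commute[of x y] by (simp add: dist_absval)

lemma absval_triangle: "absval (x + y) \<le> absval x + absval (y::'a::local_field_char_0)"
  using dist_triangle[of x "- y" 0] by (simp add: dist_absval)

lemma absval_triangle_diff: "absval (x - y) \<le> absval x + absval (y::'a::local_field_char_0)"
  using absval_triangle[of x "- y"] by simp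

lemma absval_triangle_le: "absval x \<le> a \<Longrightarrow> absval y \<le> b \<Longrightarrow> absval (x + y) \<le> a + b"
  for x y :: "'a::local_field_char_0"
  using absval_triangle[of x y] by linarith

lemma absval_triangle_diff_le: "absval x \<le> a \<Longrightarrow> absval y \<le> b \<Longrightarrow> absval (x - y) \<le> a + b"
  for x y :: "'a::local_field_char_0"
  using absval_triangle_diff[of x y] by linarith

lemma absval_power: "absval (x ^ n) = absval (x::'a::local_field_char_0) ^ n"
  by (induction n) (simp_all add: absval_mult)

lemma absval_prod: "absval (prod f S) = (\<Prod>i\<in>S. absval (f i :: 'a::local_field_char_0))"
  by (induction S rule: infinite_finite_induct) (simp_all add: absval_mult)

lemma absval_inverse: "absval (inverse x) = inverse (absval (x::'a::local_field_char_0))"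
proof (cases "x = 0")
  case False
  then have "absval (inverse x) * absval x = 1"
    by (metis absval_1 absval_mult left_inverse)
  then show ?thesis
    by (metis inverse_unique mult.commute)
qed simp

lemma absval_divide: "absval (x / y) = absval x / absval (y::'a::local_field_char_0)"
  by (simp add: divide_inverse absval_mult absval_inverse)

lemma absval_sum_le: "absval (sum f S) \<le> (\<Sum>i\<in>S. absval (f i :: 'a::local_field_char_0))"
proof (induction S rule: infinite_finite_induct)
  case (insert x F)
  then show ?case
    using absval_triangle[of "f x" "sum f F"] by simp
qed simp_all

lemma absval_sum_bound:
  fixes f :: "'i \<Rightarrow> 'a::local_field_char_0"
  assumes "\<And>i. i \<in> S \<Longrightarrow> absval (f i) \<le> B"
  shows "absval (sum f S) \<le> real (card S) * B"
  using absval_sum_le[of f S] sum_bounded_above[of S "\<lambda>i. absval (f i)" B] assms by auto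

lemma ultrametric_sum_le:
  fixes f :: "'i \<Rightarrow> 'a::local_field_char_0"
  assumes "nonarchimedean TYPE('a)" "0 \<le> B" "\<And>i. i \<in> S \<Longrightarrow> absval (f i) \<le> B"
  shows "absval (sum f S) \<le> B"
  using assms(3)
proof (induction S rule: infinite_finite_induct)
  case (insert x F)
  have "absval (f x + sum f F) \<le> max (absval (f x)) (absval (sum f F))"
    using assms(1) by (simp add: nonarchimedean_def)
  then show ?case
    using insert by fastforce
qed (use assms(2) in auto)

lemma small_element_exists:
  fixes \<epsilon> :: real
  assumes "0 < \<epsilon>"
  shows "\<exists>\<tau>::'a::local_field_char_0. \<tau> \<noteq> 0 \<and> absval \<tau> < \<epsilon>"
proof -
  obtain x :: 'a where x: "absval x \<noteq> 0" "absval x \<noteq> 1"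
    using absval_nontrivial by blast
  define y where "y = (if absval x < 1 then x else inverse x)"
  have y: "y \<noteq> 0" "absval y < 1"
    using x by (auto simp: y_def absval_inverse inverse_less_1_iff)
  obtain n where "absval y ^ n < \<epsilon>"
    using real_arch_pow_inv[OF assms y(2)] by blast
  then show ?thesis
    using y(1) by (intro exI[of _ "y ^ n"]) (simp add: absval_power)
qed

text \<open>The absolute value may take discrete values, so a prescribed size is reached only up to
  a factor. Powers of one element \<open>\<tau>\<close> suffice, and \<open>\<Lambda>\<close> is the
  inverse of \<open>absval \<tau>\<close>.\<close>

lemma scale_exists:
  shows "\<exists>\<Lambda>\<ge>1. \<forall>\<rho>>0. \<exists>x::'a::local_field_char_0. \<rho> \<le> absval x \<and> absval x \<le> \<Lambda> * \<rho>"
proof -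
  obtain \<tau> :: 'a where \<tau>: "\<tau> \<noteq> 0" "absval \<tau> < 1"
    using small_element_exists[where 'a = 'a and \<epsilon> = 1] by auto
  define a where "a = inverse (absval \<tau>)"
  have a: "1 < a"
    using \<tau> by (simp add: a_def one_less_inverse_iff)
  have "\<exists>x::'a. \<rho> \<le> absval x \<and> absval x \<le> a * \<rho>" if "0 < \<rho>" for \<rho>
  proof -
    define n where "n = \<lceil>log a \<rho>\<rceil>"
    define x where "x = inverse \<tau> powi n"
    have "absval x = a powi n"
      by (simp add: x_def a_def power_int_def absval_power absval_inverse)
    then have ax: "absval x = a powr real_of_int n"
      using a by (simp add: powr_real_of_int')
    have l: "log a \<rho> \<le> n" "n \<le> log a \<rho> + 1"
      unfolding n_def by linarith+
    have "a powr log a \<rho> \<le> a powr n" "a powr n \<le> a powr (log a \<rho> + 1)"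
      using a l by (auto intro!: powr_mono)
    moreover have "a powr log a \<rho> = \<rho>" "a powr (log a \<rho> + 1) = a * \<rho>"
      using a that by (auto simp: powr_add)
    ultimately show ?thesis
      using ax by (intro exI[of _ x]) simp
  qed
  then show ?thesis
    using a by (intro exI[of _ a]) auto
qed

section \<open>Compactness and volume of balls\<close>

abbreviation fball :: "real \<Rightarrow> 'a::local_field_char_0 set" where
  "fball \<rho> \<equiv> {x. absval x \<le> \<rho>}"

lemma fball_eq_cball: "fball \<rho> = cball (0::'a::local_field_char_0) \<rho>"
  by (auto simp: dist_absval)

lemma translate_fball: "(+) x ` fball \<rho> = cball (x::'a::local_field_char_0) \<rho>"
proof -
  have "y \<in> (+) x ` fball \<rho>" if "dist x y \<le> \<rho>" for y
    using that by (intro image_eqI[of _ _ "y - x"]) (auto simp: dist_absval absval_minus_commute)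
  then show ?thesis
    by (auto simp: dist_absval)
qed

lemma compact_scale: "compact S \<Longrightarrow> compact ((*) (c::'a::local_field_char_0) ` S)"
proof (rule compact_continuous_image)
  have *: "dist (c * x) (c * y) = absval c * dist x y" for x y :: 'a
    by (simp add: dist_absval absval_mult flip: right_diff_distrib)
  have "(absval c)-lipschitz_on S ((*) c)"
    by (intro lipschitz_onI) (simp_all add: *)
  then show "continuous_on S ((*) c)"
    by (rule lipschitz_on_continuous_on)
qed

text \<open>Local compactness provides one compact ball; multiplication by a small element maps the
  given ball into it, and the inverse multiplication carries compactness back.\<close>

lemma compact_fball: "compact (fball \<rho> :: 'a::local_field_char_0 set)"
proof -
  obtain e where e: "0 < e" "compact {x::'a. dist 0 x \<le> e}"
    using absval_locally_compact by blast
  have "0 < e / (\<bar>\<rho>\<bar> + 1)"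
    using e(1) by (simp add: add_nonneg_pos)
  then obtain \<tau> :: 'a where \<tau>: "\<tau> \<noteq> 0" "absval \<tau> < e / (\<bar>\<rho>\<bar> + 1)"
    using small_element_exists by blast
  have "fball \<rho> \<subseteq> (*) (inverse \<tau>) ` {x. dist 0 x \<le> e}"
  proof
    fix x :: 'a assume "x \<in> fball \<rho>"
    then have "absval \<tau> * absval x \<le> e / (\<bar>\<rho>\<bar> + 1) * (\<bar>\<rho>\<bar> + 1)"
      using \<tau> e(1) by (intro mult_mono) auto
    then show "x \<in> (*) (inverse \<tau>) ` {x. dist 0 x \<le> e}"
      using \<tau> by (intro image_eqI[of _ _ "\<tau> * x"]) (auto simp: dist_absval absval_mult)
  qed
  moreover have "closed (fball \<rho> :: 'a set)"
    unfolding fball_eq_cball by simp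
  ultimately show ?thesis
    using compact_scale[OF e(2), of "inverse \<tau>"]
    by (metis closed_Int_compact inf.absorb_iff1)
qed

text \<open>The Hyers-Ulam argument: \<open>f (k * n)\<close> is within \<open>k * C\<close> of
  \<open>k * f n\<close>, so comparing \<open>f m / m\<close> and \<open>f n / n\<close> with the
  quotient at \<open>n * m\<close> shows that \<open>f n / n\<close> is Cauchy. The error
  \<open>C / n\<close> survives in the limit and is multiplied by \<open>n\<close>.\<close>

lemma quasi_additive_linear:
  fixes f :: "nat \<Rightarrow> real"
  assumes "\<And>i j. \<bar>f (i + j) - f i - f j\<bar> \<le> C"
  shows "\<exists>s::real. \<forall>n. \<bar>f n - s * real n\<bar> \<le> C"
proof -
  have C: "0 \<le> C"
    using assms[of 0 0] by linarith
  have mult: "\<bar>f (k * n) - k * f n\<bar> \<le> k * C" if "k \<ge> 1" for k n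
    using that
  proof (induction k rule: nat_induct_at_least)
    case base
    then show ?case using C by simp
  next
    case (Suc k)
    then show ?case
      using assms[of n "k * n"] by (simp add: algebra_simps abs_if split: if_splits)
  qed
  define g where "g n = f n / n" for n :: nat
  have diff: "\<bar>g m - g n\<bar> \<le> C / n + C / m" if "m \<ge> 1" "n \<ge> 1" for m n
  proof -
    have "\<bar>f (n * m) / (n * m) - g m\<bar> \<le> C / m" if "m \<ge> 1" "n \<ge> 1" for m n
    proof -
      have "f (n * m) / (n * m) - g m = (f (n * m) - n * f m) / (n * m)"
        using that by (simp add: g_def field_simps)
      also have "\<bar>\<dots>\<bar> \<le> n * C / (n * m)"
        unfolding abs_divide using mult[OF that(2), of m] by (intro frac_le) (use that in auto)
      also have "n * C / (n * m) = C / m"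
        using that by simp
      finally show ?thesis .
    qed
    from this[OF that] this[OF that(2,1)] show ?thesis
      by (simp add: mult.commute abs_le_iff)
  qed
  have "Cauchy g"
  proof (rule metric_CauchyI)
    fix e :: real assume e: "e > 0"
    obtain N where N: "real N > 2 * C / e" "N \<ge> 1"
      by (meson le_max_iff_disj less_eq_real_def nat_le_linear of_nat_le_iff order_less_le_trans reals_Archimedean2)
    have "C / n < e / 2" if "n \<ge> N" for n
    proof -
      have "2 * C < e * real N"
        using N e by (simp add: field_simps)
      also have "\<dots> \<le> e * real n"
        using that e by simp
      finally show ?thesis
        using that N by (simp add: field_simps)
    qed
    then show "\<exists>M. \<forall>m\<ge>M. \<forall>n\<ge>M. dist (g m) (g n) < e"
      using diff N by (intro exI[of _ N]) (smt (verit) dist_real_def field_sum_of_halves order_trans)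
  qed
  then obtain s where s: "g \<longlonglongrightarrow> s"
    using real_Cauchy_convergent convergent_def by blast
  have "\<bar>f n - s * n\<bar> \<le> C" for n
  proof (cases "n = 0")
    case True
    then show ?thesis using assms[of 0 0] by simp
  next
    case False
    have "(\<lambda>m. \<bar>g m - g n\<bar>) \<longlonglongrightarrow> \<bar>s - g n\<bar>"
      by (intro tendsto_intros s)
    moreover have "(\<lambda>m. C / n + C / m) \<longlonglongrightarrow> C / n + 0"
      by (intro tendsto_intros lim_const_over_n)
    ultimately have "\<bar>s - g n\<bar> \<le> C / n + 0"
      using diff False by (intro LIMSEQ_le[of _ _ _ "C / n + 0"]) (auto intro!: exI[of _ 1])
    then show ?thesis
      using False by (simp add: g_def field_simps abs_le_iff)
  qed
  then show ?thesis by (intro exI[of _ s]) blast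
qed

text \<open>\<open>R\<close> is read as nearness. By \<open>bound\<close> there is a separated
  subset of largest cardinality, and maximality makes it a net.\<close>

lemma maximal_separated:
  assumes refl: "\<And>x. x \<in> X \<Longrightarrow> R x x" and sym: "\<And>x y. R x y \<Longrightarrow> R y x"
    and bound: "\<And>E. E \<subseteq> X \<Longrightarrow> finite E \<Longrightarrow> (\<forall>x\<in>E. \<forall>y\<in>E. x \<noteq> y \<longrightarrow> \<not> R x y) \<Longrightarrow> card E \<le> N"
  obtains E where "E \<subseteq> X" "finite E" "\<And>x y. x \<in> E \<Longrightarrow> y \<in> E \<Longrightarrow> x \<noteq> y \<Longrightarrow> \<not> R x y"
    "\<And>x. x \<in> X \<Longrightarrow> \<exists>y\<in>E. R x y"
proof -
  let ?P = "\<lambda>k. \<exists>E\<subseteq>X. finite E \<and> (\<forall>x\<in>E. \<forall>y\<in>E. x \<noteq> y \<longrightarrow> \<not> R x y) \<and> card E = k"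
  have "?P 0" by (intro exI[of _ "{}"]) auto
  moreover have "k \<le> N" if "?P k" for k
    using that bound by blast
  ultimately have K: "finite {k. ?P k}" "{k. ?P k} \<noteq> {}"
    by (auto intro!: finite_subset[of "{k. ?P k}" "{..N}"])
  define k where "k = Max {k. ?P k}"
  have k: "?P k"
    using Max_in[OF K] unfolding k_def by (rule CollectD)
  have k': "l \<le> k" if "?P l" for l
    unfolding k_def by (rule Max_ge[OF K(1)]) (rule CollectI, rule that)
  from k obtain E where E: "E \<subseteq> X" "finite E" "\<And>x y. x \<in> E \<Longrightarrow> y \<in> E \<Longrightarrow> x \<noteq> y \<Longrightarrow> \<not> R x y" "card E = k"
    by blast
  have max: "\<exists>y\<in>E. R x y" if x: "x \<in> X" for x
  proof (rule ccontr)
    assume neg: "\<not> (\<exists>y\<in>E. R x y)"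
    then have "x \<notin> E" using refl[OF x] by blast
    then have "?P (Suc k)"
      using E neg x sym by (intro exI[of _ "insert x E"]) auto
    then show False using k'[of "Suc k"] by simp
  qed
  show thesis
    using that[OF E(1-3) max] .
qed

lemma maximal_separated_finite:
  assumes "finite X" and refl: "\<And>x. x \<in> X \<Longrightarrow> R x x" and sym: "\<And>x y. R x y \<Longrightarrow> R y x"
  obtains E where "E \<subseteq> X" "finite E" "\<And>x y. x \<in> E \<Longrightarrow> y \<in> E \<Longrightarrow> x \<noteq> y \<Longrightarrow> \<not> R x y"
    "\<And>x. x \<in> X \<Longrightarrow> \<exists>y\<in>E. R x y"
proof (rule maximal_separated[of X R "card X"])
  show "card E \<le> card X" if "E \<subseteq> X" for E
    using that assms(1) by (rule card_mono[rotated])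
qed (use assms that in auto)

section \<open>Growth of the Haar measure of balls\<close>

definition volume :: "'a::local_field_char_0 measure \<Rightarrow> real \<Rightarrow> real" where
  "volume \<mu> \<rho> = measure \<mu> (fball \<rho> :: 'a set)"

lemma fball_cover:
  assumes "0 < b"
  obtains P where "finite P" "fball a \<subseteq> (\<Union>x\<in>P. cball (x::'a::local_field_char_0) b)"
proof -
  obtain P where "finite P" "fball a \<subseteq> (\<Union>x\<in>P. ball (x::'a) b)"
    using compact_fball[of a] assms unfolding compact_eq_totally_bounded by blast
  then show thesis
    using that[of P] ball_subset_cball by blast
qed

context
  fixes \<mu> :: "'a::local_field_char_0 measure"
  assumes haar: "haar_measure \<mu>"
begin

lemma cball_in_sets [measurable]: "cball x \<rho> \<in> sets \<mu>"
  using haar by (simp add: haar_measure_def)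

lemma emeasure_cball: "emeasure \<mu> (cball x \<rho>) = ennreal (volume \<mu> \<rho>)"
proof -
  have "fball \<rho> \<in> sets borel"
    unfolding fball_eq_cball by simp
  then have "emeasure \<mu> ((+) x ` fball \<rho>) = emeasure \<mu> (fball \<rho>)"
    using haar unfolding haar_measure_def by blast
  then have "emeasure \<mu> (cball x \<rho>) = emeasure \<mu> (fball \<rho>)"
    by (simp only: translate_fball)
  moreover have "emeasure \<mu> (fball \<rho>) < \<infinity>"
    using haar compact_fball unfolding haar_measure_def by blast
  ultimately show ?thesis
    by (simp add: volume_def emeasure_eq_ennreal_measure less_top)
qed

lemma volume_nonneg [simp]: "0 \<le> volume \<mu> \<rho>"
  by (simp add: volume_def)

lemma volume_mono: "\<rho> \<le> \<sigma> \<Longrightarrow> volume \<mu> \<rho> \<le> volume \<mu> \<sigma>"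
  using emeasure_mono[of "cball 0 \<rho>" "cball 0 \<sigma>" \<mu>]
  by (simp add: emeasure_cball subset_cball)

text \<open>Only translation invariance of the measure is given. The effect of dilations is
  recovered by transporting covers, whose cardinality does not change under multiplication by
  \<open>c\<close>.\<close>

lemma volume_cover:
  fixes c :: 'a
  assumes "finite P" "fball a \<subseteq> (\<Union>x\<in>P. cball (x::'a) b)" and False: "c \<noteq> 0"
  shows "volume \<mu> (absval c * a) \<le> real (card P) * volume \<mu> (absval c * b)"
proof -
  have "cball (0::'a) (absval c * a) \<subseteq> (\<Union>x\<in>P. cball (c * x) (absval c * b))"
  proof
    fix y assume "y \<in> cball (0::'a) (absval c * a)"
    then have "absval (y / c) \<le> a"
      using False by (simp add: dist_absval absval_divide field_simps)
    then obtain x where x: "x \<in> P" "absval (x - y / c) \<le> b"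
      using assms(2) by (auto simp: dist_absval)
    have "c * x - y = c * (x - y / c)"
      using False by (simp add: field_simps)
    then have "absval (c * x - y) \<le> absval c * b"
      using x by (simp add: absval_mult mult_left_mono)
    then show "y \<in> (\<Union>x\<in>P. cball (c * x) (absval c * b))"
      using x by (auto simp: dist_absval)
  qed
  then have "emeasure \<mu> (cball 0 (absval c * a)) \<le> emeasure \<mu> (\<Union>x\<in>P. cball (c * x) (absval c * b))"
    by (intro emeasure_mono) (use assms(1) in auto)
  also have "\<dots> \<le> (\<Sum>x\<in>P. emeasure \<mu> (cball (c * x) (absval c * b)))"
    using assms(1) by (intro emeasure_subadditive_finite) auto
  also have "\<dots> = ennreal (real (card P) * volume \<mu> (absval c * b))"
    by (simp add: emeasure_cball ennreal_mult ennreal_of_nat_eq_real_of_nat)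
  finally show ?thesis
    by (simp add: emeasure_cball)
qed

text \<open>If one ball were null, covers by translates would make every ball null, and the field is
  a countable union of balls.\<close>

lemma volume_pos:
  assumes "0 < \<rho>"
  shows "0 < volume \<mu> \<rho>"
proof (rule ccontr)
  assume "\<not> 0 < volume \<mu> \<rho>"
  then have 0: "volume \<mu> \<rho> = 0"
    using volume_nonneg[of \<rho>] by linarith
  have "volume \<mu> a = 0" for a
  proof -
    obtain P where P: "finite P" "fball a \<subseteq> (\<Union>x\<in>P. cball (x::'a) \<rho>)"
      using fball_cover[OF assms] by blast
    show ?thesis
      using volume_cover[OF P one_neq_zero] 0 volume_nonneg[of a] by simp
  qed
  then have "emeasure \<mu> (\<Union>n. cball (0::'a) (real n)) = 0"
    by (intro emeasure_UN_eq_0) (auto simp: emeasure_cball)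
  moreover have "(\<Union>n. cball (0::'a) (real n)) = UNIV"
    using real_arch_simple by (auto simp: dist_absval)
  ultimately show False
    using haar by (simp add: haar_measure_def)
qed

lemma volume_packing:
  fixes E :: "'a set"
  assumes E: "finite E" "E \<subseteq> cball x0 \<rho>" "\<And>x y. x \<in> E \<Longrightarrow> y \<in> E \<Longrightarrow> x \<noteq> y \<Longrightarrow> e < absval (x - y)"
  shows "real (card E) * volume \<mu> (e / 2) \<le> volume \<mu> (\<rho> + e / 2)"
proof -
  have "disjoint_family_on (\<lambda>x. cball x (e / 2)) E"
    unfolding disjoint_family_on_def
  proof (intro ballI impI)
    fix x y assume xy: "x \<in> E" "y \<in> E" "x \<noteq> y"
    have "e < dist x y"
      using E(3)[OF xy] by (simp add: dist_absval)
    then show "cball x (e / 2) \<inter> cball y (e / 2) = {}"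
      using disjoint_cballI[of "e / 2" "e / 2" x y] by simp
  qed
  then have "(\<Sum>x\<in>E. emeasure \<mu> (cball x (e / 2))) = emeasure \<mu> (\<Union>x\<in>E. cball x (e / 2))"
    using E(1) by (intro sum_emeasure) auto
  also have "\<dots> \<le> emeasure \<mu> (cball x0 (\<rho> + e / 2))"
  proof (rule emeasure_mono)
    show "(\<Union>x\<in>E. cball x (e / 2)) \<subseteq> cball x0 (\<rho> + e / 2)"
    proof
      fix y assume "y \<in> (\<Union>x\<in>E. cball x (e / 2))"
      then obtain x where "x \<in> E" "dist x y \<le> e / 2" by auto
      moreover have "dist x0 x \<le> \<rho>" using \<open>x \<in> E\<close> E(2) by auto
      ultimately show "y \<in> cball x0 (\<rho> + e / 2)"
        using dist_triangle[of x0 y x] by simp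
    qed
  qed simp
  finally have "ennreal (real (card E) * volume \<mu> (e / 2)) \<le> ennreal (volume \<mu> (\<rho> + e / 2))"
    by (simp add: emeasure_cball ennreal_mult ennreal_of_nat_eq_real_of_nat)
  then show ?thesis by simp
qed

text \<open>With \<open>a j\<close> the volume at radius \<open>t ^ j\<close>, scaling one separated
  set by powers of \<open>\<tau>\<close> shows that \<open>a i / a (i + j)\<close> is comparable to
  a number depending on \<open>j\<close> alone. So \<open>ln (a j)\<close> is additive up to a
  bounded error, hence linear in \<open>j\<close> with some slope \<open>s\<close>, and
  \<open>D = s / ln t\<close>.\<close>

lemma volume_growth:
  "\<exists>D>0. \<exists>C\<ge>1. \<forall>\<rho>. 0 < \<rho> \<and> \<rho> \<le> 1 \<longrightarrow> \<rho> powr D / C \<le> volume \<mu> \<rho> \<and> volume \<mu> \<rho> \<le> C * \<rho> powr D"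
proof -
  obtain \<tau> :: 'a where \<tau>: "\<tau> \<noteq> 0" "absval \<tau> < 1/2"
    using small_element_exists[where 'a = 'a and \<epsilon> = "1/2"] by auto
  define t where "t = absval \<tau>"
  have t: "0 < t" "t < 1/2" using \<tau> by (auto simp: t_def)
  define a where "a j = volume \<mu> (t ^ j)" for j :: nat
  have a_pos: "0 < a j" for j
    unfolding a_def using t by (intro volume_pos) simp
  have tpow: "absval (\<tau> ^ i) = t ^ i" for i
    by (simp add: t_def absval_power)
  obtain P1 where P1: "finite P1" "fball 2 \<subseteq> (\<Union>x\<in>P1. cball (x::'a) 1)"
    using fball_cover[of 1 2] by auto
  obtain P2 where P2: "finite P2" "fball 1 \<subseteq> (\<Union>x\<in>P2. cball (x::'a) t)"
    using fball_cover[OF t(1), of 1] by auto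
  define k where "k = real (card P1 + card P2 + 1)"
  have k: "1 \<le> k" by (simp add: k_def)
  have k1: "volume \<mu> (2 * t ^ i) \<le> k * a i" for i
  proof -
    have "volume \<mu> (2 * t ^ i) \<le> real (card P1) * a i"
      using volume_cover[OF P1, of "\<tau> ^ i"] \<tau>(1) by (simp add: tpow a_def mult.commute)
    also have "\<dots> \<le> k * a i"
      using a_pos[of i] by (intro mult_right_mono) (auto simp: k_def)
    finally show ?thesis .
  qed
  have k2: "a i \<le> k * a (Suc i)" for i
  proof -
    have "a i \<le> real (card P2) * a (Suc i)"
      using volume_cover[OF P2, of "\<tau> ^ i"] \<tau>(1) by (simp add: tpow a_def mult.commute)
    also have "\<dots> \<le> k * a (Suc i)"
      using a_pos[of "Suc i"] by (intro mult_right_mono) (auto simp: k_def)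
    finally show ?thesis .
  qed
  \<comment> \<open>\<open>N\<close> is the size of a maximal \<open>t ^ j\<close>-separated subset
    of the unit ball. Covering gives the first inequality and packing the second; scaling by
    \<open>\<tau> ^ i\<close> lets the same \<open>N\<close> serve for all \<open>i\<close>.\<close>
  have main: "\<exists>N::real. N > 0 \<and> (\<forall>i. a i \<le> N * a (i + j) \<and> N * a (i + j) \<le> k^2 * a i)" for j
  proof -
    have bound: "real (card E) * a (Suc j) \<le> volume \<mu> 2"
      if E: "E \<subseteq> fball 1" "finite E" "\<forall>x\<in>E. \<forall>y\<in>E. x \<noteq> y \<longrightarrow> \<not> absval (x - y) \<le> t ^ j" for E :: "'a set"
    proof -
      have tj: "t ^ j \<le> 1" using t by (simp add: power_le_one)
      have "real (card E) * volume \<mu> (t ^ j / 2) \<le> volume \<mu> (1 + t ^ j / 2)"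
        using E by (intro volume_packing[of E 0]) (auto simp: dist_absval not_le)
      also have "\<dots> \<le> volume \<mu> 2" using tj by (intro volume_mono) simp
      finally have "real (card E) * volume \<mu> (t ^ j / 2) \<le> volume \<mu> 2" .
      moreover have "a (Suc j) \<le> volume \<mu> (t ^ j / 2)"
        unfolding a_def using t by (intro volume_mono) (simp add: mult_right_mono)
      ultimately show ?thesis
        by (meson mult_left_mono of_nat_0_le_iff order_trans)
    qed
    obtain E :: "'a set" where E: "E \<subseteq> fball 1" "finite E"
        "\<And>x y. x \<in> E \<Longrightarrow> y \<in> E \<Longrightarrow> x \<noteq> y \<Longrightarrow> \<not> absval (x - y) \<le> t ^ j"
        "\<And>x. x \<in> fball 1 \<Longrightarrow> \<exists>y\<in>E. absval (x - y) \<le> t ^ j"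
    proof (rule maximal_separated[of "fball 1 :: 'a set" "\<lambda>x y. absval (x - y) \<le> t ^ j" "nat \<lceil>volume \<mu> 2 / a (Suc j)\<rceil>"])
      fix E :: "'a set" assume E: "E \<subseteq> fball 1" "finite E" "\<forall>x\<in>E. \<forall>y\<in>E. x \<noteq> y \<longrightarrow> \<not> absval (x - y) \<le> t ^ j"
      have "real (card E) \<le> volume \<mu> 2 / a (Suc j)"
        using bound[OF E] a_pos[of "Suc j"] by (simp add: field_simps)
      then show "card E \<le> nat \<lceil>volume \<mu> 2 / a (Suc j)\<rceil>" by linarith
    next
      fix E :: "'a set" assume "E \<subseteq> fball 1" "finite E"
        "\<And>x y. x \<in> E \<Longrightarrow> y \<in> E \<Longrightarrow> x \<noteq> y \<Longrightarrow> \<not> absval (x - y) \<le> t ^ j"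
        "\<And>x. x \<in> fball 1 \<Longrightarrow> \<exists>y\<in>E. absval (x - y) \<le> t ^ j"
      then show thesis by (rule that)
    qed (use t in \<open>auto simp: absval_minus_commute\<close>)
    have cov: "fball 1 \<subseteq> (\<Union>x\<in>E. cball x (t ^ j))"
      using E(4) by (force simp: dist_absval absval_minus_commute)
    have "a i \<le> card E * a (i + j)" for i
      using volume_cover[OF E(2) cov, of "\<tau> ^ i"] \<tau>(1) by (simp add: tpow a_def power_add)
    moreover have "card E * a (i + j) \<le> k^2 * a i" for i
    proof -
      let ?F = "(*) (\<tau> ^ i) ` E"
      have inj: "inj_on ((*) (\<tau> ^ i)) E" using \<tau> by (auto simp: inj_on_def)
      have "real (card ?F) * volume \<mu> (t ^ (i + j) / 2) \<le> volume \<mu> (t ^ i + t ^ (i + j) / 2)"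
      proof (rule volume_packing[of ?F 0])
        show "?F \<subseteq> cball 0 (t ^ i)"
        proof
          fix y assume "y \<in> ?F"
          then obtain x where x: "x \<in> E" "y = \<tau> ^ i * x" by blast
          then have "t ^ i * absval x \<le> t ^ i * 1"
            using E(1) t by (intro mult_left_mono) auto
          then show "y \<in> cball 0 (t ^ i)" using x by (simp add: dist_absval absval_mult tpow)
        qed
      next
        fix x y assume "x \<in> ?F" "y \<in> ?F" "x \<noteq> y"
        then obtain x' y' where xy: "x = \<tau> ^ i * x'" "y = \<tau> ^ i * y'" "x' \<in> E" "y' \<in> E" "x' \<noteq> y'"
          by blast
        then have "t ^ j < absval (x' - y')" using E(3) not_le by blast
        then show "t ^ (i + j) < absval (x - y)"
          using t by (simp add: xy absval_mult tpow power_add flip: right_diff_distrib)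
      qed (use E in auto)
      also have "\<dots> \<le> volume \<mu> (2 * t ^ i)"
        using mult_left_le[of "t ^ j" "t ^ i"] power_le_one[of t j] t
        by (intro volume_mono) (simp add: power_add)
      also have "\<dots> \<le> k * a i" by (rule k1)
      finally have *: "real (card E) * volume \<mu> (t ^ (i + j) / 2) \<le> k * a i"
        using inj by (simp add: card_image)
      have "a (i + j) \<le> k * a (Suc (i + j))" by (rule k2)
      also have "\<dots> \<le> k * volume \<mu> (t ^ (i + j) / 2)"
        unfolding a_def using t k by (intro mult_left_mono volume_mono) (auto simp: mult_right_mono)
      finally have "real (card E) * a (i + j) \<le> real (card E) * (k * volume \<mu> (t ^ (i + j) / 2))"
        by (intro mult_left_mono) auto
      also have "\<dots> = k * (real (card E) * volume \<mu> (t ^ (i + j) / 2))" by simp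
      also have "\<dots> \<le> k * (k * a i)"
        using * k by (intro mult_left_mono) auto
      finally show ?thesis by (simp add: power2_eq_square)
    qed
    moreover have "E \<noteq> {}"
      using E(4)[of 0] by auto
    ultimately show ?thesis
      using E(2) by (intro exI[of _ "real (card E)"]) (simp add: card_gt_0_iff)
  qed
  define B where "B = \<bar>ln (k^2 / a 0)\<bar> + \<bar>ln (k^2 * a 0)\<bar>"
  \<comment> \<open>Using \<open>main\<close> at the index \<open>i\<close> and at the index 0
    eliminates \<open>N\<close>.\<close>
  have "\<bar>ln (a (i + j)) - ln (a i) - ln (a j)\<bar> \<le> B" for i j
  proof -
    obtain N where N: "N > 0" "\<And>i. a i \<le> N * a (i + j)" "\<And>i. N * a (i + j) \<le> k^2 * a i"
      using main[of j] by blast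
    have "a (i + j) * a 0 \<le> a (i + j) * (N * a j)"
      using N(2)[of 0] a_pos[of "i + j"] by (intro mult_left_mono) auto
    also have "\<dots> = N * a (i + j) * a j" by simp
    also have "\<dots> \<le> k^2 * a i * a j"
      using N(3)[of i] a_pos[of j] by (intro mult_right_mono) auto
    finally have u: "a (i + j) / (a i * a j) \<le> k^2 / a 0"
      using a_pos by (simp add: field_simps)
    have "a i * a j \<le> N * a (i + j) * a j"
      using N(2)[of i] a_pos[of j] by (intro mult_right_mono) auto
    also have "\<dots> = a (i + j) * (N * a j)" by simp
    also have "\<dots> \<le> a (i + j) * (k^2 * a 0)"
      using N(3)[of 0] a_pos[of "i + j"] by (intro mult_left_mono) auto
    finally have l: "1 / (k^2 * a 0) \<le> a (i + j) / (a i * a j)"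
      using a_pos k by (simp add: field_simps)
    have eq: "ln (a (i + j)) - ln (a i) - ln (a j) = ln (a (i + j) / (a i * a j))"
      using a_pos[of i] a_pos[of j] a_pos[of "i + j"] by (simp add: ln_div ln_mult)
    have "ln (a (i + j) / (a i * a j)) \<le> ln (k^2 / a 0)"
      using u a_pos k by (subst ln_le_cancel_iff) (auto simp: zero_less_divide_iff)
    moreover have "ln (1 / (k^2 * a 0)) \<le> ln (a (i + j) / (a i * a j))"
      using l a_pos k by (subst ln_le_cancel_iff) (auto simp: zero_less_divide_iff)
    moreover have "ln (1 / (k^2 * a 0)) = - ln (k^2 * a 0)"
      using a_pos k by (subst ln_div) auto
    ultimately show ?thesis
      unfolding eq B_def by linarith
  qed
  then obtain s :: real where s: "\<And>n. \<bar>ln (a n) - s * real n\<bar> \<le> B"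
    using quasi_additive_linear[of "\<lambda>n. ln (a n)" B] by blast
  have a_bd: "exp (s * n - B) \<le> a n" "a n \<le> exp (s * n + B)" for n :: nat
    using s[of n] a_pos[of n] by (auto simp: abs_le_iff simp flip: ln_le_cancel_iff ln_ge_iff)
  \<comment> \<open>With a nonnegative slope all \<open>a j\<close> would stay above
    \<open>exp (- B)\<close>, although the powers of \<open>\<tau>\<close> are centres of
    arbitrarily many disjoint balls of one small radius \<open>t ^ j\<close> inside a fixed
    ball.\<close>
  have "s < 0"
  proof (rule ccontr)
    assume "\<not> s < 0"
    then have low: "exp (- B) \<le> a n" for n
      using a_bd(1)[of n] by (smt (verit) exp_le_cancel_iff mult_nonneg_nonneg of_nat_0_le_iff)
    obtain N :: nat where N: "real N > volume \<mu> 2 / exp (- B)"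
      using reals_Archimedean2 by blast
    define E where "E = (\<lambda>i. \<tau> ^ i) ` {..N}"
    obtain j where j: "t ^ j < t ^ N / 4"
      using real_arch_pow_inv[of "t ^ N / 4" t] t by auto
    have sep: "2 * t ^ j < absval (\<tau> ^ x - \<tau> ^ y)" if "x < y" "y \<le> N" for x y
    proof -
      have "t ^ y \<le> t * t ^ x"
        using that t power_decreasing[of "Suc x" y t] by simp
      moreover have "t * t ^ x \<le> 1/2 * t ^ x" using t by (intro mult_right_mono) auto
      moreover have "t ^ N \<le> t ^ x" using that t by (intro power_decreasing) auto
      moreover have "absval (\<tau> ^ x) \<le> absval (\<tau> ^ x - \<tau> ^ y) + absval (\<tau> ^ y)"
        using absval_triangle[of "\<tau> ^ x - \<tau> ^ y" "\<tau> ^ y"] by simp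
      ultimately show ?thesis using j unfolding tpow by linarith
    qed
    have "inj_on (\<lambda>i. \<tau> ^ i) {..N}"
    proof (rule linorder_inj_onI)
      fix x y assume "x < y" "x \<in> {..N}" "y \<in> {..N}"
      then have "2 * t ^ j < absval (\<tau> ^ x - \<tau> ^ y)" using sep by auto
      moreover have "0 < t ^ j" using t by simp
      ultimately have "0 < absval (\<tau> ^ x - \<tau> ^ y)" by linarith
      then show "\<tau> ^ x \<noteq> \<tau> ^ y" by auto
    qed auto
    then have card: "card E = N + 1" by (simp add: E_def card_image)
    have "real (card E) * volume \<mu> (2 * t ^ j / 2) \<le> volume \<mu> (1 + 2 * t ^ j / 2)"
    proof (rule volume_packing[of E 0])
      show "E \<subseteq> cball 0 1"
        using t by (auto simp: E_def dist_absval tpow power_le_one)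
    next
      fix x y assume "x \<in> E" "y \<in> E" "x \<noteq> y"
      then obtain i i' where "x = \<tau> ^ i" "y = \<tau> ^ i'" "i \<noteq> i'" "i \<le> N" "i' \<le> N"
        by (auto simp: E_def)
      then show "2 * t ^ j < absval (x - y)"
        using sep[of i i'] sep[of i' i] absval_minus_commute[of x y]
        by (cases "i < i'") auto
    qed (simp add: E_def)
    also have "\<dots> \<le> volume \<mu> 2"
      using power_le_one[of t j] t by (intro volume_mono) simp
    finally have "real (N + 1) * a j \<le> volume \<mu> 2"
      by (simp add: card a_def)
    moreover have "real (N + 1) * exp (- B) \<le> real (N + 1) * a j"
      using low[of j] by (intro mult_left_mono) auto
    ultimately show False
      using N by (simp add: field_simps add_pos_pos) (smt (verit) exp_gt_zero)
  qed
  define D where "D = s / ln t"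
  have lnt: "ln t < 0" using t by simp
  have D: "0 < D" using \<open>s < 0\<close> lnt by (simp add: D_def zero_less_divide_iff)
  have tD: "(t ^ n) powr D = exp (s * n)" for n :: nat
    using t lnt by (simp add: powr_def D_def ln_realpow)
  \<comment> \<open>\<open>exp B\<close> is the error of the linear approximation;
    \<open>t powr (- D)\<close> pays for rounding a radius to a power of \<open>t\<close>.\<close>
  define C where "C = exp B * t powr (- D)"
  have tD1: "1 \<le> t powr (- D)"
    using t D powr_le1[of D t] by (simp add: powr_minus one_le_inverse_iff)
  have C: "1 \<le> C"
    unfolding C_def using tD1 by (intro mult_ge1_I) (auto simp: B_def)
  have "\<rho> powr D / C \<le> volume \<mu> \<rho> \<and> volume \<mu> \<rho> \<le> C * \<rho> powr D" if \<rho>: "0 < \<rho>" "\<rho> \<le> 1" for \<rho>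
  proof -
    obtain n where n: "t ^ n < \<rho>" using real_arch_pow_inv[of \<rho> t] \<rho> t by auto
    define m where "m = (LEAST n. t ^ n < \<rho>)"
    have m: "t ^ m < \<rho>" unfolding m_def using n by (rule LeastI)
    have "m \<noteq> 0" using m \<rho> by (cases m) auto
    then obtain j where j: "m = Suc j" by (cases m) auto
    have "\<not> t ^ j < \<rho>" using not_less_Least[of j "\<lambda>n. t ^ n < \<rho>"] j m_def by simp
    then have j1: "\<rho> \<le> t ^ j" by simp
    have j2: "t * t ^ j < \<rho>" using m j by simp
    have "volume \<mu> \<rho> \<le> a j" unfolding a_def by (rule volume_mono[OF j1])
    also have "\<dots> \<le> exp B * (t ^ j) powr D" using a_bd(2)[of j] by (simp add: tD exp_add mult.commute)
    also have "\<dots> \<le> exp B * (\<rho> / t) powr D"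
      using j2 t D \<rho> by (intro mult_left_mono powr_mono2) (auto simp: field_simps)
    also have "\<dots> = C * \<rho> powr D"
      using t \<rho> by (simp add: C_def powr_divide powr_minus field_simps)
    finally have u: "volume \<mu> \<rho> \<le> C * \<rho> powr D" .
    have "\<rho> powr D / C \<le> (t ^ j) powr D / C"
      using j1 \<rho> D C by (intro divide_right_mono powr_mono2) auto
    also have "\<dots> = exp (- B) * (t ^ Suc j) powr D"
      using t by (simp add: C_def powr_minus powr_mult exp_minus field_simps)
    also have "\<dots> \<le> a (Suc j)" using a_bd(1)[of "Suc j"] unfolding tD by (simp add: exp_diff exp_minus field_simps)
    also have "\<dots> \<le> volume \<mu> \<rho>" unfolding a_def using j2 by (intro volume_mono) simp
    finally show ?thesis using u by blast
  qed
  then show ?thesis using D C by blast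
qed

text \<open>The volume bounds hold for radii at most 1, so everything is shrunk by a small scalar
  \<open>c\<close>, which changes neither the cardinality nor \<open>\<rho> / e\<close>. The factor
  \<open>3 powr D\<close> compares a ball of radius \<open>3 * \<rho> / 2\<close>, which contains
  the balls of radius \<open>e / 2\<close> around the points, with one of these.\<close>

lemma packing_growth:
  fixes E :: "'a set"
  assumes D: "0 < D" and C: "1 \<le> C"
    and vol: "\<And>\<rho>. 0 < \<rho> \<Longrightarrow> \<rho> \<le> 1 \<Longrightarrow> \<rho> powr D / C \<le> volume \<mu> \<rho> \<and> volume \<mu> \<rho> \<le> C * \<rho> powr D"
    and E: "0 < e" "e \<le> \<rho>" "finite E" "\<And>x. x \<in> E \<Longrightarrow> absval (x - x0) \<le> \<rho>"
      "\<And>x y. x \<in> E \<Longrightarrow> y \<in> E \<Longrightarrow> x \<noteq> y \<Longrightarrow> e < absval (x - y)"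
  shows "real (card E) \<le> C^2 * 3 powr D * (\<rho> / e) powr D"
proof -
  have "0 < 1 / (2 * \<rho>)" using E by simp
  then obtain c :: 'a where c: "c \<noteq> 0" "absval c < 1 / (2 * \<rho>)"
    using small_element_exists by blast
  define t where "t = absval c"
  have t: "0 < t" "t * (2 * \<rho>) \<le> 1"
    using c E by (auto simp: t_def field_simps)
  let ?F = "(*) c ` E"
  have inj: "inj_on ((*) c) E" using c by (auto simp: inj_on_def)
  have "real (card ?F) * volume \<mu> (t * e / 2) \<le> volume \<mu> (t * \<rho> + t * e / 2)"
  proof (rule volume_packing[of ?F "c * x0"])
    show "?F \<subseteq> cball (c * x0) (t * \<rho>)"
      using E(4) t by (auto simp: dist_absval absval_mult t_def[symmetric] absval_minus_commute[of x0]
        simp flip: right_diff_distrib intro!: mult_left_mono)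
  next
    fix x y assume "x \<in> ?F" "y \<in> ?F" "x \<noteq> y"
    then show "t * e < absval (x - y)"
      using E(5) t by (auto simp: absval_mult t_def[symmetric] simp flip: right_diff_distrib)
  qed (use E in auto)
  also have "\<dots> \<le> volume \<mu> (t * (3 * \<rho> / 2))"
    using E t by (intro volume_mono) (auto simp: field_simps)
  also have "\<dots> \<le> C * (t * (3 * \<rho> / 2)) powr D"
    using vol[of "t * (3 * \<rho> / 2)"] E t by (auto simp: field_simps)
  finally have 1: "real (card E) * volume \<mu> (t * e / 2) \<le> C * (t * (3 * \<rho> / 2)) powr D"
    using inj by (simp add: card_image)
  have "t * e \<le> t * \<rho>" using E t by (intro mult_left_mono) auto
  moreover have "t * \<rho> \<le> 1 / 2" using t by (simp add: field_simps)
  ultimately have "t * e / 2 \<le> 1" by linarith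
  then have "(t * e / 2) powr D / C \<le> volume \<mu> (t * e / 2)"
    using vol[of "t * e / 2"] E t by auto
  then have "real (card E) * ((t * e / 2) powr D / C) \<le> C * (t * (3 * \<rho> / 2)) powr D"
    using 1 by (meson mult_left_mono of_nat_0_le_iff order_trans)
  then have "real (card E) \<le> C * C * ((t * (3 * \<rho> / 2)) powr D / (t * e / 2) powr D)"
    using E t C by (simp add: field_simps del: powr_mult)
  also have "(t * (3 * \<rho> / 2)) powr D / (t * e / 2) powr D = ((t * (3 * \<rho> / 2)) / (t * e / 2)) powr D"
    by (rule powr_divide[symmetric])
  also have "(t * (3 * \<rho> / 2)) / (t * e / 2) = 3 * (\<rho> / e)"
    using E t by (simp add: field_simps)
  also have "(3 * (\<rho> / e)) powr D = 3 powr D * (\<rho> / e) powr D"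
    by (rule powr_mult)
  finally show ?thesis by (simp add: power2_eq_square mult.assoc)
qed

end

section \<open>Counting\<close>

lemma card_eq_sum_fibres:
  assumes "finite X" "finite Y" "f ` X \<subseteq> Y"
  shows "card X = (\<Sum>y\<in>Y. card {x\<in>X. f x = y})"
proof -
  have "X = (\<Union>y\<in>Y. {x\<in>X. f x = y})" using assms(3) by auto
  then have "card X = card (\<Union>y\<in>Y. {x\<in>X. f x = y})" by simp
  also have "\<dots> = (\<Sum>y\<in>Y. card {x\<in>X. f x = y})"
    using assms by (intro card_UN_disjoint) auto
  finally show ?thesis .
qed

lemma card_le_fibre_bound:
  assumes "finite X" "finite Y" "f ` X \<subseteq> Y" "\<And>y. y \<in> Y \<Longrightarrow> real (card {x\<in>X. f x = y}) \<le> B"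
  shows "real (card X) \<le> real (card Y) * B"
proof -
  have "card X = (\<Sum>y\<in>Y. card {x\<in>X. f x = y})"
    by (rule card_eq_sum_fibres[OF assms(1-3)])
  also have "real \<dots> \<le> (\<Sum>y\<in>Y. B)"
    unfolding of_nat_sum by (intro sum_mono assms)
  finally show ?thesis by simp
qed

text \<open>Cauchy-Schwarz for the fibre sizes: few values force many pairs with equal
  values.\<close>

lemma card_collisions:
  assumes "finite X" "finite Y" "f ` X \<subseteq> Y"
  shows "real (card X)^2 \<le> real (card {(x, y) \<in> X \<times> X. f x = f y}) * real (card Y)"
proof -
  let ?n = "\<lambda>l. real (card {x\<in>X. f x = l})"
  have "{(x, y) \<in> X \<times> X. f x = f y} = (\<Union>l\<in>Y. {x\<in>X. f x = l} \<times> {x\<in>X. f x = l})"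
    using assms(3) by auto
  also have "card \<dots> = (\<Sum>l\<in>Y. card ({x\<in>X. f x = l} \<times> {x\<in>X. f x = l}))"
    using assms by (intro card_UN_disjoint) auto
  finally have 1: "real (card {(x, y) \<in> X \<times> X. f x = f y}) = (\<Sum>l\<in>Y. (?n l)^2)"
    by (simp add: card_cartesian_product power2_eq_square)
  have 2: "real (card X) = (\<Sum>l\<in>Y. ?n l)"
    using card_eq_sum_fibres[OF assms] by simp
  have "(\<Sum>l\<in>Y. ?n l)^2 \<le> (\<Sum>l\<in>Y. (?n l)^2) * real (card Y)"
    using Cauchy_Schwarz_ineq_sum[of ?n "\<lambda>_. 1" Y] by simp
  then show ?thesis unfolding 1 2 .
qed

lemma pigeonhole_real:
  assumes "finite X" "finite Y" "f ` X \<subseteq> Y" "X \<noteq> {}"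
  obtains y where "y \<in> Y" "real (card X) \<le> real (card Y) * real (card {x\<in>X. f x = y})"
proof -
  have "Y \<noteq> {}" using assms by auto
  define B where "B = Max ((\<lambda>y. card {x\<in>X. f x = y}) ` Y)"
  have "B \<in> (\<lambda>y. card {x\<in>X. f x = y}) ` Y"
    unfolding B_def using assms \<open>Y \<noteq> {}\<close> by (intro Max_in) auto
  then obtain y where y: "y \<in> Y" "B = card {x\<in>X. f x = y}" by blast
  have "real (card X) \<le> real (card Y) * real B"
    using assms by (intro card_le_fibre_bound[where f = f]) (auto simp: B_def)
  with y that show thesis by blast
qed

lemma double_count:
  assumes "finite A" "finite B"
    and "\<And>a. a \<in> A \<Longrightarrow> lo \<le> real (card {b\<in>B. P a b})"
    and "\<And>b. b \<in> B \<Longrightarrow> real (card {a\<in>A. P a b}) \<le> hi"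
  shows "real (card A) * lo \<le> real (card B) * hi"
proof -
  have "real (card A) * lo = (\<Sum>a\<in>A. lo)" by simp
  also have "\<dots> \<le> (\<Sum>a\<in>A. real (card {b\<in>B. P a b}))"
    by (rule sum_mono) (rule assms(3))
  also have "\<dots> = (\<Sum>a\<in>A. \<Sum>b\<in>B. if P a b then 1 else 0)"
    using assms(2) by (simp add: sum.inter_filter[symmetric])
  also have "\<dots> = (\<Sum>b\<in>B. \<Sum>a\<in>A. if P a b then 1 else 0)"
    by (rule sum.swap)
  also have "\<dots> = (\<Sum>b\<in>B. real (card {a\<in>A. P a b}))"
    using assms(1) by (simp add: sum.inter_filter[symmetric])
  also have "\<dots> \<le> (\<Sum>b\<in>B. hi)"
    by (rule sum_mono) (rule assms(4))
  finally show ?thesis by simp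
qed

text \<open>Terms below \<open>a\<close> account for at most half of \<open>T\<close>; the other
  half comes from terms that are at least \<open>a\<close>, and each of them is at most
  \<open>U\<close>.\<close>

lemma many_large_values:
  fixes g :: "'x \<Rightarrow> real"
  assumes "finite X" "\<And>x. x \<in> X \<Longrightarrow> g x \<le> U" "0 < U" "T \<le> (\<Sum>x\<in>X. g x)" "real (card X) * a \<le> T / 2"
    "0 \<le> a"
  shows "T / 2 \<le> real (card {x\<in>X. a \<le> g x}) * U"
proof -
  have "(\<Sum>x\<in>X. g x) \<le> (\<Sum>x\<in>X. (if a \<le> g x then U else 0) + a)"
  proof (rule sum_mono)
    fix x assume "x \<in> X"
    then show "g x \<le> (if a \<le> g x then U else 0) + a"
      using assms(2)[of x] assms(6) by auto
  qed
  also have "\<dots> = (\<Sum>x\<in>X. if a \<le> g x then U else 0) + real (card X) * a"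
    by (simp add: sum.distrib)
  also have "(\<Sum>x\<in>X. if a \<le> g x then U else 0) = (\<Sum>x\<in>{x\<in>X. a \<le> g x}. U)"
    using assms(1) by (rule sum.inter_filter[symmetric])
  also have "\<dots> = real (card {x\<in>X. a \<le> g x}) * U" by simp
  finally show ?thesis using assms by linarith
qed

section \<open>Interpolation\<close>

text \<open>Division by \<open>x - s0\<close> lowers the degree and the number of nodes together,
  and the quotient is at most \<open>2 * \<epsilon> / \<eta>\<close> at the remaining nodes. Going
  back to \<open>P\<close> costs three times the bound for the quotient, whence the 6 in
  \<open>6 / \<eta>\<close>.\<close>

lemma poly_coeff_bound:
  fixes P :: "'a::local_field_char_0 poly"
  assumes "degree P \<le> n" "finite S" "card S = Suc n" "0 < \<eta>" "\<eta> \<le> 1"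
    "\<And>s. s \<in> S \<Longrightarrow> absval s \<le> 1" "\<And>s t. s \<in> S \<Longrightarrow> t \<in> S \<Longrightarrow> s \<noteq> t \<Longrightarrow> \<eta> \<le> absval (s - t)"
    "\<And>s. s \<in> S \<Longrightarrow> absval (poly P s) \<le> \<epsilon>"
  shows "absval (coeff P i) \<le> (6 / \<eta>) ^ n * \<epsilon>"
  using assms
proof (induction n arbitrary: P S \<epsilon> i)
  case 0
  then obtain s where s: "S = {s}" by (metis One_nat_def card_1_singletonE)
  obtain a where a: "P = [:a:]" using 0(1) by (auto elim: degree_eq_zeroE)
  have "absval a \<le> \<epsilon>" using 0(8)[of s] s a by simp
  moreover from this have "0 \<le> \<epsilon>" using absval_nonneg[of a] by linarith
  ultimately show ?case using a by (cases i) auto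
next
  case (Suc n)
  obtain s0 where s0: "s0 \<in> S" using Suc.prems(3) by fastforce
  have \<epsilon>: "0 \<le> \<epsilon>" using Suc.prems(8)[OF s0] absval_nonneg[of "poly P s0"] by linarith
  define Q where "Q = synthetic_div P s0"
  have P: "P = [:poly P s0:] + [:- s0, 1:] * Q"
    using synthetic_div_correct'[of s0 P] unfolding Q_def by (simp add: add.commute)
  have "absval (coeff Q j) \<le> (6 / \<eta>) ^ n * (2 * \<epsilon> / \<eta>)" for j
  proof (rule Suc.IH[of Q "S - {s0}"])
    show "degree Q \<le> n" using Suc.prems(1) by (simp add: Q_def degree_synthetic_div)
  next
    fix s assume s: "s \<in> S - {s0}"
    have "poly P s = poly P s0 + (s - s0) * poly Q s"
      by (subst P) (simp add: algebra_simps)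
    then have "(s - s0) * poly Q s = poly P s - poly P s0" by simp
    then have "absval ((s - s0) * poly Q s) \<le> \<epsilon> + \<epsilon>"
      using absval_triangle_diff_le[OF Suc.prems(8)[of s] Suc.prems(8)[OF s0]] s by simp
    then have "absval (s - s0) * absval (poly Q s) \<le> 2 * \<epsilon>" by (simp add: absval_mult)
    moreover have "\<eta> * absval (poly Q s) \<le> absval (s - s0) * absval (poly Q s)"
      using Suc.prems(7)[of s s0] s s0 by (intro mult_right_mono) auto
    ultimately show "absval (poly Q s) \<le> 2 * \<epsilon> / \<eta>"
      using Suc.prems(4) by (simp add: field_simps)
  qed (use Suc.prems s0 in auto)
  note Q = this
  have bd: "absval (coeff P i) \<le> \<epsilon> + (6 / \<eta>) ^ n * (2 * \<epsilon> / \<eta>) + (6 / \<eta>) ^ n * (2 * \<epsilon> / \<eta>)"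
  proof -
    have eq: "coeff P i = (coeff [:poly P s0:] i - s0 * coeff Q i) + coeff (pCons 0 Q) i"
      by (subst P) simp
    have "absval (coeff [:poly P s0:] i) \<le> \<epsilon>"
      using Suc.prems(8)[OF s0] \<epsilon> by (cases i) auto
    moreover have "absval (s0 * coeff Q i) \<le> (6 / \<eta>) ^ n * (2 * \<epsilon> / \<eta>)"
      using mult_mono[OF Suc.prems(6)[OF s0] Q[of i]] by (simp add: absval_mult)
    moreover have "absval (coeff (pCons 0 Q) i) \<le> (6 / \<eta>) ^ n * (2 * \<epsilon> / \<eta>)"
      using Q \<epsilon> Suc.prems(4) by (cases i) auto
    ultimately show ?thesis
      unfolding eq by (intro absval_triangle_le absval_triangle_diff_le)
  qed
  have "\<epsilon> \<le> (6 / \<eta>) ^ n * (2 * \<epsilon> / \<eta>)"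
  proof -
    have "1 \<le> (6 / \<eta>) ^ n" using Suc.prems(4,5) by (intro one_le_power) (simp add: field_simps)
    moreover have "\<epsilon> \<le> 2 * \<epsilon> / \<eta>"
    proof -
      have "\<eta> * \<epsilon> \<le> 2 * \<epsilon>" using Suc.prems(5) \<epsilon> by (intro mult_right_mono) auto
      then show ?thesis using Suc.prems(4) by (simp add: field_simps)
    qed
    ultimately show ?thesis using \<epsilon> mult_mono[of 1 "(6 / \<eta>) ^ n" \<epsilon> "2 * \<epsilon> / \<eta>"] by simp
  qed
  moreover have "a \<le> e + X + X \<Longrightarrow> e \<le> X \<Longrightarrow> a \<le> 3 * X" for a e X :: real by linarith
  ultimately have "absval (coeff P i) \<le> 3 * ((6 / \<eta>) ^ n * (2 * \<epsilon> / \<eta>))"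
    using bd by blast
  also have "\<dots> = (6 / \<eta>) ^ Suc n * \<epsilon>" by simp
  finally show ?case .
qed

lemma poly_absval_bound:
  fixes P :: "'a::local_field_char_0 poly"
  assumes "degree P \<le> n" "absval s \<le> 1" "\<And>i. absval (coeff P i) \<le> B"
  shows "absval (poly P s) \<le> real (Suc n) * B"
proof -
  have "poly P s = (\<Sum>i\<le>n. coeff P i * s ^ i)"
    unfolding poly_altdef using assms(1)
    by (intro sum.mono_neutral_left) (auto simp: coeff_eq_0)
  also have "absval \<dots> \<le> real (card {..n}) * B"
  proof (rule absval_sum_bound)
    fix i
    have "absval (s ^ i) \<le> 1" using assms(2) by (simp add: absval_power power_le_one)
    then show "absval (coeff P i * s ^ i) \<le> B"
      using mult_mono[OF assms(3)[of i], of "absval (s ^ i)" 1] order_trans[OF absval_nonneg assms(3)[of i]]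
      by (simp add: absval_mult)
  qed
  finally show ?thesis by simp
qed

text \<open>A polynomial of degree at most \<open>n\<close> that almost vanishes on the
  \<open>n\<close> points of \<open>Z\<close> is almost a multiple of the product of the linear
  factors of \<open>Z\<close>. Subtracting the multiple \<open>H\<close> that agrees with
  \<open>P\<close> at \<open>t\<close> leaves a polynomial that is small at \<open>n + 1\<close>
  nodes.\<close>

lemma poly_two_point_bound:
  fixes P :: "'a::local_field_char_0 poly"
  assumes P: "degree P \<le> n" and Z: "finite Z" "card Z = n" and \<eta>: "0 < \<eta>" "\<eta> \<le> 1"
    and S: "\<And>s. s \<in> insert t Z \<Longrightarrow> absval s \<le> 1" "absval s \<le> 1"
    and sep: "\<And>s z. s \<in> insert t Z \<Longrightarrow> z \<in> insert t Z \<Longrightarrow> s \<noteq> z \<Longrightarrow> \<eta> \<le> absval (s - z)"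
    and t: "t \<notin> Z" and small: "\<And>z. z \<in> Z \<Longrightarrow> absval (poly P z) \<le> \<epsilon>" "0 \<le> \<epsilon>"
  shows "absval (poly P s - (\<Prod>z\<in>Z. (s - z) / (t - z)) * poly P t) \<le> real (Suc n) * ((6 / \<eta>) ^ n * \<epsilon>)"
proof -
  define w where "w = (\<Prod>z\<in>Z. t - z)"
  have w: "w \<noteq> 0" using t Z by (auto simp: w_def)
  define H where "H = Polynomial.smult (poly P t / w) (\<Prod>z\<in>Z. [:- z, 1:])"
  have degH: "degree H \<le> n"
    unfolding H_def using degree_prod_sum_le[OF Z(1), of "\<lambda>z. [:- z, 1:]"] Z
    by (intro order_trans[OF degree_smult_le]) simp
  have polyH: "poly H x = (\<Prod>z\<in>Z. (x - z) / (t - z)) * poly P t" for x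
    by (simp add: H_def poly_prod w_def prod_dividef mult.commute)
  have "absval (poly (P - H) s) \<le> real (Suc n) * ((6 / \<eta>) ^ n * \<epsilon>)"
  proof (rule poly_absval_bound)
    show "degree (P - H) \<le> n" using P degH by (rule degree_diff_le)
    show "absval (coeff (P - H) i) \<le> (6 / \<eta>) ^ n * \<epsilon>" for i
    proof (rule poly_coeff_bound[where S = "insert t Z"])
      show "degree (P - H) \<le> n" using P degH by (rule degree_diff_le)
      fix x assume x: "x \<in> insert t Z"
      show "absval (poly (P - H) x) \<le> \<epsilon>"
      proof (cases "x = t")
        case True
        have "(\<Prod>z\<in>Z. (t - z) / (t - z)) = 1" using t by (intro prod.neutral) auto
        then have "poly H t = poly P t" unfolding polyH by simp
        then show ?thesis using True small(2) by simp
      next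
        case False
        then have "poly H x = 0" using x Z unfolding polyH by (auto simp: prod_zero_iff)
        then show ?thesis using False x small by simp
      qed
    qed (use assms in auto)
  qed (rule S(2))
  then show ?thesis by (simp add: polyH)
qed

section \<open>Projections along the moment curve\<close>

text \<open>Closeness is relative to a coordinate set \<open>I\<close> because each induction step
  drops one coordinate in place of forming an abstract quotient space.\<close>

definition near :: "nat set \<Rightarrow> real \<Rightarrow> (nat \<Rightarrow> 'a::local_field_char_0) \<Rightarrow> (nat \<Rightarrow> 'a) \<Rightarrow> bool" where
  "near I e x y \<longleftrightarrow> (\<forall>k\<in>I. absval (x k - y k) \<le> e)"

lemma near_refl: "0 \<le> e \<Longrightarrow> near I e x x"
  by (simp add: near_def)

lemma near_sym: "near I e x y \<longleftrightarrow> near I e y x"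
  by (simp add: near_def absval_minus_commute)

lemma near_mono: "near I e x y \<Longrightarrow> e \<le> e' \<Longrightarrow> near I e' x y"
  by (force simp: near_def)

lemma near_trans: "near I a x y \<Longrightarrow> near I b y z \<Longrightarrow> near I (a + b) x z"
  unfolding near_def
proof
  fix k assume *: "\<forall>k\<in>I. absval (x k - y k) \<le> a" "\<forall>k\<in>I. absval (y k - z k) \<le> b" "k \<in> I"
  then show "absval (x k - z k) \<le> a + b"
    using absval_triangle_le[of "x k - y k" a "y k - z k" b] by simp
qed

lemma near_scale: "near I e x y \<Longrightarrow> near I (absval l * e) (\<lambda>k. l * x k) (\<lambda>k. l * y k)"
  by (auto simp: near_def absval_mult mult_left_mono simp flip: right_diff_distrib)

lemma near_diff: "near I a x y \<Longrightarrow> near I b x' y' \<Longrightarrow> near I (a + b) (\<lambda>k. x k - x' k) (\<lambda>k. y k - y' k)"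
  unfolding near_def
proof
  fix k assume *: "\<forall>k\<in>I. absval (x k - y k) \<le> a" "\<forall>k\<in>I. absval (x' k - y' k) \<le> b" "k \<in> I"
  then show "absval (x k - x' k - (y k - y' k)) \<le> a + b"
    using absval_triangle_diff_le[of "x k - y k" a "x' k - y' k" b] by (simp add: algebra_simps)
qed

text \<open>The first index is the weight, the second the coordinate in the multiplicity
  space.\<close>

type_synonym 'a point = "nat \<Rightarrow> nat \<Rightarrow> 'a"

text \<open>\<open>packing\<close> says that the field has dimension at most \<open>D\<close>. The
  numbers \<open>N\<close> and \<open>e1\<close> turn powers with exponent \<open>D\<close> into
  natural powers of \<open>L\<close>: \<open>N\<close> bounds \<open>D\<close> from above, and the 5
  in the condition on \<open>e1\<close> is the saving required when parameters close to chosen ones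
  are discarded.\<close>

locale moment_curve =
  fixes D C1 :: real and N e1 d :: nat and c :: "nat \<Rightarrow> 'a::local_field_char_0"
  assumes D_pos: "0 < D" and D_le: "D \<le> real N" and e1: "5 \<le> real e1 * D"
    and C1_ge_1: "1 \<le> C1"
    and packing: "\<And>e \<rho> x0 (E :: 'a set). 0 < e \<Longrightarrow> e \<le> \<rho> \<Longrightarrow> finite E \<Longrightarrow>
      (\<And>x. x \<in> E \<Longrightarrow> absval (x - x0) \<le> \<rho>) \<Longrightarrow>
      (\<And>x y. x \<in> E \<Longrightarrow> y \<in> E \<Longrightarrow> x \<noteq> y \<Longrightarrow> e < absval (x - y)) \<Longrightarrow> real (card E) \<le> C1 * (\<rho> / e) powr D"
    and d_pos: "1 \<le> d"
    and c_upper: "\<And>p. p \<le> d \<Longrightarrow> absval (c p) \<le> C1"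
    and c_lower: "\<And>p. p \<le> d \<Longrightarrow> 1 \<le> C1 * absval (c p)"
begin

definition pr :: "'a \<Rightarrow> 'a point \<Rightarrow> nat \<Rightarrow> 'a" where
  "pr s \<theta> k = (\<Sum>p\<le>d. c p * s ^ p * \<theta> p k)"

definition pnear :: "nat set \<Rightarrow> real \<Rightarrow> 'a point \<Rightarrow> 'a point \<Rightarrow> bool" where
  "pnear I e \<theta> \<theta>' \<longleftrightarrow> (\<forall>p\<le>d. near I e (\<theta> p) (\<theta>' p))"

lemma pnear_refl: "0 \<le> e \<Longrightarrow> pnear I e x x"
  by (simp add: pnear_def near_refl)

lemma pnear_sym: "pnear I e x y \<longleftrightarrow> pnear I e y x"
  by (simp add: pnear_def near_sym)

lemma pnear_mono: "pnear I e x y \<Longrightarrow> e \<le> e' \<Longrightarrow> pnear I e' x y"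
  by (auto simp: pnear_def intro: near_mono)

lemma pnear_trans: "pnear I a x y \<Longrightarrow> pnear I b y z \<Longrightarrow> pnear I (a + b) x z"
  unfolding pnear_def using near_trans by blast

definition prpoly :: "'a point \<Rightarrow> nat \<Rightarrow> 'a poly" where
  "prpoly \<theta> k = (\<Sum>p\<le>d. Polynomial.monom (c p * \<theta> p k) p)"

lemma poly_prpoly: "poly (prpoly \<theta> k) s = pr s \<theta> k"
  by (simp add: prpoly_def pr_def poly_sum poly_monom mult_ac)

lemma coeff_prpoly: "p \<le> d \<Longrightarrow> coeff (prpoly \<theta> k) p = c p * \<theta> p k"
  by (simp add: prpoly_def coeff_sum if_distrib sum.delta cong: if_cong)

lemma degree_prpoly: "degree (prpoly \<theta> k) \<le> d"
  unfolding prpoly_def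
  by (intro degree_sum_le) (auto intro: order_trans[OF degree_monom_le])

lemma pr_diff: "pr s (\<lambda>p k. \<theta> p k - \<theta>' p k) k = pr s \<theta> k - pr s \<theta>' k"
  by (simp add: pr_def right_diff_distrib sum_subtractf)

lemma near_pr:
  assumes "pnear I e \<theta> \<theta>'" "absval s \<le> 1" "0 \<le> e"
  shows "near I (real (Suc d) * (C1 * e)) (pr s \<theta>) (pr s \<theta>')"
  unfolding near_def
proof
  fix k assume k: "k \<in> I"
  have "pr s \<theta> k - pr s \<theta>' k = (\<Sum>p\<le>d. c p * s ^ p * (\<theta> p k - \<theta>' p k))"
    by (simp add: pr_def right_diff_distrib sum_subtractf)
  also have "absval \<dots> \<le> real (card {..d}) * (C1 * e)"
  proof (rule absval_sum_bound)
    fix p assume "p \<in> {..d}"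
    then have "absval (c p) \<le> C1" "absval (\<theta> p k - \<theta>' p k) \<le> e"
      using c_upper assms(1) k by (auto simp: pnear_def near_def)
    moreover have "absval (s ^ p) \<le> 1" using assms(2) by (simp add: absval_power power_le_one)
    ultimately have "absval (c p) * absval (s ^ p) * absval (\<theta> p k - \<theta>' p k) \<le> C1 * 1 * e"
      using C1_ge_1 assms(3) by (intro mult_mono) auto
    then show "absval (c p * s ^ p * (\<theta> p k - \<theta>' p k)) \<le> C1 * e" by (simp add: absval_mult)
  qed
  finally show "absval (pr s \<theta> k - pr s \<theta>' k) \<le> real (Suc d) * (C1 * e)" by simp
qed

text \<open>Each coordinate of the projection is a polynomial in \<open>s\<close> of degree at most
  \<open>d\<close> with coefficients \<open>c p * \<theta> p k\<close>, so \<open>d + 1\<close>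
  separated parameters determine the point. The factor \<open>C1\<close> undoes the multiplication
  by \<open>c p\<close>.\<close>

lemma pnear_of_pr:
  assumes T: "finite T" "card T = Suc d" "\<And>s. s \<in> T \<Longrightarrow> absval s \<le> 1"
    "\<And>s t. s \<in> T \<Longrightarrow> t \<in> T \<Longrightarrow> s \<noteq> t \<Longrightarrow> \<eta> \<le> absval (s - t)" and \<eta>: "0 < \<eta>" "\<eta> \<le> 1"
    and nr: "\<And>s. s \<in> T \<Longrightarrow> near I e (pr s \<theta>) (pr s \<theta>')"
  shows "pnear I (C1 * ((6 / \<eta>) ^ d * e)) \<theta> \<theta>'"
  unfolding pnear_def near_def
proof (intro allI impI ballI)
  fix p k assume p: "p \<le> d" and k: "k \<in> I"
  let ?x = "\<lambda>p k. \<theta> p k - \<theta>' p k"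
  have "absval (coeff (prpoly ?x k) p) \<le> (6 / \<eta>) ^ d * e"
    using nr k by (intro poly_coeff_bound[OF degree_prpoly T(1,2) \<eta>])
      (auto simp: poly_prpoly pr_diff near_def T)
  then have *: "absval (c p) * absval (?x p k) \<le> (6 / \<eta>) ^ d * e"
    using p by (simp add: coeff_prpoly absval_mult)
  have "absval (?x p k) \<le> C1 * absval (c p) * absval (?x p k)"
    using c_lower[OF p] mult_right_mono[of 1 "C1 * absval (c p)" "absval (?x p k)"] by simp
  also have "\<dots> \<le> C1 * ((6 / \<eta>) ^ d * e)"
    using * C1_ge_1 by (simp add: mult.assoc)
  finally show "absval (?x p k) \<le> C1 * ((6 / \<eta>) ^ d * e)" .
qed

text \<open>The source of the scalars acting on differences: agreement at the \<open>d\<close>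
  parameters of \<open>Z\<close> makes the differences at \<open>s\<close> and at \<open>t\<close>
  proportional, with a factor that depends on the parameters only.\<close>

lemma pr_interpolation:
  assumes Z: "finite Z" "card Z = d" and \<eta>: "0 < \<eta>" "\<eta> \<le> 1"
    and S: "\<And>s. s \<in> insert t Z \<Longrightarrow> absval s \<le> 1" "absval s \<le> 1"
    and sep: "\<And>s z. s \<in> insert t Z \<Longrightarrow> z \<in> insert t Z \<Longrightarrow> s \<noteq> z \<Longrightarrow> \<eta> \<le> absval (s - z)"
    and t: "t \<notin> Z" and nr: "\<And>z. z \<in> Z \<Longrightarrow> near I e (pr z \<theta>) (pr z \<theta>')" and e: "0 \<le> e"
  shows "near I (real (Suc d) * ((6 / \<eta>) ^ d * e)) (\<lambda>k. pr s \<theta> k - pr s \<theta>' k)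
    (\<lambda>k. (\<Prod>z\<in>Z. (s - z) / (t - z)) * (pr t \<theta> k - pr t \<theta>' k))"
  unfolding near_def
proof
  fix k assume k: "k \<in> I"
  show "absval (pr s \<theta> k - pr s \<theta>' k - (\<Prod>z\<in>Z. (s - z) / (t - z)) * (pr t \<theta> k - pr t \<theta>' k))
      \<le> real (Suc d) * ((6 / \<eta>) ^ d * e)"
    using poly_two_point_bound[where P = "prpoly (\<lambda>p k. \<theta> p k - \<theta>' p k) k" and \<epsilon> = e,
        OF degree_prpoly Z \<eta> S sep t] nr k e
    by (auto simp: poly_prpoly pr_diff near_def)
qed

text \<open>Rounding every coordinate to a net of mesh \<open>e / 2\<close> is injective on
  \<open>X\<close>, so the packing numbers of the coordinates multiply. The coordinate map
  \<open>co\<close> is arbitrary in order to allow mixed coordinates, such as a projection in place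
  of one entry.\<close>

lemma packing_family:
  fixes X :: "'x set" and co :: "'x \<Rightarrow> 'j \<Rightarrow> 'a"
  assumes "finite X" "finite J" "0 < e" "\<And>j. j \<in> J \<Longrightarrow> e \<le> \<rho> j"
    and ball: "\<And>x j. x \<in> X \<Longrightarrow> j \<in> J \<Longrightarrow> absval (co x j - x0 j) \<le> \<rho> j"
    and sep: "\<And>x y. x \<in> X \<Longrightarrow> y \<in> X \<Longrightarrow> x \<noteq> y \<Longrightarrow> \<exists>j\<in>J. e < absval (co x j - co y j)"
  shows "real (card X) \<le> (\<Prod>j\<in>J. C1 * (2 * \<rho> j / e) powr D)"
proof -
  have "\<exists>E lab. finite E \<and> real (card E) \<le> C1 * (2 * \<rho> j / e) powr D \<and>
      (\<forall>x\<in>X. lab x \<in> E \<and> absval (co x j - lab x) \<le> e / 2)" if j: "j \<in> J" for j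
  proof -
    obtain E where E: "E \<subseteq> (\<lambda>x. co x j) ` X" "finite E"
        "\<And>x y. x \<in> E \<Longrightarrow> y \<in> E \<Longrightarrow> x \<noteq> y \<Longrightarrow> \<not> absval (x - y) \<le> e / 2"
        "\<And>x. x \<in> (\<lambda>x. co x j) ` X \<Longrightarrow> \<exists>y\<in>E. absval (x - y) \<le> e / 2"
      using maximal_separated_finite[of "(\<lambda>x. co x j) ` X" "\<lambda>x y. absval (x - y) \<le> e / 2"] assms(1,3)
      by (auto simp: absval_minus_commute)
    have "real (card E) \<le> C1 * (\<rho> j / (e / 2)) powr D"
      using E assms(3) assms(4)[OF j] ball[OF _ j]
      by (intro packing[of "e / 2" _ _ "x0 j"]) (auto simp: not_le)
    then have card: "real (card E) \<le> C1 * (2 * \<rho> j / e) powr D" by (simp add: mult.commute)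
    have "\<forall>x\<in>X. \<exists>y. y \<in> E \<and> absval (co x j - y) \<le> e / 2"
      using E(4) by auto
    then obtain lab where "\<forall>x\<in>X. lab x \<in> E \<and> absval (co x j - lab x) \<le> e / 2"
      by (rule bchoice[THEN exE])
    with card E(2) show ?thesis by (intro exI[of _ E] exI[of _ lab]) simp
  qed
  then obtain E lab where E: "\<And>j. j \<in> J \<Longrightarrow> finite (E j)"
      "\<And>j. j \<in> J \<Longrightarrow> real (card (E j)) \<le> C1 * (2 * \<rho> j / e) powr D"
      "\<And>j x. j \<in> J \<Longrightarrow> x \<in> X \<Longrightarrow> lab j x \<in> E j \<and> absval (co x j - lab j x) \<le> e / 2"
    by metis
  define f where "f x = (\<lambda>j\<in>J. lab j x)" for x
  have "inj_on f X"
  proof (rule inj_onI, rule ccontr)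
    fix x y assume xy: "x \<in> X" "y \<in> X" "f x = f y" "x \<noteq> y"
    then obtain j where j: "j \<in> J" "e < absval (co x j - co y j)" using sep by blast
    have "absval ((co x j - lab j x) - (co y j - lab j y)) \<le> e / 2 + e / 2"
      using E(3)[OF j(1) xy(1)] E(3)[OF j(1) xy(2)] by (intro absval_triangle_diff_le) auto
    moreover have "lab j x = lab j y" using fun_cong[OF xy(3), of j] j by (simp add: f_def)
    ultimately show False using j by simp
  qed
  moreover have "f ` X \<subseteq> PiE J E" using E(3) by (auto simp: f_def)
  ultimately have "card X \<le> card (PiE J E)"
    using E(1) assms(2) by (intro card_inj_on_le finite_PiE) auto
  then have "real (card X) \<le> (\<Prod>j\<in>J. real (card (E j)))"
    using assms(2) by (simp add: card_PiE flip: of_nat_prod)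
  also have "\<dots> \<le> (\<Prod>j\<in>J. C1 * (2 * \<rho> j / e) powr D)"
    using E(2) by (intro prod_mono) auto
  finally show ?thesis .
qed

end

section \<open>Finding a long direction\<close>

context moment_curve
begin

text \<open>A discretised configuration at scale \<open>\<delta>\<close>; all losses are powers of \<open>L\<close>, and \<open>n\<close> stands
  for the common size of the projections, so that \<open>\<Theta>\<close> has about \<open>n ^ (d + 1)\<close> elements.\<close>

definition config :: "nat set \<Rightarrow> real \<Rightarrow> real \<Rightarrow> 'a set \<Rightarrow> 'a point set \<Rightarrow> real \<Rightarrow> bool" where
  "config I \<delta> L R \<Theta> n \<longleftrightarrow> finite I \<and> 0 < \<delta> \<and> \<delta> \<le> 1 \<and>
     C1 \<le> L \<and> 6 \<le> L \<and> real (Suc d) \<le> L \<and> 1 / \<delta> \<le> 2 powr L \<and> 0 < n \<and>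
     finite R \<and> (\<forall>r\<in>R. absval r \<le> 1) \<and> (\<forall>r\<in>R. \<forall>r'\<in>R. r \<noteq> r' \<longrightarrow> \<delta> < absval (r - r')) \<and>
     \<delta> powr (- D) \<le> L * real (card R) \<and>
     finite \<Theta> \<and> (\<forall>\<theta>\<in>\<Theta>. \<forall>\<theta>'\<in>\<Theta>. \<theta> \<noteq> \<theta>' \<longrightarrow> \<not> pnear I \<delta> \<theta> \<theta>') \<and>
     (\<forall>\<theta>\<in>\<Theta>. \<forall>\<theta>'\<in>\<Theta>. pnear I L \<theta> \<theta>') \<and>
     n ^ Suc d \<le> L * real (card \<Theta>) \<and>
     (\<forall>r\<in>R. \<exists>Y\<subseteq>\<Theta>. real (card Y) \<le> L * n \<and> (\<forall>\<theta>\<in>\<Theta>. \<exists>y\<in>Y. near I (L * \<delta>) (pr r \<theta>) (pr r y)))"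

text \<open>Exponent of the packing number of one coordinate confined to a ball of radius
  \<open>L ^ k\<close> times the separation; see \<open>C1_Lpow\<close>.\<close>

definition pe :: "nat \<Rightarrow> nat" where
  "pe k = 1 + (k + 1) * N"

text \<open>Exponent of the loss in interpolating through parameters that are
  \<open>1 / L ^ e1\<close> apart; see \<open>interp_const\<close>.\<close>

definition ep :: nat where
  "ep = Suc e1 * d + 2"

text \<open>Exponent for the number of separated points in \<open>m\<close> coordinates whose
  projections at \<open>d + 1\<close> separated parameters agree up to \<open>L ^ a\<close> times
  the scale.\<close>

definition ue :: "nat \<Rightarrow> nat \<Rightarrow> nat" where
  "ue m a = Suc d * m * pe (ep + a)"

end

section \<open>Separated parameters within one configuration\<close>

locale step = moment_curve D C1 N e1 d c
  for D C1 :: real and N e1 d :: nat and c :: "nat \<Rightarrow> 'a::local_field_char_0" +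
  fixes I :: "nat set" and \<delta> L :: real and R :: "'a set" and \<Theta> :: "'a point set" and n :: real
  assumes config: "config I \<delta> L R \<Theta> n" and small: "L ^ e1 * \<delta> \<le> 1" and I_nonempty: "I \<noteq> {}"
begin

lemma fin [simp]: "finite I" "finite R" "finite \<Theta>"
  and \<delta>_pos: "0 < \<delta>" and n_pos: "0 < n"
  and C1_le: "C1 \<le> L" and L_ge_6: "6 \<le> L" and d_le: "real (Suc d) \<le> L"
  and scales: "1 / \<delta> \<le> 2 powr L"
  and R_card: "\<delta> powr (- D) \<le> L * real (card R)"
  and card_lower: "n ^ Suc d \<le> L * real (card \<Theta>)"
  using config unfolding config_def by simp_all

lemma R_ball: "r \<in> R \<Longrightarrow> absval r \<le> 1"
  and R_sep: "r \<in> R \<Longrightarrow> r' \<in> R \<Longrightarrow> r \<noteq> r' \<Longrightarrow> \<delta> < absval (r - r')"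
  using config unfolding config_def by simp_all

lemma sep: "\<theta> \<in> \<Theta> \<Longrightarrow> \<theta>' \<in> \<Theta> \<Longrightarrow> pnear I \<delta> \<theta> \<theta>' \<Longrightarrow> \<theta> = \<theta>'"
  using config unfolding config_def by metis

lemma diam: "\<theta> \<in> \<Theta> \<Longrightarrow> \<theta>' \<in> \<Theta> \<Longrightarrow> pnear I L \<theta> \<theta>'"
  using config unfolding config_def by simp

lemma few: "r \<in> R \<Longrightarrow> \<exists>Y\<subseteq>\<Theta>. real (card Y) \<le> L * n \<and>
      (\<forall>\<theta>\<in>\<Theta>. \<exists>y\<in>Y. near I (L * \<delta>) (pr r \<theta>) (pr r y))"
  using config unfolding config_def by simp

lemma L_pos: "0 < L" and L_ge_1: "1 \<le> L"
  using L_ge_6 by auto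

lemma Lpow_pos [simp]: "0 < L ^ k"
  using L_pos by simp

lemma Lpow_ge_1: "1 \<le> L ^ k"
  using L_ge_1 by simp

lemma Lpow_mono: "a \<le> b \<Longrightarrow> L ^ a \<le> L ^ b"
  using L_ge_1 by (simp add: power_increasing)

lemma Lpow_absorb: "x \<le> L ^ a * y \<Longrightarrow> a \<le> b \<Longrightarrow> 0 \<le> y \<Longrightarrow> x \<le> L ^ b * y"
  using Lpow_mono[of a b] mult_right_mono[of "L ^ a" "L ^ b" y] by linarith

lemma six_Lpow: "6 * L ^ a \<le> L ^ Suc a"
  using L_ge_6 by (simp add: mult_right_mono)

lemma Lpow_nonneg [simp]: "0 \<le> L ^ k"
  using Lpow_pos less_imp_le by blast

lemma Lpow_absorb6: "x \<le> 6 \<Longrightarrow> 0 \<le> y \<Longrightarrow> x * L ^ a * y \<le> L ^ Suc a * y"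
  using mult_right_mono[of x L "L ^ a"] L_ge_6 by (intro mult_right_mono) auto

lemma Lpow_powr: "(L ^ k) powr D \<le> L ^ (k * N)"
proof -
  have "(L ^ k) powr D \<le> (L ^ k) powr real N"
    using D_le Lpow_ge_1[of k] by (intro powr_mono) auto
  also have "\<dots> = L ^ (k * N)"
    using L_pos by (simp add: powr_realpow power_mult)
  finally show ?thesis .
qed

lemma C1_Lpow: "C1 * (2 * L ^ k) powr D \<le> L ^ pe k"
proof -
  have "(2 * L ^ k) powr D \<le> (L ^ Suc k) powr D"
    using L_ge_6 D_pos by (intro powr_mono2) (auto intro: mult_right_mono)
  also have "\<dots> \<le> L ^ (Suc k * N)" by (rule Lpow_powr)
  finally have "C1 * (2 * L ^ k) powr D \<le> L * L ^ (Suc k * N)"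
    using C1_le C1_ge_1 by (intro mult_mono) auto
  then show ?thesis by (simp add: pe_def)
qed

text \<open>The separation of the chosen parameters. It is a power of \<open>1 / L\<close>, so
  interpolation through them loses only powers of \<open>L\<close>, and it is small enough that a
  few balls of this radius miss half of \<open>R\<close>.\<close>

definition \<eta> :: real where
  "\<eta> = 1 / L ^ e1"

lemma \<eta>: "0 < \<eta>" "\<eta> \<le> 1" "\<delta> \<le> \<eta>"
  using small Lpow_ge_1[of e1] by (auto simp: \<eta>_def field_simps)

lemma six_\<eta>: "(6 / \<eta>) ^ d \<le> L ^ (Suc e1 * d)"
proof -
  have "6 / \<eta> \<le> L ^ Suc e1" using six_Lpow[of e1] by (simp add: \<eta>_def)
  then have "(6 / \<eta>) ^ d \<le> (L ^ Suc e1) ^ d" using \<eta> by (intro power_mono) auto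
  then show ?thesis by (simp only: power_mult)
qed

lemma interp_const: "C1 * ((6 / \<eta>) ^ d * e) \<le> L ^ ep * e" "real (Suc d) * ((6 / \<eta>) ^ d * e) \<le> L ^ ep * e"
  if "0 \<le> e"
proof -
  have *: "L * (6 / \<eta>) ^ d \<le> L ^ ep"
  proof -
    have "L * (6 / \<eta>) ^ d \<le> L ^ Suc (Suc e1 * d)" using six_\<eta> L_pos by simp
    also have "\<dots> \<le> L ^ ep" by (intro Lpow_mono) (simp add: ep_def)
    finally show ?thesis .
  qed
  have "C1 * (6 / \<eta>) ^ d \<le> L * (6 / \<eta>) ^ d" "real (Suc d) * (6 / \<eta>) ^ d \<le> L * (6 / \<eta>) ^ d"
    using C1_le d_le \<eta> by (auto intro!: mult_right_mono)
  then have "C1 * (6 / \<eta>) ^ d \<le> L ^ ep" "real (Suc d) * (6 / \<eta>) ^ d \<le> L ^ ep"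
    using * by linarith+
  then show "C1 * ((6 / \<eta>) ^ d * e) \<le> L ^ ep * e" "real (Suc d) * ((6 / \<eta>) ^ d * e) \<le> L ^ ep * e"
    using that mult_right_mono by (metis mult.assoc)+
qed

lemma near_pr_loss:
  assumes "pnear J e \<theta> \<theta>'" "absval s \<le> 1" "0 \<le> e"
  shows "near J (L ^ 2 * e) (pr s \<theta>) (pr s \<theta>')"
proof (rule near_mono[OF near_pr[OF assms]])
  have "real (Suc d) * (C1 * e) \<le> L * (L * e)"
    using d_le C1_le C1_ge_1 assms(3) L_pos by (intro mult_mono) auto
  then show "real (Suc d) * (C1 * e) \<le> L ^ 2 * e" by (simp add: power2_eq_square mult.assoc)
qed

lemma R_in_ball:
  assumes "X \<subseteq> R" "\<And>r. r \<in> X \<Longrightarrow> absval (r - x) \<le> \<sigma>" "\<delta> \<le> \<sigma>"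
  shows "real (card X) \<le> C1 * (\<sigma> / \<delta>) powr D"
proof (rule packing[OF \<delta>_pos assms(3), where ?x0.0 = x])
  show "finite X" using assms(1) fin(2) by (rule finite_subset)
  show "\<delta> < absval (r - r')" if "r \<in> X" "r' \<in> X" "r \<noteq> r'" for r r'
    using that assms(1) by (intro R_sep) auto
qed (rule assms(2))

lemma R_card_upper: "real (card R) \<le> L * \<delta> powr (- D)"
proof -
  have "\<delta> \<le> 1" using \<eta> by linarith
  then have "real (card R) \<le> C1 * (1 / \<delta>) powr D"
    using R_in_ball[of R 0 1] R_ball by simp
  also have "(1 / \<delta>) powr D = \<delta> powr (- D)"
    using \<delta>_pos by (simp add: powr_minus_divide powr_divide)
  finally show ?thesis
    using C1_le mult_right_mono[of C1 L "\<delta> powr (- D)"] by simp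
qed

lemma \<delta>D_pos: "0 < \<delta> powr (- D)"
  using \<delta>_pos by simp

text \<open>A ball of radius \<open>\<eta>\<close> holds at most about
  \<open>(\<eta> / \<delta>) powr D\<close> parameters. The saving
  \<open>\<eta> powr D \<le> 1 / L ^ 5\<close> absorbs up to \<open>2 * L\<close> balls, the
  constant \<open>C1\<close> and the factor \<open>L\<close> in the lower bound for
  \<open>card R\<close>, and leaves \<open>2 / L ^ 2\<close>.\<close>

lemma R_near_few:
  assumes "W \<subseteq> R" "card W \<le> 2 * d + 1"
  shows "real (card {r\<in>R. \<exists>x\<in>W. absval (r - x) < \<eta>}) \<le> real (card R) / 2"
proof -
  have finW: "finite W" using assms(1) finite_subset fin by blast
  have "{r\<in>R. \<exists>x\<in>W. absval (r - x) < \<eta>} = (\<Union>x\<in>W. {r\<in>R. absval (r - x) < \<eta>})" by auto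
  then have "real (card {r\<in>R. \<exists>x\<in>W. absval (r - x) < \<eta>}) \<le> (\<Sum>x\<in>W. real (card {r\<in>R. absval (r - x) < \<eta>}))"
    using card_UN_le[OF finW, of "\<lambda>x. {r\<in>R. absval (r - x) < \<eta>}"] by (simp flip: of_nat_sum)
  also have "\<dots> \<le> (\<Sum>x\<in>W. C1 * (\<eta> / \<delta>) powr D)"
  proof (rule sum_mono)
    fix x show "real (card {r\<in>R. absval (r - x) < \<eta>}) \<le> C1 * (\<eta> / \<delta>) powr D"
      using \<eta> by (intro R_in_ball[of _ x]) auto
  qed
  also have "\<dots> = real (card W) * (C1 * (\<eta> / \<delta>) powr D)" by simp
  also have "\<dots> \<le> (2 * L) * (L * (\<eta> / \<delta>) powr D)"
  proof (intro mult_mono)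
    show "real (card W) \<le> 2 * L" using assms(2) d_le by linarith
  qed (use C1_le C1_ge_1 L_pos in auto)
  also have "(\<eta> / \<delta>) powr D = \<eta> powr D * \<delta> powr (- D)"
    using \<delta>_pos by (simp add: powr_divide powr_minus_divide)
  also have "\<eta> powr D \<le> 1 / L ^ 5"
  proof -
    have "L ^ 5 = L powr 5" using L_pos powr_realpow[of L 5] by simp
    also have "\<dots> \<le> L powr (real e1 * D)" using e1 L_ge_1 by (intro powr_mono) auto
    also have "\<dots> = (L ^ e1) powr D" using L_pos by (simp add: powr_powr flip: powr_realpow)
    finally show ?thesis
      using Lpow_pos[of 5] by (simp add: \<eta>_def powr_divide frac_le)
  qed
  then have "2 * L * (L * (\<eta> powr D * \<delta> powr (- D))) \<le> 2 * L * (L * (1 / L ^ 5 * (L * real (card R))))"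
    using R_card L_pos \<delta>D_pos by (intro mult_left_mono mult_mono) auto
  also have "\<dots> = 2 * real (card R) / L ^ 2"
    using L_pos by (simp add: field_simps power_numeral_reduce)
  also have "\<dots> \<le> real (card R) / 2"
  proof -
    have "4 \<le> L ^ 2" using power_mono[OF L_ge_6, of 2] by simp
    then have "real (card R) * 4 \<le> real (card R) * L ^ 2" by (intro mult_left_mono) auto
    then show ?thesis using L_pos by (simp add: field_simps)
  qed
  finally show ?thesis by simp
qed

lemma R_nonempty: "0 < card R"
proof -
  have "0 < L * real (card R)" using R_card \<delta>D_pos by linarith
  then show ?thesis using L_pos by (simp add: zero_less_mult_iff)
qed

lemma separated_points_exist:
  "k \<le> 2 * d + 1 \<Longrightarrow> \<exists>W\<subseteq>R. card W = k \<and> (\<forall>x\<in>W. \<forall>y\<in>W. x \<noteq> y \<longrightarrow> \<eta> \<le> absval (x - y))"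
proof (induction k)
  case 0
  then show ?case by (intro exI[of _ "{}"]) auto
next
  case (Suc k)
  then obtain W where W: "W \<subseteq> R" "card W = k" "\<And>x y. x \<in> W \<Longrightarrow> y \<in> W \<Longrightarrow> x \<noteq> y \<Longrightarrow> \<eta> \<le> absval (x - y)"
    by auto
  have finW: "finite W" using W(1) finite_subset fin by blast
  have "real (card {r\<in>R. \<exists>x\<in>W. absval (r - x) < \<eta>}) < real (card R)"
    using R_near_few[OF W(1)] W(2) Suc.prems R_nonempty by auto
  then have "{r\<in>R. \<exists>x\<in>W. absval (r - x) < \<eta>} \<noteq> R" by auto
  then obtain r where r: "r \<in> R" "\<And>x. x \<in> W \<Longrightarrow> \<eta> \<le> absval (r - x)" by fastforce
  have "r \<notin> W" using r(2)[of r] \<eta> by auto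
  then show ?case
    using W r finW absval_minus_commute
    by (intro exI[of _ "insert r W"]) (auto simp: absval_minus_commute[of _ r])
qed

end

text \<open>\<open>Z\<close> supplies \<open>d - 1\<close> fixed zeros, to which one moving
  parameter \<open>r\<close> of \<open>R'\<close> is added; differences are compared between
  \<open>t\<close> and the elements of \<open>S\<close>. The set \<open>S\<close> has
  \<open>d + 1\<close> elements so that projections at \<open>S\<close> determine a point.
  \<open>Y r\<close> represents the projections at \<open>r\<close>, and \<open>\<kappa> r\<close>
  rounds to it, so \<open>\<kappa> r \<theta>\<close> is the label of \<open>\<theta>\<close> at
  \<open>r\<close>.\<close>

locale selected = step +
  fixes Z :: "'a set" and t :: 'a and S :: "'a set" and R' :: "'a set"
    and Y :: "'a \<Rightarrow> 'a point set" and \<kappa> :: "'a \<Rightarrow> 'a point \<Rightarrow> 'a point"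
  assumes sub: "Z \<subseteq> R" "t \<in> R" "S \<subseteq> R" "R' \<subseteq> R"
    and cards: "card Z = d - 1" "card S = Suc d"
    and distinct: "t \<notin> Z" "t \<notin> S" "Z \<inter> S = {}"
    and W_sep: "\<And>x y. x \<in> insert t (Z \<union> S) \<Longrightarrow> y \<in> insert t (Z \<union> S) \<Longrightarrow> x \<noteq> y \<Longrightarrow> \<eta> \<le> absval (x - y)"
    and R'_sep: "\<And>r x. r \<in> R' \<Longrightarrow> x \<in> insert t (Z \<union> S) \<Longrightarrow> \<eta> \<le> absval (r - x)"
    and R'_card: "real (card R) \<le> 2 * real (card R')"
    and Y_sub: "\<And>r. r \<in> R \<Longrightarrow> Y r \<subseteq> \<Theta>" and Y_card: "\<And>r. r \<in> R \<Longrightarrow> real (card (Y r)) \<le> L * n"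
    and Y_sep: "\<And>r y y'. r \<in> R \<Longrightarrow> y \<in> Y r \<Longrightarrow> y' \<in> Y r \<Longrightarrow> near I (2 * L * \<delta>) (pr r y) (pr r y') \<Longrightarrow> y = y'"
    and \<kappa>: "\<And>r \<theta>. r \<in> R \<Longrightarrow> \<theta> \<in> \<Theta> \<Longrightarrow> \<kappa> r \<theta> \<in> Y r"
      "\<And>r \<theta>. r \<in> R \<Longrightarrow> \<theta> \<in> \<Theta> \<Longrightarrow> near I (2 * L * \<delta>) (pr r \<theta>) (pr r (\<kappa> r \<theta>))"

lemma (in step) selection_exists:
  "\<exists>Z t S R' Y \<kappa>. selected D C1 N e1 d c I \<delta> L R \<Theta> n Z t S R' Y \<kappa>"
proof -
  \<comment> \<open>The \<open>2 * d + 1\<close> points split into \<open>d + 1\<close> for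
    \<open>S\<close>, one for \<open>t\<close> and \<open>d - 1\<close> for
    \<open>Z\<close>.\<close>
  obtain W where W: "W \<subseteq> R" "card W = 2 * d + 1" "\<And>x y. x \<in> W \<Longrightarrow> y \<in> W \<Longrightarrow> x \<noteq> y \<Longrightarrow> \<eta> \<le> absval (x - y)"
    using separated_points_exist[of "2 * d + 1"] by auto
  have finW: "finite W" using W(1) finite_subset fin by blast
  obtain S where S: "S \<subseteq> W" "card S = Suc d"
  proof (rule obtain_subset_with_card_n[of "Suc d" W])
    show "Suc d \<le> card W" using W(2) by simp
    fix T assume "T \<subseteq> W" "card T = Suc d"
    then show thesis by (rule that)
  qed
  have cWS: "card (W - S) = d"
    using S W finW by (subst card_Diff_subset) (auto intro: finite_subset)
  then have "W - S \<noteq> {}" using d_pos by (intro notI) simp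
  then obtain t where t: "t \<in> W" "t \<notin> S" by blast
  define Z where "Z = W - S - {t}"
  have Z: "card Z = d - 1" "insert t (Z \<union> S) = W"
    using cWS t S finW by (auto simp: Z_def card_Diff_singleton)
  define R' where "R' = {r\<in>R. \<not> (\<exists>x\<in>W. absval (r - x) < \<eta>)}"
  have "card R = card (R' \<union> {r\<in>R. \<exists>x\<in>W. absval (r - x) < \<eta>})"
    by (rule arg_cong[of _ _ card]) (auto simp: R'_def)
  also have "\<dots> \<le> card R' + card {r\<in>R. \<exists>x\<in>W. absval (r - x) < \<eta>}"
    by (rule card_Un_le)
  finally have "card R \<le> card R' + card {r\<in>R. \<exists>x\<in>W. absval (r - x) < \<eta>}" .
  then have R': "real (card R) \<le> 2 * real (card R')"
    using R_near_few[OF W(1)] W(2) by simp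
  have "\<exists>Y \<kappa>. Y \<subseteq> \<Theta> \<and> real (card Y) \<le> L * n \<and>
      (\<forall>y\<in>Y. \<forall>y'\<in>Y. near I (2 * L * \<delta>) (pr r y) (pr r y') \<longrightarrow> y = y') \<and>
      (\<forall>\<theta>\<in>\<Theta>. \<kappa> \<theta> \<in> Y \<and> near I (2 * L * \<delta>) (pr r \<theta>) (pr r (\<kappa> \<theta>)))" if r: "r \<in> R" for r
  proof -
    obtain Y0 where Y0: "Y0 \<subseteq> \<Theta>" "real (card Y0) \<le> L * n"
        "\<And>\<theta>. \<theta> \<in> \<Theta> \<Longrightarrow> \<exists>y\<in>Y0. near I (L * \<delta>) (pr r \<theta>) (pr r y)"
      using few[OF r] by blast
    obtain Y where Y: "Y \<subseteq> \<Theta>" "finite Y"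
        "\<And>x y. x \<in> Y \<Longrightarrow> y \<in> Y \<Longrightarrow> x \<noteq> y \<Longrightarrow> \<not> near I (2 * L * \<delta>) (pr r x) (pr r y)"
        "\<And>x. x \<in> \<Theta> \<Longrightarrow> \<exists>y\<in>Y. near I (2 * L * \<delta>) (pr r x) (pr r y)"
    proof (rule maximal_separated_finite[of \<Theta> "\<lambda>x y. near I (2 * L * \<delta>) (pr r x) (pr r y)"])
      show "near I (2 * L * \<delta>) (pr r x) (pr r x)" for x
        using L_pos \<delta>_pos by (intro near_refl) simp
    next
      fix E assume "E \<subseteq> \<Theta>" "finite E"
        "\<And>x y. x \<in> E \<Longrightarrow> y \<in> E \<Longrightarrow> x \<noteq> y \<Longrightarrow> \<not> near I (2 * L * \<delta>) (pr r x) (pr r y)"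
        "\<And>x. x \<in> \<Theta> \<Longrightarrow> \<exists>y\<in>E. near I (2 * L * \<delta>) (pr r x) (pr r y)"
      then show thesis by (rule that)
    qed (simp_all add: near_sym)
    obtain f where f: "\<And>\<theta>. \<theta> \<in> \<Theta> \<Longrightarrow> f \<theta> \<in> Y0 \<and> near I (L * \<delta>) (pr r \<theta>) (pr r (f \<theta>))"
      using Y0(3) by metis
    \<comment> \<open>Elements of \<open>Y\<close> are \<open>2 * L * \<delta>\<close> apart and
      hence cannot share a centre in \<open>Y0\<close>; thus \<open>Y\<close> inherits the bound
      \<open>L * n\<close>.\<close>
    have "inj_on f Y"
    proof (rule inj_onI, rule ccontr)
      fix x y assume xy: "x \<in> Y" "y \<in> Y" "f x = f y" "x \<noteq> y"
      then have "near I (L * \<delta>) (pr r x) (pr r (f x))" "near I (L * \<delta>) (pr r y) (pr r (f x))"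
        using f[of x] f[of y] Y(1) xy by (auto simp: subset_iff)
      then have "near I (L * \<delta> + L * \<delta>) (pr r x) (pr r y)"
        by (intro near_trans[where y = "pr r (f x)"]) (simp_all add: near_sym[of _ _ "pr r (f x)"])
      then have "near I (2 * L * \<delta>) (pr r x) (pr r y)" by (simp add: mult.assoc)
      then show False using Y(3) xy by blast
    qed
    then have "card Y \<le> card Y0"
      using f Y(1) Y0(1) by (intro card_inj_on_le[of f]) (auto intro: finite_subset)
    then have "real (card Y) \<le> L * n" using Y0(2) by linarith
    moreover obtain \<kappa> where "\<And>\<theta>. \<theta> \<in> \<Theta> \<Longrightarrow> \<kappa> \<theta> \<in> Y \<and> near I (2 * L * \<delta>) (pr r \<theta>) (pr r (\<kappa> \<theta>))"
      using Y(4) by metis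
    ultimately show ?thesis using Y by (intro exI[of _ Y] exI[of _ \<kappa>]) blast
  qed
  then obtain Y \<kappa> where Y: "\<And>r. r \<in> R \<Longrightarrow> Y r \<subseteq> \<Theta> \<and> real (card (Y r)) \<le> L * n \<and>
      (\<forall>y\<in>Y r. \<forall>y'\<in>Y r. near I (2 * L * \<delta>) (pr r y) (pr r y') \<longrightarrow> y = y') \<and>
      (\<forall>\<theta>\<in>\<Theta>. \<kappa> r \<theta> \<in> Y r \<and> near I (2 * L * \<delta>) (pr r \<theta>) (pr r (\<kappa> r \<theta>)))"
    by metis
  have "selected D C1 N e1 d c I \<delta> L R \<Theta> n Z t S R' Y \<kappa>"
  proof
    show "Z \<subseteq> R" "t \<in> R" "S \<subseteq> R" "R' \<subseteq> R" "card Z = d - 1" "card S = Suc d" "t \<notin> Z" "t \<notin> S" "Z \<inter> S = {}"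
      "real (card R) \<le> 2 * real (card R')"
      using W S t Z R' by (auto simp: Z_def R'_def)
    show "\<eta> \<le> absval (x - y)" if "x \<in> insert t (Z \<union> S)" "y \<in> insert t (Z \<union> S)" "x \<noteq> y" for x y
      using W(3) that unfolding Z(2) by blast
    show "\<eta> \<le> absval (r - x)" if "r \<in> R'" "x \<in> insert t (Z \<union> S)" for r x
      using that unfolding Z(2) R'_def by force
  qed (use Y in blast)+
  then show ?thesis by blast
qed

section \<open>Labels at \<open>d + 1\<close> nodes and pairs agreeing at \<open>d\<close>
  parameters\<close>

context selected
begin

lemma fins [simp]: "finite Z" "finite S" "finite R'" and finY: "r \<in> R \<Longrightarrow> finite (Y r)"
  using sub Y_sub finite_subset[OF _ fin(2)] finite_subset[OF _ fin(3)] by auto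

lemma t_not_in [simp]: "t \<notin> Z" "t \<notin> S"
  using distinct by auto

lemma R'_not_in: "r \<in> R' \<Longrightarrow> r \<notin> insert t (Z \<union> S)"
  using R'_sep[of r r] \<eta> by auto

lemma R'_in: "r \<in> R' \<Longrightarrow> r \<in> R"
  using sub by auto

definition nodes :: "'a set \<Rightarrow> bool" where
  "nodes T \<longleftrightarrow> T \<subseteq> R \<and> card T = Suc d \<and> (\<forall>x\<in>T. \<forall>y\<in>T. x \<noteq> y \<longrightarrow> \<eta> \<le> absval (x - y))"

lemma nodes_S: "nodes S"
  using sub cards W_sep by (auto simp: nodes_def)

lemma nodes_Z: "s \<in> S \<Longrightarrow> nodes (insert s (insert t Z))"
  using sub cards W_sep distinct d_pos by (auto simp: nodes_def card_insert_if)

lemma nodes_R': "r \<in> R' \<Longrightarrow> x \<in> insert t S \<Longrightarrow> nodes (insert r (insert x Z))"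
  using sub cards W_sep distinct d_pos R'_not_in[of r] R'_sep[of r] R'_in[of r]
  by (auto simp: nodes_def card_insert_if absval_minus_commute[of _ r])

text \<open>Stated for a general coordinate set \<open>J\<close> because it is applied both to
  \<open>I\<close> and to the quotient, where one coordinate is missing.\<close>

lemma card_nodes_bound_gen:
  assumes T: "nodes T" and X: "finite X" "finite J"
    "\<And>\<theta> \<theta>'. \<theta> \<in> X \<Longrightarrow> \<theta>' \<in> X \<Longrightarrow> pnear J \<delta> \<theta> \<theta>' \<Longrightarrow> \<theta> = \<theta>'"
    and near: "\<And>\<theta> \<theta>' s. \<theta> \<in> X \<Longrightarrow> \<theta>' \<in> X \<Longrightarrow> s \<in> T \<Longrightarrow> near J (L ^ a * \<delta>) (pr s \<theta>) (pr s \<theta>')"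
  shows "real (card X) \<le> L ^ ue (card J) a"
proof (cases "X = {}")
  case False
  then obtain \<theta>0 where \<theta>0: "\<theta>0 \<in> X" by blast
  have finT: "finite T" using T fin(2) unfolding nodes_def by (auto intro: finite_subset)
  have close: "pnear J (L ^ (ep + a) * \<delta>) \<theta> \<theta>'" if "\<theta> \<in> X" "\<theta>' \<in> X" for \<theta> \<theta>'
  proof -
    have "pnear J (C1 * ((6 / \<eta>) ^ d * (L ^ a * \<delta>))) \<theta> \<theta>'"
      using T R_ball near[OF that] \<eta> finT by (intro pnear_of_pr[of T]) (auto simp: nodes_def)
    moreover have "C1 * ((6 / \<eta>) ^ d * (L ^ a * \<delta>)) \<le> L ^ ep * (L ^ a * \<delta>)"
      using \<delta>_pos L_pos by (intro interp_const) simp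
    ultimately show ?thesis
      by (rule pnear_mono[THEN pnear_mono]) (simp add: power_add mult.assoc)
  qed
  have "real (card X) \<le> (\<Prod>j\<in>{..d} \<times> J. C1 * (2 * (L ^ (ep + a) * \<delta>) / \<delta>) powr D)"
  proof (rule packing_family[where co = "\<lambda>\<theta> j. \<theta> (fst j) (snd j)" and ?x0.0 = "\<lambda>j. \<theta>0 (fst j) (snd j)"])
    show "\<delta> \<le> L ^ (ep + a) * \<delta>" using Lpow_ge_1 \<delta>_pos by simp
    show "absval (\<theta> (fst j) (snd j) - \<theta>0 (fst j) (snd j)) \<le> L ^ (ep + a) * \<delta>"
      if "\<theta> \<in> X" "j \<in> {..d} \<times> J" for \<theta> j
      using close[OF that(1) \<theta>0] that(2) by (auto simp: pnear_def near_def)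
    show "\<exists>j\<in>{..d} \<times> J. \<delta> < absval (x (fst j) (snd j) - y (fst j) (snd j))"
      if "x \<in> X" "y \<in> X" "x \<noteq> y" for x y
      using X(3)[of x y] that by (force simp: pnear_def near_def not_le)
  qed (use \<delta>_pos X in auto)
  also have "\<dots> = (C1 * (2 * L ^ (ep + a)) powr D) ^ (Suc d * card J)"
    using \<delta>_pos by (simp add: card_cartesian_product mult.assoc)
  also have "\<dots> \<le> (L ^ pe (ep + a)) ^ (Suc d * card J)"
    using C1_Lpow[of "ep + a"] C1_ge_1 by (intro power_mono) auto
  also have "\<dots> = L ^ ue (card J) a"
    by (simp add: ue_def power_mult[symmetric] mult_ac)
  finally show ?thesis .
qed simp

lemma card_nodes_bound:
  assumes T: "nodes T" and X: "X \<subseteq> \<Theta>"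
    and near: "\<And>\<theta> \<theta>' s. \<theta> \<in> X \<Longrightarrow> \<theta>' \<in> X \<Longrightarrow> s \<in> T \<Longrightarrow> near I (L ^ a * \<delta>) (pr s \<theta>) (pr s \<theta>')"
  shows "real (card X) \<le> L ^ ue (card I) a"
  using X sep finite_subset[OF X fin(3)] by (intro card_nodes_bound_gen[OF T _ fin(1) _ near]) auto

lemma restrict_eqD: "restrict f A = restrict g A \<Longrightarrow> x \<in> A \<Longrightarrow> f x = g x"
  by (metis restrict_apply')

lemma \<kappa>_near: "near I (L ^ 2 * \<delta>) (pr r \<theta>) (pr r (\<kappa> r \<theta>))" if "r \<in> R" "\<theta> \<in> \<Theta>"
proof (rule near_mono[OF \<kappa>(2)[OF that]])
  show "2 * L * \<delta> \<le> L ^ 2 * \<delta>"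
    using Lpow_absorb6[of 2 \<delta> 1] \<delta>_pos by (simp add: numeral_2_eq_2)
qed

lemma same_\<kappa>: "r \<in> R \<Longrightarrow> \<theta> \<in> \<Theta> \<Longrightarrow> \<theta>' \<in> \<Theta> \<Longrightarrow> \<kappa> r \<theta> = \<kappa> r \<theta>' \<Longrightarrow> near I (L ^ 3 * \<delta>) (pr r \<theta>) (pr r \<theta>')"
proof -
  assume *: "r \<in> R" "\<theta> \<in> \<Theta>" "\<theta>' \<in> \<Theta>" "\<kappa> r \<theta> = \<kappa> r \<theta>'"
  have "near I (L ^ 2 * \<delta> + L ^ 2 * \<delta>) (pr r \<theta>) (pr r \<theta>')"
    using \<kappa>_near[OF *(1,2)] \<kappa>_near[OF *(1,3)] *(4) by (metis near_sym near_trans)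
  moreover have "L ^ 2 * \<delta> + L ^ 2 * \<delta> \<le> L ^ 3 * \<delta>"
    using Lpow_absorb6[of 2 \<delta> 2] \<delta>_pos by (simp add: numeral_3_eq_3)
  ultimately show ?thesis by (rule near_mono)
qed

abbreviation u3 :: nat where
  "u3 \<equiv> ue (card I) 3"

lemma card_same_labels:
  assumes "nodes T" "X \<subseteq> \<Theta>" "\<And>\<theta> \<theta>' s. \<theta> \<in> X \<Longrightarrow> \<theta>' \<in> X \<Longrightarrow> s \<in> T \<Longrightarrow> \<kappa> s \<theta> = \<kappa> s \<theta>'"
  shows "real (card X) \<le> L ^ u3"
proof (rule card_nodes_bound[OF assms(1,2)])
  fix \<theta> \<theta>' s assume *: "\<theta> \<in> X" "\<theta>' \<in> X" "s \<in> T"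
  then show "near I (L ^ 3 * \<delta>) (pr s \<theta>) (pr s \<theta>')"
    using assms(1,2) by (intro same_\<kappa>[OF _ _ _ assms(3)[OF *]]) (auto simp: nodes_def)
qed

lemma card_labels: "T \<subseteq> R \<Longrightarrow> real (card (PiE T Y)) \<le> (L * n) ^ card T"
proof -
  assume T: "T \<subseteq> R"
  then have "finite T" using fin(2) by (rule finite_subset)
  then have "real (card (PiE T Y)) = (\<Prod>s\<in>T. real (card (Y s)))"
    by (simp add: card_PiE)
  also have "\<dots> \<le> (\<Prod>s\<in>T. L * n)"
    using T Y_card by (intro prod_mono) auto
  finally show ?thesis by simp
qed

lemma finite_labels: "T \<subseteq> R \<Longrightarrow> finite (PiE T Y)"
  using finY fin(2) by (intro finite_PiE) (auto intro: finite_subset)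

text \<open>Labels at the \<open>d + 1\<close> parameters of \<open>S\<close> determine a point up
  to \<open>L ^ u3\<close> choices, and each label takes at most \<open>L * n\<close> values.
  Together with \<open>card_lower\<close> this makes \<open>\<Theta>\<close> nearly a full product
  of its projections.\<close>

lemma card_upper: "real (card \<Theta>) \<le> L ^ (Suc d + u3) * n ^ Suc d"
proof -
  have SR: "S \<subseteq> R" using sub by simp
  have "real (card \<Theta>) \<le> real (card (PiE S Y)) * L ^ u3"
  proof (rule card_le_fibre_bound[where f = "\<lambda>\<theta>. \<lambda>s\<in>S. \<kappa> s \<theta>"])
    show "(\<lambda>\<theta>. \<lambda>s\<in>S. \<kappa> s \<theta>) ` \<Theta> \<subseteq> PiE S Y" using \<kappa>(1) SR by auto
    fix y
    show "real (card {\<theta> \<in> \<Theta>. (\<lambda>s\<in>S. \<kappa> s \<theta>) = y}) \<le> L ^ u3"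
    proof (rule card_same_labels[OF nodes_S])
      fix \<theta> \<theta>' s assume *: "\<theta> \<in> {\<theta> \<in> \<Theta>. (\<lambda>s\<in>S. \<kappa> s \<theta>) = y}"
        "\<theta>' \<in> {\<theta> \<in> \<Theta>. (\<lambda>s\<in>S. \<kappa> s \<theta>) = y}" "s \<in> S"
      then have "restrict (\<lambda>s. \<kappa> s \<theta>) S = restrict (\<lambda>s. \<kappa> s \<theta>') S" by simp
      from restrict_eqD[OF this *(3)] show "\<kappa> s \<theta> = \<kappa> s \<theta>'" .
    qed auto
  qed (use SR finite_labels in auto)
  also have "\<dots> \<le> (L * n) ^ Suc d * L ^ u3"
    using card_labels[OF SR] cards by (intro mult_right_mono) auto
  finally show ?thesis by (simp add: power_mult_distrib power_add mult_ac)
qed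

definition dif :: "'a \<Rightarrow> 'a point \<Rightarrow> 'a point \<Rightarrow> nat \<Rightarrow> 'a" where
  "dif s \<theta> \<theta>' = (\<lambda>k. pr s \<theta>' k - pr s \<theta> k)"

lemma dif_\<kappa>: "s \<in> R \<Longrightarrow> \<theta> \<in> \<Theta> \<Longrightarrow> \<theta>' \<in> \<Theta> \<Longrightarrow> near I (L ^ 3 * \<delta>) (dif s \<theta> \<theta>') (dif s (\<kappa> s \<theta>) (\<kappa> s \<theta>'))"
proof -
  assume *: "s \<in> R" "\<theta> \<in> \<Theta>" "\<theta>' \<in> \<Theta>"
  have "near I (L ^ 2 * \<delta> + L ^ 2 * \<delta>) (dif s \<theta> \<theta>') (dif s (\<kappa> s \<theta>) (\<kappa> s \<theta>'))"
    unfolding dif_def by (intro near_diff \<kappa>_near *)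
  moreover have "L ^ 2 * \<delta> + L ^ 2 * \<delta> \<le> L ^ 3 * \<delta>"
    using Lpow_absorb6[of 2 \<delta> 2] \<delta>_pos by (simp add: numeral_3_eq_3)
  ultimately show ?thesis by (rule near_mono)
qed

text \<open>Equal labels at the \<open>d\<close> parameters of \<open>insert r Z\<close> are what
  makes the differences of the pair at all other parameters proportional.\<close>

definition Col :: "'a \<Rightarrow> ('a point \<times> 'a point) set" where
  "Col r = {(\<theta>, \<theta>') \<in> \<Theta> \<times> \<Theta>. \<forall>z\<in>insert r Z. \<kappa> z \<theta> = \<kappa> z \<theta>'}"

lemma Col_finite [simp]: "finite (Col r)"
  by (rule finite_subset[of _ "\<Theta> \<times> \<Theta>"]) (auto simp: Col_def)

lemma card_insert_Z: "r \<in> R' \<Longrightarrow> card (insert r Z) = d"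
  using R'_not_in[of r] cards d_pos by simp

text \<open>About \<open>n ^ (d + 1)\<close> points share at most \<open>(L * n) ^ d\<close> label
  vectors, so \<open>card_collisions\<close> produces about \<open>n ^ (d + 2)\<close>
  pairs.\<close>

lemma Col_card: "r \<in> R' \<Longrightarrow> n ^ (d + 2) \<le> L ^ (d + 2) * real (card (Col r))"
proof -
  assume r: "r \<in> R'"
  let ?f = "\<lambda>\<theta>. \<lambda>z\<in>insert r Z. \<kappa> z \<theta>"
  have T: "insert r Z \<subseteq> R" using sub r by auto
  have "(n ^ Suc d)^2 \<le> (L * real (card \<Theta>))^2"
    using card_lower n_pos by (intro power_mono) auto
  also have "\<dots> = L^2 * (real (card \<Theta>))^2" by (simp add: power_mult_distrib)
  also have "(real (card \<Theta>))^2 \<le> real (card {(x, y) \<in> \<Theta> \<times> \<Theta>. ?f x = ?f y}) * real (card (PiE (insert r Z) Y))"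
    using T \<kappa>(1) finite_labels[OF T] by (intro card_collisions) auto
  also have "{(x, y) \<in> \<Theta> \<times> \<Theta>. ?f x = ?f y} = Col r"
    by (auto simp: Col_def fun_eq_iff restrict_def; metis)
  also have "real (card (Col r)) * real (card (PiE (insert r Z) Y)) \<le> real (card (Col r)) * (L * n) ^ d"
    using card_labels[OF T] card_insert_Z[OF r] by (intro mult_left_mono) auto
  finally have "(n ^ Suc d)^2 \<le> L^2 * (real (card (Col r)) * (L * n) ^ d)"
    using L_pos by (simp add: mult_left_mono)
  then have "n ^ d * n ^ (d + 2) \<le> n ^ d * (L ^ (d + 2) * real (card (Col r)))"
    by (simp add: power_mult_distrib power2_eq_square power_add mult_ac)
  then show ?thesis using n_pos by simp
qed

text \<open>The ratio of the values at \<open>s\<close> and \<open>t\<close> of the polynomial with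
  zero set \<open>insert r Z\<close>; only the zero \<open>r\<close> will vary.\<close>

definition lam :: "'a \<Rightarrow> 'a \<Rightarrow> 'a" where
  "lam r s = (\<Prod>z\<in>insert r Z. (s - z) / (t - z))"

lemma Col_dif:
  assumes r: "r \<in> R'" and s: "s \<in> S" and C: "(\<theta>, \<theta>') \<in> Col r"
  shows "near I (L ^ (ep + 3) * \<delta>) (dif s \<theta> \<theta>') (\<lambda>k. lam r s * dif t \<theta> \<theta>' k)"
proof -
  have sub': "insert t (insert r Z) \<subseteq> R" using sub r by auto
  have \<theta>: "\<theta> \<in> \<Theta>" "\<theta>' \<in> \<Theta>" "\<And>z. z \<in> insert r Z \<Longrightarrow> \<kappa> z \<theta>' = \<kappa> z \<theta>"
    using C by (auto simp: Col_def)
  have "near I (real (Suc d) * ((6 / \<eta>) ^ d * (L ^ 3 * \<delta>))) (\<lambda>k. pr s \<theta>' k - pr s \<theta> k)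
      (\<lambda>k. (\<Prod>z\<in>insert r Z. (s - z) / (t - z)) * (pr t \<theta>' k - pr t \<theta> k))"
  proof (rule pr_interpolation)
    show "card (insert r Z) = d" by (rule card_insert_Z[OF r])
    show "absval s \<le> 1" using s sub R_ball by auto
    show "absval x \<le> 1" if "x \<in> insert t (insert r Z)" for x using that sub' R_ball by auto
    show "\<eta> \<le> absval (x - y)" if "x \<in> insert t (insert r Z)" "y \<in> insert t (insert r Z)" "x \<noteq> y" for x y
      using nodes_R'[OF r, of t] that unfolding nodes_def by (auto simp: insert_commute)
    show "t \<notin> insert r Z" using R'_not_in[OF r] by auto
    show "near I (L ^ 3 * \<delta>) (pr z \<theta>') (pr z \<theta>)" if "z \<in> insert r Z" for z
      using that sub' \<theta> by (intro same_\<kappa>) auto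
  qed (use \<eta> \<delta>_pos L_pos in auto)
  moreover have "real (Suc d) * ((6 / \<eta>) ^ d * (L ^ 3 * \<delta>)) \<le> L ^ ep * (L ^ 3 * \<delta>)"
    using \<delta>_pos L_pos by (intro interp_const) simp
  ultimately show ?thesis
    unfolding dif_def lam_def by (elim near_mono) (simp add: power_add mult.assoc)
qed

lemma node_bounds: "x \<in> R \<Longrightarrow> y \<in> R \<Longrightarrow> absval (x - y) \<le> 2"
  using absval_triangle_diff_le[of x 1 y 1] R_ball by simp

lemma half_\<eta>_pow: "(2 / \<eta>) ^ d \<le> L ^ ep" "1 \<le> L ^ ep * (\<eta> / 2) ^ d"
proof -
  have "(2 / \<eta>) ^ d \<le> (6 / \<eta>) ^ d" using \<eta> by (intro power_mono divide_right_mono) auto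
  also have "\<dots> \<le> L ^ (Suc e1 * d)" by (rule six_\<eta>)
  also have "\<dots> \<le> L ^ ep" by (intro Lpow_mono) (simp add: ep_def)
  finally show 1: "(2 / \<eta>) ^ d \<le> L ^ ep" .
  have "1 = (2 / \<eta>) ^ d * (\<eta> / 2) ^ d" using \<eta> by (simp flip: power_mult_distrib)
  also have "\<dots> \<le> L ^ ep * (\<eta> / 2) ^ d" using 1 \<eta> by (intro mult_right_mono) auto
  finally show "1 \<le> L ^ ep * (\<eta> / 2) ^ d" .
qed

text \<open>Differences of distinct nodes lie between \<open>\<eta>\<close> and 2, so each factor
  lies between \<open>\<eta> / 2\<close> and \<open>2 / \<eta>\<close>.\<close>

lemma lam_bounds:
  assumes r: "r \<in> R'" and s: "s \<in> S"
  shows "absval (lam r s) \<le> L ^ ep" "1 \<le> L ^ ep * absval (lam r s)"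
proof -
  have b: "\<eta> / 2 \<le> absval ((s - z) / (t - z)) \<and> absval ((s - z) / (t - z)) \<le> 2 / \<eta>" if z: "z \<in> insert r Z" for z
  proof -
    have "z \<noteq> s" "z \<noteq> t" using z R'_not_in[OF r] s distinct by auto
    have zR: "z \<in> R" "s \<in> R" "t \<in> R" using z s r sub by auto
    have "\<eta> \<le> absval (s - z)" "\<eta> \<le> absval (t - z)"
      using z s \<open>z \<noteq> s\<close> \<open>z \<noteq> t\<close> W_sep[of s z] W_sep[of t z] R'_sep[OF r, of s] R'_sep[OF r, of t]
      by (auto simp: absval_minus_commute[of _ r])
    moreover have "absval (s - z) \<le> 2" "absval (t - z) \<le> 2" using node_bounds zR by auto
    ultimately show ?thesis using \<eta> unfolding absval_divide by (intro conjI frac_le) linarith+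
  qed
  have "absval (lam r s) \<le> (\<Prod>z\<in>insert r Z. 2 / \<eta>)"
    unfolding lam_def absval_prod using b by (intro prod_mono) auto
  then show "absval (lam r s) \<le> L ^ ep" using card_insert_Z[OF r] half_\<eta>_pow(1) by simp
  have "(\<Prod>z\<in>insert r Z. \<eta> / 2) \<le> absval (lam r s)"
    unfolding lam_def absval_prod using b \<eta> by (intro prod_mono) auto
  then have "(\<eta> / 2) ^ d \<le> absval (lam r s)" using card_insert_Z[OF r] by simp
  then have "L ^ ep * (\<eta> / 2) ^ d \<le> L ^ ep * absval (lam r s)" by (intro mult_left_mono) auto
  then show "1 \<le> L ^ ep * absval (lam r s)" using half_\<eta>_pow(2) by linarith
qed

text \<open>As a function of \<open>r\<close>, \<open>lam r s\<close> is a constant times the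
  Moebius map \<open>(s - r) / (t - r)\<close>, which is non-degenerate since \<open>s\<close> and
  \<open>t\<close> are separated. Hence separated parameters give separated scalars; this is what
  turns many \<open>r\<close> into many points on a line.\<close>

lemma lam_diff:
  assumes r: "r \<in> R'" "r' \<in> R'" and s: "s \<in> S"
  shows "absval (r - r') \<le> L ^ (2 * ep) * absval (lam r s - lam r' s)"
proof -
  define q where "q = (\<Prod>z\<in>Z. (s - z) / (t - z))"
  have nz: "t - r \<noteq> 0" "t - r' \<noteq> 0" "s - t \<noteq> 0" "s - r \<noteq> 0"
    using R'_not_in r s distinct by auto
  have lam: "lam x s = (s - x) / (t - x) * q" if "x \<in> R'" for x
    using R'_not_in[OF that] by (simp add: lam_def q_def)
  have "(s - r) / (t - r) - (s - r') / (t - r') = ((s - r) * (t - r') - (s - r') * (t - r)) / ((t - r) * (t - r'))"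
    using nz(1,2) by (rule diff_frac_eq)
  also have "(s - r) * (t - r') - (s - r') * (t - r) = (s - t) * (r - r')"
    by (simp add: algebra_simps)
  finally have frac: "(s - r) / (t - r) - (s - r') / (t - r') = (s - t) * (r - r') / ((t - r) * (t - r'))" .
  have "lam r s - lam r' s = ((s - r) / (t - r) - (s - r') / (t - r')) * q"
    unfolding lam[OF r(1)] lam[OF r(2)] by (simp only: left_diff_distrib)
  also have "\<dots> = q / (t - r) * ((s - t) * (r - r') / (t - r'))"
    unfolding frac by simp
  also have "q / (t - r) = lam r s / (s - r)"
    unfolding lam[OF r(1)] using nz(4) by simp
  finally have eq: "lam r s - lam r' s = lam r s / (s - r) * ((s - t) * (r - r') / (t - r'))" .
  have inR: "s \<in> R" "t \<in> R" "r \<in> R" "r' \<in> R" using r s sub by auto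
  have "s \<noteq> t" using s distinct by blast
  then have "\<eta> \<le> absval (s - t)" using W_sep[of s t] s by simp
  have "absval (r - r') * \<eta> \<le> absval (r - r') * absval (s - t)"
    using \<open>\<eta> \<le> absval (s - t)\<close> by (intro mult_left_mono) auto
  also have "\<dots> = absval (lam r s - lam r' s) * absval (s - r) * absval (t - r') / absval (lam r s)"
  proof -
    have "lam r s \<noteq> 0" using lam_bounds(2)[OF r(1) s] by auto
    have gen: "y * b = A * a * e / l" if "A = l / a * (b * y / e)" "a \<noteq> 0" "e \<noteq> 0" "l \<noteq> 0" for A a b y e l :: real
      using that by simp
    show ?thesis
    proof (rule gen)
      show "absval (lam r s - lam r' s) = absval (lam r s) / absval (s - r) *
          (absval (s - t) * absval (r - r') / absval (t - r'))"
        unfolding eq by (simp only: absval_mult absval_divide)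
    qed (use nz \<open>lam r s \<noteq> 0\<close> in auto)
  qed
  also have "\<dots> \<le> absval (lam r s - lam r' s) * 2 * 2 / absval (lam r s)"
    using node_bounds inR by (intro divide_right_mono mult_mono) auto
  also have "\<dots> \<le> absval (lam r s - lam r' s) * 4 * L ^ ep"
  proof -
    have "0 < absval (lam r s)" using lam_bounds(2)[OF r(1) s] by (cases "lam r s = 0") auto
    then have "1 / absval (lam r s) \<le> L ^ ep"
      using lam_bounds(2)[OF r(1) s] by (simp add: field_simps)
    then show ?thesis using mult_left_mono[of "1 / absval (lam r s)" "L ^ ep" "absval (lam r s - lam r' s) * 4"]
      by (simp add: mult.commute)
  qed
  finally have "absval (r - r') \<le> absval (lam r s - lam r' s) * 4 * L ^ ep * (1 / \<eta>)"
    using \<eta> by (simp add: field_simps)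
  also have "4 * L ^ ep * (1 / \<eta>) \<le> L ^ ep * L ^ ep"
  proof -
    have "4 * (1 / \<eta>) \<le> 6 / \<eta>" using \<eta> by (simp add: divide_right_mono)
    also have "\<dots> \<le> (6 / \<eta>) ^ d" using \<eta> d_pos self_le_power[of "6 / \<eta>" d] by simp
    also have "\<dots> \<le> L ^ (Suc e1 * d)" by (rule six_\<eta>)
    also have "\<dots> \<le> L ^ ep" by (intro Lpow_mono) (simp add: ep_def)
    finally show ?thesis using mult_left_mono[of "4 * (1 / \<eta>)" "L ^ ep" "L ^ ep"] by (simp add: mult_ac)
  qed
  then have "absval (lam r s - lam r' s) * 4 * L ^ ep * (1 / \<eta>) \<le> absval (lam r s - lam r' s) * (L ^ ep * L ^ ep)"
    using mult_left_mono[of "4 * L ^ ep * (1 / \<eta>)" "L ^ ep * L ^ ep" "absval (lam r s - lam r' s)"]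
    by (simp add: mult_ac)
  finally show ?thesis by (simp add: mult_2 power_add mult_ac)
qed

end

section \<open>Popular pairs of labels\<close>

context selected
begin

text \<open>The reference parameter at which popularity of differences is measured.\<close>

definition s0 :: 'a where
  "s0 = (SOME s. s \<in> S)"

lemma s0: "s0 \<in> S"
proof -
  have "S \<noteq> {}" using cards by auto
  then show ?thesis unfolding s0_def by (simp add: some_in_eq)
qed

lemma in_R: "t \<in> R" "s0 \<in> R" "s \<in> S \<Longrightarrow> s \<in> R" "z \<in> Z \<Longrightarrow> z \<in> R"
  using sub s0 by auto

abbreviation ge :: nat where
  "ge \<equiv> ep + 4"

text \<open>Representations of a multiple of a difference at \<open>t\<close> as a difference of
  labels at \<open>s0\<close>. Their number measures popularity, as in arguments of Balog-Szemeredi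
  type.\<close>

definition popG :: "'a \<Rightarrow> 'a point \<Rightarrow> 'a point \<Rightarrow> ('a point \<times> 'a point) set" where
  "popG r a b = {(x, y) \<in> Y s0 \<times> Y s0. near I (L ^ ge * \<delta>) (dif s0 x y) (\<lambda>k. lam r s0 * dif t a b k)}"

lemma lam_near:
  assumes "r \<in> R'" "s \<in> S" "near I e x y" "0 \<le> e"
  shows "near I (L ^ ep * e) (\<lambda>k. lam r s * x k) (\<lambda>k. lam r s * y k)"
  using near_mono[OF near_scale[OF assms(3)]] mult_right_mono[OF lam_bounds(1)[OF assms(1,2)] assms(4)]
  by blast

lemma Col_popG:
  assumes r: "r \<in> R'" and C: "(\<theta>, \<theta>') \<in> Col r"
  shows "(\<kappa> s0 \<theta>, \<kappa> s0 \<theta>') \<in> popG r (\<kappa> t \<theta>) (\<kappa> t \<theta>')"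
proof -
  have \<theta>: "\<theta> \<in> \<Theta>" "\<theta>' \<in> \<Theta>" using C by (auto simp: Col_def)
  have "near I (L ^ 3 * \<delta>) (dif s0 (\<kappa> s0 \<theta>) (\<kappa> s0 \<theta>')) (dif s0 \<theta> \<theta>')"
    using dif_\<kappa>[OF in_R(2) \<theta>] near_sym by blast
  note near_trans[OF this Col_dif[OF r s0 C]]
  moreover have "near I (L ^ ep * (L ^ 3 * \<delta>)) (\<lambda>k. lam r s0 * dif t \<theta> \<theta>' k) (\<lambda>k. lam r s0 * dif t (\<kappa> t \<theta>) (\<kappa> t \<theta>') k)"
    using less_imp_le[OF \<delta>_pos]
    by (intro lam_near[OF r s0] dif_\<kappa> in_R \<theta> mult_nonneg_nonneg Lpow_nonneg)
  ultimately have "near I (L ^ 3 * \<delta> + L ^ (ep + 3) * \<delta> + L ^ ep * (L ^ 3 * \<delta>))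
      (dif s0 (\<kappa> s0 \<theta>) (\<kappa> s0 \<theta>')) (\<lambda>k. lam r s0 * dif t (\<kappa> t \<theta>) (\<kappa> t \<theta>') k)"
    by (rule near_trans)
  moreover have "L ^ 3 * \<delta> + L ^ (ep + 3) * \<delta> + L ^ ep * (L ^ 3 * \<delta>) \<le> L ^ ge * \<delta>"
  proof -
    have "L ^ 3 * \<delta> \<le> L ^ (ep + 3) * \<delta>"
      using Lpow_mono[of 3 "ep + 3"] \<delta>_pos by (simp add: mult_right_mono)
    moreover have "L ^ ep * (L ^ 3 * \<delta>) = L ^ (ep + 3) * \<delta>" by (simp add: power_add mult.assoc)
    moreover have "3 * L ^ (ep + 3) * \<delta> \<le> L ^ ge * \<delta>"
      using Lpow_absorb6[of 3 \<delta> "ep + 3"] \<delta>_pos by (simp add: add.commute)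
    ultimately show ?thesis by linarith
  qed
  ultimately show ?thesis
    unfolding popG_def using near_mono \<kappa>(1) in_R(2) \<theta> by blast
qed

lemma popG_finite [simp]: "finite (popG r a b)"
  by (rule finite_subset[of _ "Y s0 \<times> Y s0"]) (auto simp: popG_def finY in_R)

text \<open>The first bracket is the loss in counting unpopular pairs; the second makes them a small
  part of \<open>Col r\<close>.\<close>

abbreviation gp :: nat where
  "gp \<equiv> (Suc d + 2 * u3) + (d + 3)"

definition pop :: "'a \<Rightarrow> 'a point \<Rightarrow> 'a point \<Rightarrow> bool" where
  "pop r a b \<longleftrightarrow> n \<le> L ^ gp * real (card (popG r a b))"

definition Col' :: "'a \<Rightarrow> ('a point \<times> 'a point) set" where
  "Col' r = {p \<in> Col r. pop r (\<kappa> t (fst p)) (\<kappa> t (snd p))}"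

lemma Col'_finite [simp]: "finite (Col' r)"
  by (simp add: Col'_def)

text \<open>A pair in \<open>Col r\<close> is determined, up to \<open>L ^ (2 * u3)\<close> choices,
  by the labels of both entries at \<open>t\<close> and \<open>s0\<close> and by their common labels
  on \<open>Z\<close>, because \<open>insert s0 (insert t Z)\<close> consists of
  \<open>d + 1\<close> nodes. If the labels at \<open>t\<close> are unpopular, fewer than
  \<open>n / L ^ gp\<close> pairs of labels at \<open>s0\<close> remain.\<close>

lemma card_unpopular:
  assumes r: "r \<in> R'"
  shows "L ^ gp * real (card {p \<in> Col r. \<not> pop r (\<kappa> t (fst p)) (\<kappa> t (snd p))}) \<le> L ^ (Suc d + 2 * u3) * n ^ (d + 2)"
proof -
  let ?X = "{p \<in> Col r. \<not> pop r (\<kappa> t (fst p)) (\<kappa> t (snd p))}"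
  let ?F = "\<lambda>p. ((\<kappa> t (fst p), \<kappa> t (snd p)), ((\<kappa> s0 (fst p), \<kappa> s0 (snd p)), restrict (\<lambda>z. \<kappa> z (fst p)) Z))"
  let ?U = "{ab \<in> Y t \<times> Y t. \<not> pop r (fst ab) (snd ab)}"
  let ?Sig = "Sigma ?U (\<lambda>ab. popG r (fst ab) (snd ab) \<times> PiE Z Y)"
  have ZR: "Z \<subseteq> R" using sub by simp
  have finU: "finite ?U" by (rule finite_subset[of _ "Y t \<times> Y t"]) (auto simp: finY in_R)
  have card_pop: "L ^ gp * real (card (popG r (fst ab) (snd ab) \<times> PiE Z Y)) \<le> n * (L * n) ^ (d - 1)" if "ab \<in> ?U" for ab
  proof -
    have "(L ^ gp * real (card (popG r (fst ab) (snd ab)))) * real (card (PiE Z Y)) \<le> n * (L * n) ^ (d - 1)"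
      using that card_labels[OF ZR] cards n_pos by (intro mult_mono) (auto simp: pop_def)
    then show ?thesis by (simp add: card_cartesian_product mult.assoc)
  qed
  have "L ^ gp * real (card ?Sig) = (\<Sum>ab\<in>?U. L ^ gp * real (card (popG r (fst ab) (snd ab) \<times> PiE Z Y)))"
    using finU finite_labels[OF ZR] by (subst card_SigmaI) (auto simp: sum_distrib_left)
  also have "\<dots> \<le> (\<Sum>ab\<in>?U. n * (L * n) ^ (d - 1))"
    by (rule sum_mono) (rule card_pop)
  also have "\<dots> = real (card ?U) * (n * (L * n) ^ (d - 1))" by simp
  also have "\<dots> \<le> ((L * n) * (L * n)) * (n * (L * n) ^ (d - 1))"
  proof (rule mult_right_mono)
    have "card ?U \<le> card (Y t \<times> Y t)" by (rule card_mono) (auto simp: finY in_R)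
    then have "real (card ?U) \<le> real (card (Y t)) * real (card (Y t))"
      by (simp add: card_cartesian_product flip: of_nat_mult)
    also have "\<dots> \<le> (L * n) * (L * n)" using Y_card[OF in_R(1)] L_pos n_pos by (intro mult_mono) auto
    finally show "real (card ?U) \<le> (L * n) * (L * n)" .
  qed (use n_pos L_pos in auto)
  also have "\<dots> = n * (L * n) ^ (d + 1)"
    using d_pos by (cases d) (auto simp: mult_ac)
  finally have Sig: "L ^ gp * real (card ?Sig) \<le> n * (L * n) ^ (d + 1)" .
  have "real (card ?X) \<le> real (card ?Sig) * (L ^ u3 * L ^ u3)"
  proof (rule card_le_fibre_bound[where f = ?F])
    show "?F ` ?X \<subseteq> ?Sig"
    proof
      fix y assume "y \<in> ?F ` ?X"
      then obtain p where p: "p \<in> ?X" "y = ?F p" by blast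
      obtain \<theta> \<theta>' where pp: "p = (\<theta>, \<theta>')" by (cases p)
      have th: "\<theta> \<in> \<Theta>" "\<theta>' \<in> \<Theta>" using p pp by (auto simp: Col_def)
      have "(\<kappa> s0 \<theta>, \<kappa> s0 \<theta>') \<in> popG r (\<kappa> t \<theta>) (\<kappa> t \<theta>')" using Col_popG[OF r] p pp by auto
      then show "y \<in> ?Sig" using p pp th \<kappa>(1) in_R by auto
    qed
    fix y
    let ?fib = "{p \<in> ?X. ?F p = y}"
    let ?T = "insert s0 (insert t Z)"
    have lab: "\<kappa> s (fst p) = \<kappa> s (fst q) \<and> \<kappa> s (snd p) = \<kappa> s (snd q)"
      if "p \<in> ?fib" "q \<in> ?fib" "s \<in> ?T" for p q s
    proof -
      have eqF: "?F p = ?F q" using that by simp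
      have z: "\<kappa> z (fst p) = \<kappa> z (fst q)" if "z \<in> Z" for z
        using restrict_eqD[of "\<lambda>z. \<kappa> z (fst p)" Z "\<lambda>z. \<kappa> z (fst q)" z] eqF that by auto
      have "\<kappa> z (snd x) = \<kappa> z (fst x)" if "z \<in> Z" "x \<in> Col r" for x z
        using that by (auto simp: Col_def)
      then have "\<kappa> z (snd p) = \<kappa> z (snd q)" if "z \<in> Z" for z
        using that z \<open>p \<in> ?fib\<close> \<open>q \<in> ?fib\<close> by simp
      then show ?thesis using z eqF that(3) by auto
    qed
    have "?fib \<subseteq> fst ` ?fib \<times> snd ` ?fib" by force
    moreover have fin_fib: "finite ?fib" by (rule finite_subset[of _ "Col r"]) auto
    ultimately have "card ?fib \<le> card (fst ` ?fib \<times> snd ` ?fib)" by (intro card_mono) auto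
    then have "real (card ?fib) \<le> real (card (fst ` ?fib)) * real (card (snd ` ?fib))"
      by (simp add: card_cartesian_product flip: of_nat_mult)
    also have "\<dots> \<le> L ^ u3 * L ^ u3"
    proof (intro mult_mono)
      have subT: "fst ` ?fib \<subseteq> \<Theta>" "snd ` ?fib \<subseteq> \<Theta>" by (auto simp: Col_def)
      show "real (card (fst ` ?fib)) \<le> L ^ u3"
        by (rule card_same_labels[OF nodes_Z[OF s0] subT(1)]) (use lab in blast)
      show "real (card (snd ` ?fib)) \<le> L ^ u3"
        by (rule card_same_labels[OF nodes_Z[OF s0] subT(2)]) (use lab in blast)
    qed auto
    finally show "real (card ?fib) \<le> L ^ u3 * L ^ u3" .
  qed (use finU finite_labels[OF ZR] in auto)
  then have "L ^ gp * real (card ?X) \<le> L ^ gp * real (card ?Sig) * (L ^ u3 * L ^ u3)"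
    by (simp add: mult_left_mono mult.assoc)
  also have "\<dots> \<le> n * (L * n) ^ (d + 1) * (L ^ u3 * L ^ u3)"
    using Sig by (intro mult_right_mono) auto
  also have "\<dots> = L ^ (Suc d + 2 * u3) * n ^ (d + 2)"
    by (simp add: power_mult_distrib power_add mult_2 mult_ac)
  finally show ?thesis .
qed

lemma Col'_card:
  assumes r: "r \<in> R'"
  shows "n ^ (d + 2) \<le> L ^ (d + 3) * real (card (Col' r))"
proof -
  let ?X = "{p \<in> Col r. \<not> pop r (\<kappa> t (fst p)) (\<kappa> t (snd p))}"
  have "card (Col r) = card (Col' r \<union> ?X)"
    by (rule arg_cong[of _ _ card]) (auto simp: Col'_def)
  also have "\<dots> \<le> card (Col' r) + card ?X" by (rule card_Un_le)
  finally have "real (card (Col r)) \<le> real (card (Col' r)) + real (card ?X)" by simp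
  then have "L ^ (d + 2) * real (card (Col r)) \<le> L ^ (d + 2) * (real (card (Col' r)) + real (card ?X))"
    by (rule mult_left_mono[OF _ Lpow_nonneg])
  with Col_card[OF r] have 1: "n ^ (d + 2) \<le> L ^ (d + 2) * real (card (Col' r)) + L ^ (d + 2) * real (card ?X)"
    by (simp add: distrib_left)
  have "L ^ (Suc d + 2 * u3) * (L ^ (d + 3) * real (card ?X)) \<le> L ^ (Suc d + 2 * u3) * n ^ (d + 2)"
    using card_unpopular[OF r] unfolding power_add[of L "Suc d + 2 * u3"] by (simp only: mult.assoc)
  then have "L ^ (d + 3) * real (card ?X) \<le> n ^ (d + 2)"
    by (rule mult_left_le_imp_le) (rule Lpow_pos)
  moreover have "6 * (L ^ (d + 2) * real (card ?X)) \<le> L ^ (d + 3) * real (card ?X)"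
    using Lpow_absorb6[of 6 "real (card ?X)" "d + 2"] by (simp add: eval_nat_numeral mult_ac)
  ultimately have "n ^ (d + 2) \<le> 6 * (L ^ (d + 2) * real (card (Col' r)))"
    using 1 mult_nonneg_nonneg[OF Lpow_nonneg, of "real (card (Col' r))" "d + 2"] by linarith
  also have "\<dots> \<le> L ^ (d + 3) * real (card (Col' r))"
    using Lpow_absorb6[of 6 "real (card (Col' r))" "d + 2"] by (simp add: eval_nat_numeral mult_ac)
  finally show ?thesis .
qed

end

text \<open>Differences of the \<open>t\<close>-projections are rounded to a net \<open>W\<close>.\<close>

locale celled = selected +
  fixes W :: "(nat \<Rightarrow> 'a) set" and cell :: "'a point \<Rightarrow> 'a point \<Rightarrow> nat \<Rightarrow> 'a"
  assumes finW [simp]: "finite W"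
    and W_separated: "\<And>w w'. w \<in> W \<Longrightarrow> w' \<in> W \<Longrightarrow> near I \<delta> w w' \<Longrightarrow> w = w'"
    and cell: "\<And>a b. a \<in> Y t \<Longrightarrow> b \<in> Y t \<Longrightarrow> cell a b \<in> W"
      "\<And>a b. a \<in> Y t \<Longrightarrow> b \<in> Y t \<Longrightarrow> near I \<delta> (dif t a b) (cell a b)"

lemma (in selected) cells_exist:
  "\<exists>W cell. celled D C1 N e1 d c I \<delta> L R \<Theta> n Z t S R' Y \<kappa> W cell"
proof -
  let ?V = "(\<lambda>(a, b). dif t a b) ` (Y t \<times> Y t)"
  obtain W where W: "W \<subseteq> ?V" "finite W" "\<And>x y. x \<in> W \<Longrightarrow> y \<in> W \<Longrightarrow> x \<noteq> y \<Longrightarrow> \<not> near I \<delta> x y"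
      "\<And>x. x \<in> ?V \<Longrightarrow> \<exists>y\<in>W. near I \<delta> x y"
  proof (rule maximal_separated_finite[of ?V "near I \<delta>"])
    show "finite ?V" using finY in_R by auto
    show "near I \<delta> x x" for x using \<delta>_pos by (simp add: near_refl)
    fix E assume "E \<subseteq> ?V" "finite E" "\<And>x y. x \<in> E \<Longrightarrow> y \<in> E \<Longrightarrow> x \<noteq> y \<Longrightarrow> \<not> near I \<delta> x y"
      "\<And>x. x \<in> ?V \<Longrightarrow> \<exists>y\<in>E. near I \<delta> x y"
    then show thesis by (rule that)
  qed (simp add: near_sym)
  have "\<exists>w. w \<in> W \<and> near I \<delta> (dif t a b) w" if "a \<in> Y t" "b \<in> Y t" for a b
    using W(4)[of "dif t a b"] that by blast
  then obtain cell where cell: "\<And>a b. a \<in> Y t \<Longrightarrow> b \<in> Y t \<Longrightarrow> cell a b \<in> W \<and> near I \<delta> (dif t a b) (cell a b)"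
    by metis
  have "celled D C1 N e1 d c I \<delta> L R \<Theta> n Z t S R' Y \<kappa> W cell"
    by unfold_locales (use W cell in blast)+
  then show ?thesis by blast
qed

section \<open>Popular differences and their dyadic scale\<close>

context celled
begin

definition Wr :: "'a \<Rightarrow> (nat \<Rightarrow> 'a) set" where
  "Wr r = {w \<in> W. \<exists>a\<in>Y t. \<exists>b\<in>Y t. pop r a b \<and> cell a b = w}"

abbreviation uw :: nat where
  "uw \<equiv> card I * pe (ep + (ep + 6))"

text \<open>Differences at \<open>t\<close> could number \<open>n ^ 2\<close>, but popular cells
  number about \<open>n\<close>: each is represented by at least \<open>n / L ^ gp\<close> pairs of
  labels at \<open>s0\<close>, a pair represents at most \<open>L ^ uw\<close> cells because
  \<open>lam r s0\<close> is bounded below, and there are at most \<open>(L * n) ^ 2\<close>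
  pairs.\<close>

lemma Wr_card:
  assumes r: "r \<in> R'"
  shows "real (card (Wr r)) \<le> L ^ (gp + uw + 2) * n"
proof -
  let ?B = "Y s0 \<times> Y s0"
  let ?P = "\<lambda>w xy. near I (L ^ (ep + 5) * \<delta>) (dif s0 (fst xy) (snd xy)) (\<lambda>k. lam r s0 * w k)"
  have finWr: "finite (Wr r)" by (simp add: Wr_def)
  have "real (card (Wr r)) * (n / L ^ gp) \<le> real (card ?B) * L ^ uw"
  proof (rule double_count[where P = ?P])
    fix w assume "w \<in> Wr r"
    then obtain a b where ab: "a \<in> Y t" "b \<in> Y t" "pop r a b" "cell a b = w"
      by (auto simp: Wr_def)
    have "popG r a b \<subseteq> {xy \<in> ?B. ?P w xy}"
    proof
      fix xy assume "xy \<in> popG r a b"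
      then have xy: "xy \<in> ?B" "near I (L ^ ge * \<delta>) (dif s0 (fst xy) (snd xy)) (\<lambda>k. lam r s0 * dif t a b k)"
        by (auto simp: popG_def)
      have "near I (L ^ ep * \<delta>) (\<lambda>k. lam r s0 * dif t a b k) (\<lambda>k. lam r s0 * w k)"
        using cell(2)[OF ab(1,2)] ab(4) \<delta>_pos by (intro lam_near[OF r s0]) auto
      then have "near I (L ^ ge * \<delta> + L ^ ep * \<delta>) (dif s0 (fst xy) (snd xy)) (\<lambda>k. lam r s0 * w k)"
        using xy(2) near_trans by blast
      moreover have "L ^ ge * \<delta> + L ^ ep * \<delta> \<le> L ^ (ep + 5) * \<delta>"

      proof -
        have "2 * L ^ ge * \<delta> \<le> L ^ Suc ge * \<delta>" using \<delta>_pos by (intro Lpow_absorb6) auto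
        moreover have "L ^ ep * \<delta> \<le> L ^ ge * \<delta>"
          using \<delta>_pos by (intro mult_right_mono Lpow_mono) auto
        moreover have "Suc ge = ep + 5" by simp
        ultimately show ?thesis by (metis (no_types) add_left_mono mult.assoc mult_2 order_trans)
      qed
      ultimately show "xy \<in> {xy \<in> ?B. ?P w xy}" using xy(1) near_mono by blast
    qed
    then have "card (popG r a b) \<le> card {xy \<in> ?B. ?P w xy}"
      by (intro card_mono) (auto simp: finY in_R)
    then have "L ^ gp * real (card (popG r a b)) \<le> L ^ gp * real (card {xy \<in> ?B. ?P w xy})"
      by (intro mult_left_mono) auto
    then have "n \<le> L ^ gp * real (card {xy \<in> ?B. ?P w xy})"
      using ab(3) unfolding pop_def by linarith
    then show "n / L ^ gp \<le> real (card {xy \<in> ?B. ?P w xy})"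
      using Lpow_pos[of gp] by (simp add: pos_divide_le_eq mult.commute)
  next
    fix xy assume "xy \<in> ?B"
    let ?X = "{w \<in> Wr r. ?P w xy}"
    show "real (card ?X) \<le> L ^ uw"
    proof (cases "?X = {}")
      case False
      then obtain w0 where w0: "w0 \<in> ?X" by blast
      have "real (card ?X) \<le> (\<Prod>j\<in>I. C1 * (2 * (L ^ (ep + (ep + 6)) * \<delta>) / \<delta>) powr D)"
      proof (rule packing_family[where co = "\<lambda>w. w" and ?x0.0 = w0])
        show "\<delta> \<le> L ^ (ep + (ep + 6)) * \<delta>" using Lpow_ge_1 \<delta>_pos by simp
        fix w j assume w: "w \<in> ?X" and j: "j \<in> I"
        have "absval ((dif s0 (fst xy) (snd xy) j - lam r s0 * w0 j) - (dif s0 (fst xy) (snd xy) j - lam r s0 * w j))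
            \<le> L ^ (ep + 5) * \<delta> + L ^ (ep + 5) * \<delta>"
          using w w0 j by (intro absval_triangle_diff_le) (auto simp: near_def)
        also have "(dif s0 (fst xy) (snd xy) j - lam r s0 * w0 j) - (dif s0 (fst xy) (snd xy) j - lam r s0 * w j)
            = lam r s0 * (w j - w0 j)" by (simp add: algebra_simps)
        finally have 1: "absval (lam r s0) * absval (w j - w0 j) \<le> 2 * L ^ (ep + 5) * \<delta>"
          by (simp add: absval_mult mult_ac)
        have "1 * absval (w j - w0 j) \<le> L ^ ep * absval (lam r s0) * absval (w j - w0 j)"
          using lam_bounds(2)[OF r s0] by (intro mult_right_mono) auto
        also have "\<dots> \<le> L ^ ep * (2 * L ^ (ep + 5) * \<delta>)"
          using 1 by (simp add: mult.assoc mult_left_mono)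
        also have "\<dots> \<le> L ^ ep * (L ^ (ep + 6) * \<delta>)"
          using Lpow_absorb6[of 2 \<delta> "ep + 5"] \<delta>_pos by (intro mult_left_mono) (auto simp: eval_nat_numeral)
        finally show "absval (w j - w0 j) \<le> L ^ (ep + (ep + 6)) * \<delta>"
          by (simp only: power_add mult.assoc mult_1)
      next
        fix x y assume "x \<in> ?X" "y \<in> ?X" "x \<noteq> y"
        then have "x \<in> W" "y \<in> W" "x \<noteq> y" by (auto simp: Wr_def)
        then have "\<not> near I \<delta> x y" using W_separated by blast
        then show "\<exists>j\<in>I. \<delta> < absval (x j - y j)" by (auto simp: near_def not_le)
      qed (use finWr \<delta>_pos in auto)
      also have "\<dots> = (C1 * (2 * L ^ (ep + (ep + 6))) powr D) ^ card I"
        using \<delta>_pos by (simp add: mult.assoc)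
      also have "\<dots> \<le> (L ^ pe (ep + (ep + 6))) ^ card I"
        using C1_Lpow[of "ep + (ep + 6)"] C1_ge_1 by (intro power_mono) auto
      also have "\<dots> = L ^ uw" by (simp add: power_mult[symmetric] mult.commute)
      finally show ?thesis .
    next
      case True
      show ?thesis unfolding True by simp
    qed
  qed (use finWr finY in_R in auto)
  also have "\<dots> \<le> (L * n) * (L * n) * L ^ uw"
    using Y_card[OF in_R(2)] L_pos n_pos by (intro mult_right_mono) (auto simp: card_cartesian_product intro!: mult_mono)
  finally have bd: "real (card (Wr r)) * (n / L ^ gp) \<le> L * n * (L * n) * L ^ uw" .
  have gen: "n * x \<le> n * (A * U * L ^ 2 * n)" if "x * (n / A) \<le> L * n * (L * n) * U" "0 < A" for x A U :: real
    using that by (simp add: pos_divide_le_eq power2_eq_square mult_ac)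
  have "n * real (card (Wr r)) \<le> n * (L ^ (gp + uw + 2) * n)"
    unfolding power_add[of L _ 2] power_add[of L gp uw] by (rule gen[OF bd Lpow_pos])
  then show ?thesis using n_pos by simp
qed

definition Delta :: real where
  "Delta = \<delta> powr (- D)"

lemma Delta_pos: "0 < Delta"
  using \<delta>_pos by (simp add: Delta_def)

lemma R'_upper: "real (card R') \<le> L * Delta"
proof -
  have "card R' \<le> card R" using sub by (intro card_mono) auto
  then show ?thesis using R_card_upper unfolding Delta_def by linarith
qed

text \<open>The dyadic size of a difference, counted from \<open>L ^ 4 * \<delta>\<close>, a
  threshold above the rounding errors of the labels. For points of \<open>\<Theta>\<close> the
  minimum exists: differences are at most \<open>L ^ 3\<close> and
  \<open>1 / \<delta> \<le> 2 powr L\<close>.\<close>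

definition sc :: "'a point \<Rightarrow> 'a point \<Rightarrow> nat" where
  "sc a b = (LEAST j. near I (2 ^ j * (L ^ 4 * \<delta>)) (dif t a b) (\<lambda>_. 0))"

definition J :: nat where
  "J = nat \<lceil>L\<rceil>"

lemma dif_bounded:
  assumes "a \<in> \<Theta>" "b \<in> \<Theta>"
  shows "near I (L ^ 3) (dif t a b) (\<lambda>_. 0)"
proof -
  have "near I (L ^ 2 * L) (pr t b) (pr t a)"
    using diam[OF assms(2,1)] R_ball[OF in_R(1)] L_pos by (intro near_pr_loss) auto
  then show ?thesis by (simp add: near_def dif_def numeral_3_eq_3 numeral_2_eq_2 mult_ac)
qed

lemma sc:
  assumes "a \<in> \<Theta>" "b \<in> \<Theta>"
  shows "sc a b \<le> J" "near I (2 ^ sc a b * (L ^ 4 * \<delta>)) (dif t a b) (\<lambda>_. 0)"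
    "sc a b = Suc i \<Longrightarrow> \<not> near I (2 ^ i * (L ^ 4 * \<delta>)) (dif t a b) (\<lambda>_. 0)"
proof -
  have "1 / \<delta> \<le> 2 powr L" by (rule scales)
  also have "\<dots> \<le> 2 powr real J" unfolding J_def by (intro powr_mono) linarith+
  also have "\<dots> = 2 ^ J" by (simp add: powr_realpow)
  finally have "1 \<le> 2 ^ J * \<delta>" using \<delta>_pos by (simp add: field_simps)
  then have "L ^ 4 * 1 \<le> L ^ 4 * (2 ^ J * \<delta>)" by (intro mult_left_mono) auto
  then have "L ^ 3 \<le> 2 ^ J * (L ^ 4 * \<delta>)"
    using Lpow_mono[of 3 4] by (simp add: mult_ac)
  then have P: "near I (2 ^ J * (L ^ 4 * \<delta>)) (dif t a b) (\<lambda>_. 0)"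
    using near_mono[OF dif_bounded[OF assms]] by blast
  show "sc a b \<le> J" unfolding sc_def by (rule Least_le) (rule P)
  show "near I (2 ^ sc a b * (L ^ 4 * \<delta>)) (dif t a b) (\<lambda>_. 0)"
    unfolding sc_def by (rule LeastI) (rule P)
  show "\<not> near I (2 ^ i * (L ^ 4 * \<delta>)) (dif t a b) (\<lambda>_. 0)" if "sc a b = Suc i"
    using that not_less_Least[of i "\<lambda>j. near I (2 ^ j * (L ^ 4 * \<delta>)) (dif t a b) (\<lambda>_. 0)"]
    unfolding sc_def by linarith
qed

definition triples :: "('a \<times> 'a point \<times> 'a point) set" where
  "triples = Sigma R' Col'"

lemma finite_triples [simp]: "finite triples"
  by (simp add: triples_def)

lemma triples_card: "Delta * n ^ (d + 2) \<le> L ^ (d + 5) * real (card triples)"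
proof -
  have "real (card R') * n ^ (d + 2) = (\<Sum>r\<in>R'. n ^ (d + 2))" by simp
  also have "\<dots> \<le> (\<Sum>r\<in>R'. L ^ (d + 3) * real (card (Col' r)))"
    by (rule sum_mono) (rule Col'_card)
  also have "\<dots> = L ^ (d + 3) * real (card triples)"
    unfolding triples_def by (subst card_SigmaI) (auto simp: sum_distrib_left)
  finally have 1: "real (card R') * n ^ (d + 2) \<le> L ^ (d + 3) * real (card triples)" .
  have "Delta \<le> L * real (card R)" using R_card by (simp add: Delta_def)
  also have "\<dots> \<le> L * (2 * real (card R'))" using R'_card L_pos by (intro mult_left_mono) auto
  also have "\<dots> \<le> L ^ 2 * real (card R')"
    using Lpow_absorb6[of 2 "real (card R')" 1] by (simp add: eval_nat_numeral)
  finally have "Delta * n ^ (d + 2) \<le> L ^ 2 * real (card R') * n ^ (d + 2)"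
    using n_pos by (intro mult_right_mono) auto
  also have "\<dots> = L ^ 2 * (real (card R') * n ^ (d + 2))" by simp
  also have "\<dots> \<le> L ^ 2 * (L ^ (d + 3) * real (card triples))"
    using 1 by (intro mult_left_mono) auto
  finally show ?thesis by (simp add: power_add eval_nat_numeral mult_ac)
qed

text \<open>The bound on \<open>1 / \<delta>\<close> in \<open>config\<close> leaves at most
  \<open>L + 2\<close> dyadic scales, so fixing one of them costs two powers of
  \<open>L\<close>.\<close>

lemma scale_selection:
  "\<exists>j. Delta * n ^ (d + 2) \<le> L ^ (d + 7) * real (card {x \<in> triples. sc (\<kappa> t (fst (snd x))) (\<kappa> t (snd (snd x))) = j})"
proof -
  have "0 < Delta * n ^ (d + 2)" using Delta_pos n_pos by simp
  then have "triples \<noteq> {}" using triples_card by auto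
  obtain j where j: "j \<in> {..J}" "real (card triples) \<le> real (card {..J}) *
      real (card {x \<in> triples. sc (\<kappa> t (fst (snd x))) (\<kappa> t (snd (snd x))) = j})"
  proof (rule pigeonhole_real[of triples "{..J}" "\<lambda>x. sc (\<kappa> t (fst (snd x))) (\<kappa> t (snd (snd x)))"])
    show "(\<lambda>x. sc (\<kappa> t (fst (snd x))) (\<kappa> t (snd (snd x)))) ` triples \<subseteq> {..J}"
    proof
      fix y assume "y \<in> (\<lambda>x. sc (\<kappa> t (fst (snd x))) (\<kappa> t (snd (snd x)))) ` triples"
      then obtain r \<theta> \<theta>' where "y = sc (\<kappa> t \<theta>) (\<kappa> t \<theta>')" "\<theta> \<in> \<Theta>" "\<theta>' \<in> \<Theta>"
        by (auto simp: triples_def Col'_def Col_def)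
      then show "y \<in> {..J}" using sc(1) \<kappa>(1) in_R Y_sub by (auto simp: subset_iff)
    qed
    show "triples \<noteq> {}" by fact
  qed (auto intro: that)
  have "real (card {..J}) \<le> L + 2" unfolding J_def using L_pos by simp linarith
  also have "\<dots> \<le> L ^ 2" 
  proof -
    have "L * 6 \<le> L * L" using L_ge_6 L_pos by (intro mult_left_mono) auto
    then show ?thesis using L_ge_6 unfolding power2_eq_square by linarith
  qed
  finally have "real (card triples) \<le> L ^ 2 * real (card {x \<in> triples. sc (\<kappa> t (fst (snd x))) (\<kappa> t (snd (snd x))) = j})"
    using j(2) by (meson mult_right_mono of_nat_0_le_iff order_trans)
  then have "L ^ (d + 5) * real (card triples) \<le> L ^ (d + 5) * (L ^ 2 * real (card {x \<in> triples. sc (\<kappa> t (fst (snd x))) (\<kappa> t (snd (snd x))) = j}))"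
    by (intro mult_left_mono) auto
  also have "\<dots> = L ^ (d + 7) * real (card {x \<in> triples. sc (\<kappa> t (fst (snd x))) (\<kappa> t (snd (snd x))) = j})"
    by (simp add: power_add eval_nat_numeral mult_ac)
  finally show ?thesis using triples_card by (intro exI[of _ j]) linarith
qed

end

section \<open>Points and labels joined by many parameters at one scale\<close>

locale scaled = celled +
  fixes j :: nat
  assumes j: "Delta * n ^ (d + 2) \<le> L ^ (d + 7) *
    real (card {x \<in> triples. sc (\<kappa> t (fst (snd x))) (\<kappa> t (snd (snd x))) = j})"
begin

lemma divide_Lpow_le_iff: "x / L ^ k \<le> y \<longleftrightarrow> x \<le> L ^ k * y"
  using pos_divide_le_eq[OF Lpow_pos] by (simp only: mult.commute[of y])

definition \<rho> :: real where
  "\<rho> = 2 ^ j * (L ^ 4 * \<delta>)"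

lemma \<rho>_ge: "L ^ 4 * \<delta> \<le> \<rho>" "\<delta> \<le> \<rho>"
proof -
  show 1: "L ^ 4 * \<delta> \<le> \<rho>"
    unfolding \<rho>_def using \<delta>_pos mult_right_mono[of 1 "2 ^ j" "L ^ 4 * \<delta>"] by simp
  have "1 * \<delta> \<le> L ^ 4 * \<delta>" using Lpow_ge_1 \<delta>_pos by (intro mult_right_mono) auto
  with 1 show "\<delta> \<le> \<rho>" by linarith
qed

lemma \<rho>_pos: "0 < \<rho>"
  using \<rho>_ge \<delta>_pos by linarith

text \<open>Each such \<open>r\<close> displaces the projections of \<open>\<theta>\<close> by
  \<open>lam r s\<close> times one and the same vector, the difference at \<open>t\<close> between
  the label \<open>b\<close> and \<open>\<theta>\<close>, up to rounding.\<close>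

definition Rs :: "'a point \<Rightarrow> 'a point \<Rightarrow> 'a set" where
  "Rs \<theta> b = {r \<in> R'. \<exists>\<theta>'. (\<theta>, \<theta>') \<in> Col' r \<and> \<kappa> t \<theta>' = b}"

definition Q :: "('a point \<times> 'a point) set" where
  "Q = {q \<in> \<Theta> \<times> Y t. sc (\<kappa> t (fst q)) (snd q) = j}"

lemma Q_finite [simp]: "finite Q"
  by (rule finite_subset[of _ "\<Theta> \<times> Y t"]) (auto simp: Q_def finY in_R)

lemma Rs_finite [simp]: "finite (Rs \<theta> b)"
  by (simp add: Rs_def)

lemma Q_card: "real (card Q) \<le> L ^ (d + 2 + u3) * n ^ (d + 2)"
proof -
  have "card Q \<le> card (\<Theta> \<times> Y t)" by (rule card_mono) (auto simp: Q_def finY in_R)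
  then have "real (card Q) \<le> real (card \<Theta>) * real (card (Y t))"
    by (simp add: card_cartesian_product flip: of_nat_mult)
  also have "\<dots> \<le> (L ^ (Suc d + u3) * n ^ Suc d) * (L * n)"
    using less_imp_le[OF n_pos]
    by (intro mult_mono card_upper Y_card in_R mult_nonneg_nonneg zero_le_power Lpow_nonneg of_nat_0_le_iff)
  also have "\<dots> = L ^ (d + 2 + u3) * n ^ (d + 2)" by (simp add: power_add mult_ac)
  finally show ?thesis .
qed

abbreviation e2 :: nat where
  "e2 \<equiv> d + 7 + u3"

text \<open>Remembering only the label \<open>b\<close> of \<open>\<theta>'\<close> at
  \<open>t\<close> costs a factor \<open>L ^ u3\<close>: the labels of \<open>\<theta>'\<close> on
  \<open>insert r Z\<close> are those of \<open>\<theta>\<close>, and together with \<open>t\<close>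
  these are \<open>d + 1\<close> nodes.\<close>

lemma Rs_sum: "Delta * n ^ (d + 2) \<le> L ^ e2 * (\<Sum>q\<in>Q. real (card (Rs (fst q) (snd q))))"
proof -
  let ?X = "{x \<in> triples. sc (\<kappa> t (fst (snd x))) (\<kappa> t (snd (snd x))) = j}"
  let ?S = "Sigma Q (\<lambda>q. Rs (fst q) (snd q))"
  let ?f = "\<lambda>x. ((fst (snd x), \<kappa> t (snd (snd x))), fst x)"
  have "real (card ?X) \<le> real (card ?S) * L ^ u3"
  proof (rule card_le_fibre_bound[where f = ?f])
    show "?f ` ?X \<subseteq> ?S"
    proof
      fix y assume "y \<in> ?f ` ?X"
      then obtain r \<theta> \<theta>' where x: "(r, \<theta>, \<theta>') \<in> triples" "sc (\<kappa> t \<theta>) (\<kappa> t \<theta>') = j" "y = ((\<theta>, \<kappa> t \<theta>'), r)"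
        by auto
      then have *: "r \<in> R'" "(\<theta>, \<theta>') \<in> Col' r" "\<theta> \<in> \<Theta>" "\<theta>' \<in> \<Theta>"
        by (auto simp: triples_def Col'_def Col_def)
      then have "r \<in> Rs \<theta> (\<kappa> t \<theta>')" by (auto simp: Rs_def)
      moreover have "(\<theta>, \<kappa> t \<theta>') \<in> Q" using * x(2) \<kappa>(1) in_R by (simp add: Q_def)
      ultimately show "y \<in> ?S" using x(3) by simp
    qed
    fix y assume "y \<in> ?S"
    then obtain \<theta> b r where y: "y = ((\<theta>, b), r)" "r \<in> R'" by (auto simp: Rs_def)
    let ?fib = "{x \<in> ?X. ?f x = y}"
    have fibeq: "x = (r, \<theta>, snd (snd x)) \<and> (\<theta>, snd (snd x)) \<in> Col r \<and> \<kappa> t (snd (snd x)) = b" if "x \<in> ?fib" for x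
    proof -
      obtain r' \<phi> \<phi>' where x: "x = (r', \<phi>, \<phi>')" by (cases x)
      with that y have "r' = r" "\<phi> = \<theta>" "\<kappa> t \<phi>' = b" "x \<in> triples" by auto
      then show ?thesis using x by (auto simp: triples_def Col'_def)
    qed
    have "inj_on (\<lambda>x. snd (snd x)) ?fib"
      by (rule inj_on_inverseI[where g = "\<lambda>\<phi>. (r, \<theta>, \<phi>)"]) (rule conjunct1[OF fibeq, symmetric])
    then have "real (card ?fib) = real (card ((\<lambda>x. snd (snd x)) ` ?fib))" by (simp add: card_image)
    also have "\<dots> \<le> L ^ u3"
    proof (rule card_same_labels[OF nodes_R'[OF y(2), of t]])
      have fib: "(\<theta>, \<phi>) \<in> Col r \<and> \<kappa> t \<phi> = b" if "\<phi> \<in> (\<lambda>x. snd (snd x)) ` ?fib" for \<phi>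
        using that conjunct2[OF fibeq] by blast
      then show "(\<lambda>x. snd (snd x)) ` ?fib \<subseteq> \<Theta>" unfolding Col_def by blast
      fix \<phi> \<phi>' s assume *: "\<phi> \<in> (\<lambda>x. snd (snd x)) ` ?fib" "\<phi>' \<in> (\<lambda>x. snd (snd x)) ` ?fib" "s \<in> insert r (insert t Z)"
      have "\<kappa> t \<phi> = b \<and> (\<theta>, \<phi>) \<in> Col r" "\<kappa> t \<phi>' = b \<and> (\<theta>, \<phi>') \<in> Col r" using *(1,2) fib by blast+
      then show "\<kappa> s \<phi> = \<kappa> s \<phi>'" using *(3) by (auto simp: Col_def)
    qed simp
    finally show "real (card ?fib) \<le> L ^ u3" .
  qed auto
  also have "real (card ?S) = (\<Sum>q\<in>Q. real (card (Rs (fst q) (snd q))))"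
    by (subst card_SigmaI) auto
  finally have "L ^ (d + 7) * real (card ?X) \<le> L ^ (d + 7) * ((\<Sum>q\<in>Q. real (card (Rs (fst q) (snd q)))) * L ^ u3)"
    by (rule mult_left_mono) simp
  from order_trans[OF j this] show ?thesis by (simp only: power_add mult_ac)
qed

abbreviation e3 :: nat where
  "e3 \<equiv> d + 3 + u3 + e2"

definition Good :: "('a point \<times> 'a point) set" where
  "Good = {q \<in> Q. Delta / L ^ e3 \<le> real (card (Rs (fst q) (snd q)))}"

lemma Good_finite [simp]: "finite Good"
  by (simp add: Good_def)

lemma Rs_upper: "real (card (Rs \<theta> b)) \<le> L * Delta"
proof -
  have "card (Rs \<theta> b) \<le> card R'" by (rule card_mono) (auto simp: Rs_def)
  then show ?thesis using R'_upper by linarith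
qed

text \<open>By \<open>Rs_sum\<close> and \<open>Q_card\<close> the average of
  \<open>card (Rs \<theta> b)\<close> over \<open>Q\<close> is within a power of \<open>L\<close> of
  its maximal possible size, about \<open>Delta\<close>; so many pairs come close to the
  maximum.\<close>

lemma Good_card: "n ^ (d + 2) \<le> L ^ (e2 + 2) * real (card Good)"
proof -
  let ?T = "Delta * n ^ (d + 2) / L ^ e2"
  have "?T / 2 \<le> real (card {q \<in> Q. Delta / L ^ e3 \<le> real (card (Rs (fst q) (snd q)))}) * (L * Delta)"
  proof (rule many_large_values)
    show "?T \<le> (\<Sum>q\<in>Q. real (card (Rs (fst q) (snd q))))"
      using Rs_sum unfolding divide_Lpow_le_iff .
    have "real (card Q) * (Delta / L ^ e3) \<le> (L ^ (d + 2 + u3) * n ^ (d + 2)) * (Delta / L ^ e3)"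
      using Q_card Delta_pos by (intro mult_right_mono) auto
    also have "\<dots> = ?T / L"
    proof -
      have "A * v * (x / (A * L * E)) = x * v / E / L" if "0 < A" "0 < E" for A E v x :: real
        using that L_pos by (simp add: mult_ac)
      from this[OF Lpow_pos Lpow_pos, of "d + 2 + u3" "n ^ (d + 2)" Delta e2]
      show ?thesis by (simp only: power_add[symmetric] power_Suc2[symmetric]) (simp add: add.commute add.left_commute)
    qed
    also have "\<dots> \<le> ?T / 2"
      using L_ge_6 Delta_pos n_pos by (intro divide_left_mono) auto
    finally show "real (card Q) * (Delta / L ^ e3) \<le> ?T / 2" .
  qed (use Rs_upper Delta_pos L_pos in auto)
  then have bd: "?T / 2 \<le> real (card Good) * (L * Delta)"
    unfolding Good_def .
  have gen: "v \<le> 2 * (L * E) * x" if "Delta * v / E / 2 \<le> x * (L * Delta)" "0 < E" for v E x :: real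
  proof -
    have "Delta * v \<le> Delta * (2 * (L * E) * x)" using that by (simp add: field_simps)
    then show ?thesis using Delta_pos by simp
  qed
  have "n ^ (d + 2) \<le> 2 * (L * L ^ e2) * real (card Good)" by (rule gen[OF bd Lpow_pos])
  also have "\<dots> = 2 * L ^ Suc e2 * real (card Good)" by (simp only: power_Suc)
  also have "\<dots> \<le> L ^ Suc (Suc e2) * real (card Good)" by (rule Lpow_absorb6) auto
  also have "Suc (Suc e2) = e2 + 2" by simp
  finally show ?thesis .
qed

text \<open>Cells that are popular for many parameters at once. Averaging \<open>Wr_card\<close>
  over \<open>r\<close> shows that there are about \<open>n\<close> of them, whereas all cells
  together could number \<open>n ^ 2\<close>.\<close>

definition Wst :: "(nat \<Rightarrow> 'a) set" where
  "Wst = {w \<in> W. Delta / L ^ e3 \<le> real (card {r \<in> R'. w \<in> Wr r})}"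

abbreviation ew :: nat where
  "ew \<equiv> e3 + gp + uw + 3"

lemma Wst_card: "real (card Wst) \<le> L ^ ew * n"
proof -
  have "real (card Wst) * (Delta / L ^ e3) \<le> real (card R') * (L ^ (gp + uw + 2) * n)"
  proof (rule double_count[where P = "\<lambda>w r. w \<in> Wr r"])
    fix r assume r: "r \<in> R'"
    have "card {a \<in> Wst. a \<in> Wr r} \<le> card (Wr r)"
      by (rule card_mono) (auto simp: Wr_def)
    then show "real (card {a \<in> Wst. a \<in> Wr r}) \<le> L ^ (gp + uw + 2) * n"
      using Wr_card[OF r] by linarith
  qed (auto simp: Wst_def)
  also have "\<dots> \<le> (L * Delta) * (L ^ (gp + uw + 2) * n)"
    using R'_upper n_pos by (intro mult_right_mono) auto
  finally have bd: "real (card Wst) * (Delta / L ^ e3) \<le> (L * Delta) * (L ^ (gp + uw + 2) * n)" .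
  have gen: "x \<le> E * L * F * n" if "x * (Delta / E) \<le> (L * Delta) * (F * n)" "0 < E" for x E F :: real
  proof -
    have "Delta * x \<le> Delta * (E * L * F * n)" using that by (simp add: field_simps)
    then show ?thesis using Delta_pos by simp
  qed
  have "real (card Wst) \<le> L ^ e3 * L * L ^ (gp + uw + 2) * n" by (rule gen[OF bd Lpow_pos])
  also have "L ^ e3 * L * L ^ (gp + uw + 2) = L ^ (Suc e3 + (gp + uw + 2))"
    by (simp only: power_add power_Suc2)
  also have "Suc e3 + (gp + uw + 2) = ew" by simp
  finally show ?thesis .
qed

lemma Good_in: "(\<theta>, b) \<in> Good \<Longrightarrow> \<theta> \<in> \<Theta> \<and> b \<in> Y t \<and> sc (\<kappa> t \<theta>) b = j \<and> Delta \<le> L ^ e3 * real (card (Rs \<theta> b))"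
  unfolding Good_def Q_def divide_Lpow_le_iff by auto

text \<open>The cell of a good pair does not depend on \<open>r\<close>, and every parameter in
  \<open>Rs \<theta> b\<close> makes it popular.\<close>

lemma Good_cell: "(\<theta>, b) \<in> Good \<Longrightarrow> cell (\<kappa> t \<theta>) b \<in> Wst"
proof -
  assume g: "(\<theta>, b) \<in> Good"
  have \<theta>: "\<kappa> t \<theta> \<in> Y t" "b \<in> Y t" using Good_in[OF g] \<kappa>(1) in_R by auto
  have "Rs \<theta> b \<subseteq> {r \<in> R'. cell (\<kappa> t \<theta>) b \<in> Wr r}"
    using \<theta> cell(1)[OF \<theta>] by (auto simp: Rs_def Col'_def Wr_def)
  then have "card (Rs \<theta> b) \<le> card {r \<in> R'. cell (\<kappa> t \<theta>) b \<in> Wr r}"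
    by (intro card_mono) auto
  then have "L ^ e3 * real (card (Rs \<theta> b)) \<le> L ^ e3 * real (card {r \<in> R'. cell (\<kappa> t \<theta>) b \<in> Wr r})"
    by (intro mult_left_mono) auto
  then have "Delta / L ^ e3 \<le> real (card {r \<in> R'. cell (\<kappa> t \<theta>) b \<in> Wr r})"
    unfolding divide_Lpow_le_iff using Good_in[OF g] by linarith
  then show ?thesis using cell(1)[OF \<theta>] by (simp add: Wst_def)
qed

lemma Rs_wit:
  assumes "r \<in> Rs \<theta> b"
  obtains \<theta>' where "r \<in> R'" "(\<theta>, \<theta>') \<in> Col r" "\<kappa> t \<theta>' = b" "\<theta> \<in> \<Theta>" "\<theta>' \<in> \<Theta>"
  using assms by (auto simp: Rs_def Col'_def Col_def)

abbreviation e4 :: nat where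
  "e4 \<equiv> d + 4 + u3 + e2"

definition \<Theta>g :: "'a point set" where
  "\<Theta>g = {\<theta> \<in> \<Theta>. n / L ^ e4 \<le> real (card {b \<in> Y t. (\<theta>, b) \<in> Good})}"

definition Good1 :: "('a point \<times> 'a point) set" where
  "Good1 = {q \<in> Good. fst q \<in> \<Theta>g}"

lemma Good1_finite [simp]: "finite Good1"
  by (simp add: Good1_def)

lemma Good1_card: "n ^ (d + 2) \<le> L ^ (e2 + 3) * real (card Good1)"
proof -
  let ?B = "{q \<in> Good. fst q \<notin> \<Theta>g}"
  have "real (card ?B) \<le> real (card \<Theta>) * (n / L ^ e4)"
  proof (rule card_le_fibre_bound[where f = fst])
    show "fst ` ?B \<subseteq> \<Theta>" using Good_in by auto
    fix \<theta> assume \<theta>: "\<theta> \<in> \<Theta>"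
    show "real (card {x \<in> ?B. fst x = \<theta>}) \<le> n / L ^ e4"
    proof (cases "\<theta> \<in> \<Theta>g")
      case True
      then have empty: "{x \<in> ?B. fst x = \<theta>} = {}" by auto
      show ?thesis unfolding empty using n_pos by simp
    next
      case False
      have "{x \<in> ?B. fst x = \<theta>} \<subseteq> Pair \<theta> ` {b \<in> Y t. (\<theta>, b) \<in> Good}" using Good_in by auto
      then have "card {x \<in> ?B. fst x = \<theta>} \<le> card (Pair \<theta> ` {b \<in> Y t. (\<theta>, b) \<in> Good})"
        by (intro card_mono) (auto simp: finY in_R)
      also have "\<dots> \<le> card {b \<in> Y t. (\<theta>, b) \<in> Good}" by (intro card_image_le) (simp add: finY in_R)
      finally show ?thesis using False \<theta> by (simp add: \<Theta>g_def)
    qed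
  qed auto
  also have "\<dots> \<le> (L ^ (Suc d + u3) * n ^ Suc d) * (n / L ^ e4)"
    using card_upper n_pos by (intro mult_right_mono) auto
  also have "\<dots> = n ^ (d + 2) / L ^ (e2 + 3)"
  proof -
    have "A * n ^ Suc d * (n / (A * E)) = n ^ (d + 2) / E" if "0 < A" "0 < E" for A E :: real
      using that by simp
    from this[OF Lpow_pos Lpow_pos, of "Suc d + u3" "e2 + 3"]
    show ?thesis by (simp only: power_add[symmetric]) (simp add: add.commute add.left_commute)
  qed
  finally have "L ^ (e2 + 3) * real (card ?B) \<le> n ^ (d + 2)"
    using Lpow_pos[of "e2 + 3"] by (simp only: pos_le_divide_eq mult.commute)
  moreover have "6 * (L ^ (e2 + 2) * real (card ?B)) \<le> L ^ (e2 + 3) * real (card ?B)"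
    using Lpow_absorb6[of 6 "real (card ?B)" "e2 + 2"] by (simp add: eval_nat_numeral mult_ac)
  moreover have "card Good \<le> card Good1 + card ?B"
  proof -
    have "card Good = card (Good1 \<union> ?B)" by (rule arg_cong[of _ _ card]) (auto simp: Good1_def)
    then show ?thesis using card_Un_le[of Good1 ?B] by simp
  qed
  then have "L ^ (e2 + 2) * real (card Good) \<le> L ^ (e2 + 2) * (real (card Good1) + real (card ?B))"
    by (intro mult_left_mono) (auto simp flip: of_nat_add)
  then have "n ^ (d + 2) \<le> L ^ (e2 + 2) * real (card Good1) + L ^ (e2 + 2) * real (card ?B)"
    using Good_card by (simp add: distrib_left)
  ultimately have "n ^ (d + 2) \<le> 6 * (L ^ (e2 + 2) * real (card Good1))"
    using mult_nonneg_nonneg[OF Lpow_nonneg, of "real (card Good1)" "e2 + 2"] by linarith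
  also have "\<dots> \<le> L ^ (e2 + 3) * real (card Good1)"
    using Lpow_absorb6[of 6 "real (card Good1)" "e2 + 2"] by (simp add: eval_nat_numeral mult_ac)
  finally show ?thesis .
qed

text \<open>By the choice of scale the displacement at \<open>t\<close> is at most about
  \<open>\<rho>\<close>, and the proportionality in \<open>Col_dif\<close> carries this bound to the
  parameters of \<open>S\<close>.\<close>

lemma Rs_displacement:
  assumes r: "r \<in> R'" and C: "(\<theta>, \<theta>') \<in> Col r" and b: "\<kappa> t \<theta>' = b" "sc (\<kappa> t \<theta>) b = j" and s: "s \<in> S"
  shows "near I (L ^ Suc ep * \<rho>) (pr s (\<kappa> s \<theta>')) (pr s \<theta>)"
proof -
  have th: "\<theta> \<in> \<Theta>" "\<theta>' \<in> \<Theta>" using C by (auto simp: Col_def)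
  have lab: "\<kappa> t \<theta> \<in> \<Theta>" "b \<in> \<Theta>" using th b(1) \<kappa>(1)[OF in_R(1)] Y_sub[OF in_R(1)] by auto
  have "near I \<rho> (dif t (\<kappa> t \<theta>) b) (\<lambda>_. 0)"
    using sc(2)[OF lab] b(2) by (simp add: \<rho>_def)
  then have "near I (L ^ 3 * \<delta> + \<rho>) (dif t \<theta> \<theta>') (\<lambda>_. 0)"
    using dif_\<kappa>[OF in_R(1) th] b(1) near_trans by blast
  moreover have sm: "L ^ 3 * \<delta> \<le> \<rho>" "L ^ 2 * \<delta> \<le> \<rho>"
  proof -
    have "L ^ 3 * \<delta> \<le> L ^ 4 * \<delta>" "L ^ 2 * \<delta> \<le> L ^ 4 * \<delta>"
      using \<delta>_pos by (intro mult_right_mono Lpow_mono; simp)+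
    then show "L ^ 3 * \<delta> \<le> \<rho>" "L ^ 2 * \<delta> \<le> \<rho>" using \<rho>_ge(1) by linarith+
  qed
  ultimately have "near I (2 * \<rho>) (dif t \<theta> \<theta>') (\<lambda>_. 0)"
    by (elim near_mono) linarith
  then have "near I (L ^ ep * (2 * \<rho>)) (\<lambda>k. lam r s * dif t \<theta> \<theta>' k) (\<lambda>k. lam r s * 0)"
    using \<rho>_pos by (intro lam_near[OF r s]) auto
  from near_trans[OF Col_dif[OF r s C] this]
  have 1: "near I (L ^ (ep + 3) * \<delta> + L ^ ep * (2 * \<rho>)) (dif s \<theta> \<theta>') (\<lambda>k. 0)" by simp
  have "near I (L ^ (ep + 3) * \<delta> + L ^ ep * (2 * \<rho>)) (pr s \<theta>') (pr s \<theta>)"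
    using 1 by (simp add: near_def dif_def)
  moreover have "near I (L ^ 2 * \<delta>) (pr s (\<kappa> s \<theta>')) (pr s \<theta>')"
    using \<kappa>_near[OF in_R(3)[OF s] th(2)] near_sym by blast
  ultimately have "near I (L ^ 2 * \<delta> + (L ^ (ep + 3) * \<delta> + L ^ ep * (2 * \<rho>))) (pr s (\<kappa> s \<theta>')) (pr s \<theta>)"
    using near_trans by blast
  moreover have "L ^ 2 * \<delta> + (L ^ (ep + 3) * \<delta> + L ^ ep * (2 * \<rho>)) \<le> L ^ Suc ep * \<rho>"
  proof -
    have "L ^ (ep + 3) * \<delta> \<le> L ^ ep * \<rho>"
      using sm(1) by (simp add: power_add mult.assoc)
    moreover have "\<rho> \<le> L ^ ep * \<rho>" using Lpow_ge_1[of ep] \<rho>_pos by simp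
    moreover have "6 * L ^ ep * \<rho> \<le> L ^ Suc ep * \<rho>" using \<rho>_pos by (intro Lpow_absorb6) auto
    ultimately show ?thesis using sm(2) \<rho>_pos by linarith
  qed
  ultimately show ?thesis by (rule near_mono)
qed

abbreviation e6 :: nat where
  "e6 \<equiv> e4 + (e3 + (u3 + 1))"

text \<open>Pairs of a label \<open>b\<close> and a parameter \<open>r\<close> are counted in two
  ways. For fixed \<open>r\<close>, the point joined to \<open>\<theta>\<close> is determined up to
  \<open>L ^ u3\<close> choices by its label at \<open>s\<close>, since its labels on
  \<open>insert r Z\<close> are those of \<open>\<theta>\<close>. So about \<open>n\<close> values
  of \<open>b\<close> force about \<open>n\<close> labels at \<open>s\<close>, all of them close to
  \<open>\<theta>\<close>: a proportion of the whole projection lies within about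
  \<open>\<rho>\<close> of \<open>\<theta>\<close>.\<close>

lemma \<Theta>g_dense:
  assumes \<theta>: "\<theta> \<in> \<Theta>g" and s: "s \<in> S"
  shows "n \<le> L ^ e6 * real (card {y \<in> Y s. near I (L ^ Suc ep * \<rho>) (pr s y) (pr s \<theta>)})"
proof -
  let ?B = "{b \<in> Y t. (\<theta>, b) \<in> Good}"
  let ?Ys = "{y \<in> Y s. near I (L ^ Suc ep * \<rho>) (pr s y) (pr s \<theta>)}"
  have finB: "finite ?B" by (simp add: finY in_R)
  have 1: "real (card ?B) * (Delta / L ^ e3) \<le> real (card R') * (L ^ u3 * real (card ?Ys))"
  proof (rule double_count[where P = "\<lambda>b r. r \<in> Rs \<theta> b"])
    fix b assume "b \<in> ?B"
    then have "Delta \<le> L ^ e3 * real (card (Rs \<theta> b))" using Good_in by blast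
    moreover have "{r \<in> R'. r \<in> Rs \<theta> b} = Rs \<theta> b" by (auto simp: Rs_def)
    ultimately show "Delta / L ^ e3 \<le> real (card {r \<in> R'. r \<in> Rs \<theta> b})"
      unfolding divide_Lpow_le_iff by simp
  next
    fix r assume r: "r \<in> R'"
    let ?Br = "{b \<in> ?B. r \<in> Rs \<theta> b}"
    have "\<forall>b\<in>?Br. \<exists>\<theta>'. (\<theta>, \<theta>') \<in> Col r \<and> \<kappa> t \<theta>' = b \<and> \<theta>' \<in> \<Theta>"
      using Rs_wit by blast
    from bchoice[OF this] obtain h where
      h: "\<And>b. b \<in> ?Br \<Longrightarrow> (\<theta>, h b) \<in> Col r \<and> \<kappa> t (h b) = b \<and> h b \<in> \<Theta>"
      by blast
    have "real (card ?Br) \<le> real (card ?Ys) * L ^ u3"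
    proof (rule card_le_fibre_bound[where f = "\<lambda>b. \<kappa> s (h b)"])
      show "(\<lambda>b. \<kappa> s (h b)) ` ?Br \<subseteq> ?Ys"
      proof (rule image_subsetI)
        fix b assume b: "b \<in> ?Br"
        then have "sc (\<kappa> t \<theta>) b = j" using Good_in by blast
        with h[OF b] have "near I (L ^ Suc ep * \<rho>) (pr s (\<kappa> s (h b))) (pr s \<theta>)"
          by (intro Rs_displacement[OF r _ _ _ s]) auto
        then show "\<kappa> s (h b) \<in> ?Ys" using \<kappa>(1)[OF in_R(3)[OF s]] h[OF b] by simp
      qed
      fix y
      let ?F = "{b \<in> ?Br. \<kappa> s (h b) = y}"
      have "inj_on h ?F"
        by (rule inj_on_inverseI[where g = "\<kappa> t"]) (use h in auto)
      then have "real (card ?F) = real (card (h ` ?F))" by (simp add: card_image)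
      also have "\<dots> \<le> L ^ u3"
      proof (rule card_same_labels[OF nodes_R'[OF r, of s]])
        show "h ` ?F \<subseteq> \<Theta>" using h by auto
        fix \<phi> \<phi>' x assume *: "\<phi> \<in> h ` ?F" "\<phi>' \<in> h ` ?F" "x \<in> insert r (insert s Z)"
        then have "(\<theta>, \<phi>) \<in> Col r" "(\<theta>, \<phi>') \<in> Col r" "\<kappa> s \<phi> = y" "\<kappa> s \<phi>' = y" using h by auto
        then show "\<kappa> x \<phi> = \<kappa> x \<phi>'" using *(3) by (auto simp: Col_def)
      qed (use s in simp)
      finally show "real (card ?F) \<le> L ^ u3" .
    qed (use finite_subset[OF _ finB, of ?Br] finY in_R(3)[OF s] in auto)
    then show "real (card ?Br) \<le> L ^ u3 * real (card ?Ys)" by (simp add: mult.commute)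
  qed (use finB in auto)
  also have "\<dots> \<le> L * Delta * (L ^ u3 * real (card ?Ys))"
    using R'_upper by (intro mult_right_mono) auto
  finally have bd: "real (card ?B) * (Delta / L ^ e3) \<le> L * Delta * (L ^ u3 * real (card ?Ys))" .
  have gen: "x \<le> E * (F * L) * y" if "x * (Delta / E) \<le> L * Delta * (F * y)" "0 < E" for x y E F :: real
  proof -
    have "Delta * x \<le> Delta * (E * (F * L) * y)" using that by (simp add: field_simps)
    then show ?thesis using Delta_pos by simp
  qed
  have 2: "real (card ?B) \<le> L ^ (e3 + (u3 + 1)) * real (card ?Ys)"
    using gen[OF bd Lpow_pos] by (simp only: power_add power_one_right)
  have "n \<le> L ^ e4 * real (card ?B)"
    using \<theta> unfolding \<Theta>g_def divide_Lpow_le_iff by simp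
  also have "\<dots> \<le> L ^ e4 * (L ^ (e3 + (u3 + 1)) * real (card ?Ys))"
    using 2 by (intro mult_left_mono) auto
  also have "\<dots> = L ^ e6 * real (card ?Ys)" by (simp only: power_add mult.assoc)
  finally show ?thesis .
qed

end

section \<open>Quotient by a direction, in coordinates\<close>

context moment_curve
begin

text \<open>Projection along \<open>w\<close> to the hyperplane where the \<open>i\<close>-th
  coordinate vanishes, provided \<open>w i = 1\<close>. It realises the quotient by the line of
  \<open>w\<close> on the coordinates \<open>I - {i}\<close>.\<close>

definition ell :: "nat \<Rightarrow> (nat \<Rightarrow> 'a) \<Rightarrow> (nat \<Rightarrow> 'a) \<Rightarrow> nat \<Rightarrow> 'a" where
  "ell i w x = (\<lambda>k. x k - x i * w k)"

text \<open>The multiple of \<open>w\<close> is read off from the \<open>i\<close>-th coordinate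
  with error \<open>e\<close>; since the entries of \<open>w\<close> are at most 1, the error only
  doubles.\<close>

lemma ell_near_multiple:
  assumes "near I e (\<lambda>k. x k - y k) (\<lambda>k. l * w k)" "i \<in> I" "w i = 1" "\<And>k. k \<in> I \<Longrightarrow> absval (w k) \<le> 1"
  shows "near (I - {i}) (2 * e) (ell i w x) (ell i w y)"
  unfolding near_def
proof
  fix k assume k: "k \<in> I - {i}"
  have "absval (x k - y k - l * w k) \<le> e" "absval (x i - y i - l) \<le> e"
    using assms k by (auto simp: near_def)
  moreover from this have "absval ((x i - y i - l) * w k) \<le> e * 1"
    unfolding absval_mult using assms(4)[of k] k by (intro mult_mono) (auto intro: order_trans[OF absval_nonneg])
  ultimately have "absval ((x k - y k - l * w k) - (x i - y i - l) * w k) \<le> e + e * 1"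
    by (intro absval_triangle_diff_le)
  also have "(x k - y k - l * w k) - (x i - y i - l) * w k = ell i w x k - ell i w y k"
    by (simp add: ell_def algebra_simps)
  finally show "absval (ell i w x k - ell i w y k) \<le> 2 * e" by simp
qed

lemma near_ell:
  assumes "near I e x y" "i \<in> I" "w i = 1" "\<And>k. k \<in> I \<Longrightarrow> absval (w k) \<le> 1"
  shows "near (I - {i}) (2 * e) (ell i w x) (ell i w y)"
  using assms by (intro ell_near_multiple[where l = 0]) (auto simp: near_def)

text \<open>The quotient acts on the coordinates and the projection on the weights, so they commute.
  This keeps the same moment curve through the induction.\<close>

lemma pr_ell: "pr s (\<lambda>p. ell i w (\<theta> p)) = ell i w (pr s \<theta>)"
  by (simp add: pr_def ell_def fun_eq_iff right_diff_distrib sum_subtractf sum_distrib_right mult.assoc)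

end

context scaled
begin

text \<open>By \<open>\<Theta>g_dense\<close> separated centres own disjoint sets of at least
  \<open>n / L ^ e6\<close> labels among at most \<open>L * n\<close>.\<close>

lemma localisation:
  assumes s: "s \<in> S"
  shows "\<exists>Cs cl. finite Cs \<and> real (card Cs) \<le> L ^ Suc e6 \<and>
    (\<forall>\<theta>\<in>\<Theta>g. cl \<theta> \<in> Cs \<and> near I (2 * (L ^ Suc ep * \<rho>)) (pr s \<theta>) (pr s (cl \<theta>)))"
proof -
  let ?E = "L ^ Suc ep * \<rho>"
  let ?R = "\<lambda>x y. near I (2 * ?E) (pr s x) (pr s y)"
  have E: "0 \<le> ?E" using \<rho>_pos less_imp_le[OF \<rho>_pos] by (intro mult_nonneg_nonneg Lpow_nonneg)
  have fin\<Theta>g: "finite \<Theta>g" by (simp add: \<Theta>g_def)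
  obtain Cs where Cs: "Cs \<subseteq> \<Theta>g" "finite Cs" "\<And>x y. x \<in> Cs \<Longrightarrow> y \<in> Cs \<Longrightarrow> x \<noteq> y \<Longrightarrow> \<not> ?R x y"
      "\<And>x. x \<in> \<Theta>g \<Longrightarrow> \<exists>y\<in>Cs. ?R x y"
  proof (rule maximal_separated_finite[of \<Theta>g ?R])
    show "finite \<Theta>g" by fact
    show "?R x x" for x using E by (simp add: near_refl)
    show "?R y x" if "?R x y" for x y using that near_sym by blast
    fix E assume "E \<subseteq> \<Theta>g" "finite E" "\<And>x y. x \<in> E \<Longrightarrow> y \<in> E \<Longrightarrow> x \<noteq> y \<Longrightarrow> \<not> ?R x y"
      "\<And>x. x \<in> \<Theta>g \<Longrightarrow> \<exists>y\<in>E. ?R x y"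
    then show thesis by (rule that)
  qed
  have "real (card Cs) * (n / L ^ e6) \<le> real (card (Y s)) * 1"
  proof (rule double_count[where P = "\<lambda>c y. near I ?E (pr s y) (pr s c)"])
    fix c assume "c \<in> Cs"
    then show "n / L ^ e6 \<le> real (card {y \<in> Y s. near I ?E (pr s y) (pr s c)})"
      using \<Theta>g_dense[OF _ s] Cs(1) unfolding divide_Lpow_le_iff by blast
  next
    fix y assume "y \<in> Y s"
    let ?X = "{c \<in> Cs. near I ?E (pr s y) (pr s c)}"
    have "c = c'" if "c \<in> ?X" "c' \<in> ?X" for c c'
    proof -
      have "near I ?E (pr s c) (pr s y)" "near I ?E (pr s y) (pr s c')"
        using that near_sym[of I ?E "pr s y" "pr s c"] by blast+
      from near_trans[OF this] have "?R c c'" by (simp only: mult_2)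
      then show ?thesis using Cs(3)[of c c'] that by blast
    qed
    moreover have "finite ?X" using Cs(2) by simp
    ultimately have "card ?X \<le> Suc 0" unfolding card_le_Suc0_iff_eq[OF \<open>finite ?X\<close>] by blast
    then show "real (card ?X) \<le> 1" by simp
  qed (use Cs finY in_R s in auto)
  also have "\<dots> \<le> L * n" using Y_card[OF in_R(3)[OF s]] by simp
  finally have bd: "real (card Cs) * (n / L ^ e6) \<le> L * n" .
  have gen: "x \<le> L * A" if "x * (n / A) \<le> L * n" "0 < A" for x A :: real
    using that n_pos by (simp add: field_simps)
  have "real (card Cs) \<le> L ^ Suc e6" using gen[OF bd Lpow_pos] by (simp only: power_Suc)
  moreover have "\<forall>\<theta>\<in>\<Theta>g. \<exists>y. y \<in> Cs \<and> ?R \<theta> y" using Cs(4) by blast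
  from bchoice[OF this] obtain cl where "\<forall>\<theta>\<in>\<Theta>g. cl \<theta> \<in> Cs \<and> ?R \<theta> (cl \<theta>)" by blast
  ultimately show ?thesis using Cs(2) by blast
qed

abbreviation e7 :: nat where
  "e7 \<equiv> (e2 + 3) + (Suc e6 * Suc d + ew)"

text \<open>Pigeonhole on the cluster at every \<open>s\<close> in \<open>S\<close> and on the cell:
  about \<open>n ^ (d + 2)\<close> good pairs, a power of \<open>L\<close> many clusters and about
  \<open>n\<close> cells leave about \<open>n ^ (d + 1)\<close> pairs. Each point occurs in one of
  them only, because its label at \<open>t\<close> and the cell determine \<open>b\<close>.\<close>

lemma common_cell:
  "\<exists>w \<Theta>2. \<Theta>2 \<subseteq> \<Theta> \<and> n ^ Suc d \<le> L ^ e7 * real (card \<Theta>2) \<and>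
    (\<forall>\<theta>\<in>\<Theta>2. \<exists>b. (\<theta>, b) \<in> Good \<and> cell (\<kappa> t \<theta>) b = w) \<and>
    (\<forall>\<theta>\<in>\<Theta>2. \<forall>\<theta>'\<in>\<Theta>2. pnear I (L ^ (2 * ep + 2) * \<rho>) \<theta> \<theta>')"
proof -
  let ?E = "L ^ Suc ep * \<rho>"
  have "\<forall>s\<in>S. \<exists>Cscl. finite (fst Cscl) \<and> real (card (fst Cscl)) \<le> L ^ Suc e6 \<and>
    (\<forall>\<theta>\<in>\<Theta>g. (snd Cscl) \<theta> \<in> fst Cscl \<and> near I (2 * ?E) (pr s \<theta>) (pr s ((snd Cscl) \<theta>)))"
    using localisation by fastforce
  from bchoice[OF this] obtain C where C: "\<And>s. s \<in> S \<Longrightarrow> finite (fst (C s))"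
      "\<And>s. s \<in> S \<Longrightarrow> real (card (fst (C s))) \<le> L ^ Suc e6"
      "\<And>s \<theta>. s \<in> S \<Longrightarrow> \<theta> \<in> \<Theta>g \<Longrightarrow> snd (C s) \<theta> \<in> fst (C s) \<and> near I (2 * ?E) (pr s \<theta>) (pr s (snd (C s) \<theta>))"
    by blast
  let ?f = "\<lambda>q. (restrict (\<lambda>s. snd (C s) (fst q)) S, cell (\<kappa> t (fst q)) (snd q))"
  let ?Y = "PiE S (\<lambda>s. fst (C s)) \<times> Wst"
  have "0 < n ^ (d + 2)" using n_pos by simp
  then have "Good1 \<noteq> {}" using Good1_card by auto
  have finWst: "finite Wst" by (simp add: Wst_def)
  obtain y where y: "y \<in> ?Y" "real (card Good1) \<le> real (card ?Y) * real (card {q \<in> Good1. ?f q = y})"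
  proof (rule pigeonhole_real[of Good1 ?Y ?f])
    show "finite ?Y" using C(1) finWst by (intro finite_cartesian_product finite_PiE) auto
    show "?f ` Good1 \<subseteq> ?Y" using C(3) Good_cell by (auto simp: Good1_def)
    show "Good1 \<noteq> {}" by fact
  qed (auto intro: that)
  define F where "F = {q \<in> Good1. ?f q = y}"
  define \<Theta>2 where "\<Theta>2 = fst ` F"
  have "real (card (PiE S (\<lambda>s. fst (C s)))) = (\<Prod>s\<in>S. real (card (fst (C s))))"
    by (simp add: card_PiE)
  also have "\<dots> \<le> (\<Prod>s\<in>S. L ^ Suc e6)" using C(2) by (intro prod_mono) auto
  also have "\<dots> = L ^ (Suc e6 * Suc d)" using cards by (simp only: prod_constant power_mult)
  finally have cY: "real (card ?Y) \<le> L ^ (Suc e6 * Suc d) * (L ^ ew * n)"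
    unfolding card_cartesian_product of_nat_mult using Wst_card by (intro mult_mono) auto
  have inj: "inj_on fst F"
  proof (rule inj_onI)
    fix q q' assume q: "q \<in> F" "q' \<in> F" "fst q = fst q'"
    obtain \<theta> b b' where qq: "q = (\<theta>, b)" "q' = (\<theta>, b')" using q(3) by (cases q; cases q') auto
    have G: "(\<theta>, b) \<in> Good" "(\<theta>, b') \<in> Good" "cell (\<kappa> t \<theta>) b = cell (\<kappa> t \<theta>) b'"
      using q qq by (auto simp: F_def Good1_def)
    have Yt: "\<kappa> t \<theta> \<in> Y t" "b \<in> Y t" "b' \<in> Y t" using Good_in G \<kappa>(1) in_R(1) by auto
    have "near I (\<delta> + \<delta>) (dif t (\<kappa> t \<theta>) b) (dif t (\<kappa> t \<theta>) b')"
      using cell(2)[OF Yt(1,2)] cell(2)[OF Yt(1,3)] G(3) near_sym near_trans by metis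
    then have "near I (\<delta> + \<delta>) (pr t b) (pr t b')"
      by (simp add: near_def dif_def)
    moreover have "\<delta> + \<delta> \<le> 2 * L * \<delta>" using L_ge_1 \<delta>_pos by simp
    ultimately have "near I (2 * L * \<delta>) (pr t b) (pr t b')" by (rule near_mono)
    then have "b = b'" using Y_sep in_R(1) Yt by blast
    then show "q = q'" using qq by simp
  qed
  have c2: "card \<Theta>2 = card F" unfolding \<Theta>2_def using inj by (rule card_image)
  have "n ^ (d + 2) \<le> L ^ (e2 + 3) * real (card Good1)" by (rule Good1_card)
  also have "\<dots> \<le> L ^ (e2 + 3) * (real (card ?Y) * real (card F))"
    using y(2) unfolding F_def by (intro mult_left_mono) auto
  also have "\<dots> \<le> L ^ (e2 + 3) * ((L ^ (Suc e6 * Suc d) * (L ^ ew * n)) * real (card F))"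
    using cY by (intro mult_left_mono mult_right_mono) auto
  finally have bd: "n ^ (d + 2) \<le> L ^ (e2 + 3) * ((L ^ (Suc e6 * Suc d) * (L ^ ew * n)) * real (card F))" .
  have gen: "n ^ Suc d \<le> A * (B * E) * x" if "n ^ (d + 2) \<le> A * ((B * (E * n)) * x)" for A B E x :: real
  proof -
    have "n * n ^ Suc d \<le> n * (A * (B * E) * x)" using that by (simp add: mult_ac)
    then show ?thesis using n_pos by simp
  qed
  have card2: "n ^ Suc d \<le> L ^ e7 * real (card \<Theta>2)"
    using gen[OF bd] unfolding c2 by (simp only: power_add)
  have "pnear I (L ^ (2 * ep + 2) * \<rho>) \<theta> \<theta>'" if th: "\<theta> \<in> \<Theta>2" "\<theta>' \<in> \<Theta>2" for \<theta> \<theta>'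
  proof -
    obtain q q' where q: "q \<in> F" "q' \<in> F" "\<theta> = fst q" "\<theta>' = fst q'" using th by (auto simp: \<Theta>2_def)
    have g: "\<theta> \<in> \<Theta>g" "\<theta>' \<in> \<Theta>g" using q by (auto simp: F_def Good1_def)
    have eq: "snd (C s) \<theta> = snd (C s) \<theta>'" if "s \<in> S" for s
      using restrict_eqD[of "\<lambda>s. snd (C s) \<theta>" S "\<lambda>s. snd (C s) \<theta>'" s] q that by (auto simp: F_def)
    have nr: "near I (2 * ?E + 2 * ?E) (pr s \<theta>) (pr s \<theta>')" if s: "s \<in> S" for s
      using C(3)[OF s g(1)] C(3)[OF s g(2)] eq[OF s] near_sym near_trans by metis
    have "pnear I (C1 * ((6 / \<eta>) ^ d * (2 * ?E + 2 * ?E))) \<theta> \<theta>'"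
      using nodes_S R_ball nr \<eta> sub by (intro pnear_of_pr[of S]) (auto simp: nodes_def)
    moreover have "C1 * ((6 / \<eta>) ^ d * (2 * ?E + 2 * ?E)) \<le> L ^ (2 * ep + 2) * \<rho>"
    proof -
      have E: "0 \<le> ?E" using less_imp_le[OF \<rho>_pos] by (intro mult_nonneg_nonneg Lpow_nonneg)
      have "C1 * ((6 / \<eta>) ^ d * (2 * ?E + 2 * ?E)) \<le> L ^ ep * (2 * ?E + 2 * ?E)"
        using E by (intro interp_const) linarith
      also have "\<dots> = 4 * L ^ (ep + Suc ep) * \<rho>" by (simp add: power_add mult_ac)
      also have "\<dots> \<le> L ^ Suc (ep + Suc ep) * \<rho>" using \<rho>_pos by (intro Lpow_absorb6) auto
      also have "Suc (ep + Suc ep) = 2 * ep + 2" by simp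
      finally show ?thesis .
    qed
    ultimately show ?thesis by (rule pnear_mono)
  qed
  moreover have "\<exists>b. (\<theta>, b) \<in> Good \<and> cell (\<kappa> t \<theta>) b = snd y" if "\<theta> \<in> \<Theta>2" for \<theta>
    using that by (auto simp: \<Theta>2_def F_def Good1_def)
  moreover have "\<Theta>2 \<subseteq> \<Theta>" using Good_in by (auto simp: \<Theta>2_def F_def Good1_def)
  ultimately show ?thesis using card2 by blast
qed

text \<open>The size, at scale \<open>\<delta>\<close>, of a filled segment of length
  \<open>\<rho>\<close>.\<close>

definition Qr :: real where
  "Qr = (\<rho> / \<delta>) powr D"

lemma Qr_ge_1: "1 \<le> Qr"
  unfolding Qr_def using \<rho>_ge(2) \<delta>_pos D_pos by (intro ge_one_powr_ge_zero) auto

abbreviation e9 :: nat where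
  "e9 \<equiv> (e3 + (1 + (3 * ep + 6) * N)) + 4 * N"

lemma Rs_line:
  assumes G: "(\<theta>, b) \<in> Good" and s: "s \<in> S" and r: "r \<in> R'" and C: "(\<theta>, \<theta>') \<in> Col r" "\<kappa> t \<theta>' = b"
  shows "near I (L ^ (ep + 4) * \<delta>) (\<lambda>k. pr s (\<kappa> s \<theta>') k - pr s \<theta> k) (\<lambda>k. lam r s * cell (\<kappa> t \<theta>) b k)"
proof -
  have th: "\<theta> \<in> \<Theta>" "\<theta>' \<in> \<Theta>" using C by (auto simp: Col_def)
  have Yt: "\<kappa> t \<theta> \<in> Y t" "b \<in> Y t" using Good_in[OF G] \<kappa>(1) in_R(1) by auto
  have "near I (L ^ 2 * \<delta>) (pr s (\<kappa> s \<theta>')) (pr s \<theta>')"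
    using \<kappa>_near[OF in_R(3)[OF s] th(2)] near_sym by blast
  then have 1: "near I (L ^ 2 * \<delta>) (\<lambda>k. pr s (\<kappa> s \<theta>') k - pr s \<theta> k) (dif s \<theta> \<theta>')"
    by (simp add: near_def dif_def)
  have 2: "near I (L ^ (ep + 3) * \<delta>) (dif s \<theta> \<theta>') (\<lambda>k. lam r s * dif t \<theta> \<theta>' k)"
    by (rule Col_dif[OF r s C(1)])
  have "near I (L ^ 3 * \<delta> + \<delta>) (dif t \<theta> \<theta>') (cell (\<kappa> t \<theta>) b)"
    using dif_\<kappa>[OF in_R(1) th] C(2) cell(2)[OF Yt] near_trans by blast
  then have 3: "near I (L ^ ep * (L ^ 3 * \<delta> + \<delta>)) (\<lambda>k. lam r s * dif t \<theta> \<theta>' k) (\<lambda>k. lam r s * cell (\<kappa> t \<theta>) b k)"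
    using less_imp_le[OF \<delta>_pos]
    by (intro lam_near[OF r s] add_nonneg_nonneg mult_nonneg_nonneg Lpow_nonneg)
  note near_trans[OF near_trans[OF 1 2] 3]
  moreover have "L ^ 2 * \<delta> + L ^ (ep + 3) * \<delta> + L ^ ep * (L ^ 3 * \<delta> + \<delta>) \<le> L ^ (ep + 4) * \<delta>"
  proof -
    have "L ^ ep * (L ^ 3 * \<delta> + \<delta>) = L ^ (ep + 3) * \<delta> + L ^ ep * \<delta>" by (simp add: power_add algebra_simps)
    moreover have "L ^ 2 * \<delta> \<le> L ^ (ep + 3) * \<delta>" "L ^ ep * \<delta> \<le> L ^ (ep + 3) * \<delta>"
      using \<delta>_pos by (intro mult_right_mono Lpow_mono; simp)+
    moreover have "4 * (L ^ (ep + 3) * \<delta>) \<le> L ^ (ep + 4) * \<delta>"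
      using Lpow_absorb6[of 4 \<delta> "ep + 3"] \<delta>_pos unfolding mult.assoc by (simp only: add_Suc_right[symmetric] Suc_numeral) simp
    ultimately show ?thesis by linarith
  qed
  ultimately show ?thesis by (rule near_mono)
qed

end

context scaled
begin

text \<open>Each \<open>r\<close> in \<open>Rs \<theta> b\<close> gives a label at \<open>s\<close>
  near the line through the projection of \<open>\<theta>\<close> in direction \<open>w\<close>, at
  position \<open>lam r s * x\<close>. By \<open>lam_diff\<close> one label comes from parameters in
  a ball of radius \<open>\<sigma>\<close> only, that is from about \<open>\<rho> powr (- D)\<close>
  of the about \<open>Delta\<close> parameters; the quotient of the two numbers is
  \<open>Qr\<close>.\<close>

lemma rich_lines:
  assumes G: "(\<theta>, b) \<in> Good" and s: "s \<in> S" and i: "i \<in> I" "w i = 1" "\<And>k. k \<in> I \<Longrightarrow> absval (w k) \<le> 1"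
    and cell_w: "\<And>k. k \<in> I \<Longrightarrow> cell (\<kappa> t \<theta>) b k = x * w k" and x: "\<rho> \<le> 4 * absval x"
    and \<rho>: "\<rho> \<le> L ^ 4"
  shows "Qr \<le> L ^ (e3 + (1 + (3 * ep + 6) * N)) *
    real (card {y \<in> Y s. near (I - {i}) (L ^ (ep + 5) * \<delta>) (ell i w (pr s y)) (ell i w (pr s \<theta>))})"
    (is "_ \<le> _ * real (card ?Ys)")
proof -
  have "\<forall>r\<in>Rs \<theta> b. \<exists>\<theta>'. (\<theta>, \<theta>') \<in> Col r \<and> \<kappa> t \<theta>' = b \<and> \<theta>' \<in> \<Theta> \<and> r \<in> R'"
    using Rs_wit by blast
  from bchoice[OF this] obtain h where
    h: "\<And>r. r \<in> Rs \<theta> b \<Longrightarrow> (\<theta>, h r) \<in> Col r \<and> \<kappa> t (h r) = b \<and> h r \<in> \<Theta> \<and> r \<in> R'"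
    by blast
  have line: "near I (L ^ (ep + 4) * \<delta>) (\<lambda>k. pr s (\<kappa> s (h r)) k - pr s \<theta> k) (\<lambda>k. lam r s * x * w k)"
    if r: "r \<in> Rs \<theta> b" for r
  proof -
    have "near I (L ^ (ep + 4) * \<delta>) (\<lambda>k. pr s (\<kappa> s (h r)) k - pr s \<theta> k) (\<lambda>k. lam r s * cell (\<kappa> t \<theta>) b k)"
      using h[OF r] by (intro Rs_line[OF G s]) auto
    then show ?thesis using cell_w by (simp add: near_def mult.assoc)
  qed
  \<comment> \<open>The exponent collects \<open>L ^ (2 * ep)\<close> from \<open>lam_diff\<close>,
    \<open>L ^ (ep + 4)\<close> from the distance to the line, and \<open>L ^ 2\<close> for the
    constant 8. The premise \<open>\<rho> \<le> L ^ 4\<close> keeps \<open>\<sigma>\<close> above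
    the separation \<open>\<delta>\<close> of \<open>R\<close>.\<close>
  define \<sigma> where "\<sigma> = L ^ (3 * ep + 6) * \<delta> / \<rho>"
  have \<delta>\<sigma>: "\<delta> \<le> \<sigma>"
  proof -
    have "\<rho> \<le> L ^ (3 * ep + 6)" using \<rho> Lpow_mono[of 4 "3 * ep + 6"] by linarith
    then have "\<delta> * \<rho> \<le> \<delta> * L ^ (3 * ep + 6)" using \<delta>_pos by (intro mult_left_mono) auto
    then show ?thesis using \<rho>_pos by (simp add: \<sigma>_def pos_le_divide_eq mult.commute)
  qed
  have "real (card (Rs \<theta> b)) \<le> real (card ?Ys) * (C1 * (\<sigma> / \<delta>) powr D)"
  proof (rule card_le_fibre_bound[where f = "\<lambda>r. \<kappa> s (h r)"])
    show "(\<lambda>r. \<kappa> s (h r)) ` Rs \<theta> b \<subseteq> ?Ys"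
    proof (rule image_subsetI)
      fix r assume r: "r \<in> Rs \<theta> b"
      have "near (I - {i}) (2 * (L ^ (ep + 4) * \<delta>)) (ell i w (pr s (\<kappa> s (h r)))) (ell i w (pr s \<theta>))"
        by (rule ell_near_multiple[OF line[OF r] i(1,2)]) (rule i(3))
      moreover have "2 * (L ^ (ep + 4) * \<delta>) \<le> L ^ (ep + 5) * \<delta>"
        using Lpow_absorb6[of 2 \<delta> "ep + 4"] \<delta>_pos unfolding mult.assoc by (simp only: add_Suc_right[symmetric] Suc_numeral) simp
      ultimately show "\<kappa> s (h r) \<in> ?Ys"
        using \<kappa>(1)[OF in_R(3)[OF s]] h[OF r] near_mono by blast
    qed
    fix y
    let ?F = "{r \<in> Rs \<theta> b. \<kappa> s (h r) = y}"
    show "real (card ?F) \<le> C1 * (\<sigma> / \<delta>) powr D"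
    proof (cases "?F = {}")
      case False
      then obtain r0 where r0: "r0 \<in> ?F" by blast
      show ?thesis
      proof (rule R_in_ball[of _ r0])
        show "?F \<subseteq> R" using h R'_in by blast
        fix r assume r: "r \<in> ?F"
        have "absval (pr s y i - pr s \<theta> i - lam r s * x) \<le> L ^ (ep + 4) * \<delta>"
            "absval (pr s y i - pr s \<theta> i - lam r0 s * x) \<le> L ^ (ep + 4) * \<delta>"
          using line[of r] line[of r0] r r0 i by (auto simp: near_def)
        then have "absval ((pr s y i - pr s \<theta> i - lam r0 s * x) - (pr s y i - pr s \<theta> i - lam r s * x))
            \<le> L ^ (ep + 4) * \<delta> + L ^ (ep + 4) * \<delta>"
          by (intro absval_triangle_diff_le)
        also have "(pr s y i - pr s \<theta> i - lam r0 s * x) - (pr s y i - pr s \<theta> i - lam r s * x) = (lam r s - lam r0 s) * x"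
          by (simp add: algebra_simps)
        finally have 1: "absval (lam r s - lam r0 s) * absval x \<le> 2 * (L ^ (ep + 4) * \<delta>)"
          by (simp add: absval_mult mult_ac)
        have "absval (r - r0) \<le> L ^ (2 * ep) * absval (lam r s - lam r0 s)"
          using h r r0 by (intro lam_diff[OF _ _ s]) auto
        then have "absval (r - r0) * \<rho> \<le> L ^ (2 * ep) * absval (lam r s - lam r0 s) * (4 * absval x)"
          using x \<rho>_pos by (intro mult_mono) auto
        also have "\<dots> = 4 * L ^ (2 * ep) * (absval (lam r s - lam r0 s) * absval x)" by simp
        also have "\<dots> \<le> 4 * L ^ (2 * ep) * (2 * (L ^ (ep + 4) * \<delta>))"
          using 1 by (intro mult_left_mono) auto
        also have "\<dots> = 8 * (L ^ (2 * ep + (ep + 4)) * \<delta>)" by (simp only: power_add mult_ac)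
        also have "\<dots> \<le> L ^ 2 * (L ^ (2 * ep + (ep + 4)) * \<delta>)"
        proof (intro mult_right_mono)
          show "8 \<le> L ^ 2" using power_mono[OF L_ge_6, of 2] by simp
        qed (use \<delta>_pos in auto)
        also have "\<dots> = L ^ (2 + (2 * ep + (ep + 4))) * \<delta>" by (simp only: power_add mult_ac)
        also have "2 + (2 * ep + (ep + 4)) = 3 * ep + 6" by simp
        finally show "absval (r - r0) \<le> \<sigma>"
          using \<rho>_pos by (simp only: \<sigma>_def pos_le_divide_eq)
      qed (rule \<delta>\<sigma>)
    next
      case True
      show ?thesis unfolding True using C1_ge_1 by simp
    qed
  qed (use finY[OF in_R(3)[OF s]] in auto)
  also have "C1 * (\<sigma> / \<delta>) powr D \<le> L ^ (1 + (3 * ep + 6) * N) * \<rho> powr (- D)"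
  proof -
    have "(\<sigma> / \<delta>) powr D = (L ^ (3 * ep + 6)) powr D * \<rho> powr (- D)"
      using \<delta>_pos by (simp add: \<sigma>_def powr_divide powr_minus_divide)
    also have "\<dots> \<le> L ^ ((3 * ep + 6) * N) * \<rho> powr (- D)"
      by (intro mult_right_mono Lpow_powr) simp
    finally have "C1 * (\<sigma> / \<delta>) powr D \<le> L * (L ^ ((3 * ep + 6) * N) * \<rho> powr (- D))"
      using C1_le C1_ge_1 by (intro mult_mono) auto
    then show ?thesis by (simp only: power_add power_one_right mult.assoc)
  qed
  finally have "real (card (Rs \<theta> b)) \<le> real (card ?Ys) * (L ^ (1 + (3 * ep + 6) * N) * \<rho> powr (- D))"
    by (simp add: mult_left_mono)
  moreover have "Delta \<le> L ^ e3 * real (card (Rs \<theta> b))" using Good_in[OF G] by blast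
  ultimately have 2: "Delta \<le> L ^ e3 * (real (card ?Ys) * (L ^ (1 + (3 * ep + 6) * N) * \<rho> powr (- D)))"
    by (meson Lpow_nonneg mult_left_mono order_trans)
  have "Qr = \<rho> powr D * Delta"
    using \<delta>_pos \<rho>_pos by (simp add: Qr_def Delta_def powr_divide powr_minus_divide)
  also have "\<dots> \<le> \<rho> powr D * (L ^ e3 * (real (card ?Ys) * (L ^ (1 + (3 * ep + 6) * N) * \<rho> powr (- D))))"
    using 2 by (intro mult_left_mono) auto
  also have "\<dots> = (\<rho> powr D * \<rho> powr (- D)) * (L ^ (e3 + (1 + (3 * ep + 6) * N)) * real (card ?Ys))"
    by (simp only: power_add mult_ac)
  also have "\<rho> powr D * \<rho> powr (- D) = 1" using \<rho>_pos by (simp flip: powr_add)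
  finally show ?thesis by simp
qed

text \<open>The common cell gives the direction. At the lowest scale \<open>j = 0\<close> the cell
  may vanish, but there \<open>Qr\<close> is bounded by a power of \<open>L\<close>, and any
  coordinate direction works with the single label of \<open>\<theta>\<close>.\<close>

lemma direction:
  "\<exists>i w \<Theta>2. i \<in> I \<and> w i = 1 \<and> (\<forall>k\<in>I. absval (w k) \<le> 1) \<and> \<Theta>2 \<subseteq> \<Theta> \<and>
    n ^ Suc d \<le> L ^ e7 * real (card \<Theta>2) \<and>
    (\<forall>\<theta>\<in>\<Theta>2. \<forall>\<theta>'\<in>\<Theta>2. pnear I (L ^ (2 * ep + 2) * \<rho>) \<theta> \<theta>') \<and>
    (\<forall>\<theta>\<in>\<Theta>2. \<forall>s\<in>S. Qr \<le> L ^ e9 *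
      real (card {y \<in> Y s. near (I - {i}) (L ^ (ep + 5) * \<delta>) (ell i w (pr s y)) (ell i w (pr s \<theta>))}))"
proof -
  obtain v \<Theta>2 where \<Theta>2: "\<Theta>2 \<subseteq> \<Theta>" "n ^ Suc d \<le> L ^ e7 * real (card \<Theta>2)"
    "\<And>\<theta>. \<theta> \<in> \<Theta>2 \<Longrightarrow> \<exists>b. (\<theta>, b) \<in> Good \<and> cell (\<kappa> t \<theta>) b = v"
    "\<forall>\<theta>\<in>\<Theta>2. \<forall>\<theta>'\<in>\<Theta>2. pnear I (L ^ (2 * ep + 2) * \<rho>) \<theta> \<theta>'"
    using common_cell by blast
  have "\<exists>i w. i \<in> I \<and> w i = 1 \<and> (\<forall>k\<in>I. absval (w k) \<le> 1) \<and>
    (\<forall>\<theta>\<in>\<Theta>2. \<forall>s\<in>S. Qr \<le> L ^ e9 *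
      real (card {y \<in> Y s. near (I - {i}) (L ^ (ep + 5) * \<delta>) (ell i w (pr s y)) (ell i w (pr s \<theta>))}))"
  proof (cases j)
    case 0
    obtain i where i: "i \<in> I" using I_nonempty by blast
    define w where "w = (\<lambda>k. if k = i then 1 else 0 :: 'a)"
    have Q: "Qr \<le> L ^ e9"
    proof -
      have "Qr = (L ^ 4) powr D" unfolding Qr_def \<rho>_def using 0 \<delta>_pos by simp
      also have "\<dots> \<le> L ^ (4 * N)" by (rule Lpow_powr)
      also have "\<dots> \<le> L ^ e9" by (rule Lpow_mono) simp
      finally show ?thesis .
    qed
    have "Qr \<le> L ^ e9 *
      real (card {y \<in> Y s. near (I - {i}) (L ^ (ep + 5) * \<delta>) (ell i w (pr s y)) (ell i w (pr s \<theta>))})"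
      if \<theta>: "\<theta> \<in> \<Theta>2" and s: "s \<in> S" for \<theta> s
    proof -
      let ?Ys = "{y \<in> Y s. near (I - {i}) (L ^ (ep + 5) * \<delta>) (ell i w (pr s y)) (ell i w (pr s \<theta>))}"
      have th: "\<theta> \<in> \<Theta>" using \<theta> \<Theta>2(1) by blast
      have "near (I - {i}) (2 * (L ^ 2 * \<delta>)) (ell i w (pr s (\<kappa> s \<theta>))) (ell i w (pr s \<theta>))"
        using \<kappa>_near[OF in_R(3)[OF s] th] near_sym i by (intro near_ell) (auto simp: w_def near_sym)
      moreover have "2 * (L ^ 2 * \<delta>) \<le> L ^ (ep + 5) * \<delta>"
      proof -
        have "2 * L ^ 2 * \<delta> \<le> L ^ Suc 2 * \<delta>" using \<delta>_pos by (intro Lpow_absorb6) auto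
        also have "\<dots> \<le> L ^ (ep + 5) * \<delta>" using \<delta>_pos by (intro mult_right_mono Lpow_mono) auto
        finally show ?thesis by simp
      qed
      ultimately have "\<kappa> s \<theta> \<in> ?Ys" using \<kappa>(1)[OF in_R(3)[OF s] th] near_mono by blast
      moreover have "finite ?Ys" using finY[OF in_R(3)[OF s]] by simp
      ultimately have "0 < card ?Ys" unfolding card_gt_0_iff by blast
      then have "1 \<le> card ?Ys" by linarith
      then have "L ^ e9 * 1 \<le> L ^ e9 * real (card ?Ys)" by (intro mult_left_mono) auto
      then show ?thesis using Q by linarith
    qed
    then show ?thesis using i by (intro exI[of _ i] exI[of _ w]) (auto simp: w_def)
  next
    case (Suc j0)
    have "0 < L ^ e7 * real (card \<Theta>2)" using \<Theta>2(2) n_pos by (meson less_le_trans zero_less_power)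
    then have "\<Theta>2 \<noteq> {}" by auto
    then obtain \<theta>0 b0 where G0: "(\<theta>0, b0) \<in> Good" "cell (\<kappa> t \<theta>0) b0 = v" using \<Theta>2(3) by blast
    have Yt: "\<kappa> t \<theta>0 \<in> Y t" "b0 \<in> Y t" "sc (\<kappa> t \<theta>0) b0 = Suc j0"
      using Good_in[OF G0(1)] \<kappa>(1) in_R(1) Suc by auto
    then have Th: "\<kappa> t \<theta>0 \<in> \<Theta>" "b0 \<in> \<Theta>" using Y_sub[OF in_R(1)] by auto
    have half: "2 ^ j0 * (L ^ 4 * \<delta>) = \<rho> / 2" unfolding \<rho>_def unfolding Suc by simp
    obtain k where k: "k \<in> I" "\<rho> / 2 < absval (dif t (\<kappa> t \<theta>0) b0 k)"
      using sc(3)[OF Th Yt(3)] unfolding half by (auto simp: near_def not_le)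
    have "absval (dif t (\<kappa> t \<theta>0) b0 k) \<le> L ^ 3"
      using dif_bounded[OF Th] k(1) by (simp add: near_def)
    then have "\<rho> \<le> 2 * L ^ 3" using k(2) by linarith
    also have "\<dots> \<le> L ^ 4" using Lpow_absorb6[of 2 1 3] by (simp add: eval_nat_numeral)
    finally have \<rho>4: "\<rho> \<le> L ^ 4" .
    have "absval (dif t (\<kappa> t \<theta>0) b0 k - v k) \<le> \<delta>"
      using cell(2)[OF Yt(1,2)] G0(2) k(1) by (simp add: near_def)
    then have "absval (dif t (\<kappa> t \<theta>0) b0 k) \<le> \<delta> + absval (v k)"
      using absval_triangle[of "dif t (\<kappa> t \<theta>0) b0 k - v k" "v k"] by simp
    moreover have "4 * \<delta> \<le> \<rho>"
    proof -
      have "4 \<le> L ^ 4" using Lpow_absorb6[of 4 1 3] Lpow_ge_1[of 3] by (simp add: eval_nat_numeral)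
      then have "4 * \<delta> \<le> L ^ 4 * \<delta>" using \<delta>_pos by (intro mult_right_mono) auto
      then show ?thesis using \<rho>_ge(1) by linarith
    qed
    ultimately have vk: "\<rho> \<le> 4 * absval (v k)" using k(2) by linarith
    \<comment> \<open>Minimality of the scale makes the difference longer than
      \<open>\<rho> / 2\<close>, and rounding to its cell moves it by at most
      \<open>\<delta>\<close>. Dividing by the largest entry of the cell gives
      \<open>w i = 1\<close> and all entries at most 1.\<close>
    have "Max ((\<lambda>k. absval (v k)) ` I) \<in> (\<lambda>k. absval (v k)) ` I"
      using I_nonempty by (intro Max_in) auto
    then obtain i where i: "i \<in> I" "absval (v i) = Max ((\<lambda>k. absval (v k)) ` I)" by auto
    have max: "absval (v l) \<le> absval (v i)" if "l \<in> I" for l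
      unfolding i(2) using that by (intro Max_ge) auto
    have vi: "\<rho> \<le> 4 * absval (v i)" using vk max[OF k(1)] by linarith
    then have vi0: "v i \<noteq> 0" using \<rho>_pos by auto
    define w where "w = (\<lambda>k. v k / v i)"
    have w: "w i = 1" "\<And>l. l \<in> I \<Longrightarrow> absval (w l) \<le> 1"
      using vi0 max by (auto simp: w_def absval_divide)
    have "Qr \<le> L ^ e9 *
      real (card {y \<in> Y s. near (I - {i}) (L ^ (ep + 5) * \<delta>) (ell i w (pr s y)) (ell i w (pr s \<theta>))})"
      if \<theta>: "\<theta> \<in> \<Theta>2" and s: "s \<in> S" for \<theta> s
    proof -
      obtain b where b: "(\<theta>, b) \<in> Good" "cell (\<kappa> t \<theta>) b = v" using \<Theta>2(3)[OF \<theta>] by blast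
      have "Qr \<le> L ^ (e3 + (1 + (3 * ep + 6) * N)) *
        real (card {y \<in> Y s. near (I - {i}) (L ^ (ep + 5) * \<delta>) (ell i w (pr s y)) (ell i w (pr s \<theta>))})"
      proof (rule rich_lines[where x = "v i", OF b(1) s i(1)])
        show "cell (\<kappa> t \<theta>) b k = v i * w k" for k
          using b(2) vi0 by (simp add: w_def)
      qed (use w vi \<rho>4 in auto)
      then show ?thesis by (rule Lpow_absorb) auto
    qed
    then show ?thesis using i(1) w by blast
  qed
  then show ?thesis using \<Theta>2 by blast
qed

end

section \<open>Passing to the quotient by the long direction\<close>

text \<open>\<open>\<Xi>\<close> is a \<open>\<delta>\<close>-net of the quotient of
  \<open>\<Theta>2\<close> with rounding map \<open>q\<close>. By \<open>lines\<close>, each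
  projection at \<open>S\<close> of a point of \<open>\<Theta>2\<close> lies near a line filled with
  labels.\<close>

locale directed = scaled +
  fixes i :: nat and w :: "nat \<Rightarrow> 'a" and \<Theta>2 :: "'a point set" and \<Xi> :: "'a point set" and q :: "'a point \<Rightarrow> 'a point"
  assumes i: "i \<in> I" and w: "w i = 1" "\<And>k. k \<in> I \<Longrightarrow> absval (w k) \<le> 1"
    and \<Theta>2: "\<Theta>2 \<subseteq> \<Theta>" "n ^ Suc d \<le> L ^ e7 * real (card \<Theta>2)"
      "\<And>\<theta> \<theta>'. \<theta> \<in> \<Theta>2 \<Longrightarrow> \<theta>' \<in> \<Theta>2 \<Longrightarrow> pnear I (L ^ (2 * ep + 2) * \<rho>) \<theta> \<theta>'"
    and lines: "\<And>\<theta> s. \<theta> \<in> \<Theta>2 \<Longrightarrow> s \<in> S \<Longrightarrow> Qr \<le> L ^ e9 *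
      real (card {y \<in> Y s. near (I - {i}) (L ^ (ep + 5) * \<delta>) (ell i w (pr s y)) (ell i w (pr s \<theta>))})"
    and \<Xi>_sub: "\<Xi> \<subseteq> (\<lambda>\<theta> p. ell i w (\<theta> p)) ` \<Theta>2"
    and \<Xi>_sep: "\<And>x y. x \<in> \<Xi> \<Longrightarrow> y \<in> \<Xi> \<Longrightarrow> pnear (I - {i}) \<delta> x y \<Longrightarrow> x = y"
    and q: "\<And>\<theta>. \<theta> \<in> \<Theta>2 \<Longrightarrow> q \<theta> \<in> \<Xi>"
      "\<And>\<theta>. \<theta> \<in> \<Theta>2 \<Longrightarrow> pnear (I - {i}) \<delta> (\<lambda>p. ell i w (\<theta> p)) (q \<theta>)"

lemma (in scaled) directed_exists:
  "\<exists>i w \<Theta>2 \<Xi> q. directed D C1 N e1 d c I \<delta> L R \<Theta> n Z t S R' Y \<kappa> W cell j i w \<Theta>2 \<Xi> q"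
proof -
  obtain i w \<Theta>2 where *: "i \<in> I" "w i = 1" "\<forall>k\<in>I. absval (w k) \<le> 1" "\<Theta>2 \<subseteq> \<Theta>"
    "n ^ Suc d \<le> L ^ e7 * real (card \<Theta>2)"
    "\<forall>\<theta>\<in>\<Theta>2. \<forall>\<theta>'\<in>\<Theta>2. pnear I (L ^ (2 * ep + 2) * \<rho>) \<theta> \<theta>'"
    "\<forall>\<theta>\<in>\<Theta>2. \<forall>s\<in>S. Qr \<le> L ^ e9 *
      real (card {y \<in> Y s. near (I - {i}) (L ^ (ep + 5) * \<delta>) (ell i w (pr s y)) (ell i w (pr s \<theta>))})"
    using direction by blast
  let ?V = "(\<lambda>\<theta> p. ell i w (\<theta> p)) ` \<Theta>2"
  obtain \<Xi> where \<Xi>: "\<Xi> \<subseteq> ?V" "finite \<Xi>" "\<And>x y. x \<in> \<Xi> \<Longrightarrow> y \<in> \<Xi> \<Longrightarrow> x \<noteq> y \<Longrightarrow> \<not> pnear (I - {i}) \<delta> x y"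
      "\<And>x. x \<in> ?V \<Longrightarrow> \<exists>y\<in>\<Xi>. pnear (I - {i}) \<delta> x y"
  proof (rule maximal_separated_finite[of ?V "pnear (I - {i}) \<delta>"])
    show "finite ?V" using *(4) finite_subset fin(3) by blast
    show "pnear (I - {i}) \<delta> x x" for x using \<delta>_pos by (simp add: pnear_refl)
    show "pnear (I - {i}) \<delta> y x" if "pnear (I - {i}) \<delta> x y" for x y using that pnear_sym by blast
    fix E assume "E \<subseteq> ?V" "finite E" "\<And>x y. x \<in> E \<Longrightarrow> y \<in> E \<Longrightarrow> x \<noteq> y \<Longrightarrow> \<not> pnear (I - {i}) \<delta> x y"
      "\<And>x. x \<in> ?V \<Longrightarrow> \<exists>y\<in>E. pnear (I - {i}) \<delta> x y"
    then show thesis by (rule that)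
  qed
  have "\<forall>\<theta>\<in>\<Theta>2. \<exists>y. y \<in> \<Xi> \<and> pnear (I - {i}) \<delta> (\<lambda>p. ell i w (\<theta> p)) y" using \<Xi>(4) by blast
  from bchoice[OF this] obtain q where q: "\<forall>\<theta>\<in>\<Theta>2. q \<theta> \<in> \<Xi> \<and> pnear (I - {i}) \<delta> (\<lambda>p. ell i w (\<theta> p)) (q \<theta>)"
    by blast
  have "directed D C1 N e1 d c I \<delta> L R \<Theta> n Z t S R' Y \<kappa> W cell j i w \<Theta>2 \<Xi> q"
    by unfold_locales (use * \<Xi> q in blast)+
  then show ?thesis by blast
qed

section \<open>Sizes of the quotient set and of its fibres\<close>

context directed
begin

lemma fin2 [simp]: "finite \<Theta>2" "finite \<Xi>"
proof -
  show 1: "finite \<Theta>2" using \<Theta>2(1) fin(3) by (rule finite_subset)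
  show "finite \<Xi>" using \<Xi>_sub 1 by (meson finite_imageI finite_subset)
qed

text \<open>The size parameter of the quotient: each projection loses a filled segment.\<close>

definition \<nu> :: real where
  "\<nu> = n / Qr"

lemma Qr_pos: "0 < Qr"
  using Qr_ge_1 by linarith

lemma \<nu>: "0 < \<nu>" "\<nu> ^ k * Qr ^ k = n ^ k"
  using Qr_pos n_pos by (auto simp: \<nu>_def power_divide)

lemma card_le_1_of_eq: "finite X \<Longrightarrow> (\<And>x y. x \<in> X \<Longrightarrow> y \<in> X \<Longrightarrow> x = y) \<Longrightarrow> real (card X) \<le> 1"
  by (metis One_nat_def card_le_Suc0_iff_eq of_nat_1 of_nat_mono)

text \<open>Quotient points with separated projections own disjoint sets of at least
  \<open>Qr / L ^ e9\<close> labels among the at most \<open>L * n\<close> labels at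
  \<open>s\<close>.\<close>

lemma \<Xi>_labels:
  assumes s: "s \<in> S"
  shows "\<exists>Zs lab. finite Zs \<and> real (card Zs) \<le> L ^ Suc e9 * \<nu> \<and>
    (\<forall>\<xi>\<in>\<Xi>. lab \<xi> \<in> Zs \<and> near (I - {i}) (2 * (L ^ (ep + 5) * \<delta>)) (pr s \<xi>) (pr s (lab \<xi>)))"
proof -
  let ?E = "L ^ (ep + 5) * \<delta>"
  let ?R = "\<lambda>x y. near (I - {i}) (2 * ?E) (pr s x) (pr s y)"
  have E: "0 \<le> 2 * ?E" using less_imp_le[OF \<delta>_pos] by (intro mult_nonneg_nonneg Lpow_nonneg) auto
  obtain Zs where Zs: "Zs \<subseteq> \<Xi>" "finite Zs" "\<And>x y. x \<in> Zs \<Longrightarrow> y \<in> Zs \<Longrightarrow> x \<noteq> y \<Longrightarrow> \<not> ?R x y"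
      "\<And>x. x \<in> \<Xi> \<Longrightarrow> \<exists>y\<in>Zs. ?R x y"
  proof (rule maximal_separated_finite[of \<Xi> ?R])
    show "?R x x" for x using E by (rule near_refl)
    show "?R y x" if "?R x y" for x y using that near_sym by blast
    fix E assume "E \<subseteq> \<Xi>" "finite E" "\<And>x y. x \<in> E \<Longrightarrow> y \<in> E \<Longrightarrow> x \<noteq> y \<Longrightarrow> \<not> ?R x y"
      "\<And>x. x \<in> \<Xi> \<Longrightarrow> \<exists>y\<in>E. ?R x y"
    then show thesis by (rule that)
  qed simp
  have "real (card Zs) * (Qr / L ^ e9) \<le> real (card (Y s)) * 1"
  proof (rule double_count[where P = "\<lambda>z y. near (I - {i}) ?E (ell i w (pr s y)) (pr s z)"])
    fix z assume "z \<in> Zs"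
    then obtain \<theta> where "\<theta> \<in> \<Theta>2" "z = (\<lambda>p. ell i w (\<theta> p))" using Zs(1) \<Xi>_sub by blast
    then show "Qr / L ^ e9 \<le> real (card {y \<in> Y s. near (I - {i}) ?E (ell i w (pr s y)) (pr s z)})"
      using lines[OF _ s] unfolding divide_Lpow_le_iff by (simp only: pr_ell)
  next
    fix y assume "y \<in> Y s"
    show "real (card {z \<in> Zs. near (I - {i}) ?E (ell i w (pr s y)) (pr s z)}) \<le> 1"
    proof (rule card_le_1_of_eq)
      fix z z' assume z: "z \<in> {z \<in> Zs. near (I - {i}) ?E (ell i w (pr s y)) (pr s z)}"
        "z' \<in> {z \<in> Zs. near (I - {i}) ?E (ell i w (pr s y)) (pr s z)}"
      have "near (I - {i}) ?E (pr s z) (ell i w (pr s y))" "near (I - {i}) ?E (ell i w (pr s y)) (pr s z')"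
        using z near_sym[of "I - {i}" ?E "pr s z" "ell i w (pr s y)"] by blast+
      from near_trans[OF this] have "?R z z'" by (simp only: mult_2)
      then show "z = z'" using Zs(3)[of z z'] z by blast
    qed (use Zs in simp)
  qed (use Zs finY in_R s in auto)
  also have "\<dots> \<le> L * n" using Y_card[OF in_R(3)[OF s]] by simp
  finally have bd: "real (card Zs) * (Qr / L ^ e9) \<le> L * n" .
  have gen: "x \<le> L * A * \<nu>" if "x * (Qr / A) \<le> L * n" "0 < A" for x A :: real
    using that Qr_pos by (simp add: \<nu>_def field_simps)
  have "real (card Zs) \<le> L ^ Suc e9 * \<nu>" using gen[OF bd Lpow_pos] by (simp only: power_Suc)
  moreover have "\<forall>\<xi>\<in>\<Xi>. \<exists>y. y \<in> Zs \<and> ?R \<xi> y" using Zs(4) by blast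
  from bchoice[OF this] obtain lab where "\<forall>\<xi>\<in>\<Xi>. lab \<xi> \<in> Zs \<and> ?R \<xi> (lab \<xi>)" by blast
  ultimately show ?thesis using Zs(2) by blast
qed

abbreviation ux :: nat where
  "ux \<equiv> ue (card (I - {i})) (ep + 6)"

lemma \<Xi>_card: "real (card \<Xi>) \<le> L ^ (Suc e9 * Suc d + ux) * \<nu> ^ Suc d"
proof -
  let ?E = "L ^ (ep + 5) * \<delta>"
  have "\<forall>s\<in>S. \<exists>C. finite (fst C) \<and> real (card (fst C)) \<le> L ^ Suc e9 * \<nu> \<and>
    (\<forall>\<xi>\<in>\<Xi>. snd C \<xi> \<in> fst C \<and> near (I - {i}) (2 * ?E) (pr s \<xi>) (pr s (snd C \<xi>)))"
    using \<Xi>_labels by fastforce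
  from bchoice[OF this] obtain C where C: "\<And>s. s \<in> S \<Longrightarrow> finite (fst (C s))"
      "\<And>s. s \<in> S \<Longrightarrow> real (card (fst (C s))) \<le> L ^ Suc e9 * \<nu>"
      "\<And>s \<xi>. s \<in> S \<Longrightarrow> \<xi> \<in> \<Xi> \<Longrightarrow> snd (C s) \<xi> \<in> fst (C s) \<and>
        near (I - {i}) (2 * ?E) (pr s \<xi>) (pr s (snd (C s) \<xi>))"
    by blast
  let ?P = "PiE S (\<lambda>s. fst (C s))"
  let ?f = "\<lambda>\<xi>. restrict (\<lambda>s. snd (C s) \<xi>) S"
  have "real (card \<Xi>) \<le> real (card ?P) * L ^ ux"
  proof (rule card_le_fibre_bound[where f = ?f])
    show "finite ?P" using C(1) by (intro finite_PiE) auto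
    show "?f ` \<Xi> \<subseteq> ?P" using C(3) by auto
    fix y
    show "real (card {x \<in> \<Xi>. ?f x = y}) \<le> L ^ ux"
    proof (rule card_nodes_bound_gen[OF nodes_S])
      fix x x' s assume x: "x \<in> {x \<in> \<Xi>. ?f x = y}" "x' \<in> {x \<in> \<Xi>. ?f x = y}" "s \<in> S"
      then have eq: "snd (C s) x = snd (C s) x'"
        using restrict_eqD[of "\<lambda>s. snd (C s) x" S "\<lambda>s. snd (C s) x'" s] by simp
      have "near (I - {i}) (2 * ?E) (pr s x) (pr s (snd (C s) x))"
        "near (I - {i}) (2 * ?E) (pr s (snd (C s) x)) (pr s x')"
        using C(3)[OF x(3), of x] C(3)[OF x(3), of x'] x eq near_sym[of "I - {i}" "2 * ?E" "pr s x'"] by auto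
      from near_trans[OF this] show "near (I - {i}) (L ^ (ep + 6) * \<delta>) (pr s x) (pr s x')"
      proof (rule near_mono)
        have "4 * L ^ (ep + 5) * \<delta> \<le> L ^ Suc (ep + 5) * \<delta>" using \<delta>_pos by (intro Lpow_absorb6) auto
        also have "Suc (ep + 5) = ep + 6" by simp
        finally show "2 * ?E + 2 * ?E \<le> L ^ (ep + 6) * \<delta>" by (simp add: mult_ac)
      qed
    qed (use \<Xi>_sep in auto)
  qed simp
  also have "real (card ?P) = (\<Prod>s\<in>S. real (card (fst (C s))))"
    by (simp add: card_PiE)
  also have "\<dots> \<le> (\<Prod>s\<in>S. L ^ Suc e9 * \<nu>)" using C(2) by (intro prod_mono) auto
  also have "\<dots> = L ^ (Suc e9 * Suc d) * \<nu> ^ Suc d"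
    using cards by (simp only: prod_constant power_mult power_mult_distrib)
  finally have "real (card \<Xi>) \<le> L ^ (Suc e9 * Suc d) * \<nu> ^ Suc d * L ^ ux"
    by (simp add: mult_right_mono)
  then show ?thesis by (simp only: power_add mult_ac)
qed

definition fib :: "'a point \<Rightarrow> 'a point set" where
  "fib \<xi> = {\<theta> \<in> \<Theta>2. q \<theta> = \<xi>}"

lemma fib_finite [simp]: "finite (fib \<xi>)"
  by (simp add: fib_def)

abbreviation ub :: nat where
  "ub \<equiv> pe (2 * ep + 6) * d + pe 5 * (Suc d * card (I - {i}))"

lemma C1_Qr: "C1 * (2 * (L ^ k * \<rho>) / \<delta>) powr D \<le> L ^ pe k * Qr"
proof -
  have "C1 * (2 * (L ^ k * \<rho>) / \<delta>) powr D = C1 * (2 * L ^ k) powr D * Qr"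
    unfolding Qr_def by (simp add: powr_mult[symmetric] mult.assoc)
  also have "\<dots> \<le> L ^ pe k * Qr" using C1_Lpow Qr_pos by (intro mult_right_mono) auto
  finally show ?thesis .
qed

text \<open>Replacing the entry \<open>\<theta> 0 i\<close> by the projection at \<open>r\<close> is
  an invertible change of coordinates since \<open>c 0\<close> is bounded below. The remaining
  entries are recovered from the quotient coordinates by adding multiples of
  \<open>w\<close>.\<close>

lemma separation_in_mixed_coordinates:
  assumes th: "\<theta> \<in> \<Theta>" "\<theta>' \<in> \<Theta>" and r: "r \<in> R"
    and e: "e * L ^ 4 \<le> \<delta>" "0 \<le> e"
    and a: "\<And>p k. p \<le> d \<Longrightarrow> k \<in> I - {i} \<Longrightarrow> absval (ell i w (\<theta> p) k - ell i w (\<theta>' p) k) \<le> e"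
    and b: "\<And>p. 1 \<le> p \<Longrightarrow> p \<le> d \<Longrightarrow> absval (\<theta> p i - \<theta>' p i) \<le> e"
    and c: "absval (pr r \<theta> i - pr r \<theta>' i) \<le> e"
  shows "\<theta> = \<theta>'"
proof (rule sep[OF th])
  have rp: "absval (r ^ p) \<le> 1" for p using R_ball[OF r] by (simp add: absval_power power_le_one)
  have pr0: "pr r \<theta> i - pr r \<theta>' i = c 0 * (\<theta> 0 i - \<theta>' 0 i) + (\<Sum>p\<in>{1..d}. c p * r ^ p * (\<theta> p i - \<theta>' p i))"
  proof -
    have "pr r \<theta> i - pr r \<theta>' i = (\<Sum>p\<le>d. c p * r ^ p * (\<theta> p i - \<theta>' p i))"
      by (simp add: pr_def right_diff_distrib sum_subtractf)
    also have "{..d} = insert 0 {1..d}" by auto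
    finally show ?thesis by simp
  qed
  have "absval (\<Sum>p\<in>{1..d}. c p * r ^ p * (\<theta> p i - \<theta>' p i)) \<le> real (card {1..d}) * (C1 * e)"
  proof (rule absval_sum_bound)
    fix p assume p: "p \<in> {1..d}"
    have "absval (c p) * absval (r ^ p) * absval (\<theta> p i - \<theta>' p i) \<le> C1 * 1 * e"
      using p c_upper[of p] b[of p] rp C1_ge_1 e by (intro mult_mono) auto
    then show "absval (c p * r ^ p * (\<theta> p i - \<theta>' p i)) \<le> C1 * e" by (simp add: absval_mult)
  qed
  then have "absval (c 0 * (\<theta> 0 i - \<theta>' 0 i)) \<le> e + real d * (C1 * e)"
    using absval_triangle_diff_le[OF c, of "\<Sum>p\<in>{1..d}. c p * r ^ p * (\<theta> p i - \<theta>' p i)" "real d * (C1 * e)"]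
    unfolding pr0 by simp
  then have c0: "absval (c 0) * absval (\<theta> 0 i - \<theta>' 0 i) \<le> e + real d * (C1 * e)" by (simp add: absval_mult)
  have "absval (\<theta> 0 i - \<theta>' 0 i) \<le> C1 * absval (c 0) * absval (\<theta> 0 i - \<theta>' 0 i)"
    using c_lower[of 0] mult_right_mono[of 1 "C1 * absval (c 0)" "absval (\<theta> 0 i - \<theta>' 0 i)"] by simp
  also have "\<dots> \<le> C1 * (e + real d * (C1 * e))"
    using c0 C1_ge_1 by (simp add: mult.assoc)
  also have "\<dots> \<le> L * (L * (L * e))"
  proof (intro mult_mono)
    have "e \<le> C1 * e" using C1_ge_1 e by (simp add: mult_le_cancel_right1)
    then have "e + real d * (C1 * e) \<le> real (Suc d) * (C1 * e)" by (simp add: algebra_simps)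
    also have "\<dots> \<le> L * (L * e)" using d_le C1_le C1_ge_1 e L_pos by (intro mult_mono) auto
    finally show "e + real d * (C1 * e) \<le> L * (L * e)" .
  qed (use C1_le C1_ge_1 e L_pos in auto)
  also have "\<dots> = L ^ 3 * e" by (simp add: eval_nat_numeral)
  finally have z: "absval (\<theta> 0 i - \<theta>' 0 i) \<le> L ^ 3 * e" .
  have eL: "e \<le> L ^ 3 * e" using Lpow_ge_1[of 3] e by (simp add: mult_le_cancel_right1)
  have all: "absval (\<theta> p i - \<theta>' p i) \<le> L ^ 3 * e" if "p \<le> d" for p
    using z b[of p] eL that by (cases "p = 0") (auto intro: order_trans)
  have L4: "L ^ 3 * e + L ^ 3 * e \<le> \<delta>"
    using Lpow_absorb6[of 2 e 3] e by (simp add: eval_nat_numeral mult_ac)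
  show "pnear I \<delta> \<theta> \<theta>'"
    unfolding pnear_def near_def
  proof (intro allI impI ballI)
    fix p k assume p: "p \<le> d" and k: "k \<in> I"
    have "\<theta> p k - \<theta>' p k = (ell i w (\<theta> p) k - ell i w (\<theta>' p) k) + (\<theta> p i - \<theta>' p i) * w k"
      by (simp add: ell_def algebra_simps)
    moreover have "absval ((\<theta> p i - \<theta>' p i) * w k) \<le> L ^ 3 * e * 1"
      unfolding absval_mult using all[OF p] w(2)[OF k] by (intro mult_mono) (auto intro: order_trans[OF absval_nonneg])
    moreover have "absval (ell i w (\<theta> p) k - ell i w (\<theta>' p) k) \<le> L ^ 3 * e"
    proof (cases "k = i")
      case True
      then show ?thesis using w(1) mult_nonneg_nonneg[OF Lpow_nonneg e(2)] by (simp add: ell_def)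
    next
      case False
      then show ?thesis using a[OF p, of k] k eL by auto
    qed
    ultimately have "absval (\<theta> p k - \<theta>' p k) \<le> L ^ 3 * e + L ^ 3 * e * 1"
      by (simp only:) (intro absval_triangle_le)
    then show "absval (\<theta> p k - \<theta>' p k) \<le> \<delta>" using L4 by simp
  qed
qed

text \<open>On a fibre the quotient coordinates vary by \<open>2 * \<delta>\<close> only, and the
  \<open>d\<close> entries \<open>\<theta> p i\<close> with positive \<open>p\<close> range over
  segments of length about \<open>\<rho>\<close>, which gives \<open>Qr ^ d\<close>. The projection
  at \<open>r\<close> replaces the last entry, so a small \<open>\<tau>\<close> saves a factor of
  about \<open>Qr\<close>.\<close>

lemma fib_packing:
  assumes X: "X \<subseteq> fib \<xi>" and r: "r \<in> R" and \<tau>: "\<delta> \<le> \<tau>"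
    and near: "\<And>\<theta> \<theta>'. \<theta> \<in> X \<Longrightarrow> \<theta>' \<in> X \<Longrightarrow> absval (pr r \<theta> i - pr r \<theta>' i) \<le> \<tau>"
  shows "real (card X) \<le> C1 * (2 * (L ^ 4 * \<tau>) / \<delta>) powr D * (L ^ ub * Qr ^ d)"
proof (cases "X = {}")
  case False
  then obtain \<theta>0 where \<theta>0: "\<theta>0 \<in> X" by blast
  let ?e = "\<delta> / L ^ 4"
  have e: "0 < ?e" "?e \<le> \<delta>" "?e * L ^ 4 \<le> \<delta>"
  proof -
    show "0 < ?e" using \<delta>_pos by (intro divide_pos_pos Lpow_pos)
    show "?e \<le> \<delta>" unfolding divide_Lpow_le_iff using Lpow_ge_1[of 4] \<delta>_pos by (simp add: mult_le_cancel_right1)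
    show "?e * L ^ 4 \<le> \<delta>" using L_pos by simp
  qed
  define co where "co = (\<lambda>\<theta> (j :: nat \<times> nat). if snd j \<noteq> i then ell i w (\<theta> (fst j)) (snd j)
    else if fst j = 0 then pr r \<theta> i else (\<theta> :: 'a point) (fst j) i)"
  define B where "B = L ^ (2 * ep + 2) * \<rho>"
  define rad where "rad = (\<lambda>j :: nat \<times> nat. if snd j \<noteq> i then 2 * \<delta> else if fst j = 0 then \<tau> else B)"
  define g where "g = (\<lambda>j. C1 * (2 * rad j / ?e) powr D)"
  have X2: "X \<subseteq> \<Theta>2" "\<And>\<theta>. \<theta> \<in> X \<Longrightarrow> q \<theta> = \<xi>" using X by (auto simp: fib_def)
  have "1 * \<rho> \<le> B" unfolding B_def using \<rho>_pos by (intro mult_right_mono Lpow_ge_1) auto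
  then have eB: "?e \<le> B" "?e \<le> 2 * \<delta>" "?e \<le> \<tau>" using e(1,2) \<rho>_ge(2) \<tau> by linarith+
  have "real (card X) \<le> (\<Prod>j\<in>{..d} \<times> I. C1 * (2 * rad j / ?e) powr D)"
  proof (rule packing_family[where co = co and ?x0.0 = "co \<theta>0"])
    show "finite X" using X2(1) fin2(1) by (rule finite_subset)
    show "?e \<le> rad j" for j unfolding rad_def using eB by simp
    fix \<theta> j assume \<theta>: "\<theta> \<in> X" and j: "j \<in> {..d} \<times> I"
    obtain p k where pk: "j = (p, k)" "p \<le> d" "k \<in> I" using j by auto
    show "absval (co \<theta> j - co \<theta>0 j) \<le> rad j"
    proof (cases "k = i")
      case True
      have "pnear I B \<theta> \<theta>0" unfolding B_def using \<Theta>2(3) X2(1) \<theta> \<theta>0 by blast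
      then show ?thesis using True pk near[OF \<theta> \<theta>0]
        by (auto simp: co_def rad_def pnear_def near_def)
    next
      case False
      have "pnear (I - {i}) \<delta> (\<lambda>p. ell i w (\<theta> p)) \<xi>" "pnear (I - {i}) \<delta> \<xi> (\<lambda>p. ell i w (\<theta>0 p))"
        using q(2) X2 \<theta> \<theta>0 pnear_sym by blast+
      from pnear_trans[OF this] show ?thesis
        using False pk by (simp add: co_def rad_def pnear_def near_def)
    qed
  next
    fix x y assume xy: "x \<in> X" "y \<in> X" "x \<noteq> y"
    show "\<exists>j\<in>{..d} \<times> I. ?e < absval (co x j - co y j)"
    proof (rule ccontr)
      assume "\<not> ?thesis"
      then have all: "absval (co x (p, k) - co y (p, k)) \<le> ?e" if "p \<le> d" "k \<in> I" for p k
        using that by (force simp: not_less)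
      have "x = y"
      proof (rule separation_in_mixed_coordinates[OF _ _ r e(3)])
        show "x \<in> \<Theta>" "y \<in> \<Theta>" using xy X2 \<Theta>2(1) by auto
        show "absval (ell i w (x p) k - ell i w (y p) k) \<le> ?e" if "p \<le> d" "k \<in> I - {i}" for p k
          using all[of p k] that by (simp add: co_def)
        show "absval (x p i - y p i) \<le> ?e" if "1 \<le> p" "p \<le> d" for p
          using all[of p i] that i by (simp add: co_def)
        show "absval (pr r x i - pr r y i) \<le> ?e"
          using all[of 0 i] i by (simp add: co_def)
      qed (use e in auto)
      then show False using xy by blast
    qed
  qed (use e in auto)
  also have "\<dots> = (\<Prod>p\<le>d. \<Prod>k\<in>I. g (p, k))"
    unfolding g_def[symmetric] by (simp add: prod.cartesian_product)
  also have "\<dots> = (\<Prod>p\<le>d. g (p, i) * (\<Prod>k\<in>I - {i}. g (p, k)))"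
    using i by (intro prod.cong refl prod.remove) auto
  also have "\<dots> \<le> (\<Prod>p\<le>d. g (p, i) * (L ^ pe 5) ^ card (I - {i}))"
  proof (intro prod_mono conjI mult_left_mono)
    fix p
    have "g (p, k) \<le> L ^ pe 5" if "k \<in> I - {i}" for k
    proof -
      have "g (p, k) = C1 * (4 * L ^ 4) powr D" using that \<delta>_pos by (simp add: g_def rad_def)
      also have "\<dots> \<le> C1 * (2 * L ^ 5) powr D"
      proof (intro mult_left_mono powr_mono2)
        have "2 * L ^ 4 * 1 \<le> L ^ Suc 4 * 1" by (rule Lpow_absorb6) auto
        then show "4 * L ^ 4 \<le> 2 * L ^ 5" by (simp add: eval_nat_numeral)
      qed (use D_pos C1_ge_1 in auto)
      also have "\<dots> \<le> L ^ pe 5" by (rule C1_Lpow)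
      finally show ?thesis .
    qed
    then show "(\<Prod>k\<in>I - {i}. g (p, k)) \<le> (L ^ pe 5) ^ card (I - {i})"
      using C1_ge_1 by (intro order_trans[OF prod_mono[of "I - {i}" "\<lambda>k. g (p, k)" "\<lambda>_. L ^ pe 5"]]) (auto simp: g_def)
  qed (use C1_ge_1 in \<open>auto simp: g_def intro!: prod_nonneg mult_nonneg_nonneg\<close>)
  also have "\<dots> = (\<Prod>p\<le>d. g (p, i)) * (L ^ pe 5) ^ (Suc d * card (I - {i}))"
    by (simp only: prod.distrib prod_constant card_atMost power_mult[symmetric] mult_ac)
  also have "(\<Prod>p\<le>d. g (p, i)) = g (0, i) * (\<Prod>p\<in>{1..d}. g (p, i))"
  proof -
    have "{..d} = insert 0 {1..d}" by auto
    then show ?thesis by simp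
  qed
  also have "(\<Prod>p\<in>{1..d}. g (p, i)) \<le> (\<Prod>p\<in>{1..d}. L ^ pe (2 * ep + 6) * Qr)"
  proof (intro prod_mono conjI)
    fix p assume "p \<in> {1..d}"
    have "2 * ep + 6 = (2 * ep + 2) + 4" by simp
    then have eq: "L ^ (2 * ep + 6) * \<rho> = B * L ^ 4"
      unfolding B_def by (simp only: power_add mult_ac)
    from \<open>p \<in> {1..d}\<close> have "g (p, i) = C1 * (2 * (L ^ (2 * ep + 6) * \<rho>) / \<delta>) powr D"
      unfolding eq by (simp add: g_def rad_def mult_ac)
    then show "g (p, i) \<le> L ^ pe (2 * ep + 6) * Qr" using C1_Qr by simp
  qed (use C1_ge_1 in \<open>auto simp: g_def\<close>)
  also have "(\<Prod>p\<in>{1..d}. L ^ pe (2 * ep + 6) * Qr) = L ^ (pe (2 * ep + 6) * d) * Qr ^ d"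
    by (simp add: power_mult power_mult_distrib)
  finally have "real (card X) \<le> g (0, i) * (L ^ (pe (2 * ep + 6) * d) * Qr ^ d) * (L ^ pe 5) ^ (Suc d * card (I - {i}))"
    using C1_ge_1 by (simp add: g_def mult_right_mono mult_left_mono)
  also have "\<dots> = g (0, i) * (L ^ ub * Qr ^ d)"
    unfolding power_mult[of L "pe 5" "Suc d * card (I - {i})", symmetric] power_add[of L "pe (2 * ep + 6) * d"]
    by (simp only: mult_ac)
  also have "g (0, i) = C1 * (2 * (L ^ 4 * \<tau>) / \<delta>) powr D"
    by (simp add: g_def rad_def mult_ac)
  finally show ?thesis .
qed (use C1_ge_1 Qr_pos in simp)

end

section \<open>Full fibres and the configuration on the quotient\<close>

context directed
begin

abbreviation uf :: nat where
  "uf \<equiv> pe (2 * ep + 8) + ub"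

abbreviation ug :: nat where
  "ug \<equiv> pe 7 + ub"

lemma fib_upper: "real (card (fib \<xi>)) \<le> L ^ uf * Qr ^ Suc d"
proof -
  let ?\<tau> = "L ^ 2 * (L ^ (2 * ep + 2) * \<rho>)"
  have pos: "0 \<le> L ^ (2 * ep + 2) * \<rho>" using less_imp_le[OF \<rho>_pos] by (intro mult_nonneg_nonneg Lpow_nonneg)
  have "real (card (fib \<xi>)) \<le> C1 * (2 * (L ^ 4 * ?\<tau>) / \<delta>) powr D * (L ^ ub * Qr ^ d)"
  proof (rule fib_packing[OF order_refl in_R(1)])
    have "1 * \<rho> \<le> L ^ (2 + (2 * ep + 2)) * \<rho>"
      using \<rho>_pos by (intro mult_right_mono Lpow_ge_1) auto
    also have "L ^ (2 + (2 * ep + 2)) * \<rho> = ?\<tau>" by (simp only: power_add mult.assoc)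
    finally show "\<delta> \<le> ?\<tau>" using \<rho>_ge(2) by linarith
    fix \<theta> \<theta>' assume "\<theta> \<in> fib \<xi>" "\<theta>' \<in> fib \<xi>"
    then have "pnear I (L ^ (2 * ep + 2) * \<rho>) \<theta> \<theta>'" using \<Theta>2(3) by (auto simp: fib_def)
    then show "absval (pr t \<theta> i - pr t \<theta>' i) \<le> ?\<tau>"
      using near_pr_loss[OF _ R_ball[OF in_R(1)] pos] i by (auto simp: near_def)
  qed
  also have "L ^ 4 * ?\<tau> = L ^ (2 * ep + 8) * \<rho>"
    by (simp add: power_add eval_nat_numeral mult_ac)
  also have "C1 * (2 * (L ^ (2 * ep + 8) * \<rho>) / \<delta>) powr D * (L ^ ub * Qr ^ d) \<le> (L ^ pe (2 * ep + 8) * Qr) * (L ^ ub * Qr ^ d)"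
    using C1_Qr Qr_pos by (intro mult_right_mono) auto
  also have "\<dots> = L ^ uf * Qr ^ Suc d" by (simp only: power_add power_Suc mult_ac)
  finally show ?thesis .
qed

abbreviation e10 :: nat where
  "e10 \<equiv> (Suc e9 * Suc d + ux) + (e7 + 1)"

text \<open>Points whose fibre has nearly the maximal size allowed by \<open>fib_upper\<close>. A
  full fibre still projects to many labels at an arbitrary parameter.\<close>

definition \<Xi>f :: "'a point set" where
  "\<Xi>f = {\<xi> \<in> \<Xi>. Qr ^ Suc d / L ^ e10 \<le> real (card (fib \<xi>))}"

lemma \<Xi>f_sub: "\<Xi>f \<subseteq> \<Xi>" and \<Xi>f_finite [simp]: "finite \<Xi>f"
  by (auto simp: \<Xi>f_def)

text \<open>\<open>\<Xi>_card\<close> bounds the number of fibres by about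
  \<open>\<nu> ^ (d + 1)\<close> and \<open>fib_upper\<close> their size by about
  \<open>Qr ^ (d + 1)\<close>. The product is about \<open>n ^ (d + 1)\<close>, which is also the
  size of \<open>\<Theta>2\<close>, so many fibres are full.\<close>

lemma \<Xi>f_card: "\<nu> ^ Suc d \<le> L ^ (e7 + uf + 1) * real (card \<Xi>f)"
proof -
  have sum: "card \<Theta>2 = (\<Sum>\<xi>\<in>\<Xi>. card (fib \<xi>))"
    unfolding fib_def by (rule card_eq_sum_fibres) (use q in auto)
  have Qp: "0 < Qr ^ Suc d" using Qr_pos by simp
  have "real (card \<Theta>2) / 2 \<le> real (card {\<xi> \<in> \<Xi>. Qr ^ Suc d / L ^ e10 \<le> real (card (fib \<xi>))}) * (L ^ uf * Qr ^ Suc d)"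
  proof (rule many_large_values)
    show "real (card \<Theta>2) \<le> (\<Sum>\<xi>\<in>\<Xi>. real (card (fib \<xi>)))" by (simp add: sum)
    have "real (card \<Xi>) * (Qr ^ Suc d / L ^ e10) \<le> (L ^ (Suc e9 * Suc d + ux) * \<nu> ^ Suc d) * (Qr ^ Suc d / L ^ e10)"
      using \<Xi>_card Qp by (intro mult_right_mono divide_nonneg_nonneg) auto
    also have "\<dots> = n ^ Suc d / L ^ (e7 + 1)"
    proof -
      have gen: "(A * v) * (u / (A * B)) = v * u / B" if "0 < A" for A B u v :: real
        using that by simp
      show ?thesis
        unfolding power_add[of L "Suc e9 * Suc d + ux" "e7 + 1"] gen[OF Lpow_pos] \<nu>(2) ..
    qed
    also have "\<dots> \<le> real (card \<Theta>2) / 2"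
    proof -
      have gen: "v / (B * L) \<le> x / 2" if "v \<le> B * x" "0 < B" "0 \<le> x" for v B x :: real
      proof -
        have "2 * v \<le> 2 * (B * x)" using that by simp
        also have "\<dots> \<le> L * (B * x)" using that L_ge_6 by (intro mult_right_mono) auto
        finally show ?thesis using that L_pos by (simp add: field_simps)
      qed
      show ?thesis unfolding power_add power_one_right
        using gen[OF \<Theta>2(2)[unfolded power_add] ] Lpow_pos[of e7] unfolding power_add by simp
    qed
    finally show "real (card \<Xi>) * (Qr ^ Suc d / L ^ e10) \<le> real (card \<Theta>2) / 2" .
    show "0 < L ^ uf * Qr ^ Suc d" using Qp by (intro mult_pos_pos Lpow_pos)
    show "0 \<le> Qr ^ Suc d / L ^ e10" using Qp by (intro divide_nonneg_nonneg) auto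
  qed (use fib_upper in auto)
  then have 1: "real (card \<Theta>2) / 2 \<le> real (card \<Xi>f) * (L ^ uf * Qr ^ Suc d)" unfolding \<Xi>f_def .
  have gen: "v \<le> A * B * L * x" if "T / 2 \<le> x * (B * u)" "v * u \<le> A * T" "0 < A" "0 < B" "0 < u" "0 \<le> x"
    for v u A B T x :: real
  proof -
    have "A * T \<le> A * (2 * (x * (B * u)))" using that by (intro mult_left_mono) auto
    also have "\<dots> = 2 * (A * B * x * u)" by simp
    also have "\<dots> \<le> L * (A * B * x * u)" using that L_ge_6 by (intro mult_right_mono) auto
    finally have "v * u \<le> (A * B * L * x) * u" using that(2) by (simp add: mult_ac)
    then show ?thesis using that(5) by (rule mult_right_le_imp_le)
  qed
  have "\<nu> ^ Suc d \<le> L ^ e7 * L ^ uf * L * real (card \<Xi>f)"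
    by (rule gen[OF 1]) (use \<Theta>2(2) \<nu>(2)[of "Suc d"] Qp in \<open>auto simp only: Lpow_pos of_nat_0_le_iff\<close>)
  then show ?thesis by (simp only: power_add power_one_right)
qed

text \<open>Filled lines are known only at the parameters of \<open>S\<close>, while here
  \<open>r\<close> is any element of \<open>R\<close>. A full fibre has about
  \<open>Qr ^ (d + 1)\<close> points, of which at most about \<open>Qr ^ d\<close> share a label at
  \<open>r\<close> by \<open>fib_packing\<close>; so it meets about \<open>Qr\<close> labels, and
  quotient points with separated projections meet disjoint sets of labels.\<close>

lemma \<Xi>f_few:
  assumes r: "r \<in> R"
  shows "\<exists>Y'\<subseteq>\<Xi>f. real (card Y') \<le> L ^ (e10 + ug + 1) * \<nu> \<and>
    (\<forall>\<xi>\<in>\<Xi>f. \<exists>y\<in>Y'. near (I - {i}) (L ^ 4 * \<delta>) (pr r \<xi>) (pr r y))"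
proof -
  let ?R = "\<lambda>x y. near (I - {i}) (L ^ 4 * \<delta>) (pr r x) (pr r y)"
  let ?P = "\<lambda>\<xi> y. \<exists>\<theta>\<in>fib \<xi>. \<kappa> r \<theta> = y"
  have E: "0 \<le> L ^ 4 * \<delta>" using less_imp_le[OF \<delta>_pos] by (intro mult_nonneg_nonneg Lpow_nonneg)
  obtain Y' where Y': "Y' \<subseteq> \<Xi>f" "finite Y'" "\<And>x y. x \<in> Y' \<Longrightarrow> y \<in> Y' \<Longrightarrow> x \<noteq> y \<Longrightarrow> \<not> ?R x y"
      "\<And>x. x \<in> \<Xi>f \<Longrightarrow> \<exists>y\<in>Y'. ?R x y"
  proof (rule maximal_separated_finite[of \<Xi>f ?R])
    show "?R x x" for x using E by (rule near_refl)
    show "?R y x" if "?R x y" for x y using that near_sym by blast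
    fix E assume "E \<subseteq> \<Xi>f" "finite E" "\<And>x y. x \<in> E \<Longrightarrow> y \<in> E \<Longrightarrow> x \<noteq> y \<Longrightarrow> \<not> ?R x y"
      "\<And>x. x \<in> \<Xi>f \<Longrightarrow> \<exists>y\<in>E. ?R x y"
    then show thesis by (rule that)
  qed simp
  have fibT: "fib \<xi> \<subseteq> \<Theta>" for \<xi> using \<Theta>2(1) by (auto simp: fib_def)
  have "real (card Y') * (Qr / (L ^ e10 * L ^ ug)) \<le> real (card (Y r)) * 1"
  proof (rule double_count[where P = ?P])
    fix \<xi> assume \<xi>: "\<xi> \<in> Y'"
    have "real (card (fib \<xi>)) \<le> real (card (\<kappa> r ` fib \<xi>)) * (L ^ ug * Qr ^ d)"
    proof (rule card_le_fibre_bound[where f = "\<kappa> r"])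
      fix y
      let ?X = "{\<theta> \<in> fib \<xi>. \<kappa> r \<theta> = y}"
      have "real (card ?X) \<le> C1 * (2 * (L ^ 4 * (L ^ 3 * \<delta>)) / \<delta>) powr D * (L ^ ub * Qr ^ d)"
      proof (rule fib_packing[OF _ r])
        show "?X \<subseteq> fib \<xi>" by auto
        show "\<delta> \<le> L ^ 3 * \<delta>" using Lpow_ge_1[of 3] \<delta>_pos by (simp add: mult_le_cancel_right1)
        fix \<theta> \<theta>' assume "\<theta> \<in> ?X" "\<theta>' \<in> ?X"
        then have "near I (L ^ 3 * \<delta>) (pr r \<theta>) (pr r \<theta>')" using fibT by (intro same_\<kappa>[OF r]) auto
        then show "absval (pr r \<theta> i - pr r \<theta>' i) \<le> L ^ 3 * \<delta>" using i by (simp add: near_def)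
      qed
      also have "2 * (L ^ 4 * (L ^ 3 * \<delta>)) / \<delta> = 2 * L ^ 7"
        using \<delta>_pos by (simp add: eval_nat_numeral)
      also have "C1 * (2 * L ^ 7) powr D * (L ^ ub * Qr ^ d) \<le> L ^ pe 7 * (L ^ ub * Qr ^ d)"
        using Qr_pos by (intro mult_right_mono C1_Lpow mult_nonneg_nonneg Lpow_nonneg) auto
      finally show "real (card ?X) \<le> L ^ ug * Qr ^ d" by (simp only: power_add mult.assoc)
    qed auto
    moreover have "\<kappa> r ` fib \<xi> = {y \<in> Y r. ?P \<xi> y}" using \<kappa>(1)[OF r] fibT by auto
    moreover have "Qr ^ Suc d / L ^ e10 \<le> real (card (fib \<xi>))" using \<xi> Y'(1) by (auto simp only: \<Xi>f_def)
    ultimately have 1: "Qr ^ Suc d / L ^ e10 \<le> real (card {y \<in> Y r. ?P \<xi> y}) * (L ^ ug * Qr ^ d)"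
      by (simp only:)
    have gen: "Qr / (A * B) \<le> x" if "Qr ^ Suc d / A \<le> x * (B * Qr ^ d)" "0 < A" "0 < B" for A B x :: real
    proof -
      have "Qr ^ d * Qr \<le> Qr ^ d * (A * B * x)" using that by (simp add: pos_divide_le_eq mult_ac)
      then have "Qr \<le> A * B * x" using Qr_pos by simp
      then show ?thesis using that by (simp add: pos_divide_le_eq mult_ac)
    qed
    show "Qr / (L ^ e10 * L ^ ug) \<le> real (card {y \<in> Y r. ?P \<xi> y})"
      by (rule gen[OF 1 Lpow_pos Lpow_pos])
  next
    fix y assume y: "y \<in> Y r"
    have close: "near (I - {i}) (3 * (L ^ 2 * \<delta>)) (pr r \<xi>) (ell i w (pr r y))" if A: "?P \<xi> y" for \<xi>
    proof -
      from A obtain \<theta> where \<theta>: "\<theta> \<in> \<Theta>2" "q \<theta> = \<xi>" "\<kappa> r \<theta> = y" unfolding fib_def by blast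
      have "near (I - {i}) (L ^ 2 * \<delta>) (pr r (\<lambda>p. ell i w (\<theta> p))) (pr r \<xi>)"
        using q(2)[OF \<theta>(1)] \<theta>(2) \<delta>_pos R_ball[OF r] by (intro near_pr_loss) auto
      then have 1: "near (I - {i}) (L ^ 2 * \<delta>) (pr r \<xi>) (ell i w (pr r \<theta>))"
        unfolding pr_ell using near_sym by blast
      have "near I (L ^ 2 * \<delta>) (pr r \<theta>) (pr r y)" using \<kappa>_near[OF r] \<theta> \<Theta>2(1) by blast
      then have "near (I - {i}) (2 * (L ^ 2 * \<delta>)) (ell i w (pr r \<theta>)) (ell i w (pr r y))"
        by (rule near_ell[where w = w and i = i, OF _ i w])
      from near_trans[OF 1 this] show ?thesis by (simp add: mult_ac)
    qed
    show "real (card {\<xi> \<in> Y'. ?P \<xi> y}) \<le> 1"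
    proof (rule card_le_1_of_eq)
      fix x x' assume x: "x \<in> {\<xi> \<in> Y'. ?P \<xi> y}" "x' \<in> {\<xi> \<in> Y'. ?P \<xi> y}"
      have "near (I - {i}) (3 * (L ^ 2 * \<delta>)) (pr r x) (ell i w (pr r y))"
          "near (I - {i}) (3 * (L ^ 2 * \<delta>)) (ell i w (pr r y)) (pr r x')"
        using x close[of x] close[of x'] near_sym[of "I - {i}" "3 * (L ^ 2 * \<delta>)" "pr r x'"] by blast+
      from near_trans[OF this] have "?R x x'"
      proof (rule near_mono)
        have "6 * L ^ 2 * \<delta> \<le> L ^ Suc 2 * \<delta>" using \<delta>_pos by (intro Lpow_absorb6) auto
        also have "\<dots> \<le> L ^ 4 * \<delta>" using \<delta>_pos by (intro mult_right_mono Lpow_mono) auto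
        finally show "3 * (L ^ 2 * \<delta>) + 3 * (L ^ 2 * \<delta>) \<le> L ^ 4 * \<delta>" by (simp add: mult_ac)
      qed
      then show "x = x'" using Y'(3)[of x x'] x by blast
    qed (use Y'(2) in simp)
  qed (use Y' finY[OF r] in auto)
  also have "\<dots> \<le> L * n" using Y_card[OF r] by simp
  finally have bd: "real (card Y') * (Qr / (L ^ e10 * L ^ ug)) \<le> L * n" .
  have gen: "x \<le> A * B * L * \<nu>" if "x * (Qr / (A * B)) \<le> L * n" "0 < A" "0 < B" for x A B :: real
    using that Qr_pos by (simp add: \<nu>_def field_simps)
  have "real (card Y') \<le> L ^ (e10 + ug + 1) * \<nu>"
    using gen[OF bd Lpow_pos Lpow_pos] by (simp only: power_add power_one_right)
  then show ?thesis by (intro exI[of _ Y'] conjI Y'(1) ballI Y'(4))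
qed

abbreviation eE :: nat where
  "eE \<equiv> (e7 + uf + 1) + (e10 + ug + 1) + 4"

text \<open>\<open>R\<close> and \<open>\<delta>\<close> stay the same; \<open>L\<close> is replaced
  by a power of itself, which absorbs all losses of the step.\<close>

lemma config_quotient: "config (I - {i}) \<delta> (L ^ eE) R \<Xi>f \<nu>"
proof -
  have L1: "L \<le> L ^ eE" using Lpow_mono[of 1 eE] by simp
  have ineq: "x \<le> L ^ eE * y" if "x \<le> L * y" "0 \<le> y" for x y
    using that mult_right_mono[OF L1 that(2)] by linarith
  have "1 / \<delta> \<le> 2 powr L" by (rule scales)
  also have "\<dots> \<le> 2 powr (L ^ eE)" using L1 by (intro powr_mono) auto
  finally have s: "1 / \<delta> \<le> 2 powr (L ^ eE)" .
  have d1: "\<delta> \<le> 1" using \<eta> by linarith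
  have diam': "pnear (I - {i}) (L ^ eE) x y" if xy: "x \<in> \<Xi>f" "y \<in> \<Xi>f" for x y
  proof -
    obtain \<theta> \<theta>' where th: "\<theta> \<in> \<Theta>2" "\<theta>' \<in> \<Theta>2" "x = (\<lambda>p. ell i w (\<theta> p))" "y = (\<lambda>p. ell i w (\<theta>' p))"
      using xy \<Xi>f_sub \<Xi>_sub by blast
    have "pnear I L \<theta> \<theta>'" using diam th \<Theta>2(1) by blast
    then have "near (I - {i}) (2 * L) (x p) (y p)" if "p \<le> d" for p
      unfolding th(3,4) using that near_ell[where w = w and i = i, OF _ i w] by (simp add: pnear_def)
    moreover have "2 * L \<le> L ^ eE"
    proof -
      have "2 * L ^ 1 * 1 \<le> L ^ Suc 1 * 1" by (rule Lpow_absorb6) auto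
      also have "\<dots> \<le> L ^ eE * 1" by (intro mult_right_mono Lpow_mono) auto
      finally show ?thesis by simp
    qed
    ultimately show ?thesis unfolding pnear_def using near_mono by blast
  qed
  have few': "\<exists>Y'\<subseteq>\<Xi>f. real (card Y') \<le> L ^ eE * \<nu> \<and>
    (\<forall>\<xi>\<in>\<Xi>f. \<exists>y\<in>Y'. near (I - {i}) (L ^ eE * \<delta>) (pr r \<xi>) (pr r y))" if r: "r \<in> R" for r
  proof -
    obtain Y' where Y': "Y' \<subseteq> \<Xi>f" "real (card Y') \<le> L ^ (e10 + ug + 1) * \<nu>"
      "\<forall>\<xi>\<in>\<Xi>f. \<exists>y\<in>Y'. near (I - {i}) (L ^ 4 * \<delta>) (pr r \<xi>) (pr r y)"
      using \<Xi>f_few[OF r] by blast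
    have "real (card Y') \<le> L ^ eE * \<nu>"
      by (rule Lpow_absorb[OF Y'(2)]) (use \<nu>(1) in auto)
    have L4: "L ^ 4 * \<delta> \<le> L ^ eE * \<delta>" using \<delta>_pos by (intro mult_right_mono Lpow_mono) auto
    have "\<exists>y\<in>Y'. near (I - {i}) (L ^ eE * \<delta>) (pr r \<xi>) (pr r y)" if "\<xi> \<in> \<Xi>f" for \<xi>
      using bspec[OF Y'(3) that] by (elim bexE) (rule bexI, rule near_mono[OF _ L4])
    with \<open>real (card Y') \<le> L ^ eE * \<nu>\<close> show ?thesis by (intro exI[of _ Y'] conjI Y'(1) ballI)
  qed
  have cd: "\<nu> ^ Suc d \<le> L ^ eE * real (card \<Xi>f)"
    by (rule Lpow_absorb[OF \<Xi>f_card]) auto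
  have Rc: "\<delta> powr (- D) \<le> L ^ eE * real (card R)"
    using R_card by (rule ineq) simp
  have c6: "C1 \<le> L ^ eE" "6 \<le> L ^ eE" "real (Suc d) \<le> L ^ eE"
    using L1 C1_le L_ge_6 d_le by linarith+
  show ?thesis
    unfolding config_def
  proof (intro conjI ballI impI)
    show "\<not> pnear (I - {i}) \<delta> x y" if "x \<in> \<Xi>f" "y \<in> \<Xi>f" "x \<noteq> y" for x y
      using that \<Xi>_sep \<Xi>f_sub by blast
    show "\<exists>Y\<subseteq>\<Xi>f. real (card Y) \<le> L ^ eE * \<nu> \<and> (\<forall>\<theta>\<in>\<Xi>f. \<exists>y\<in>Y. near (I - {i}) (L ^ eE * \<delta>) (pr r \<theta>) (pr r y))"
      if "r \<in> R" for r using that by (rule few')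
    show "finite (I - {i})" "finite \<Xi>f" "finite R" by simp_all
  qed (fact \<delta>_pos d1 c6 s \<nu>(1) cd Rc | (rule R_ball R_sep diam'; assumption))+
qed

end

section \<open>Boxes\<close>

text \<open>The second clause bounds the inverse change of basis. Over a non-archimedean field the
  constant is 1, so that arbitrary rescalings of the family are orthogonal; otherwise it depends
  only on the dimension, which is enough for a Gram-Schmidt process with uniform bounds.\<close>

definition quasi_orthonormal :: "nat set \<Rightarrow> (nat \<Rightarrow> nat \<Rightarrow> 'a::local_field_char_0) \<Rightarrow> bool" where
  "quasi_orthonormal I f \<longleftrightarrow> (\<forall>j\<in>I. \<forall>k\<in>I. absval (f j k) \<le> 1) \<and>
    (\<forall>y B. (\<forall>k\<in>I. absval (\<Sum>j\<in>I. y j * f j k) \<le> B) \<longrightarrow>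
      (\<forall>j\<in>I. absval (y j) \<le> (if nonarchimedean TYPE('a) then 1 else 2 ^ card I) * B)) \<and>
    (\<forall>x. \<exists>y. \<forall>k\<in>I. x k = (\<Sum>j\<in>I. y j * f j k))"

lemma quasi_orthonormal_standard:
  assumes "finite I"
  shows "quasi_orthonormal I (\<lambda>j k. if j = k then 1 else (0 :: 'a::local_field_char_0))"
proof -
  have eq: "(\<Sum>j\<in>I. y j * (if j = k then 1 else 0)) = y k" if "k \<in> I" for y :: "nat \<Rightarrow> 'a" and k
    using assms that by (simp add: if_distrib sum.delta cong: if_cong)
  have "x \<le> (if nonarchimedean TYPE('a) then 1 else 2 ^ card I) * B" if "x \<le> B" "0 \<le> x" for x B :: real
    using that mult_right_mono[of 1 "2 ^ card I" B] by auto
  then show ?thesis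
    unfolding quasi_orthonormal_def using eq by (auto intro!: exI[of _ x for x])
qed

text \<open>The new family is block triangular: \<open>w\<close> has \<open>i\<close>-th entry 1 and
  the old vectors have \<open>i\<close>-th entry 0. Removing the contribution of \<open>w\<close>
  costs a factor 2 in the archimedean case and nothing under the ultrametric inequality.\<close>

lemma quasi_orthonormal_extend:
  fixes w :: "nat \<Rightarrow> 'a::local_field_char_0"
  assumes fin: "finite I" and i: "i \<in> I" and w: "w i = 1" "\<And>k. k \<in> I \<Longrightarrow> absval (w k) \<le> 1"
    and f: "quasi_orthonormal (I - {i}) f"
  shows "quasi_orthonormal I (\<lambda>j k. if j = i then w k else if k = i then 0 else f j k)"
proof -
  let ?f = "\<lambda>j k. if j = i then w k else if k = i then 0 else f j k"
  let ?K = "if nonarchimedean TYPE('a) then 1 else 2 ^ card (I - {i}) :: real"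
  have f1: "\<And>j k. j \<in> I - {i} \<Longrightarrow> k \<in> I - {i} \<Longrightarrow> absval (f j k) \<le> 1"
    and f2: "\<And>y B j. (\<And>k. k \<in> I - {i} \<Longrightarrow> absval (\<Sum>j\<in>I - {i}. y j * f j k) \<le> B) \<Longrightarrow> j \<in> I - {i} \<Longrightarrow> absval (y j) \<le> ?K * B"
    and f3: "\<And>x. \<exists>y. \<forall>k\<in>I - {i}. x k = (\<Sum>j\<in>I - {i}. y j * f j k)"
    using f unfolding quasi_orthonormal_def by blast+
  have sum: "(\<Sum>j\<in>I. y j * ?f j k) = y i * w k + (if k = i then 0 else (\<Sum>j\<in>I - {i}. y j * f j k))" for y k
  proof -
    have "(\<Sum>j\<in>I - {i}. y j * ?f j k) = (\<Sum>j\<in>I - {i}. if k = i then 0 else y j * f j k)"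
      by (intro sum.cong) auto
    then show ?thesis using fin i by (simp add: sum.remove[of I i])
  qed
  have card: "card I = Suc (card (I - {i}))" using fin i by (rule card.remove)
  have bound: "absval (y j) \<le> (if nonarchimedean TYPE('a) then 1 else 2 ^ card I) * B"
    if B: "\<And>k. k \<in> I \<Longrightarrow> absval (\<Sum>j\<in>I. y j * ?f j k) \<le> B" and j: "j \<in> I" for y :: "nat \<Rightarrow> 'a" and B j
  proof -
    have yi: "absval (y i) \<le> B" using B[OF i] unfolding sum using w by simp
    then have B0: "0 \<le> B" using absval_nonneg[of "y i"] by linarith
    have yw: "absval (y i * w k) \<le> B" if "k \<in> I" for k
      using mult_mono[OF yi w(2)[OF that] B0] by (simp add: absval_mult)
    let ?c = "if nonarchimedean TYPE('a) then 1 else 2 :: real"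
    have "absval (\<Sum>j\<in>I - {i}. y j * f j k) \<le> ?c * B" if k: "k \<in> I - {i}" for k
    proof -
      have eq: "(\<Sum>j\<in>I - {i}. y j * f j k) = (\<Sum>j\<in>I. y j * ?f j k) + - (y i * w k)"
        unfolding sum using k by simp
      have b: "absval (\<Sum>j\<in>I. y j * ?f j k) \<le> B" "absval (- (y i * w k)) \<le> B"
        using B[of k] yw[of k] k by auto
      show ?thesis
      proof (cases "nonarchimedean TYPE('a)")
        case True
        then have "absval ((\<Sum>j\<in>I. y j * ?f j k) + - (y i * w k)) \<le> max (absval (\<Sum>j\<in>I. y j * ?f j k)) (absval (- (y i * w k)))"
          unfolding nonarchimedean_def by blast
        then show ?thesis unfolding eq using b True by auto
      next
        case False
        then show ?thesis unfolding eq using absval_triangle_le[OF b] by simp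
      qed
    qed
    from f2[OF this] have "absval (y j) \<le> ?K * (?c * B)" if "j \<noteq> i" using j that by blast
    moreover have "?K * (?c * B) = (if nonarchimedean TYPE('a) then 1 else 2 ^ card I) * B"
      by (simp add: card)
    moreover have "B \<le> (if nonarchimedean TYPE('a) then 1 else 2 ^ card I) * B"
      using B0 mult_right_mono[of 1 "2 ^ card I" B] by simp
    ultimately show ?thesis using yi by (cases "j = i") auto
  qed
  have span: "\<exists>y. \<forall>k\<in>I. x k = (\<Sum>j\<in>I. y j * ?f j k)" for x :: "nat \<Rightarrow> 'a"
  proof -
    obtain y where y: "\<forall>k\<in>I - {i}. x k - x i * w k = (\<Sum>j\<in>I - {i}. y j * f j k)"
      using f3[of "\<lambda>k. x k - x i * w k"] by blast
    have c: "(\<Sum>j\<in>I - {i}. (y(i := x i)) j * f j k) = (\<Sum>j\<in>I - {i}. y j * f j k)" for k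
      by (intro sum.cong) auto
    have "x k = (\<Sum>j\<in>I. (y(i := x i)) j * ?f j k)" if "k \<in> I" for k
      unfolding sum c using y that w(1) by (auto simp: algebra_simps)
    then show ?thesis by blast
  qed
  show ?thesis unfolding quasi_orthonormal_def using bound span f1 w(2) by (simp add: card del: card_Diff_insert)
qed

context moment_curve
begin

text \<open>The radius \<open>\<rho> j\<close> is the same for all weights \<open>p\<close>; this is
  what makes the box a representation box.\<close>

definition inbox :: "nat set \<Rightarrow> (nat \<Rightarrow> nat \<Rightarrow> 'a) \<Rightarrow> (nat \<Rightarrow> real) \<Rightarrow> 'a point \<Rightarrow> 'a point \<Rightarrow> bool" where
  "inbox I f \<rho> v \<theta> \<longleftrightarrow> (\<exists>y. (\<forall>p\<le>d. \<forall>j\<in>I. absval (y p j) \<le> \<rho> j) \<and>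
     (\<forall>p\<le>d. \<forall>k\<in>I. \<theta> p k = v p k + (\<Sum>j\<in>I. y p j * f j k)))"

text \<open>With all radii at least \<open>\<delta>\<close> the product is comparable to the
  covering number of the box. A lower bound for that number comes from the separated points
  inside.\<close>

definition box_concl :: "nat set \<Rightarrow> real \<Rightarrow> real \<Rightarrow> 'a point set \<Rightarrow> real \<Rightarrow> bool" where
  "box_concl I \<delta> M \<Theta> n \<longleftrightarrow> (\<exists>f \<rho> v. quasi_orthonormal I f \<and> (\<forall>j\<in>I. \<delta> \<le> \<rho> j) \<and>
     (\<Prod>j\<in>I. (\<rho> j / \<delta>) powr D) ^ Suc d \<le> M * n ^ Suc d \<and>
     n ^ Suc d \<le> M * real (card {\<theta>\<in>\<Theta>. inbox I f \<rho> v \<theta>}))"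

text \<open>The losses of one step as functions of the number of coordinates alone, so that the
  induction yields one exponent for all configurations of a given dimension. The first component is
  the exponent of the new \<open>L\<close>, the second the loss in lifting a box.\<close>

definition exponents :: "nat \<Rightarrow> nat \<times> nat" where
  "exponents m = (let u3 = ue m 3; gp = (Suc d + 2 * u3) + (d + 3); uw = m * pe (ep + (ep + 6));
    e2 = d + 7 + u3; e3 = d + 3 + u3 + e2; ew = e3 + gp + uw + 3; e4 = d + 4 + u3 + e2;
    e6 = e4 + (e3 + (u3 + 1)); e7 = (e2 + 3) + (Suc e6 * Suc d + ew);
    e9 = (e3 + (1 + (3 * ep + 6) * N)) + 4 * N; ux = ue (m - 1) (ep + 6);
    ub = pe (2 * ep + 6) * d + pe 5 * (Suc d * (m - 1)); uf = pe (2 * ep + 8) + ub; ug = pe 7 + ub;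
    e10 = (Suc e9 * Suc d + ux) + (e7 + 1); eP = ((2 * ep + 2) * N + m * N * (m - 1)) * Suc d
    in ((e7 + uf + 1) + (e10 + ug + 1) + 4, eP + e10))"

end

section \<open>Lifting a box from the quotient\<close>

context directed
begin

abbreviation eP :: nat where
  "eP \<equiv> ((2 * ep + 2) * N + card I * N * card (I - {i})) * Suc d"

lemma exponents_eq: "exponents (card I) = (eE, eP + e10)"
proof -
  have "card I - 1 = card (I - {i})" using i by simp
  then show ?thesis unfolding exponents_def Let_def by simp
qed

text \<open>The box gains one side, in direction \<open>w\<close> and of radius comparable to
  \<open>\<rho>\<close>, which also bounds the diameter of \<open>\<Theta>2\<close>. The volume and
  the number of points both gain about \<open>Qr ^ (d + 1)\<close>, the latter because fibres over
  \<open>\<Xi>f\<close> are full.\<close>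

lemma box_lift:
  assumes "box_concl (I - {i}) \<delta> M \<Xi>f \<nu>" and M: "1 \<le> M"
  shows "box_concl I \<delta> (L ^ (eP + e10) * M) \<Theta> n"
proof -
  let ?I = "I - {i}"
  obtain f \<rho>' v' where f: "quasi_orthonormal ?I f" and \<rho>': "\<And>j. j \<in> ?I \<Longrightarrow> \<delta> \<le> \<rho>' j"
    and prod: "(\<Prod>j\<in>?I. (\<rho>' j / \<delta>) powr D) ^ Suc d \<le> M * \<nu> ^ Suc d"
    and count: "\<nu> ^ Suc d \<le> M * real (card {\<theta>\<in>\<Xi>f. inbox ?I f \<rho>' v' \<theta>})"
    using assms(1) unfolding box_concl_def by blast
  define K :: real where "K = 2 ^ card ?I"
  have cardI: "card I = Suc (card ?I)" using fin(1) i by (rule card.remove)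
  have fK: "\<And>y B j. (\<And>k. k \<in> ?I \<Longrightarrow> absval (\<Sum>j\<in>?I. y j * f j k) \<le> B) \<Longrightarrow> j \<in> ?I \<Longrightarrow> 0 \<le> B \<Longrightarrow> absval (y j) \<le> K * B"
  proof -
    fix y B j assume *: "\<And>k. k \<in> ?I \<Longrightarrow> absval (\<Sum>j\<in>?I. y j * f j k) \<le> B" "j \<in> ?I" "0 \<le> (B :: real)"
    then have "absval (y j) \<le> (if nonarchimedean TYPE('a) then 1 else 2 ^ card ?I) * B"
      using f unfolding quasi_orthonormal_def by blast
    also have "\<dots> \<le> K * B" using *(3) by (intro mult_right_mono) (auto simp: K_def)
    finally show "absval (y j) \<le> K * B" .
  qed
  have fspan: "\<exists>y. \<forall>k\<in>?I. x k = (\<Sum>j\<in>?I. y j * f j k)" for x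
    using f unfolding quasi_orthonormal_def by blast
  have "0 < L ^ e7 * real (card \<Theta>2)" using \<Theta>2(2) n_pos by (meson less_le_trans zero_less_power)
  then obtain \<theta>0 where \<theta>0: "\<theta>0 \<in> \<Theta>2" by (metis card.empty ex_in_conv less_irrefl mult_zero_right of_nat_0)
  define F where "F = (\<lambda>j k. if j = i then w k else if k = i then 0 else f j k)"
  \<comment> \<open>The factor \<open>1 + K\<close> absorbs the rounding by \<open>q\<close>: the
    error \<open>\<delta>\<close> has coefficients at most \<open>K * \<delta>\<close> in the basis
    \<open>f\<close>, and \<open>\<delta> \<le> \<rho>' j\<close>.\<close>
  define rad where "rad = (\<lambda>j. if j = i then L ^ (2 * ep + 2) * \<rho> else (1 + K) * \<rho>' j)"
  define v where "v = (\<lambda>p k. if k = i then \<theta>0 p i else v' p k + \<theta>0 p i * w k)"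
  have Fsum: "(\<Sum>j\<in>I. y j * F j k) = y i * w k + (if k = i then 0 else (\<Sum>j\<in>?I. y j * f j k))" for y k
  proof -
    have "(\<Sum>j\<in>?I. y j * F j k) = (\<Sum>j\<in>?I. if k = i then 0 else y j * f j k)"
      by (intro sum.cong) (auto simp: F_def)
    then show ?thesis using i by (simp add: sum.remove[of I i] F_def)
  qed
  have inb: "inbox I F rad v \<theta>" if \<theta>: "\<theta> \<in> \<Theta>2" "inbox ?I f \<rho>' v' (q \<theta>)" for \<theta>
  proof -
    obtain y where y: "\<And>p j. p \<le> d \<Longrightarrow> j \<in> ?I \<Longrightarrow> absval (y p j) \<le> \<rho>' j"
      "\<And>p k. p \<le> d \<Longrightarrow> k \<in> ?I \<Longrightarrow> q \<theta> p k = v' p k + (\<Sum>j\<in>?I. y p j * f j k)"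
      using \<theta>(2) unfolding inbox_def by blast
    have "\<forall>p. \<exists>z. \<forall>k\<in>?I. ell i w (\<theta> p) k - q \<theta> p k = (\<Sum>j\<in>?I. z j * f j k)"
      using fspan[of "\<lambda>k. ell i w (\<theta> p) k - q \<theta> p k" for p] by blast
    then obtain z where z: "\<And>p k. k \<in> ?I \<Longrightarrow> ell i w (\<theta> p) k - q \<theta> p k = (\<Sum>j\<in>?I. z p j * f j k)"
      by metis
    have zb: "absval (z p j) \<le> K * \<delta>" if "p \<le> d" "j \<in> ?I" for p j
    proof (rule fK[OF _ that(2)])
      show "absval (\<Sum>j\<in>?I. z p j * f j k) \<le> \<delta>" if "k \<in> ?I" for k
        using q(2)[OF \<theta>(1)] \<open>p \<le> d\<close> that unfolding z[OF that, symmetric] by (simp add: pnear_def near_def)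
    qed (use \<delta>_pos in auto)
    define Yc where "Yc = (\<lambda>p j. if j = i then \<theta> p i - \<theta>0 p i else y p j + z p j)"
    have "absval (Yc p j) \<le> rad j" if p: "p \<le> d" and j: "j \<in> I" for p j
    proof (cases "j = i")
      case True
      then show ?thesis using \<Theta>2(3)[OF \<theta>(1) \<theta>0] p j by (simp add: Yc_def rad_def pnear_def near_def)
    next
      case False
      then have "absval (y p j + z p j) \<le> \<rho>' j + K * \<delta>"
        using j p by (intro absval_triangle_le y zb) auto
      also have "K * \<delta> \<le> K * \<rho>' j" using \<rho>'[of j] j False by (intro mult_left_mono) (auto simp: K_def)
      finally show ?thesis using False by (simp add: Yc_def rad_def algebra_simps)
    qed
    moreover have "\<theta> p k = v p k + (\<Sum>j\<in>I. Yc p j * F j k)" if p: "p \<le> d" and k: "k \<in> I" for p k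
    proof (cases "k = i")
      case True
      then show ?thesis unfolding Fsum by (simp add: v_def Yc_def w(1))
    next
      case False
      have "(\<Sum>j\<in>?I. Yc p j * f j k) = (\<Sum>j\<in>?I. y p j * f j k) + (\<Sum>j\<in>?I. z p j * f j k)"
        unfolding sum.distrib[symmetric] by (intro sum.cong) (auto simp: Yc_def algebra_simps)
      also have "\<dots> = ell i w (\<theta> p) k - v' p k"
      proof -
        have kI: "k \<in> ?I" using False k by simp
        show ?thesis unfolding z[OF kI, symmetric] y(2)[OF p kI] by (simp add: algebra_simps)
      qed
      finally show ?thesis unfolding Fsum using False by (simp add: v_def Yc_def ell_def algebra_simps)
    qed
    ultimately show ?thesis unfolding inbox_def by blast
  qed
  have "n ^ Suc d \<le> L ^ (eP + e10) * M * real (card {\<theta>\<in>\<Theta>. inbox I F rad v \<theta>})"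
  proof -
    let ?B = "{\<xi>\<in>\<Xi>f. inbox ?I f \<rho>' v' \<xi>}" and ?X = "{\<theta>\<in>\<Theta>2. q \<theta> \<in> {\<xi>\<in>\<Xi>f. inbox ?I f \<rho>' v' \<xi>}}"
    have "card ?X = (\<Sum>\<xi>\<in>?B. card {\<theta>\<in>?X. q \<theta> = \<xi>})"
      by (rule card_eq_sum_fibres) auto
    also have "\<dots> = (\<Sum>\<xi>\<in>?B. card (fib \<xi>))"
      by (intro sum.cong arg_cong[of _ _ card]) (auto simp: fib_def)
    finally have "real (card ?X) = (\<Sum>\<xi>\<in>?B. real (card (fib \<xi>)))" by simp
    also have "\<dots> \<ge> (\<Sum>\<xi>\<in>?B. Qr ^ Suc d / L ^ e10)"
      by (rule sum_mono) (simp only: \<Xi>f_def mem_Collect_eq)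
    finally have 1: "real (card ?B) * (Qr ^ Suc d / L ^ e10) \<le> real (card ?X)" by simp
    have "?X \<subseteq> {\<theta>\<in>\<Theta>. inbox I F rad v \<theta>}" using inb \<Theta>2(1) by blast
    then have 2: "real (card ?X) \<le> real (card {\<theta>\<in>\<Theta>. inbox I F rad v \<theta>})"
      by (intro of_nat_mono card_mono) auto
    have Qp: "0 < Qr ^ Suc d" using Qr_pos by simp
    have gen: "\<nu> ^ Suc d * u \<le> A * (M * x)" if "b * (u / A) \<le> x" "\<nu> ^ Suc d \<le> M * b" "0 < A" "0 < u" for A b u x :: real
    proof -
      have "\<nu> ^ Suc d * u \<le> M * b * u" using that by (intro mult_right_mono) auto
      also have "\<dots> = A * (M * (b * (u / A)))" using that by simp
      also have "\<dots> \<le> A * (M * x)" using that M by (intro mult_left_mono) auto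
      finally show ?thesis .
    qed
    have "\<nu> ^ Suc d * Qr ^ Suc d \<le> L ^ e10 * (M * real (card {\<theta>\<in>\<Theta>. inbox I F rad v \<theta>}))"
      by (rule gen[OF order_trans[OF 1 2] count Lpow_pos Qp])
    then have "n ^ Suc d \<le> L ^ e10 * (M * real (card {\<theta>\<in>\<Theta>. inbox I F rad v \<theta>}))" unfolding \<nu>(2) .
    also have "\<dots> \<le> L ^ (eP + e10) * (M * real (card {\<theta>\<in>\<Theta>. inbox I F rad v \<theta>}))"
      using M by (intro mult_right_mono Lpow_mono) auto
    finally show ?thesis by (simp only: mult.assoc)
  qed
  moreover have "(\<Prod>j\<in>I. (rad j / \<delta>) powr D) ^ Suc d \<le> L ^ (eP + e10) * M * n ^ Suc d"
  proof -
    have K1: "1 + K \<le> L ^ card I"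
    proof -
      have "1 + K \<le> 2 ^ card I" by (simp add: K_def cardI)
      also have "\<dots> \<le> L ^ card I" using L_ge_6 by (intro power_mono) auto
      finally show ?thesis .
    qed
    have "(\<Prod>j\<in>I. (rad j / \<delta>) powr D) = (rad i / \<delta>) powr D * (\<Prod>j\<in>?I. (rad j / \<delta>) powr D)"
      using i by (intro prod.remove) auto
    also have "(rad i / \<delta>) powr D = (L ^ (2 * ep + 2)) powr D * Qr"
      by (simp only: rad_def if_True refl Qr_def powr_mult[symmetric] times_divide_eq_right)
    also have "(\<Prod>j\<in>?I. (rad j / \<delta>) powr D) = (\<Prod>j\<in>?I. (1 + K) powr D * (\<rho>' j / \<delta>) powr D)"
      by (intro prod.cong) (auto simp: rad_def simp flip: powr_mult)
    also have "\<dots> = ((1 + K) powr D) ^ card ?I * (\<Prod>j\<in>?I. (\<rho>' j / \<delta>) powr D)"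
      by (simp add: prod.distrib)
    finally have eq: "(\<Prod>j\<in>I. (rad j / \<delta>) powr D) =
      ((L ^ (2 * ep + 2)) powr D * ((1 + K) powr D) ^ card ?I) * (Qr * (\<Prod>j\<in>?I. (\<rho>' j / \<delta>) powr D))"
      by (simp only: mult_ac)
    have A: "(L ^ (2 * ep + 2)) powr D * ((1 + K) powr D) ^ card ?I \<le> L ^ ((2 * ep + 2) * N + card I * N * card ?I)"
    proof -
      have "(1 + K) powr D \<le> (L ^ card I) powr D"
        using K1 D_pos by (intro powr_mono2) (auto simp: K_def)
      also have "\<dots> \<le> L ^ (card I * N)" by (rule Lpow_powr)
      finally have "((1 + K) powr D) ^ card ?I \<le> (L ^ (card I * N)) ^ card ?I" by (intro power_mono) auto
      then have "(L ^ (2 * ep + 2)) powr D * ((1 + K) powr D) ^ card ?I \<le> L ^ ((2 * ep + 2) * N) * (L ^ (card I * N)) ^ card ?I"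
        by (intro mult_mono Lpow_powr zero_le_power powr_ge_zero Lpow_nonneg)
      then show ?thesis by (simp only: power_add power_mult[symmetric])
    qed
    have P0: "0 \<le> (\<Prod>j\<in>?I. (\<rho>' j / \<delta>) powr D)" by (intro prod_nonneg) auto
    have "(\<Prod>j\<in>I. (rad j / \<delta>) powr D) ^ Suc d \<le>
      (L ^ ((2 * ep + 2) * N + card I * N * card ?I) * (Qr * (\<Prod>j\<in>?I. (\<rho>' j / \<delta>) powr D))) ^ Suc d"
      unfolding eq using A P0 Qr_pos by (intro power_mono mult_right_mono mult_nonneg_nonneg) auto
    also have "\<dots> = L ^ eP * (Qr ^ Suc d * (\<Prod>j\<in>?I. (\<rho>' j / \<delta>) powr D) ^ Suc d)"
      by (simp only: power_mult_distrib power_mult[symmetric])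
    also have "\<dots> \<le> L ^ eP * (Qr ^ Suc d * (M * \<nu> ^ Suc d))"
      using prod Qr_pos by (intro mult_left_mono) auto
    also have "\<dots> = L ^ eP * (M * n ^ Suc d)" unfolding \<nu>(2)[of "Suc d", symmetric] by (simp only: mult_ac)
    also have "\<dots> \<le> L ^ (eP + e10) * (M * n ^ Suc d)"
      using M n_pos by (intro mult_right_mono Lpow_mono) auto
    finally show ?thesis by (simp only: mult.assoc)
  qed
  moreover have "quasi_orthonormal I F"
    unfolding F_def by (rule quasi_orthonormal_extend[where i = i and w = w, OF fin(1) i w f])
  moreover have "\<delta> \<le> rad j" if "j \<in> I" for j
  proof (cases "j = i")
    case True
    have "1 * \<rho> \<le> L ^ (2 * ep + 2) * \<rho>" using \<rho>_pos by (intro mult_right_mono Lpow_ge_1) auto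
    moreover have "rad j = L ^ (2 * ep + 2) * \<rho>" using True by (simp only: rad_def if_True refl)
    ultimately show ?thesis using \<rho>_ge(2) by linarith
  next
    case False
    then have "\<delta> \<le> \<rho>' j" using that \<rho>' by blast
    moreover have "1 * \<rho>' j \<le> (1 + K) * \<rho>' j" using \<open>\<delta> \<le> \<rho>' j\<close> \<delta>_pos by (intro mult_right_mono) (auto simp: K_def)
    moreover have "rad j = (1 + K) * \<rho>' j" using False by (simp only: rad_def if_False)
    ultimately show ?thesis by linarith
  qed
  ultimately show ?thesis unfolding box_concl_def by blast
qed

end

section \<open>Induction on the dimension\<close>

context moment_curve
begin

text \<open>\<open>\<Theta>\<close> has at most a power of \<open>L\<close> elements: either there
  are no coordinates, or its diameter bound \<open>L\<close> is below
  \<open>L ^ Suc e1 * \<delta>\<close>. A box of radius \<open>\<delta>\<close> around a single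
  point is then good enough.\<close>

lemma box_concl_trivial:
  assumes cfg: "config I \<delta> L R \<Theta> n" and triv: "I = {} \<or> 1 < L ^ e1 * \<delta>"
  shows "box_concl I \<delta> (L ^ (Suc d + pe (Suc e1) * (Suc d * card I))) \<Theta> n"
proof -
  have finI: "finite I" and \<delta>: "0 < \<delta>" "\<delta> \<le> 1" and C1L: "C1 \<le> L" and L6: "6 \<le> L" and n: "0 < n"
    and fin\<Theta>: "finite \<Theta>" and low: "n ^ Suc d \<le> L * real (card \<Theta>)" and Rc: "\<delta> powr (- D) \<le> L * real (card R)"
    using cfg unfolding config_def by simp_all
  have sep: "\<And>x y. x \<in> \<Theta> \<Longrightarrow> y \<in> \<Theta> \<Longrightarrow> x \<noteq> y \<Longrightarrow> \<not> pnear I \<delta> x y" and diam: "\<And>x y. x \<in> \<Theta> \<Longrightarrow> y \<in> \<Theta> \<Longrightarrow> pnear I L x y"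
    using cfg unfolding config_def by blast+
  have "0 < L * real (card \<Theta>)" using low n by (meson less_le_trans zero_less_power)
  then obtain \<theta>0 where \<theta>0: "\<theta>0 \<in> \<Theta>" by fastforce
  have "0 < \<delta> powr (- D)" using \<delta> by simp
  then have "0 < L * real (card R)" using Rc by linarith
  then obtain r where r: "r \<in> R" by fastforce
  obtain Y where Y: "Y \<subseteq> \<Theta>" "real (card Y) \<le> L * n" "\<forall>\<theta>\<in>\<Theta>. \<exists>y\<in>Y. near I (L * \<delta>) (pr r \<theta>) (pr r y)"
  proof -
    have "\<forall>r\<in>R. \<exists>Y\<subseteq>\<Theta>. real (card Y) \<le> L * n \<and> (\<forall>\<theta>\<in>\<Theta>. \<exists>y\<in>Y. near I (L * \<delta>) (pr r \<theta>) (pr r y))"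
      using cfg by (simp add: config_def)
    from bspec[OF this r] show thesis using that by blast
  qed
  \<comment> \<open>A nonempty net yields \<open>1 \<le> L * n\<close>, which is the volume bound
    for a box whose normalised volume is 1.\<close>
  have "Y \<noteq> {}" using Y(3) \<theta>0 by blast
  then have "0 < card Y" using Y(1) fin\<Theta> finite_subset card_gt_0_iff by blast
  then have Ln: "1 \<le> L * n" using Y(2) by linarith
  have L1: "1 \<le> L" using L6 by linarith
  have big: "real (card \<Theta>) \<le> L ^ (pe (Suc e1) * (Suc d * card I))"
  proof -
    have "real (card \<Theta>) \<le> (\<Prod>j\<in>{..d} \<times> I. C1 * (2 * (L ^ Suc e1 * \<delta>) / \<delta>) powr D)"
    proof (rule packing_family[where co = "\<lambda>\<theta> j. \<theta> (fst j) (snd j)" and ?x0.0 = "\<lambda>j. \<theta>0 (fst j) (snd j)"])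
      have LL: "L \<le> L ^ Suc e1 * \<delta>" if "I \<noteq> {}"
      proof -
        have "L * 1 \<le> L * (L ^ e1 * \<delta>)" using that triv L1 by (intro mult_left_mono) auto
        then show ?thesis by (simp add: mult.assoc)
      qed
      fix j assume j: "j \<in> {..d} \<times> I"
      then have LLj: "L \<le> L ^ Suc e1 * \<delta>" using LL by auto
      then show "\<delta> \<le> L ^ Suc e1 * \<delta>" using \<delta> L1 by linarith
      show "absval (\<theta> (fst j) (snd j) - \<theta>0 (fst j) (snd j)) \<le> L ^ Suc e1 * \<delta>" if "\<theta> \<in> \<Theta>" for \<theta>
      proof -
        have "absval (\<theta> (fst j) (snd j) - \<theta>0 (fst j) (snd j)) \<le> L"
          using diam[OF that \<theta>0] j by (auto simp: pnear_def near_def)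
        then show ?thesis using LLj by linarith
      qed
    next
      show "\<exists>j\<in>{..d} \<times> I. \<delta> < absval (x (fst j) (snd j) - y (fst j) (snd j))"
        if "x \<in> \<Theta>" "y \<in> \<Theta>" "x \<noteq> y" for x y
        using sep[OF that] by (force simp: pnear_def near_def not_le)
    qed (use fin\<Theta> finI \<delta> in auto)
    also have "\<dots> = (C1 * (2 * L ^ Suc e1) powr D) ^ (Suc d * card I)"
      using \<delta> by (simp add: card_cartesian_product mult.assoc)
    also have "\<dots> \<le> (L ^ pe (Suc e1)) ^ (Suc d * card I)"
    proof (intro power_mono)
      have "2 * L ^ Suc e1 \<le> L ^ Suc (Suc e1)" using L6 by (simp add: mult_right_mono)
      then have "(2 * L ^ Suc e1) powr D \<le> (L ^ Suc (Suc e1)) powr D"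
        using D_pos L1 by (intro powr_mono2) auto
      also have "\<dots> \<le> (L ^ Suc (Suc e1)) powr real N"
        by (rule powr_mono[OF D_le one_le_power[OF L1]])
      also have "\<dots> = L ^ (Suc (Suc e1) * N)" 
      proof -
        have "0 < L ^ Suc (Suc e1)" using L6 by (intro zero_less_power) linarith
        then show ?thesis by (simp only: powr_realpow power_mult)
      qed
      finally have "C1 * (2 * L ^ Suc e1) powr D \<le> L * L ^ (Suc (Suc e1) * N)"
        using C1L C1_ge_1 by (intro mult_mono) auto
      then show "C1 * (2 * L ^ Suc e1) powr D \<le> L ^ pe (Suc e1)" by (simp add: pe_def)
    qed (use C1_ge_1 in auto)
    finally show ?thesis by (simp only: power_mult)
  qed
  let ?f = "\<lambda>j k. if j = k then 1 else (0 :: 'a)"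
  let ?M = "L ^ (Suc d + pe (Suc e1) * (Suc d * card I))"
  have inb: "inbox I ?f (\<lambda>_. \<delta>) \<theta>0 \<theta>0"
    unfolding inbox_def using \<delta> by (intro exI[of _ "\<lambda>_ _. 0"]) auto
  have M1: "L ^ Suc d * 1 \<le> ?M"
    unfolding power_add using L1 one_le_power[OF L1] by (intro mult_left_mono) auto
  have "1 \<le> (L * n) ^ Suc d" using Ln by (rule one_le_power)
  also have "\<dots> \<le> ?M * n ^ Suc d" unfolding power_mult_distrib using M1 n by (intro mult_right_mono) auto
  finally have 1: "1 \<le> ?M * n ^ Suc d" .
  have "n ^ Suc d \<le> L ^ Suc d * L ^ (pe (Suc e1) * (Suc d * card I))"
  proof -
    have "L \<le> L ^ Suc d" using self_le_power[OF L1, of "Suc d"] by simp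
    then have "L * real (card \<Theta>) \<le> L ^ Suc d * L ^ (pe (Suc e1) * (Suc d * card I))"
      using big L1 by (intro mult_mono) auto
    then show ?thesis using low by linarith
  qed
  then have 2: "n ^ Suc d \<le> ?M * 1" by (simp only: power_add mult_1_right)
  also have "\<dots> \<le> ?M * real (card {\<theta>\<in>\<Theta>. inbox I ?f (\<lambda>_. \<delta>) \<theta>0 \<theta>})"
  proof (intro mult_left_mono)
    have "{\<theta>\<in>\<Theta>. inbox I ?f (\<lambda>_. \<delta>) \<theta>0 \<theta>} \<noteq> {}" using \<theta>0 inb by blast
    then have "0 < card {\<theta>\<in>\<Theta>. inbox I ?f (\<lambda>_. \<delta>) \<theta>0 \<theta>}" using fin\<Theta> by (simp add: card_gt_0_iff)
    then show "1 \<le> real (card {\<theta>\<in>\<Theta>. inbox I ?f (\<lambda>_. \<delta>) \<theta>0 \<theta>})" by linarith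
  qed (use L1 in auto)
  finally have 3: "n ^ Suc d \<le> ?M * real (card {\<theta>\<in>\<Theta>. inbox I ?f (\<lambda>_. \<delta>) \<theta>0 \<theta>})" .
  have "(\<Prod>j\<in>I. (\<delta> / \<delta>) powr D) ^ Suc d \<le> ?M * n ^ Suc d" using 1 \<delta> by simp
  then show ?thesis
    unfolding box_concl_def using quasi_orthonormal_standard[OF finI] 3
    by (intro exI[of _ ?f] exI[of _ "\<lambda>_. \<delta>"] exI[of _ \<theta>0]) auto
qed

lemma quotient_step:
  assumes "config I \<delta> L R \<Theta> n" "L ^ e1 * \<delta> \<le> 1" "I \<noteq> {}"
  shows "\<exists>i \<Xi> \<nu>. i \<in> I \<and> config (I - {i}) \<delta> (L ^ fst (exponents (card I))) R \<Xi> \<nu> \<and>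
    (\<forall>M\<ge>1. box_concl (I - {i}) \<delta> M \<Xi> \<nu> \<longrightarrow> box_concl I \<delta> (L ^ snd (exponents (card I)) * M) \<Theta> n)"
proof -
  interpret step D C1 N e1 d c I \<delta> L R \<Theta> n
    by unfold_locales (use assms in auto)
  obtain Z t S R' Y \<kappa> where "selected D C1 N e1 d c I \<delta> L R \<Theta> n Z t S R' Y \<kappa>"
    using selection_exists by blast
  then interpret selected D C1 N e1 d c I \<delta> L R \<Theta> n Z t S R' Y \<kappa> .
  obtain W cell where "celled D C1 N e1 d c I \<delta> L R \<Theta> n Z t S R' Y \<kappa> W cell"
    using cells_exist by blast
  then interpret celled D C1 N e1 d c I \<delta> L R \<Theta> n Z t S R' Y \<kappa> W cell .
  obtain j where j: "Delta * n ^ (d + 2) \<le> L ^ (d + 7) *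
      real (card {x \<in> triples. sc (\<kappa> t (fst (snd x))) (\<kappa> t (snd (snd x))) = j})"
    using scale_selection by blast
  interpret scaled D C1 N e1 d c I \<delta> L R \<Theta> n Z t S R' Y \<kappa> W cell j
    by unfold_locales (rule j)
  obtain i w \<Theta>2 \<Xi> q where "directed D C1 N e1 d c I \<delta> L R \<Theta> n Z t S R' Y \<kappa> W cell j i w \<Theta>2 \<Xi> q"
    using directed_exists by blast
  then interpret directed D C1 N e1 d c I \<delta> L R \<Theta> n Z t S R' Y \<kappa> W cell j i w \<Theta>2 \<Xi> q .
  have "config (I - {i}) \<delta> (L ^ fst (exponents (card I))) R \<Xi>f \<nu>"
    unfolding exponents_eq fst_conv by (rule config_quotient)
  moreover have "\<forall>M\<ge>1. box_concl (I - {i}) \<delta> M \<Xi>f \<nu> \<longrightarrow> box_concl I \<delta> (L ^ snd (exponents (card I)) * M) \<Theta> n"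
    unfolding exponents_eq snd_conv using box_lift by blast
  ultimately show ?thesis using i by blast
qed

text \<open>If \<open>\<delta>\<close> is not small compared with \<open>L\<close>, the trivial box
  works; otherwise one coordinate is removed. Since \<open>L\<close> becomes \<open>L ^ a\<close>,
  exponents multiply from one dimension to the next but never depend on
  \<open>\<delta>\<close>.\<close>

theorem box_concl_of_config:
  "\<exists>E. \<forall>I \<delta> L R \<Theta> n. card I = m \<longrightarrow> config I \<delta> L R \<Theta> n \<longrightarrow> box_concl I \<delta> (L ^ E) \<Theta> n"
proof (induction m)
  case 0
  show ?case
  proof (intro exI[of _ "Suc d + pe (Suc e1) * (Suc d * 0)"] allI impI)
    fix I \<delta> L R \<Theta> n assume I: "card I = 0" and cfg: "config I \<delta> L R \<Theta> n"
    then have "I = {}" by (simp add: config_def)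
    then show "box_concl I \<delta> (L ^ (Suc d + pe (Suc e1) * (Suc d * 0))) \<Theta> n"
      using box_concl_trivial[OF cfg] I by simp
  qed
next
  case (Suc m)
  then obtain E where E: "\<And>I \<delta> L R \<Theta> n. card I = m \<Longrightarrow> config I \<delta> L R \<Theta> n \<Longrightarrow> box_concl I \<delta> (L ^ E) \<Theta> n"
    by blast
  define a where "a = fst (exponents (Suc m))"
  define b where "b = snd (exponents (Suc m))"
  define E0 where "E0 = Suc d + pe (Suc e1) * (Suc d * Suc m)"
  show ?case
  proof (intro exI[of _ "E0 + (b + a * E)"] allI impI)
    fix I \<delta> L R \<Theta> n assume I: "card I = Suc m" and cfg: "config I \<delta> L R \<Theta> n"
    have L: "1 \<le> L" and n: "0 < n" using cfg by (auto simp: config_def)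
    have mono: "box_concl I \<delta> (L ^ (E0 + (b + a * E))) \<Theta> n" if "box_concl I \<delta> (L ^ k) \<Theta> n" "k \<le> E0 + (b + a * E)" for k
    proof -
      have "L ^ k * x \<le> L ^ (E0 + (b + a * E)) * x" if "0 \<le> x" for x
        using power_increasing[OF \<open>k \<le> _\<close> L] that by (rule mult_right_mono)
      then have "L ^ k * n ^ Suc d \<le> L ^ (E0 + (b + a * E)) * n ^ Suc d"
        "\<And>X. L ^ k * real (card X) \<le> L ^ (E0 + (b + a * E)) * real (card X)" using n by auto
      then show ?thesis using that(1) unfolding box_concl_def by (meson order_trans)
    qed
    show "box_concl I \<delta> (L ^ (E0 + (b + a * E))) \<Theta> n"
    proof (cases "L ^ e1 * \<delta> \<le> 1")
      case False
      then have "box_concl I \<delta> (L ^ E0) \<Theta> n"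
        using box_concl_trivial[OF cfg] unfolding I E0_def by simp
      then show ?thesis by (rule mono) simp
    next
      case True
      have "I \<noteq> {}" using I by auto
      from quotient_step[OF cfg True this] obtain i \<Xi> \<nu> where i: "i \<in> I" "config (I - {i}) \<delta> (L ^ a) R \<Xi> \<nu>"
        "\<forall>M\<ge>1. box_concl (I - {i}) \<delta> M \<Xi> \<nu> \<longrightarrow> box_concl I \<delta> (L ^ b * M) \<Theta> n"
        unfolding I a_def b_def by blast
      have "box_concl (I - {i}) \<delta> ((L ^ a) ^ E) \<Xi> \<nu>"
        using I i(1) by (intro E[OF _ i(2)]) simp
      moreover have "1 \<le> (L ^ a) ^ E" using L by (intro one_le_power)
      ultimately have "box_concl I \<delta> (L ^ b * (L ^ a) ^ E) \<Theta> n" using i(3) by blast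
      then have "box_concl I \<delta> (L ^ (b + a * E)) \<Theta> n" by (simp only: power_add power_mult)
      then show ?thesis by (rule mono) simp
    qed
  qed
qed

end

section \<open>Unipotent elements in the irreducible representation\<close>

lemma poly_eq_of_infinite:
  fixes P Q :: "'a::field_char_0 poly"
  assumes "finite B" "\<And>x. x \<notin> B \<Longrightarrow> poly P x = poly Q x"
  shows "P = Q"
proof (rule ccontr)
  assume "P \<noteq> Q"
  then have "finite {x. poly (P - Q) x = 0}" by (intro poly_roots_finite) simp
  moreover have "UNIV = B \<union> {x. poly (P - Q) x = 0}" using assms(2) by auto
  ultimately have "finite (UNIV :: 'a set)" using assms(1) by (metis finite_UnI)
  then show False using infinite_UNIV_char_0 by blast
qed

text \<open>For nonzero \<open>c\<close> the second factor is a unit modulo \<open>W\<close>. As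
  \<open>W\<close> may be reducible, its powers are split off one at a time.\<close>

lemma power_dvd_cancel:
  fixes W X :: "'a::field poly"
  assumes "W ^ n dvd X * ([:c:] + [:b:] * W)" "c \<noteq> 0"
  shows "W ^ n dvd X"
  using assms(1)
proof (induction n)
  case (Suc n)
  show ?case
  proof (cases "W = 0")
    case True
    then have "X * ([:c:] + [:b:] * W) = 0" using Suc.prems by simp
    then show ?thesis using True assms(2) by simp
  next
    case False
    have "W ^ n dvd X * ([:c:] + [:b:] * W)" using Suc.prems by (metis dvd_mult_right power_Suc)
    then obtain X' where X': "X = W ^ n * X'" using Suc.IH by (auto elim: dvdE)
    have "W ^ n * W dvd W ^ n * (X' * ([:c:] + [:b:] * W))"
      using Suc.prems unfolding X' by (simp add: mult_ac)
    then have "W dvd X' * ([:c:] + [:b:] * W)" using False by simp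
    then have "W dvd X' * [:c:] + W * (X' * [:b:])" by (simp add: algebra_simps)
    then have "W dvd X' * [:c:]" by (simp only: dvd_add_left_iff dvd_triv_left)
    then have "W dvd Polynomial.smult c X'" by simp
    then have "W dvd X'" using assms(2) by (rule dvd_smult_cancel)
    then show ?thesis unfolding X' by (simp add: mult_dvd_mono mult.commute)
  qed
qed simp

lemma power_dvd_cancel_power:
  fixes W X :: "'a::field poly"
  assumes "W ^ n dvd X * ([:c:] + [:b:] * W) ^ m" "c \<noteq> 0"
  shows "W ^ n dvd X"
  using assms(1)
proof (induction m)
  case (Suc m)
  then have "W ^ n dvd (X * ([:c:] + [:b:] * W) ^ m) * ([:c:] + [:b:] * W)"
    by (simp add: mult_ac)
  from power_dvd_cancel[OF this assms(2)] show ?case by (rule Suc.IH)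
qed simp

text \<open>A one-parameter group that is homogeneous under the squares of the torus is polynomial: every
  scalar is a difference of two squares, so each entry is a rational function with poles at most at
  \<open>\<plusminus>1\<close>, and homogeneity under \<open>r \<mapsto> 4 r\<close> excludes those poles.\<close>

lemma homogeneous_one_parameter_group:
  fixes u :: "'a::field_char_0 \<Rightarrow> nat \<Rightarrow> nat \<Rightarrow> 'a"
  assumes add: "\<And>r s i j. i \<le> d \<Longrightarrow> j \<le> d \<Longrightarrow> u (r + s) i j = (\<Sum>k\<le>d. u r i k * u s k j)"
    and hom: "\<And>t r i j. t \<noteq> 0 \<Longrightarrow> i \<le> d \<Longrightarrow> j \<le> d \<Longrightarrow> t ^ (2 * i) * u (t ^ 2 * r) i j = t ^ (2 * j) * u r i j"
    and ij: "i \<le> d" "j \<le> d"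
  shows "\<exists>c. \<forall>r. u r i j = (if i \<le> j then c * r ^ (j - i) else 0)"
proof -
  \<comment> \<open>At \<open>r\<close> these take the values \<open>(r + 1) / 2\<close> and
    \<open>(r - 1) / 2\<close>, whose squares differ by \<open>r\<close>; both are nonzero away from
    1 and -1.\<close>
  define p :: "'a poly" where "p = [:1/2, 1/2:]"
  define q :: "'a poly" where "q = [:-1/2, 1/2:]"
  define P where "P = (\<Sum>k\<le>d. Polynomial.smult (u 1 i k * u (-1) k j) (p ^ (2 * (d - i + k)) * q ^ (2 * (d - k + j))))"
  define W where "W = p * q"
  have W: "W = [:-1/4, 0, 1/4:]" by (simp add: W_def p_def q_def)
  \<comment> \<open>The factor \<open>W ^ (2 * d)\<close> clears the negative powers that appear
    when homogeneity is solved for the entries at the two squares.\<close>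
  have G: "poly W r ^ (2 * d) * u r i j = poly P r" if r: "r \<noteq> 1" "r \<noteq> -1" for r
  proof -
    define x y where "x = poly p r" and "y = poly q r"
    have "x \<noteq> 0" "y \<noteq> 0" using r by (auto simp: x_def y_def p_def q_def field_simps eq_neg_iff_add_eq_0 add.commute)
    have xy: "r = x ^ 2 * 1 + y ^ 2 * (-1)"
      by (simp add: x_def y_def p_def q_def power2_eq_square field_simps)
    have 1: "x ^ (2 * d) * u (x ^ 2 * 1) i k = x ^ (2 * (d - i + k)) * u 1 i k" if "k \<le> d" for k
    proof -
      have "x ^ (2 * d) = x ^ (2 * (d - i)) * x ^ (2 * i)"
        using ij by (simp flip: power_add add: algebra_simps)
      then have "x ^ (2 * d) * u (x ^ 2 * 1) i k = x ^ (2 * (d - i)) * (x ^ (2 * k) * u 1 i k)"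
        using hom[OF \<open>x \<noteq> 0\<close> ij(1) that, of 1] by (simp add: mult_ac)
      then show ?thesis by (simp add: power_add distrib_left mult_ac)
    qed
    have 2: "y ^ (2 * d) * u (y ^ 2 * (-1)) k j = y ^ (2 * (d - k + j)) * u (-1) k j" if "k \<le> d" for k
    proof -
      have "y ^ (2 * d) = y ^ (2 * (d - k)) * y ^ (2 * k)"
        using that by (simp flip: power_add add: algebra_simps)
      then have "y ^ (2 * d) * u (y ^ 2 * (-1)) k j = y ^ (2 * (d - k)) * (y ^ (2 * j) * u (-1) k j)"
        using hom[OF \<open>y \<noteq> 0\<close> that ij(2), of "-1"] by (simp add: mult_ac)
      then show ?thesis by (simp add: power_add distrib_left mult_ac)
    qed
    have "poly W r ^ (2 * d) * u r i j = (\<Sum>k\<le>d. (x ^ (2 * d) * u (x ^ 2 * 1) i k) * (y ^ (2 * d) * u (y ^ 2 * (-1)) k j))"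
      unfolding add[OF ij, of "x ^ 2 * 1" "y ^ 2 * (-1)", folded xy] sum_distrib_left
      by (intro sum.cong) (auto simp: W_def x_def y_def power_mult_distrib mult_ac)
    also have "\<dots> = (\<Sum>k\<le>d. (x ^ (2 * (d - i + k)) * u 1 i k) * (y ^ (2 * (d - k + j)) * u (-1) k j))"
      by (intro sum.cong) (auto simp only: 1 2 atMost_iff)
    also have "\<dots> = poly P r"
      unfolding P_def x_def y_def by (simp add: poly_sum mult_ac)
    finally show ?thesis .
  qed
  define W4 where "W4 = pcompose W [:0, 4:]"
  define P4 where "P4 = pcompose P [:0, 4:]"
  let ?B = "{1, -1, 1/4, -1/4 :: 'a}"
  have h4: "4 ^ i * u (4 * r) i j = 4 ^ j * u r i j" for r
    using hom[of 2 i j r] ij by (simp add: power_mult)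
  have nB: "4 * r \<noteq> 1" "4 * r \<noteq> -1" if "r \<notin> ?B" for r :: 'a
  proof -
    have "4 * r = 1 \<longleftrightarrow> r = 1/4" "4 * r = -1 \<longleftrightarrow> r = -1/4" by (simp_all add: field_simps)
    then show "4 * r \<noteq> 1" "4 * r \<noteq> -1" using that by auto
  qed
  \<comment> \<open>Homogeneity with \<open>t = 2\<close> relates the rational function at
    \<open>r\<close> and at \<open>4 * r\<close>. Since \<open>W4\<close> and \<open>W\<close> have
    no common zero, \<open>W ^ (2 * d)\<close> must divide \<open>P\<close>.\<close>
  have "W4 ^ (2 * d) * Polynomial.smult (4 ^ j) P = Polynomial.smult (4 ^ i) (W ^ (2 * d) * P4)"
  proof (rule poly_eq_of_infinite)
    fix r assume r: "r \<notin> ?B"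
    have "poly P r = poly W r ^ (2 * d) * u r i j" using r by (intro G[symmetric]) auto
    moreover have "poly P4 r = poly W4 r ^ (2 * d) * u (4 * r) i j"
      unfolding P4_def W4_def using nB[OF r] G[of "4 * r"] by (simp add: poly_pcompose mult.commute)
    moreover have "4 ^ j * u r i j = 4 ^ i * u (4 * r) i j" by (rule h4[symmetric])
    ultimately show "poly (W4 ^ (2 * d) * Polynomial.smult (4 ^ j) P) r = poly (Polynomial.smult (4 ^ i) (W ^ (2 * d) * P4)) r"
      by (simp add: mult_ac)
  qed simp
  note eq = this
  have "Polynomial.smult (4 ^ j) P * W4 ^ (2 * d) = W4 ^ (2 * d) * Polynomial.smult (4 ^ j) P"
    by (rule mult.commute)
  also note eq
  also have "Polynomial.smult (4 ^ i) (W ^ (2 * d) * P4) = W ^ (2 * d) * Polynomial.smult (4 ^ i) P4"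
    by (rule mult_smult_right[symmetric])
  finally have "W ^ (2 * d) dvd Polynomial.smult (4 ^ j) P * W4 ^ (2 * d)"
    by (rule dvdI)
  moreover have W4: "W4 = [:15/4:] + [:16:] * W"
    unfolding W4_def W by (simp add: pcompose_pCons)
  ultimately have "W ^ (2 * d) dvd Polynomial.smult (4 ^ j) P * ([:15/4:] + [:16:] * W) ^ (2 * d)"
    by (simp only:)
  then have "W ^ (2 * d) dvd Polynomial.smult (4 ^ j) P"
    by (rule power_dvd_cancel_power) simp
  then have "W ^ (2 * d) dvd P" by (rule dvd_smult_cancel) simp
  then obtain Q where Q: "P = W ^ (2 * d) * Q" by (auto elim: dvdE)
  have GQ: "u r i j = poly Q r" if r: "r \<noteq> 1" "r \<noteq> -1" for r
  proof -
    have "poly W r = (r - 1) * (r + 1) / 4" unfolding W by (simp add: field_simps)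
    then have "poly W r \<noteq> 0" using r by (auto simp: eq_neg_iff_add_eq_0)
    then show ?thesis using G[OF r] unfolding Q by simp
  qed
  have Q4: "Polynomial.smult (4 ^ i) (pcompose Q [:0, 4:]) = Polynomial.smult (4 ^ j) Q"
  proof (rule poly_eq_of_infinite)
    fix r assume r: "r \<notin> ?B"
    show "poly (Polynomial.smult (4 ^ i) (pcompose Q [:0, 4:])) r = poly (Polynomial.smult (4 ^ j) Q) r"
      using h4[of r] GQ[of r] GQ[of "4 * r"] nB[OF r] r by (simp add: poly_pcompose mult.commute)
  qed simp
  \<comment> \<open>Scaling by 4 multiplies the coefficient of degree \<open>k\<close> by a power of
    4 that is compatible with homogeneity only if \<open>i + k = j\<close>; powers of 4 are distinct
    in characteristic zero.\<close>
  have coeffQ: "coeff Q k = 0" if "i + k \<noteq> j" for k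
  proof -
    have "coeff (pcompose Q [:0, 4:]) k = 4 ^ k * coeff Q k"
      by (rule coeff_pcompose_linear)
    then have "4 ^ (i + k) * coeff Q k = 4 ^ j * coeff Q k"
      using arg_cong[OF Q4, of "\<lambda>P. coeff P k"] by (simp add: power_add mult_ac)
    moreover have "(4 :: 'a) ^ (i + k) \<noteq> 4 ^ j"
    proof -
      have "(4 :: nat) ^ (i + k) \<noteq> 4 ^ j" using that by simp
      then have "of_nat (4 ^ (i + k)) \<noteq> (of_nat (4 ^ j) :: 'a)" unfolding of_nat_eq_iff .
      then show ?thesis by simp
    qed
    ultimately show ?thesis by simp
  qed
  have Qall: "u r i j = poly Q r" for r
  proof (cases "r = 1 \<or> r = -1")
    case True
    have n4: "4 * r \<noteq> 1" "4 * r \<noteq> -1" using True by auto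
    have "4 ^ j * u r i j = 4 ^ i * poly Q (4 * r)" using h4[of r] GQ[OF n4] by simp
    also have "\<dots> = 4 ^ j * poly Q r"
      using arg_cong[OF Q4, of "\<lambda>P. poly P r"] by (simp add: poly_pcompose mult.commute)
    finally show ?thesis by simp
  qed (use GQ in blast)
  show ?thesis
  proof (cases "i \<le> j")
    case True
    have "Q = Polynomial.monom (coeff Q (j - i)) (j - i)"
      by (rule poly_eqI) (use coeffQ True in auto)
    then have "poly Q r = coeff Q (j - i) * r ^ (j - i)" for r by (metis poly_monom)
    then show ?thesis using Qall True by auto
  next
    case False
    then have "Q = 0" by (intro poly_eqI) (use coeffQ in auto)
    then show ?thesis using Qall False by auto
  qed
qed

text \<open>Comparison of the coefficients of \<open>r ^ (k - i)\<close> in the addition law for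
  \<open>r + 1\<close>.\<close>

lemma coeff_relation:
  fixes a :: "nat \<Rightarrow> nat \<Rightarrow> 'a::field_char_0"
  assumes u: "\<And>r i j. i \<le> d \<Longrightarrow> j \<le> d \<Longrightarrow> u r i j = (if i \<le> j then a i j * r ^ (j - i) else 0)"
    and add: "\<And>r s i j. i \<le> d \<Longrightarrow> j \<le> d \<Longrightarrow> u (r + s) i j = (\<Sum>k\<le>d. u r i k * u s k j)"
    and k: "i \<le> k" "k \<le> j" "j \<le> d"
  shows "a i k * a k j = of_nat ((j - i) choose (k - i)) * a i j"
proof -
  have "Polynomial.smult (a i j) ([:1, 1:] ^ (j - i)) = (\<Sum>k\<in>{i..j}. Polynomial.monom (a i k * a k j) (k - i))"
  proof (rule poly_eq_of_infinite[of "{}"])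
    fix r :: 'a
    have "a i j * (1 + r) ^ (j - i) = u (r + 1) i j" using u[of i j "r + 1"] k by (simp add: add.commute)
    also have "\<dots> = (\<Sum>k\<le>d. u r i k * u 1 k j)" using k by (intro add) auto
    also have "\<dots> = (\<Sum>k\<in>{i..j}. u r i k * u 1 k j)"
      using k u by (intro sum.mono_neutral_right) (auto simp: not_le)
    also have "\<dots> = (\<Sum>k\<in>{i..j}. a i k * a k j * r ^ (k - i))"
      using k u by (intro sum.cong) auto
    finally show "poly (Polynomial.smult (a i j) ([:1, 1:] ^ (j - i))) r = poly (\<Sum>k\<in>{i..j}. Polynomial.monom (a i k * a k j) (k - i)) r"
      by (simp add: poly_sum poly_monom)
  qed simp
  then have "coeff (Polynomial.smult (a i j) ([:1, 1:] ^ (j - i))) (k - i) = coeff (\<Sum>k\<in>{i..j}. Polynomial.monom (a i k * a k j) (k - i)) (k - i)"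
    by simp
  moreover have "coeff (\<Sum>l\<in>{i..j}. Polynomial.monom (a i l * a l j) (l - i)) (k - i) = (\<Sum>l\<in>{i..j}. if l = k then a i l * a l j else 0)"
    unfolding coeff_sum using k by (intro sum.cong) auto
  moreover have "(\<Sum>l\<in>{i..j}. if l = k then a i l * a l j else 0) = a i k * a k j"
    using k by simp
  moreover have "coeff ([:1, 1 :: 'a:] ^ (j - i)) (k - i) = of_nat ((j - i) choose (k - i))"
    using k by (subst coeff_linear_poly_power) auto
  ultimately show ?thesis by (simp add: mult.commute)
qed

section \<open>Two by two matrices and the first row of the unipotent action\<close>

definition lower_unip :: "'a::field \<Rightarrow> 'a mat" where
  "lower_unip r = mat_of_rows_list 2 [[1, 0], [r, 1]]"

lemma mat2_entries:
  "mat_of_rows_list 2 [[a, b], [c, e]] $$ (0, 0) = a" "mat_of_rows_list 2 [[a, b], [c, e]] $$ (0, Suc 0) = b"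
  "mat_of_rows_list 2 [[a, b], [c, e]] $$ (Suc 0, 0) = c" "mat_of_rows_list 2 [[a, b], [c, e]] $$ (Suc 0, Suc 0) = e"
  "mat_of_rows_list 2 [[a, b], [c, e]] \<in> carrier_mat 2 2"
  by (auto simp: mat_of_rows_list_def)

lemma mat2_mult:
  fixes a b c e a' b' c' e' :: "'a::field"
  shows "mat_of_rows_list 2 [[a, b], [c, e]] * mat_of_rows_list 2 [[a', b'], [c', e']] =
    mat_of_rows_list 2 [[a * a' + b * c', a * b' + b * e'], [c * a' + e * c', c * b' + e * e']]"
  by (rule eq_matI) (auto simp: mat_of_rows_list_def scalar_prod_def numeral_2_eq_2 less_Suc_eq)

lemma mat2_eqI:
  assumes "g \<in> carrier_mat 2 2"
  shows "g = mat_of_rows_list 2 [[g $$ (0, 0), g $$ (0, Suc 0)], [g $$ (Suc 0, 0), g $$ (Suc 0, Suc 0)]]"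
  by (rule eq_matI) (use assms in \<open>auto simp: mat_of_rows_list_def numeral_2_eq_2 less_Suc_eq\<close>)

lemma det_mat2: "Determinant.det (mat_of_rows_list 2 [[a, b], [c, e :: 'a::field]]) = a * e - b * c"
proof -
  let ?A = "mat_of_rows_list 2 [[a, b], [c, e]]"
  have "Determinant.det ?A = (\<Sum>i<2. ?A $$ (i, 0) * cofactor ?A i 0)"
    by (rule laplace_expansion_column) (auto simp: mat_of_rows_list_def)
  also have "\<dots> = ?A $$ (0, 0) * cofactor ?A 0 0 + ?A $$ (Suc 0, 0) * cofactor ?A (Suc 0) 0"
    by (simp add: numeral_2_eq_2)
  also have "cofactor ?A 0 0 = e"
    unfolding cofactor_def by (subst det_single) (auto simp: mat_delete_def mat_of_rows_list_def)
  also have "cofactor ?A (Suc 0) 0 = - b"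
    unfolding cofactor_def by (subst det_single) (auto simp: mat_delete_def mat_of_rows_list_def)
  finally show ?thesis by (simp add: mat2_entries mult.commute)
qed

lemma SL2_mat2: "mat_of_rows_list 2 [[a, b], [c, e]] \<in> SL2 \<longleftrightarrow> a * e - b * c = (1 :: 'a::field)"
  unfolding SL2_def using mat2_entries(5) by (auto simp: det_mat2)

text \<open>A matrix with nonzero lower left entry is a product of an upper, a lower and an upper
  unipotent matrix. If that entry is 0, splitting off a lower unipotent factor makes it
  nonzero.\<close>

lemma SL2_generated:
  fixes g :: "'a::field mat"
  assumes g: "g \<in> SL2" and U: "\<And>r. Q (upper_unip r)" and L: "\<And>r. Q (lower_unip r)"
    and mult: "\<And>g h. g \<in> SL2 \<Longrightarrow> h \<in> SL2 \<Longrightarrow> Q g \<Longrightarrow> Q h \<Longrightarrow> Q (g * h)"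
  shows "Q g"
proof -
  have inS: "upper_unip r \<in> SL2" "lower_unip r \<in> SL2" for r :: 'a
    by (simp_all add: upper_unip_def lower_unip_def SL2_mat2)
  have multS: "g * h \<in> SL2" if "g \<in> SL2" "h \<in> SL2" for g h :: "'a mat"
    using that by (auto simp: SL2_def det_mult[of _ 2])
  have *: "Q (mat_of_rows_list 2 [[a, b], [c, e]])" if det: "a * e - b * c = 1" and c: "c \<noteq> 0" for a b c e
  proof -
    have "mat_of_rows_list 2 [[a, b], [c, e]] = upper_unip ((a - 1) / c) * lower_unip c * upper_unip ((e - 1) / c)"
    proof -
      have "a * ((e - 1) / c) + (a - 1) / c = b" using det c by (simp add: field_simps)
      then show ?thesis unfolding upper_unip_def lower_unip_def mat2_mult using c by simp
    qed
    then show ?thesis using U L mult inS multS by simp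
  qed
  obtain a b c e where abce: "g = mat_of_rows_list 2 [[a, b], [c, e]]"
    using g mat2_eqI[of g] unfolding SL2_def by blast
  have det: "a * e - b * c = 1" using g unfolding abce SL2_mat2 .
  show ?thesis
  proof (cases "c = 0")
    case False
    then show ?thesis unfolding abce using *[OF det] by blast
  next
    case True
    then have "e \<noteq> 0" using det by auto
    have "Q (mat_of_rows_list 2 [[a + b, b], [e, e]])"
      by (rule *) (use det True \<open>e \<noteq> 0\<close> in \<open>auto simp: algebra_simps\<close>)
    moreover have "g = mat_of_rows_list 2 [[a + b, b], [e, e]] * lower_unip (-1)"
      unfolding abce lower_unip_def mat2_mult using True by simp
    moreover have "mat_of_rows_list 2 [[a + b, b], [e, e]] \<in> SL2"
      unfolding SL2_mat2 using det True by (simp add: algebra_simps)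
    ultimately show ?thesis using mult L inS by metis
  qed
qed

text \<open>Conjugation by the torus makes both unipotent groups homogeneous, so the upper one acts
  by triangular matrices with monomial entries and the lower one by lower triangular matrices. If an
  entry of row 0 vanished, the span of the basis vectors beyond some index \<open>q\<close> would be
  stable under both, against irreducibility.\<close>

lemma standard_irrep_first_row:
  fixes \<rho> :: "'a::field_char_0 mat \<Rightarrow> 'a mat"
  assumes "standard_irrep d \<rho>"
  shows "\<exists>c. (\<forall>p\<le>d. c p \<noteq> 0) \<and> (\<forall>r. \<forall>p\<le>d. \<rho> (upper_unip r) $$ (0, p) = c p * r ^ p)"
proof -
  have rep: "SL2_representation (d + 1) \<rho>" and irr: "irreducible_SL2_representation (d + 1) \<rho>"
    and tor: "\<And>t i. t \<noteq> 0 \<Longrightarrow> i \<le> d \<Longrightarrow> \<rho> (torus_elt t) *\<^sub>v unit_vec (d + 1) i =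
          (t powi (int d - 2 * int i)) \<cdot>\<^sub>v unit_vec (d + 1) i"
    using assms by (auto simp: standard_irrep_def irreducible_SL2_representation_def)
  have car: "\<And>g. g \<in> SL2 \<Longrightarrow> \<rho> g \<in> carrier_mat (d + 1) (d + 1)" and one: "\<rho> (1\<^sub>m 2) = 1\<^sub>m (d + 1)"
    and mult: "\<And>g h. g \<in> SL2 \<Longrightarrow> h \<in> SL2 \<Longrightarrow> \<rho> (g * h) = \<rho> g * \<rho> h"
    using rep by (auto simp: SL2_representation_def)
  have S: "upper_unip r \<in> SL2" "lower_unip r \<in> SL2" "t \<noteq> 0 \<Longrightarrow> torus_elt t \<in> SL2" for r t :: 'a
    by (simp_all add: upper_unip_def lower_unip_def torus_elt_def SL2_mat2)
  have entry: "(A * B) $$ (i, j) = (\<Sum>k\<le>d. A $$ (i, k) * B $$ (k, j))"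
    if "A \<in> carrier_mat (d + 1) (d + 1)" "B \<in> carrier_mat (d + 1) (d + 1)" "i \<le> d" "j \<le> d" for A B :: "'a mat" and i j
    using that by (simp add: scalar_prod_def atLeast0LessThan lessThan_Suc_atMost)
  have T: "\<rho> (torus_elt t) $$ (k, i) = (if k = i then t powi (int d - 2 * int i) else 0)"
    if "t \<noteq> 0" "i \<le> d" "k \<le> d" for t i k
  proof -
    have "(\<rho> (torus_elt t) *\<^sub>v unit_vec (d + 1) i) $ k = \<rho> (torus_elt t) $$ (k, i)"
      using that car[OF S(3)[OF that(1)]] by (simp add: scalar_prod_right_unit)
    moreover have "(\<rho> (torus_elt t) *\<^sub>v unit_vec (d + 1) i) $ k = (if k = i then t powi (int d - 2 * int i) else 0)"
      unfolding tor[OF that(1,2)] using that by auto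
    ultimately show ?thesis by simp
  qed
  have conj: "t powi (int d - 2 * int i) * \<rho> g $$ (i, j) = \<rho> h $$ (i, j) * t powi (int d - 2 * int j)"
    if "t \<noteq> 0" "g \<in> SL2" "h \<in> SL2" "torus_elt t * g = h * torus_elt t" "i \<le> d" "j \<le> d" for t g h i j
  proof -
    have "\<rho> (torus_elt t) * \<rho> g = \<rho> h * \<rho> (torus_elt t)"
      using mult[OF S(3)[OF that(1)] that(2)] mult[OF that(3) S(3)[OF that(1)]] that(4) by simp
    then have "(\<rho> (torus_elt t) * \<rho> g) $$ (i, j) = (\<rho> h * \<rho> (torus_elt t)) $$ (i, j)" by simp
    then have "(\<Sum>k\<le>d. \<rho> (torus_elt t) $$ (i, k) * \<rho> g $$ (k, j)) = (\<Sum>k\<le>d. \<rho> h $$ (i, k) * \<rho> (torus_elt t) $$ (k, j))"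
      using entry[OF car[OF S(3)[OF that(1)]] car[OF that(2)] that(5,6)]
        entry[OF car[OF that(3)] car[OF S(3)[OF that(1)]] that(5,6)] by simp
    moreover have "(\<Sum>k\<le>d. \<rho> (torus_elt t) $$ (i, k) * \<rho> g $$ (k, j)) = (\<Sum>k\<le>d. if i = k then t powi (int d - 2 * int i) * \<rho> g $$ (i, j) else 0)"
      using T that by (intro sum.cong) auto
    moreover have "(\<Sum>k\<le>d. \<rho> h $$ (i, k) * \<rho> (torus_elt t) $$ (k, j)) = (\<Sum>k\<le>d. if k = j then \<rho> h $$ (i, j) * t powi (int d - 2 * int j) else 0)"
      using T that by (intro sum.cong) auto
    ultimately show ?thesis using that by simp
  qed
  have powi: "t ^ (2 * i) * t powi (int d - 2 * int i) = t ^ d" if "t \<noteq> 0" for t :: 'a and i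
  proof -
    have "t ^ (2 * i) * t powi (int d - 2 * int i) = t powi (int (2 * i)) * t powi (int d - 2 * int i)"
      by (simp only: power_int_of_nat)
    also have "\<dots> = t powi (int (2 * i) + (int d - 2 * int i))" using that by (subst power_int_add) auto
    finally show ?thesis by simp
  qed
  have hom: "t ^ (2 * i) * \<rho> h $$ (i, j) = t ^ (2 * j) * \<rho> g $$ (i, j)"
    if t: "t \<noteq> 0" and *: "g \<in> SL2" "h \<in> SL2" "torus_elt t * g = h * torus_elt t" "i \<le> d" "j \<le> d" for t g h i j
  proof -
    have "t ^ d * (t ^ (2 * i) * \<rho> h $$ (i, j)) = t ^ (2 * i) * t ^ (2 * j) * (\<rho> h $$ (i, j) * t powi (int d - 2 * int j))"
      unfolding powi[OF t, of j, symmetric] by (simp add: mult_ac)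
    also have "\<dots> = t ^ (2 * i) * t ^ (2 * j) * (t powi (int d - 2 * int i) * \<rho> g $$ (i, j))"
      using conj[OF t *] by simp
    also have "\<dots> = t ^ d * (t ^ (2 * j) * \<rho> g $$ (i, j))"
      unfolding powi[OF t, of i, symmetric] by (simp add: mult_ac)
    finally show ?thesis using t by simp
  qed
  define u where "u r i j = \<rho> (upper_unip r) $$ (i, j)" for r i j
  \<comment> \<open>Transposing lets the lower unipotents satisfy the same homogeneity relation as
    the upper ones.\<close>
  define l where "l r i j = \<rho> (lower_unip r) $$ (j, i)" for r i j
  have u_add: "u (r + s) i j = (\<Sum>k\<le>d. u r i k * u s k j)" if "i \<le> d" "j \<le> d" for r s i j
  proof -
    have "upper_unip (r + s) = upper_unip r * upper_unip s"
      unfolding upper_unip_def mat2_mult by (simp add: add.commute)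
    then show ?thesis using entry[OF car[OF S(1)] car[OF S(1)] that] by (simp add: u_def mult[OF S(1) S(1)])
  qed
  have l_add: "l (r + s) i j = (\<Sum>k\<le>d. l r i k * l s k j)" if "i \<le> d" "j \<le> d" for r s i j
  proof -
    have "lower_unip (r + s) = lower_unip s * lower_unip r"
      unfolding lower_unip_def mat2_mult by (simp add: add.commute)
    then have "l (r + s) i j = (\<Sum>k\<le>d. \<rho> (lower_unip s) $$ (j, k) * \<rho> (lower_unip r) $$ (k, i))"
      using entry[OF car[OF S(2)] car[OF S(2)] that(2,1)] by (simp add: l_def mult[OF S(2) S(2)])
    then show ?thesis by (simp add: l_def mult.commute)
  qed
  have u_hom: "t ^ (2 * i) * u (t ^ 2 * r) i j = t ^ (2 * j) * u r i j" if "t \<noteq> 0" "i \<le> d" "j \<le> d" for t r i j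
  proof -
    have e: "t ^ 2 * r * inverse t = t * r" using that by (simp add: power2_eq_square)
    have "torus_elt t * upper_unip r = upper_unip (t ^ 2 * r) * torus_elt t"
      unfolding torus_elt_def upper_unip_def mat2_mult
      by (simp only: e mult_1_left mult_1_right mult_zero_left mult_zero_right add_0_left add_0_right)
    then show ?thesis unfolding u_def using that by (intro hom S)
  qed
  have l_hom: "t ^ (2 * i) * l (t ^ 2 * r) i j = t ^ (2 * j) * l r i j" if "t \<noteq> 0" "i \<le> d" "j \<le> d" for t r i j
  proof -
    have e: "inverse t * (t ^ 2 * r) = r * t" using that by (simp add: power2_eq_square)
    have "torus_elt t * lower_unip (t ^ 2 * r) = lower_unip r * torus_elt t"
      unfolding torus_elt_def lower_unip_def mat2_mult
      by (simp only: e mult_1_left mult_1_right mult_zero_left mult_zero_right add_0_left add_0_right)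
    then have "t ^ (2 * j) * \<rho> (lower_unip r) $$ (j, i) = t ^ (2 * i) * \<rho> (lower_unip (t ^ 2 * r)) $$ (j, i)"
      using that by (intro hom S)
    then show ?thesis by (simp add: l_def)
  qed
  have "\<forall>i j. \<exists>c. i \<le> d \<longrightarrow> j \<le> d \<longrightarrow> (\<forall>r. u r i j = (if i \<le> j then c * r ^ (j - i) else 0))"
    using homogeneous_one_parameter_group[OF u_add u_hom] by blast
  then obtain a where a: "\<And>i j r. i \<le> d \<Longrightarrow> j \<le> d \<Longrightarrow> u r i j = (if i \<le> j then a i j * r ^ (j - i) else 0)"
    by metis
  have lz: "l r i j = 0" if "i \<le> d" "j \<le> d" "j < i" for r i j
    using homogeneous_one_parameter_group[OF l_add l_hom that(1,2)] that(3) by auto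
  have rel: "a i k * a k j = of_nat ((j - i) choose (k - i)) * a i j" if "i \<le> k" "k \<le> j" "j \<le> d" for i k j
    by (rule coeff_relation[OF a u_add that])
  have "upper_unip 0 = (1\<^sub>m 2 :: 'a mat)"
    unfolding upper_unip_def by (rule eq_matI) (auto simp: mat_of_rows_list_def numeral_2_eq_2 less_Suc_eq)
  then have a00: "a 0 0 = 1" using a[of 0 0 0] one by (simp add: u_def)
  have "a 0 p \<noteq> 0" if p: "p \<le> d" for p
  proof
    assume "a 0 p = 0"
    \<comment> \<open>With \<open>p0 = Suc q\<close> the least vanishing entry, \<open>rel\<close>
      forces \<open>a q (Suc q) = 0\<close> and from there all \<open>a k j\<close> with
      \<open>k \<le> q\<close> and \<open>j > q\<close>.\<close>
    define p0 where "p0 = (LEAST p. a 0 p = 0)"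
    have p0: "a 0 p0 = 0" "p0 \<le> p" unfolding p0_def using \<open>a 0 p = 0\<close> by (rule LeastI, rule Least_le)
    then have "p0 \<noteq> 0" using a00 by (intro notI) simp
    then obtain q where q: "p0 = Suc q" by (cases p0) auto
    have "a 0 q \<noteq> 0" using not_less_Least[of q "\<lambda>p. a 0 p = 0"] q p0_def by auto
    moreover have "a 0 q * a q (Suc q) = 0" using rel[of 0 q "Suc q"] p0 q p by simp
    ultimately have qq: "a q (Suc q) = 0" by simp
    have aq: "a q j = 0" if "Suc q \<le> j" "j \<le> d" for j
    proof -
      have "of_nat ((j - q) choose 1) * a q j = 0" using rel[of q "Suc q" j] that qq by simp
      then show ?thesis using that by simp
    qed
    have az: "a k j = 0" if "k \<le> q" "Suc q \<le> j" "j \<le> d" for k j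
    proof -
      have "of_nat ((j - k) choose (q - k)) * a k j = 0" using rel[of k q j] that aq[of j] by simp
      moreover have "q - k \<le> j - k" using that by linarith
      then have "(of_nat ((j - k) choose (q - k)) :: 'a) \<noteq> 0" by (simp add: not_less)
      ultimately show ?thesis by (simp only: mult_eq_0_iff simp_thms)
    qed
    define V where "V = {x \<in> carrier_vec (d + 1). \<forall>k\<le>q. x $ k = (0 :: 'a)}"
    have inv: "\<rho> g *\<^sub>v x \<in> V" if g: "g \<in> SL2" "x \<in> V" for g x
    proof -
      have "\<forall>x\<in>V. \<rho> g *\<^sub>v x \<in> V"
      proof (rule SL2_generated[OF g(1), where Q = "\<lambda>g. \<forall>x\<in>V. \<rho> g *\<^sub>v x \<in> V"])
        have gen: "\<forall>x\<in>V. \<rho> h *\<^sub>v x \<in> V" if h: "h \<in> SL2" and z: "\<And>k j. k \<le> q \<Longrightarrow> Suc q \<le> j \<Longrightarrow> j \<le> d \<Longrightarrow> \<rho> h $$ (k, j) = 0" for h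
        proof
          fix x assume x: "x \<in> V"
          have "(\<rho> h *\<^sub>v x) $ k = 0" if "k \<le> q" for k
          proof -
            have "(\<rho> h *\<^sub>v x) $ k = (\<Sum>j\<le>d. \<rho> h $$ (k, j) * x $ j)"
              using that car[OF h] x p p0(2) q by (auto simp: V_def scalar_prod_def atLeast0LessThan lessThan_Suc_atMost)
            also have "\<dots> = 0"
              using x z[OF that] by (intro sum.neutral) (force simp: V_def not_less_eq_eq)
            finally show ?thesis .
          qed
          then show "\<rho> h *\<^sub>v x \<in> V" using car[OF h] x by (auto simp: V_def)
        qed
        show "\<forall>x\<in>V. \<rho> (upper_unip r) *\<^sub>v x \<in> V" for r
        proof (rule gen[OF S(1)])
          fix k j assume kj: "k \<le> q" "Suc q \<le> j" "j \<le> d"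
          then have "u r k j = 0" using a[of k j r] az by auto
          then show "\<rho> (upper_unip r) $$ (k, j) = 0" by (simp add: u_def)
        qed
        show "\<forall>x\<in>V. \<rho> (lower_unip r) *\<^sub>v x \<in> V" for r
        proof (rule gen[OF S(2)])
          fix k j assume kj: "k \<le> q" "Suc q \<le> j" "j \<le> d"
          then have "l r j k = 0" by (intro lz) auto
          then show "\<rho> (lower_unip r) $$ (k, j) = 0" by (simp add: l_def)
        qed
        show "\<forall>x\<in>V. \<rho> (g * h) *\<^sub>v x \<in> V"
          if gh: "g \<in> SL2" "h \<in> SL2" "\<forall>x\<in>V. \<rho> g *\<^sub>v x \<in> V" "\<forall>x\<in>V. \<rho> h *\<^sub>v x \<in> V" for g h
        proof
          fix x assume x: "x \<in> V"
          then have "\<rho> (g * h) *\<^sub>v x = \<rho> g *\<^sub>v (\<rho> h *\<^sub>v x)"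
            using mult[OF gh(1,2)] car[OF gh(1)] car[OF gh(2)] by (simp add: V_def)
          then show "\<rho> (g * h) *\<^sub>v x \<in> V" using gh x by simp
        qed
      qed
      then show ?thesis using g(2) by blast
    qed
    interpret vs: vec_space "TYPE('a)" "d + 1" .
    have "VectorSpace.subspace class_ring V (module_vec TYPE('a) (d + 1))"
    proof (rule subspace.intro)
      show "vectorspace class_ring (module_vec TYPE('a) (d + 1))" by (rule vec_vs)
      show "submodule class_ring V (module_vec TYPE('a) (d + 1))"
        using p0(2) q p vec_module[of "d + 1"]
        by (intro submodule.intro) (auto simp: V_def module_vec_simps class_ring_simps)
    qed
    then have "V = {0\<^sub>v (d + 1)} \<or> V = carrier_vec (d + 1)"
      using irr inv unfolding irreducible_SL2_representation_def by blast
    moreover have "unit_vec (d + 1) (Suc q) \<in> V" using q p0(2) p by (auto simp: V_def)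
    moreover have "unit_vec (d + 1) 0 \<notin> V" using p0(2) q p by (auto simp: V_def intro!: exI[of _ 0])
    moreover have "unit_vec (d + 1) (Suc q) \<noteq> (0\<^sub>v (d + 1) :: 'a vec)"
    proof
      assume "unit_vec (d + 1) (Suc q) = (0\<^sub>v (d + 1) :: 'a vec)"
      then have "unit_vec (d + 1) (Suc q) $ Suc q = (0\<^sub>v (d + 1) :: 'a vec) $ Suc q" by simp
      then show False using p0(2) q p by simp
    qed
    ultimately show False by auto
  qed
  moreover have "\<rho> (upper_unip r) $$ (0, p) = a 0 p * r ^ p" if "p \<le> d" for r p
    using a[of 0 p r] that by (simp add: u_def)
  ultimately show ?thesis by blast
qed

section \<open>Orthogonal families\<close>

text \<open>The image contains the rationals, and images of balls are compact, so it contains every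
  real number. The conjugate of \<open>\<phi> x\<close> is the real number
  \<open>2 * Re (\<phi> x)\<close> minus \<open>\<phi> x\<close>.\<close>

lemma isometric_embedding_conj:
  fixes \<phi> :: "'a::local_field_char_0 \<Rightarrow> complex"
  assumes "isometric_embedding \<phi>"
  shows "\<exists>cj. \<forall>x. \<phi> (cj x) = cnj (\<phi> x)"
proof -
  have add: "\<phi> (x + y) = \<phi> x + \<phi> y" and mult: "\<phi> (x * y) = \<phi> x * \<phi> y" and one: "\<phi> 1 = 1"
    and norm: "cmod (\<phi> x) = absval x" for x y
    using assms by (auto simp: isometric_embedding_def)
  have zero: "\<phi> 0 = 0" using norm[of 0] by simp
  have minus: "\<phi> (- x) = - \<phi> x" for x using add[of x "- x"] zero by (simp add: eq_neg_iff_add_eq_0 add.commute)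
  have diff: "\<phi> (x - y) = \<phi> x - \<phi> y" for x y using add[of x "- y"] minus[of y] by simp
  have nat: "\<phi> (of_nat k) = of_nat k" for k by (induction k) (simp_all add: zero one add)
  have int: "\<phi> (of_int k) = of_int k" for k by (cases k rule: int_cases2) (simp_all add: nat minus)
  have quot: "\<phi> (of_int a / of_int b) = of_int a / of_int b" if "b \<noteq> 0" for a b
  proof -
    have "\<phi> (of_int a / of_int b) * \<phi> (of_int b) = \<phi> (of_int a)" using that by (simp flip: mult)
    then show ?thesis using that by (simp add: int field_simps)
  qed
  have real: "\<exists>x. \<phi> x = complex_of_real r" for r
  proof -
    have "continuous_on (fball (\<bar>r\<bar> + 1)) \<phi>"
      by (rule lipschitz_on_continuous_on[where L = 1], rule lipschitz_onI)
        (simp_all add: dist_norm dist_absval norm flip: diff)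
    then have "compact (\<phi> ` fball (\<bar>r\<bar> + 1))" by (rule compact_continuous_image) (rule compact_fball)
    then have cl: "closed (\<phi> ` fball (\<bar>r\<bar> + 1))" by (rule compact_imp_closed)
    have "complex_of_real r \<in> closure (\<phi> ` fball (\<bar>r\<bar> + 1))"
      unfolding closure_approachable
    proof (intro allI impI)
      fix e :: real assume e: "0 < e"
      obtain s where s: "s \<in> \<rat>" "r < s" "s < r + min e 1"
        using Rats_dense_in_real[of r "r + min e 1"] e by auto
      obtain a b where ab: "b \<noteq> (0 :: int)" "s = of_int a / of_int b"
        using s(1) by (elim Rats_cases') (metis less_irrefl that)
      let ?x = "of_int a / of_int b :: 'a"
      have eq: "\<phi> ?x = complex_of_real s" unfolding quot[OF ab(1)] ab(2) by simp
      have "absval ?x = \<bar>s\<bar>" unfolding norm[symmetric] eq by simp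
      then have "?x \<in> fball (\<bar>r\<bar> + 1)" using s by simp
      moreover have "dist (\<phi> ?x) (complex_of_real r) < e" unfolding eq dist_of_real using s by (simp add: dist_real_def)
      ultimately show "\<exists>y\<in>\<phi> ` fball (\<bar>r\<bar> + 1). dist y (complex_of_real r) < e" by blast
    qed
    then show ?thesis unfolding closure_closed[OF cl] by (metis imageE)
  qed
  have "\<exists>y. \<phi> y = cnj (\<phi> x)" for x
  proof -
    obtain z where z: "\<phi> z = complex_of_real (2 * Re (\<phi> x))" using real by blast
    have "\<phi> (z - x) = cnj (\<phi> x)" unfolding diff z by (simp add: complex_eq_iff)
    then show ?thesis by blast
  qed
  then show ?thesis by metis
qed

text \<open>One constant \<open>A\<close> has to serve every family \<open>g\<close> with entries at
  most 1 and inverse bounded by \<open>K\<close>. The coefficient 1 of \<open>g j\<close> in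
  \<open>h j\<close> is recorded because, with the inverse bound, it prevents \<open>h j\<close>
  from being short.\<close>

definition gram_schmidt_bound :: "('a::local_field_char_0 \<Rightarrow> 'a) \<Rightarrow> nat \<Rightarrow> real \<Rightarrow> nat \<Rightarrow> real \<Rightarrow> bool" where
  "gram_schmidt_bound cj m K k A \<longleftrightarrow> (\<forall>g :: nat \<Rightarrow> nat \<Rightarrow> 'a.
    (\<forall>j<m. \<forall>l<m. absval (g j l) \<le> 1) \<longrightarrow>
    (\<forall>y B. (\<forall>l<m. absval (\<Sum>j<m. y j * g j l) \<le> B) \<longrightarrow> (\<forall>j<m. absval (y j) \<le> K * B)) \<longrightarrow>
    (\<exists>h. (\<forall>j<k. \<exists>\<nu>. \<nu> j = 1 \<and> (\<forall>l. h j l = (\<Sum>i\<le>j. \<nu> i * g i l))) \<and>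
       (\<forall>i<k. \<forall>j<k. i \<noteq> j \<longrightarrow> (\<Sum>l<m. h i l * cj (h j l)) = 0) \<and>
       (\<forall>j<k. \<exists>\<mu>. (\<forall>l. g j l = h j l + (\<Sum>i<j. \<mu> i * h i l)) \<and> (\<forall>i<j. absval (\<mu> i) \<le> A)) \<and>
       (\<forall>j<k. \<forall>l<m. absval (h j l) \<le> A)))"

text \<open>\<open>cj\<close> stands for complex conjugation transported to the field. Positivity
  and Hermitian symmetry of the inner product enter as \<open>lower\<close> and \<open>sym\<close>,
  so the argument can be carried out inside the field.\<close>

lemma gram_schmidt:
  fixes cj :: "'a::local_field_char_0 \<Rightarrow> 'a"
  assumes cj: "\<And>x. absval (cj x) = absval x"
    and lower: "\<And>x :: nat \<Rightarrow> 'a. \<And>l. l < m \<Longrightarrow> absval (x l) ^ 2 \<le> absval (\<Sum>l<m. x l * cj (x l))"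
    and sym: "\<And>x y :: nat \<Rightarrow> 'a. (\<Sum>l<m. x l * cj (y l)) = 0 \<Longrightarrow> (\<Sum>l<m. y l * cj (x l)) = 0"
    and K: "0 < K"
  shows "k \<le> m \<Longrightarrow> \<exists>A\<ge>1. gram_schmidt_bound cj m K k A"
proof (induction k)
  case 0
  show ?case by (intro exI[of _ 1]) (auto simp: gram_schmidt_bound_def)
next
  case (Suc k)
  have "k \<le> m" using Suc.prems by simp
  from Suc.IH[OF this] obtain A where A: "1 \<le> A" and IH: "gram_schmidt_bound cj m K k A" by blast
  define A1 where "A1 = real m * A * K ^ 2"
  define A2 where "A2 = A + A1 + (1 + real k * (A1 * A))"
  have A1: "0 \<le> A1" using A by (simp add: A1_def)
  have A2: "1 \<le> A2" "A \<le> A2" "A1 \<le> A2" "1 + real k * (A1 * A) \<le> A2"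
    using A A1 by (auto simp: A2_def)
  show ?case
  proof (intro exI[of _ A2] conjI gram_schmidt_bound_def[THEN iffD2] allI impI)
    fix g :: "nat \<Rightarrow> nat \<Rightarrow> 'a"
    assume g1: "\<forall>j<m. \<forall>l<m. absval (g j l) \<le> 1"
      and g2: "\<forall>y B. (\<forall>l<m. absval (\<Sum>j<m. y j * g j l) \<le> B) \<longrightarrow> (\<forall>j<m. absval (y j) \<le> K * B)"
    obtain h where H: "\<forall>j<k. \<exists>\<nu>. \<nu> j = 1 \<and> (\<forall>l. h j l = (\<Sum>i\<le>j. \<nu> i * g i l))"
        "\<forall>i<k. \<forall>j<k. i \<noteq> j \<longrightarrow> (\<Sum>l<m. h i l * cj (h j l)) = 0"
        "\<forall>j<k. \<exists>\<mu>. (\<forall>l. g j l = h j l + (\<Sum>i<j. \<mu> i * h i l)) \<and> (\<forall>i<j. absval (\<mu> i) \<le> A)"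
        "\<forall>j<k. \<forall>l<m. absval (h j l) \<le> A"
      using IH[unfolded gram_schmidt_bound_def, THEN spec, THEN mp, THEN mp, OF g1 g2]
      by (elim exE conjE) (rule that)
    note h1 = H(1)[rule_format] and h2 = H(2)[rule_format] and h3 = H(3)[rule_format] and h4 = H(4)[rule_format]
    define ip where "ip x y = (\<Sum>l<m. x l * cj (y l))" for x y :: "nat \<Rightarrow> 'a"
    \<comment> \<open>The coefficient 1 and the inverse bound give an entry of \<open>h i\<close> of
      size at least \<open>1 / K\<close>, so the divisions in the projection coefficients are
      controlled.\<close>
    have big: "1 \<le> K ^ 2 * absval (ip (h i) (h i))" if i: "i < k" for i
    proof -
      obtain \<nu> where \<nu>: "\<nu> i = 1" "\<And>l. h i l = (\<Sum>i'\<le>i. \<nu> i' * g i' l)" using h1[OF i] by blast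
      let ?y = "\<lambda>j. if j \<le> i then \<nu> j else 0"
      have s: "(\<Sum>j<m. ?y j * g j l) = h i l" for l
      proof -
        have "(\<Sum>j<m. ?y j * g j l) = (\<Sum>j\<le>i. ?y j * g j l)"
          using i Suc.prems by (intro sum.mono_neutral_right) auto
        then show ?thesis unfolding \<nu>(2) by simp
      qed
      define M where "M = Max ((\<lambda>l. absval (h i l)) ` {..<m})"
      have "0 \<in> {..<m}" using i Suc.prems by simp
      then have ne: "(\<lambda>l. absval (h i l)) ` {..<m} \<noteq> {}" by blast
      have "absval (h i l) \<le> M" if "l < m" for l unfolding M_def using that by (intro Max_ge) auto
      then have "\<forall>l<m. absval (\<Sum>j<m. ?y j * g j l) \<le> M" unfolding s by blast
      then have "absval (?y i) \<le> K * M" using g2 i Suc.prems by (meson Suc_le_lessD less_trans)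
      then have KM: "1 \<le> K * M" using \<nu>(1) by simp
      have "M \<in> (\<lambda>l. absval (h i l)) ` {..<m}" unfolding M_def using ne by (intro Max_in) auto
      then obtain l where l: "l < m" "M = absval (h i l)" by auto
      have "1 \<le> (K * M) ^ 2" using KM by (rule one_le_power)
      also have "\<dots> \<le> K ^ 2 * absval (ip (h i) (h i))"
        unfolding power_mult_distrib l(2) ip_def using lower[OF l(1)] by (intro mult_left_mono) auto
      finally show ?thesis .
    qed
    have nz: "ip (h i) (h i) \<noteq> 0" if "i < k" for i using big[OF that] by auto
    define \<mu> where "\<mu> i = ip (g k) (h i) / ip (h i) (h i)" for i
    have \<mu>A: "absval (\<mu> i) \<le> A1" if i: "i < k" for i
    proof -
      have "absval (ip (g k) (h i)) \<le> real (card {..<m}) * A"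
        unfolding ip_def
      proof (rule absval_sum_bound)
        fix l assume "l \<in> {..<m}"
        then have "absval (g k l) * absval (h i l) \<le> 1 * A"
          using g1 h4[OF i] Suc.prems by (intro mult_mono) auto
        then show "absval (g k l * cj (h i l)) \<le> A" by (simp add: absval_mult cj)
      qed
      then have "absval (\<mu> i) \<le> real m * A * (1 / absval (ip (h i) (h i)))"
        unfolding \<mu>_def absval_divide by (simp add: divide_right_mono)
      also have "\<dots> \<le> real m * A * K ^ 2"
        using big[OF i] nz[OF i] A by (intro mult_left_mono) (auto simp: divide_le_eq)
      finally show ?thesis by (simp add: A1_def)
    qed
    define hk where "hk l = g k l - (\<Sum>i<k. \<mu> i * h i l)" for l
    define h' where "h' = h(k := hk)"
    have h'k: "h' k = hk" "\<And>j. j < k \<Longrightarrow> h' j = h j" by (auto simp: h'_def)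
    have orth: "ip hk (h j) = 0" if j: "j < k" for j
    proof -
      have "ip hk (h j) = ip (g k) (h j) - (\<Sum>i<k. \<mu> i * ip (h i) (h j))"
        unfolding ip_def hk_def
        by (simp add: left_diff_distrib sum_subtractf sum_distrib_right sum_distrib_left mult.assoc sum.swap[of _ "{..<m}"])
      also have "(\<Sum>i<k. \<mu> i * ip (h i) (h j)) = (\<Sum>i<k. if i = j then \<mu> j * ip (h j) (h j) else 0)"
        using h2 j by (intro sum.cong) (auto simp: ip_def)
      also have "\<dots> = ip (g k) (h j)" using j nz[OF j] by (simp add: \<mu>_def)
      finally show ?thesis by simp
    qed
    show "\<exists>h. (\<forall>j<Suc k. \<exists>\<nu>. \<nu> j = 1 \<and> (\<forall>l. h j l = (\<Sum>i\<le>j. \<nu> i * g i l))) \<and>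
       (\<forall>i<Suc k. \<forall>j<Suc k. i \<noteq> j \<longrightarrow> (\<Sum>l<m. h i l * cj (h j l)) = 0) \<and>
       (\<forall>j<Suc k. \<exists>\<mu>. (\<forall>l. g j l = h j l + (\<Sum>i<j. \<mu> i * h i l)) \<and> (\<forall>i<j. absval (\<mu> i) \<le> A2)) \<and>
       (\<forall>j<Suc k. \<forall>l<m. absval (h j l) \<le> A2)"
    proof (intro exI[of _ h'] conjI allI impI)
      fix j assume j: "j < Suc k"
      show "\<exists>\<nu>. \<nu> j = 1 \<and> (\<forall>l. h' j l = (\<Sum>i\<le>j. \<nu> i * g i l))"
      proof (cases "j = k")
        case False
        then show ?thesis using h1[of j] h'k(2)[of j] j by simp
      next
        case True
        have "\<forall>i\<in>{..<k}. \<exists>\<nu>. \<nu> i = 1 \<and> (\<forall>l. h i l = (\<Sum>i'\<le>i. \<nu> i' * g i' l))" using h1 by auto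
        from bchoice[OF this] obtain N where N: "\<And>i l. i < k \<Longrightarrow> h i l = (\<Sum>i'\<le>i. N i i' * g i' l)" by auto
        define \<nu> where "\<nu> i' = (if i' = k then 1 else - (\<Sum>i<k. if i' \<le> i then \<mu> i * N i i' else 0))" for i'
        have hk: "hk l = (\<Sum>i\<le>k. \<nu> i * g i l)" for l
        proof -
          have "(\<Sum>i<k. \<mu> i * h i l) = (\<Sum>i<k. \<Sum>i'<k. (if i' \<le> i then \<mu> i * N i i' else 0) * g i' l)"
          proof (rule sum.cong)
            fix i assume i: "i \<in> {..<k}"
            have "(\<Sum>i'<k. (if i' \<le> i then \<mu> i * N i i' else 0) * g i' l) = (\<Sum>i'\<le>i. (if i' \<le> i then \<mu> i * N i i' else 0) * g i' l)"
              using i by (intro sum.mono_neutral_right) auto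
            also have "\<dots> = \<mu> i * h i l" using N[of i l] i by (simp add: sum_distrib_left mult.assoc)
            finally show "\<mu> i * h i l = (\<Sum>i'<k. (if i' \<le> i then \<mu> i * N i i' else 0) * g i' l)" by simp
          qed simp
          also have "\<dots> = (\<Sum>i'<k. (\<Sum>i<k. if i' \<le> i then \<mu> i * N i i' else 0) * g i' l)"
            by (subst sum.swap) (simp add: sum_distrib_right)
          also have "\<dots> = (\<Sum>i'<k. - (\<nu> i' * g i' l))" by (intro sum.cong) (auto simp: \<nu>_def)
          finally have "(\<Sum>i<k. \<mu> i * h i l) = - (\<Sum>i'<k. \<nu> i' * g i' l)" by (simp add: sum_negf)
          moreover have "{..k} = insert k {..<k}" by auto
          ultimately show ?thesis by (simp add: hk_def \<nu>_def)
        qed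
        show ?thesis using hk True by (intro exI[of _ \<nu>]) (simp add: h'k \<nu>_def)
      qed
    next
      fix i j assume ij: "i < Suc k" "j < Suc k" "i \<noteq> j"
      consider "i = k" "j < k" | "j = k" "i < k" | "i < k" "j < k" using ij by linarith
      then show "(\<Sum>l<m. h' i l * cj (h' j l)) = 0"
      proof cases
        case 1
        then show ?thesis using orth[of j] by (simp add: h'k ip_def)
      next
        case 2
        then show ?thesis using sym[of hk "h i"] orth[of i] by (simp add: h'k ip_def)
      next
        case 3
        then show ?thesis using h2 ij(3) by (simp add: h'k)
      qed
    next
      fix j assume j: "j < Suc k"
      show "\<exists>\<mu>. (\<forall>l. g j l = h' j l + (\<Sum>i<j. \<mu> i * h' i l)) \<and> (\<forall>i<j. absval (\<mu> i) \<le> A2)"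
      proof (cases "j = k")
        case False
        then have jk: "j < k" using j by simp
        obtain \<mu>' where "\<And>l. g j l = h j l + (\<Sum>i<j. \<mu>' i * h i l)" "\<And>i. i < j \<Longrightarrow> absval (\<mu>' i) \<le> A"
          using h3[OF jk] by blast
        then show ?thesis using jk A2 h'k(2) by (intro exI[of _ \<mu>']) (auto intro: order_trans)
      next
        case True
        then show ?thesis using \<mu>A A2 h'k by (intro exI[of _ \<mu>]) (auto simp: hk_def intro: order_trans)
      qed
    next
      fix j l assume jl: "j < Suc k" "l < m"
      show "absval (h' j l) \<le> A2"
      proof (cases "j = k")
        case False
        then show ?thesis using h4[of j l] jl A2 h'k(2)[of j] by auto
      next
        case True
        have "absval (\<Sum>i<k. \<mu> i * h i l) \<le> real (card {..<k}) * (A1 * A)"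
          using \<mu>A h4 jl A1 by (intro absval_sum_bound) (auto simp: absval_mult intro!: mult_mono)
        moreover have "absval (g k l) \<le> 1" using g1 jl Suc.prems by simp
        ultimately have "absval (hk l) \<le> 1 + real (card {..<k}) * (A1 * A)"
          unfolding hk_def by (intro absval_triangle_diff_le)
        then show ?thesis using A2(4) True h'k by simp
      qed
    qed
  qed (rule A2(1))
qed

lemma sorted_permutation:
  fixes \<rho> :: "nat \<Rightarrow> real"
  shows "\<exists>\<sigma>. bij_betw \<sigma> {..<m} {..<m} \<and> (\<forall>i<m. \<forall>j<m. i \<le> j \<longrightarrow> \<rho> (\<sigma> j) \<le> \<rho> (\<sigma> i))"
proof -
  define xs where "xs = sort_key (\<lambda>i. - \<rho> i) [0..<m]"
  have len: "length xs = m" and set: "set xs = {..<m}" and dist: "distinct xs"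
    by (auto simp: xs_def)
  have sorted: "sorted (map (\<lambda>i. - \<rho> i) xs)" by (simp add: xs_def)
  have "bij_betw (\<lambda>i. xs ! i) {..<m} {..<m}"
    by (rule bij_betw_nth[OF dist]) (simp_all only: len set)
  moreover have "\<rho> (xs ! j) \<le> \<rho> (xs ! i)" if "i < m" "j < m" "i \<le> j" for i j
    using sorted_nth_mono[OF sorted that(3)] that len by simp
  ultimately show ?thesis by blast
qed

text \<open>The constant is uniform in the family \<open>f\<close> and the radii; sorting the radii makes the
  triangular change of basis of the Gram-Schmidt process bounded on the box.\<close>

lemma orthogonal_box:
  "\<exists>A\<ge>1. \<forall>(f :: nat \<Rightarrow> nat \<Rightarrow> 'a::local_field_char_0) \<rho>. quasi_orthonormal {..<m} f \<longrightarrow> (\<forall>j<m. 0 < \<rho> j) \<longrightarrow> 0 < m \<longrightarrow>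
    (\<exists>\<sigma> x h. bij_betw \<sigma> {..<m} {..<m} \<and> (\<forall>j<m. absval (x j) \<le> A * \<rho> (\<sigma> j)) \<and>
      (\<forall>j<m. \<forall>l<m. absval (h j l) \<le> A) \<and>
      orthogonal_family m (m - 1) (\<lambda>j. vec m (\<lambda>l. x j * h j l)) \<and>
      (\<forall>y. (\<forall>j<m. absval (y j) \<le> \<rho> j) \<longrightarrow>
        (\<exists>r. (\<forall>j<m. absval (r j) \<le> 1) \<and> (\<forall>l<m. (\<Sum>j<m. y j * f j l) = (\<Sum>j<m. r j * (x j * h j l))))))"
proof -
  obtain \<Lambda> where \<Lambda>: "1 \<le> \<Lambda>" "\<And>\<rho>. 0 < \<rho> \<Longrightarrow> \<exists>x::'a. \<rho> \<le> absval x \<and> absval x \<le> \<Lambda> * \<rho>"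
    using scale_exists[where 'a = 'a] by blast
  show ?thesis
  proof (cases "nonarchimedean TYPE('a)")
    case True
    show ?thesis
    proof (intro exI[of _ \<Lambda>] conjI allI impI \<Lambda>(1))
      fix f :: "nat \<Rightarrow> nat \<Rightarrow> 'a" and \<rho> :: "nat \<Rightarrow> real"
      assume f: "quasi_orthonormal {..<m} f" and \<rho>: "\<forall>j<m. 0 < \<rho> j" and m: "0 < m"
      have f1: "absval (f j l) \<le> 1" if "j < m" "l < m" for j l
        using f that by (auto simp: quasi_orthonormal_def)
      have f2: "absval (y j) \<le> B" if "\<And>l. l < m \<Longrightarrow> absval (\<Sum>j<m. y j * f j l) \<le> B" "j < m" for y B j
        using f that True unfolding quasi_orthonormal_def by (simp add: lessThan_def)
      have "\<forall>j\<in>{..<m}. \<exists>x::'a. \<rho> j \<le> absval x \<and> absval x \<le> \<Lambda> * \<rho> j" using \<Lambda>(2) \<rho> by auto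
      from bchoice[OF this] obtain x :: "nat \<Rightarrow> 'a" where x: "\<And>j. j < m \<Longrightarrow> \<rho> j \<le> absval (x j)" "\<And>j. j < m \<Longrightarrow> absval (x j) \<le> \<Lambda> * \<rho> j"
        by auto
      let ?w = "\<lambda>j. vec m (\<lambda>l. x j * f j l)"
      have norm_ge: "absval (v $ l) \<le> vec_norm v" if "l < m" "dim_vec v = m" for v :: "'a vec" and l
        unfolding vec_norm_def coord_norm_def using that True by auto
      have norm_le: "vec_norm v \<le> B" if "dim_vec v = m" "\<And>l. l < m \<Longrightarrow> absval (v $ l) \<le> B" for v :: "'a vec" and B
      proof -
        have "Max ((\<lambda>l. absval (v $ l)) ` {..<dim_vec v}) \<le> B"
          using that m by (intro Max.boundedI) auto
        then show ?thesis unfolding vec_norm_def coord_norm_def using True by simp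
      qed
      have mm: "{..m - 1} = {..<m}" using m by auto
      \<comment> \<open>With constant 1, the bound on coefficients in
        \<open>quasi_orthonormal\<close> is one half of orthogonality; the ultrametric inequality is
        the other.\<close>
      have orth: "orthogonal_family m (m - 1) ?w"
        unfolding orthogonal_family_def mm using True
      proof (simp only: if_True, intro allI antisym)
        fix c :: "nat \<Rightarrow> 'a"
        let ?v = "vec m (\<lambda>l. \<Sum>j<m. c j * ?w j $ l)"
        let ?M = "Max ((\<lambda>j. absval (c j) * vec_norm (?w j)) ` {..<m})"
        have M: "absval (c j) * vec_norm (?w j) \<le> ?M" if "j < m" for j
          using that by (intro Max_ge) auto
        show "vec_norm ?v \<le> ?M"
        proof (rule norm_le)
          fix l assume l: "l < m"
          have le: "absval (c j * ?w j $ l) \<le> ?M" if "j \<in> {..<m}" for j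
          proof -
            have "absval (c j) * absval (?w j $ l) \<le> absval (c j) * vec_norm (?w j)"
              using l by (intro mult_left_mono norm_ge) auto
            then show ?thesis using M[of j] that by (auto simp: absval_mult intro: order_trans)
          qed
          have "0 \<le> ?M" using le[of 0] m by (meson absval_nonneg lessThan_iff order_trans)
          then have "absval (\<Sum>j<m. c j * ?w j $ l) \<le> ?M"
            by (rule ultrametric_sum_le[OF True]) (rule le)
          then show "absval (?v $ l) \<le> ?M" using l by simp
        qed simp
        show "?M \<le> vec_norm ?v"
        proof (rule Max.boundedI)
          fix b assume "b \<in> (\<lambda>j. absval (c j) * vec_norm (?w j)) ` {..<m}"
          then obtain j where j: "j < m" "b = absval (c j) * vec_norm (?w j)" by auto
          have "absval (c j * x j) \<le> vec_norm ?v"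
          proof (rule f2[OF _ j(1)])
            fix l assume l: "l < m"
            then show "absval (\<Sum>j<m. c j * x j * f j l) \<le> vec_norm ?v"
              using norm_ge[of l ?v] by (simp add: mult.assoc)
          qed
          moreover have "vec_norm (?w j) \<le> absval (x j)"
            using j f1 by (intro norm_le) (auto simp: absval_mult mult_left_le)
          then have "b \<le> absval (c j) * absval (x j)" unfolding j(2) by (intro mult_left_mono) auto
          ultimately show "b \<le> vec_norm ?v" by (simp add: absval_mult)
        qed (use m in auto)
      qed
      have "\<exists>r. (\<forall>j<m. absval (r j) \<le> 1) \<and> (\<forall>l<m. (\<Sum>j<m. y j * f j l) = (\<Sum>j<m. r j * (x j * f j l)))"
        if y: "\<forall>j<m. absval (y j) \<le> \<rho> j" for y
      proof (intro exI[of _ "\<lambda>j. y j / x j"] conjI allI impI)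
        have nz: "x j \<noteq> 0" if "j < m" for j using x(1)[OF that] \<rho> that by force
        show "absval (y j / x j) \<le> 1" if "j < m" for j
          using x(1)[OF that] y that nz[OF that] by (auto simp: absval_divide divide_le_eq_1 intro: order_trans)
        show "(\<Sum>j<m. y j * f j l) = (\<Sum>j<m. y j / x j * (x j * f j l))" for l
          using nz by (intro sum.cong) auto
      qed
      moreover have "absval (f j l) \<le> \<Lambda>" if "j < m" "l < m" for j l using f1[OF that] \<Lambda>(1) by linarith
      ultimately show "\<exists>\<sigma> x h. bij_betw \<sigma> {..<m} {..<m} \<and> (\<forall>j<m. absval (x j) \<le> \<Lambda> * \<rho> (\<sigma> j)) \<and>
        (\<forall>j<m. \<forall>l<m. absval (h j l) \<le> \<Lambda>) \<and> orthogonal_family m (m - 1) (\<lambda>j. vec m (\<lambda>l. x j * h j l)) \<and>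
        (\<forall>y. (\<forall>j<m. absval (y j) \<le> \<rho> j) \<longrightarrow>
          (\<exists>r. (\<forall>j<m. absval (r j) \<le> 1) \<and> (\<forall>l<m. (\<Sum>j<m. y j * f j l) = (\<Sum>j<m. r j * (x j * h j l)))))"
        using x(2) orth by (intro exI[of _ id] exI[of _ x] exI[of _ f]) auto
    qed
  next
    case False
    then obtain \<phi> :: "'a \<Rightarrow> complex" where \<phi>: "isometric_embedding \<phi>"
      using absval_ultrametric_or_usual[where 'a = 'a] by blast
    obtain cj where cj: "\<And>x. \<phi> (cj x) = cnj (\<phi> x)" using isometric_embedding_conj[OF \<phi>] by blast
    have add: "\<phi> (x + y) = \<phi> x + \<phi> y" and mult: "\<phi> (x * y) = \<phi> x * \<phi> y"
      and norm: "cmod (\<phi> x) = absval x" for x y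
      using \<phi> by (auto simp: isometric_embedding_def)
    have zero: "\<phi> x = 0 \<longleftrightarrow> x = 0" for x using norm[of x] by (metis absval_eq_0_iff norm_eq_zero)
    have sum: "\<phi> (\<Sum>l<m. g l) = (\<Sum>l<m. \<phi> (g l))" for g :: "nat \<Rightarrow> 'a" and m
      by (induction m) (simp_all add: add zero)
    have ipphi: "\<phi> (\<Sum>l<m. x l * cj (y l)) = (\<Sum>l<m. \<phi> (x l) * cnj (\<phi> (y l)))" for x y :: "nat \<Rightarrow> 'a"
      by (simp add: sum mult cj)
    have gs1: "absval (cj x) = absval x" for x by (simp add: cj flip: norm)
    have gs2: "absval (x l) ^ 2 \<le> absval (\<Sum>l<m. x l * cj (x l))" if "l < m" for x :: "nat \<Rightarrow> 'a" and l
    proof -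
      have re: "(\<Sum>l<m. \<phi> (x l) * cnj (\<phi> (x l))) = complex_of_real (\<Sum>l<m. absval (x l) ^ 2)"
        by (simp add: complex_norm_square[symmetric] norm)
      have "absval (\<Sum>l<m. x l * cj (x l)) = cmod (\<phi> (\<Sum>l<m. x l * cj (x l)))" by (rule norm[symmetric])
      also have "\<dots> = (\<Sum>l<m. absval (x l) ^ 2)"
        unfolding ipphi re norm_of_real by (simp add: sum_nonneg)
      finally have "absval (\<Sum>l<m. x l * cj (x l)) = (\<Sum>l<m. absval (x l) ^ 2)" .
      moreover have "absval (x l) ^ 2 \<le> (\<Sum>l<m. absval (x l) ^ 2)"
        using that by (intro member_le_sum) auto
      ultimately show ?thesis by simp
    qed
    have gs3: "(\<Sum>l<m. y l * cj (x l)) = 0" if "(\<Sum>l<m. x l * cj (y l)) = 0" for x y :: "nat \<Rightarrow> 'a"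
    proof -
      have "\<phi> (\<Sum>l<m. y l * cj (x l)) = cnj (\<phi> (\<Sum>l<m. x l * cj (y l)))"
        unfolding ipphi by (simp add: mult.commute)
      then show ?thesis using that zero[of 0] zero[of "\<Sum>l<m. y l * cj (x l)"] by simp
    qed
    have "\<exists>A\<ge>1. gram_schmidt_bound cj m (2 ^ m) m A"
      by (rule gram_schmidt[OF gs1 gs2 gs3]) auto
    then obtain A where A: "1 \<le> A" and GS: "gram_schmidt_bound cj m (2 ^ m) m A" by blast
    define A' where "A' = 1 + real m * A"
    define A3 where "A3 = A + \<Lambda> * A'"
    have A': "1 \<le> A'" "0 < A'" using A by (auto simp: A'_def add_pos_nonneg)
    have A3: "1 \<le> A3" "A \<le> A3" "\<Lambda> * A' \<le> A3" using A A' \<Lambda>(1) by (auto simp: A3_def add_increasing2)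
    show ?thesis
    proof (intro exI[of _ A3] conjI allI impI A3(1))
      fix f :: "nat \<Rightarrow> nat \<Rightarrow> 'a" and \<rho> :: "nat \<Rightarrow> real"
      assume f: "quasi_orthonormal {..<m} f" and \<rho>: "\<forall>j<m. 0 < \<rho> j" and m: "0 < m"
      obtain \<sigma> where \<sigma>: "bij_betw \<sigma> {..<m} {..<m}" "\<And>i j. i < m \<Longrightarrow> j < m \<Longrightarrow> i \<le> j \<Longrightarrow> \<rho> (\<sigma> j) \<le> \<rho> (\<sigma> i)"
        using sorted_permutation[of m \<rho>] by blast
      have \<sigma>m: "\<sigma> j < m" if "j < m" for j using \<sigma>(1) that by (auto simp: bij_betw_def)
      define g where "g j = f (\<sigma> j)" for j
      have reindex: "(\<Sum>j<m. F (\<sigma> j)) = (\<Sum>j<m. F j)" for F :: "nat \<Rightarrow> 'a"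
        by (rule sum.reindex_bij_betw[OF \<sigma>(1)])
      have g1: "\<forall>j<m. \<forall>l<m. absval (g j l) \<le> 1"
        using f \<sigma>m by (auto simp: quasi_orthonormal_def g_def)
      have g2: "\<forall>y B. (\<forall>l<m. absval (\<Sum>j<m. y j * g j l) \<le> B) \<longrightarrow> (\<forall>j<m. absval (y j) \<le> 2 ^ m * B)"
      proof (intro allI impI)
        fix y B j assume B: "\<forall>l<m. absval (\<Sum>j<m. y j * g j l) \<le> B" and j: "j < m"
        define \<tau> where "\<tau> = the_inv_into {..<m} \<sigma>"
        have \<tau>: "\<tau> (\<sigma> j) = j" if "j < m" for j
          unfolding \<tau>_def using \<sigma>(1) that by (intro the_inv_into_f_f) (auto simp: bij_betw_def)
        have "(\<Sum>j<m. y (\<tau> j) * f j l) = (\<Sum>j<m. y j * g j l)" for l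
          using reindex[of "\<lambda>j. y (\<tau> j) * f j l"] \<tau> by (simp add: g_def)
        then have "\<forall>k\<in>{..<m}. absval (\<Sum>j\<in>{..<m}. y (\<tau> j) * f j k) \<le> B" using B by simp
        moreover have "\<forall>y B. (\<forall>k\<in>{..<m}. absval (\<Sum>j\<in>{..<m}. y j * f j k) \<le> B) \<longrightarrow> (\<forall>j\<in>{..<m}. absval (y j) \<le> 2 ^ m * B)"
          using f False by (simp add: quasi_orthonormal_def)
        ultimately have "\<forall>j\<in>{..<m}. absval (y (\<tau> j)) \<le> 2 ^ m * B"
          by (elim allE[where x = "\<lambda>j. y (\<tau> j)"] allE[where x = B] mp)
        then show "absval (y j) \<le> 2 ^ m * B" using \<tau>[OF j] \<sigma>m[OF j] by force
      qed
      obtain h where h1: "\<And>i j. i < m \<Longrightarrow> j < m \<Longrightarrow> i \<noteq> j \<Longrightarrow> (\<Sum>l<m. h i l * cj (h j l)) = 0"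
        and h2: "\<And>j. j < m \<Longrightarrow> \<exists>\<mu>. (\<forall>l. g j l = h j l + (\<Sum>i<j. \<mu> i * h i l)) \<and> (\<forall>i<j. absval (\<mu> i) \<le> A)"
        and h3: "\<And>j l. j < m \<Longrightarrow> l < m \<Longrightarrow> absval (h j l) \<le> A"
        using GS[unfolded gram_schmidt_bound_def, THEN spec, THEN mp, THEN mp, OF g1 g2]
        by (elim exE conjE) (rule that, auto)
      have "\<forall>j\<in>{..<m}. \<exists>\<mu>. (\<forall>l. g j l = h j l + (\<Sum>i<j. \<mu> i * h i l)) \<and> (\<forall>i<j. absval (\<mu> i) \<le> A)" using h2 by auto
      from bchoice[OF this] obtain \<mu> where \<mu>: "\<And>j l. j < m \<Longrightarrow> g j l = h j l + (\<Sum>i<j. \<mu> j i * h i l)"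
        "\<And>j i. j < m \<Longrightarrow> i < j \<Longrightarrow> absval (\<mu> j i) \<le> A" by auto
      have "\<forall>j\<in>{..<m}. \<exists>x::'a. A' * \<rho> (\<sigma> j) \<le> absval x \<and> absval x \<le> \<Lambda> * (A' * \<rho> (\<sigma> j))"
        using \<Lambda>(2) \<rho> \<sigma>m A' by auto
      from bchoice[OF this] obtain x :: "nat \<Rightarrow> 'a" where x: "\<And>j. j < m \<Longrightarrow> A' * \<rho> (\<sigma> j) \<le> absval (x j)"
        "\<And>j. j < m \<Longrightarrow> absval (x j) \<le> \<Lambda> * (A' * \<rho> (\<sigma> j))" by auto
      have nz: "x j \<noteq> 0" if "j < m" for j
      proof -
        have "0 < A' * \<rho> (\<sigma> j)" using A' \<rho> \<sigma>m[OF that] by simp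
        then show ?thesis using x(1)[OF that] by auto
      qed
      have orth: "orthogonal_family m (m - 1) (\<lambda>j. vec m (\<lambda>l. x j * h j l))"
        unfolding orthogonal_family_def using False
      proof (simp only: if_False, intro exI[of _ \<phi>] conjI \<phi> allI impI)
        fix i j assume ij: "i \<le> m - 1" "j \<le> m - 1" "i \<noteq> j"
        then have "i < m" "j < m" using m by auto
        have "(\<Sum>l<m. \<phi> (vec m (\<lambda>l. x i * h i l) $ l) * cnj (\<phi> (vec m (\<lambda>l. x j * h j l) $ l)))
            = \<phi> (x i) * cnj (\<phi> (x j)) * (\<Sum>l<m. \<phi> (h i l) * cnj (\<phi> (h j l)))"
          unfolding sum_distrib_left by (intro sum.cong) (auto simp: mult mult_ac)
        also have "(\<Sum>l<m. \<phi> (h i l) * cnj (\<phi> (h j l))) = 0"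
          unfolding ipphi[symmetric] h1[OF \<open>i < m\<close> \<open>j < m\<close> ij(3)] using zero by simp
        finally show "(\<Sum>l<m. \<phi> (vec m (\<lambda>l. x i * h i l) $ l) * cnj (\<phi> (vec m (\<lambda>l. x j * h j l) $ l))) = 0" by simp
      qed
      have rep: "\<exists>r. (\<forall>j<m. absval (r j) \<le> 1) \<and> (\<forall>l<m. (\<Sum>j<m. y j * f j l) = (\<Sum>j<m. r j * (x j * h j l)))"
        if y: "\<forall>j<m. absval (y j) \<le> \<rho> j" for y
      proof -
        \<comment> \<open>The coefficient of \<open>h i\<close> receives contributions from indices
          \<open>j > i\<close> only, where
          \<open>\<rho> (\<sigma> j) \<le> \<rho> (\<sigma> i)\<close> by the sorting. This is why
          radii \<open>A' * \<rho> (\<sigma> i)\<close> suffice.\<close>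
        define z where "z i = y (\<sigma> i) + (\<Sum>j<m. if i < j then y (\<sigma> j) * \<mu> j i else 0)" for i
        have "(\<Sum>j<m. y j * f j l) = (\<Sum>i<m. z i * h i l)" for l
        proof -
          have "(\<Sum>j<m. y j * f j l) = (\<Sum>j<m. y (\<sigma> j) * g j l)"
            using reindex[of "\<lambda>j. y j * f j l"] by (simp add: g_def)
          also have "\<dots> = (\<Sum>j<m. y (\<sigma> j) * h j l + (\<Sum>i<m. (if i < j then y (\<sigma> j) * \<mu> j i else 0) * h i l))"
          proof (rule sum.cong)
            fix j assume j: "j \<in> {..<m}"
            have "(\<Sum>i<m. (if i < j then y (\<sigma> j) * \<mu> j i else 0) * h i l) = (\<Sum>i<j. (if i < j then y (\<sigma> j) * \<mu> j i else 0) * h i l)"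
              using j by (intro sum.mono_neutral_right) auto
            then show "y (\<sigma> j) * g j l = y (\<sigma> j) * h j l + (\<Sum>i<m. (if i < j then y (\<sigma> j) * \<mu> j i else 0) * h i l)"
              using \<mu>(1)[of j l] j by (simp add: distrib_left sum_distrib_left mult.assoc)
          qed simp
          also have "\<dots> = (\<Sum>i<m. z i * h i l)"
            unfolding sum.distrib z_def distrib_right sum_distrib_right by (subst sum.swap) (rule refl)
          finally show ?thesis .
        qed
        moreover have zb: "absval (z i) \<le> A' * \<rho> (\<sigma> i)" if i: "i < m" for i
        proof -
          have "absval (\<Sum>j<m. if i < j then y (\<sigma> j) * \<mu> j i else 0) \<le> real (card {..<m}) * (\<rho> (\<sigma> i) * A)"
          proof (rule absval_sum_bound)
            fix j assume j: "j \<in> {..<m}"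
            have pos: "0 < \<rho> (\<sigma> i)" using \<rho> \<sigma>m[OF i] by simp
            show "absval (if i < j then y (\<sigma> j) * \<mu> j i else 0) \<le> \<rho> (\<sigma> i) * A"
            proof (cases "i < j")
              case True
              have "absval (y (\<sigma> j)) \<le> \<rho> (\<sigma> i)"
                using y \<sigma>m[of j] \<sigma>(2)[of i j] i j True by (force intro: order_trans)
              then have "absval (y (\<sigma> j)) * absval (\<mu> j i) \<le> \<rho> (\<sigma> i) * A"
                using \<mu>(2)[of j i] j True pos by (intro mult_mono) auto
              then show ?thesis using True by (simp add: absval_mult)
            qed (use pos A in simp)
          qed
          moreover have "absval (y (\<sigma> i)) \<le> \<rho> (\<sigma> i)" using y \<sigma>m[OF i] by blast
          ultimately have "absval (z i) \<le> \<rho> (\<sigma> i) + real (card {..<m}) * (\<rho> (\<sigma> i) * A)"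
            unfolding z_def by (intro absval_triangle_le)
          then show ?thesis by (simp add: A'_def algebra_simps)
        qed
        moreover have "(\<Sum>i<m. z i * h i l) = (\<Sum>i<m. z i / x i * (x i * h i l))" for l
          using nz by (intro sum.cong) auto
        moreover have "absval (z i / x i) \<le> 1" if "i < m" for i
          using zb[OF that] x(1)[OF that] nz[OF that] by (simp add: absval_divide divide_le_eq_1)
        ultimately show ?thesis by (intro exI[of _ "\<lambda>i. z i / x i"]) auto
      qed
      have xb: "absval (x j) \<le> A3 * \<rho> (\<sigma> j)" if "j < m" for j
      proof -
        have "absval (x j) \<le> \<Lambda> * A' * \<rho> (\<sigma> j)" using x(2)[OF that] by (simp add: mult.assoc)
        also have "\<dots> \<le> A3 * \<rho> (\<sigma> j)" using A3(3) \<rho> \<sigma>m[OF that] by (intro mult_right_mono) auto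
        finally show ?thesis .
      qed
      have hb: "absval (h j l) \<le> A3" if "j < m" "l < m" for j l using h3[OF that] A3(2) by linarith
      show "\<exists>\<sigma> x h. bij_betw \<sigma> {..<m} {..<m} \<and> (\<forall>j<m. absval (x j) \<le> A3 * \<rho> (\<sigma> j)) \<and>
        (\<forall>j<m. \<forall>l<m. absval (h j l) \<le> A3) \<and> orthogonal_family m (m - 1) (\<lambda>j. vec m (\<lambda>l. x j * h j l)) \<and>
        (\<forall>y. (\<forall>j<m. absval (y j) \<le> \<rho> j) \<longrightarrow>
          (\<exists>r. (\<forall>j<m. absval (r j) \<le> 1) \<and> (\<forall>l<m. (\<Sum>j<m. y j * f j l) = (\<Sum>j<m. r j * (x j * h j l)))))"
        by (rule exI[of _ \<sigma>], rule exI[of _ x], rule exI[of _ h]) (intro conjI allI impI \<sigma>(1) orth xb hb rep; simp)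
    qed
  qed
qed

section \<open>Covering numbers of sets of matrices\<close>

lemma coord_norm_ge:
  fixes x :: "'i \<Rightarrow> 'a::local_field_char_0"
  assumes "finite I" "i \<in> I"
  shows "absval (x i) \<le> coord_norm x I"
  unfolding coord_norm_def
  using assms member_le_L2_set[OF assms, of "\<lambda>i. absval (x i)"] by (auto intro!: Max_ge)

text \<open>The factor \<open>card I\<close> is crude but covers the maximum norm and the Euclidean
  norm alike.\<close>

lemma coord_norm_le:
  fixes x :: "'i \<Rightarrow> 'a::local_field_char_0"
  assumes "finite I" "I \<noteq> {}" "\<And>i. i \<in> I \<Longrightarrow> absval (x i) \<le> b"
  shows "coord_norm x I \<le> real (card I) * b"
proof (cases "nonarchimedean TYPE('a)")
  case True
  obtain i where "i \<in> I" using assms(2) by blast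
  then have "0 \<le> b" using assms(3)[of i] absval_nonneg[of "x i"] by linarith
  moreover have "1 \<le> real (card I)" using assms by (simp add: Suc_le_eq card_gt_0_iff)
  ultimately have "1 * b \<le> real (card I) * b" by (intro mult_right_mono)
  moreover have "Max ((\<lambda>i. absval (x i)) ` I) \<le> b" using assms by (intro Max.boundedI) auto
  ultimately show ?thesis using True by (simp add: coord_norm_def)
next
  case False
  have "L2_set (\<lambda>i. absval (x i)) I \<le> (\<Sum>i\<in>I. absval (x i))" by (intro L2_set_le_sum) auto
  also have "\<dots> \<le> real (card I) * b" using assms(3) by (rule sum_bounded_above)
  finally show ?thesis using False by (simp add: coord_norm_def)
qed

lemma entry_le_mat_norm:
  fixes A :: "'a::local_field_char_0 mat"
  assumes "A \<in> carrier_mat n m" "p < n" "k < m"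
  shows "absval (A $$ (p, k)) \<le> mat_norm A"
  unfolding mat_norm_def using assms by (intro coord_norm_ge) auto

lemma mat_norm_le:
  fixes A :: "'a::local_field_char_0 mat"
  assumes "A \<in> carrier_mat n m" "0 < n" "0 < m" "\<And>p k. p < n \<Longrightarrow> k < m \<Longrightarrow> absval (A $$ (p, k)) \<le> b"
  shows "mat_norm A \<le> real (n * m) * b"
proof -
  have "coord_norm (\<lambda>ij. A $$ ij) ({..<n} \<times> {..<m}) \<le> real (card ({..<n} \<times> {..<m})) * b"
    using assms by (intro coord_norm_le) (auto simp: lessThan_empty_iff)
  then show ?thesis using assms(1) by (auto simp: mat_norm_def)
qed

lemma mat_norm_minus_commute:
  fixes A B :: "'a::local_field_char_0 mat"
  assumes "A \<in> carrier_mat n m" "B \<in> carrier_mat n m"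
  shows "mat_norm (A - B) = mat_norm (B - A)"
proof -
  have "absval ((A - B) $$ ij) = absval ((B - A) $$ ij)" if "ij \<in> {..<n} \<times> {..<m}" for ij
    using that assms by (auto simp: absval_minus_commute)
  then show ?thesis
    unfolding mat_norm_def coord_norm_def using assms
    by (auto intro!: arg_cong[of _ _ Max] image_cong L2_set_cong)
qed

lemma mat_norm_diff_self:
  fixes A :: "'a::local_field_char_0 mat"
  assumes "A \<in> carrier_mat n m" "0 < n" "0 < m"
  shows "mat_norm (A - A) \<le> 0"
  using mat_norm_le[of "A - A" n m 0] assms by auto

lemma covering_number_le:
  fixes E :: "'a::local_field_char_0 mat set"
  assumes "P \<subseteq> Phi d m" "finite P" "E \<subseteq> (\<Union>c\<in>P. {x \<in> Phi d m. mat_norm (x - c) \<le> \<delta>})"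
  shows "covering_number d m \<delta> E \<le> card P"
  unfolding covering_number_def using assms by (intro Least_le) blast

text \<open>The \<open>LEAST\<close> in \<open>covering_number\<close> is meaningful once some
  finite cover exists; the premises supply one.\<close>

lemma covering_number_attained:
  fixes E :: "'a::local_field_char_0 mat set"
  assumes "P \<subseteq> Phi d m" "finite P" "E \<subseteq> (\<Union>c\<in>P. {x \<in> Phi d m. mat_norm (x - c) \<le> \<delta>})"
  obtains Q where "Q \<subseteq> Phi d m" "finite Q" "card Q = covering_number d m \<delta> E"
    "E \<subseteq> (\<Union>c\<in>Q. {x \<in> Phi d m. mat_norm (x - c) \<le> \<delta>})"
proof -
  let ?Q = "\<lambda>n. \<exists>P \<subseteq> Phi d m. finite P \<and> card P = n \<and>
    E \<subseteq> (\<Union>c\<in>P. {x \<in> Phi d m. mat_norm (x - c) \<le> \<delta>})"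
  have "?Q (card P)" using assms by blast
  then have "?Q (LEAST n. ?Q n)" by (rule LeastI)
  then have "?Q (covering_number d m \<delta> E)" unfolding covering_number_def .
  then show thesis using that by blast
qed

lemma box_entry:
  fixes r :: "nat \<Rightarrow> nat \<Rightarrow> 'a::local_field_char_0"
  assumes "p \<le> d" "q < m" "\<And>j. j \<le> k \<Longrightarrow> w j \<in> carrier_vec m"
  shows "(\<Sum>i\<le>d. \<Sum>j\<le>k. r i j * tensor (unit_vec (d + 1) i) (w j) $$ (p, q)) = (\<Sum>j\<le>k. r p j * w j $ q)"
proof -
  have "(\<Sum>i\<le>d. \<Sum>j\<le>k. r i j * tensor (unit_vec (d + 1) i) (w j) $$ (p, q))
      = (\<Sum>i\<le>d. if i = p then \<Sum>j\<le>k. r p j * w j $ q else 0)"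
  proof (rule sum.cong[OF refl])
    fix i assume i: "i \<in> {..d}"
    have "tensor (unit_vec (d + 1) i) (w j) $$ (p, q) = (if i = p then w j $ q else 0)" if "j \<le> k" for j
      using assms(1,2) assms(3)[OF that] i by (auto simp: tensor_def)
    then show "(\<Sum>j\<le>k. r i j * tensor (unit_vec (d + 1) i) (w j) $$ (p, q)) = (if i = p then \<Sum>j\<le>k. r p j * w j $ q else 0)"
      by simp
  qed
  then show ?thesis using assms(1) by simp
qed

lemma dimension_ge_1: "0 < m \<Longrightarrow> 1 \<le> real ((d + 1) * m)"
proof -
  assume "0 < m"
  then have "1 \<le> (d + 1) * m" by simp
  then show ?thesis by (simp only: of_nat_1 flip: of_nat_le_iff)
qed

abbreviation entries :: "'a mat \<Rightarrow> nat \<Rightarrow> nat \<Rightarrow> 'a" where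
  "entries x \<equiv> \<lambda>p k. x $$ (p, k)"

context moment_curve
begin

text \<open>Separation by \<open>\<delta>\<close> in norm forces separation by
  \<open>\<delta> / real ((d + 1) * m)\<close> in some entry. This is the scale at which
  configurations of matrices are formed.\<close>

lemma packing_matrices:
  fixes X :: "'a mat set"
  assumes X: "finite X" "X \<subseteq> Phi d m" and m: "0 < m" and \<delta>: "0 < \<delta>" "\<delta> \<le> real ((d + 1) * m) * b"
    and x0: "\<And>x p k. x \<in> X \<Longrightarrow> p \<le> d \<Longrightarrow> k < m \<Longrightarrow> absval (x $$ (p, k) - x0 $$ (p, k)) \<le> b"
    and sep: "\<And>x y. x \<in> X \<Longrightarrow> y \<in> X \<Longrightarrow> x \<noteq> y \<Longrightarrow> \<delta> < mat_norm (x - y)"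
  shows "real (card X) \<le> (C1 * (2 * b / (\<delta> / real ((d + 1) * m))) powr D) ^ ((d + 1) * m)"
proof -
  define \<kappa> where "\<kappa> = real ((d + 1) * m)"
  have \<kappa>: "0 < \<kappa>" using dimension_ge_1[OF m, of d] unfolding \<kappa>_def by linarith
  have "real (card X) \<le> (\<Prod>j\<in>{..d} \<times> {..<m}. C1 * (2 * b / (\<delta> / \<kappa>)) powr D)"
  proof (rule packing_family[where co = "\<lambda>x j. x $$ j" and ?x0.0 = "\<lambda>j. x0 $$ j"])
    show "\<delta> / \<kappa> \<le> b" using \<delta>(2) \<kappa> unfolding \<kappa>_def[symmetric] by (simp add: divide_le_eq mult.commute)
    fix x y assume xy: "x \<in> X" "y \<in> X" "x \<noteq> y"
    show "\<exists>j\<in>{..d} \<times> {..<m}. \<delta> / \<kappa> < absval (x $$ j - y $$ j)"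
    proof (rule ccontr)
      assume *: "\<not> ?thesis"
      have car: "x \<in> carrier_mat (d + 1) m" "y \<in> carrier_mat (d + 1) m" using xy X by (auto simp: Phi_def)
      have "mat_norm (x - y) \<le> real ((d + 1) * m) * (\<delta> / \<kappa>)"
        using * car m by (intro mat_norm_le) (force simp: not_less)+
      also have "\<dots> = \<delta>" using \<kappa> unfolding \<kappa>_def[symmetric] by simp
      finally show False using sep[OF xy] by simp
    qed
  qed (use X \<delta> \<kappa> x0 in auto)
  then show ?thesis by (simp add: \<kappa>_def)
qed

lemma maximal_separated_matrices:
  fixes E :: "'a mat set"
  assumes E: "E \<subseteq> Phi d m" and m: "0 < m" and \<delta>: "0 < \<delta>"
    and b: "\<And>x p k. x \<in> E \<Longrightarrow> p \<le> d \<Longrightarrow> k < m \<Longrightarrow> absval (x $$ (p, k)) \<le> b"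
  obtains X where "X \<subseteq> E" "finite X" "\<And>x y. x \<in> X \<Longrightarrow> y \<in> X \<Longrightarrow> x \<noteq> y \<Longrightarrow> \<delta> < mat_norm (x - y)"
    "E \<subseteq> (\<Union>c\<in>X. {x \<in> Phi d m. mat_norm (x - c) \<le> \<delta>})"
proof -
  define b' where "b' = max b \<delta>"
  let ?R = "\<lambda>x y :: 'a mat. x \<in> Phi d m \<and> y \<in> Phi d m \<and> mat_norm (x - y) \<le> \<delta>"
  let ?N = "(C1 * (2 * b' / (\<delta> / real ((d + 1) * m))) powr D) ^ ((d + 1) * m)"
  obtain X where X: "X \<subseteq> E" "finite X" "\<And>x y. x \<in> X \<Longrightarrow> y \<in> X \<Longrightarrow> x \<noteq> y \<Longrightarrow> \<not> ?R x y"
    "\<And>x. x \<in> E \<Longrightarrow> \<exists>y\<in>X. ?R x y"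
  proof (rule maximal_separated[of E ?R "nat \<lceil>?N\<rceil>"])
    show "?R x x" if "x \<in> E" for x
      using that E mat_norm_diff_self[of x "d + 1" m] m \<delta> by (force simp: Phi_def)
    show "?R y x" if "?R x y" for x y
      using that mat_norm_minus_commute[of x "d + 1" m y] by (simp add: Phi_def)
    fix X assume X: "X \<subseteq> E" "finite X" "\<forall>x\<in>X. \<forall>y\<in>X. x \<noteq> y \<longrightarrow> \<not> ?R x y"
    have "real (card X) \<le> ?N"
    proof (rule packing_matrices[where ?x0.0 = "0\<^sub>m (d + 1) m", OF X(2) _ m \<delta>])
      have "1 * \<delta> \<le> real ((d + 1) * m) * b'"
        using dimension_ge_1[OF m] \<delta> by (intro mult_mono) (auto simp: b'_def simp del: of_nat_mult)
      then show "\<delta> \<le> real ((d + 1) * m) * b'" by simp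
      show "absval (x $$ (p, k) - 0\<^sub>m (d + 1) m $$ (p, k)) \<le> b'" if "x \<in> X" "p \<le> d" "k < m" for x p k
        using b[of x p k] that X(1) by (auto simp: b'_def)
      show "\<delta> < mat_norm (x - y)" if "x \<in> X" "y \<in> X" "x \<noteq> y" for x y
        using X(3) that X(1) E by force
    qed (use X E in auto)
    then show "card X \<le> nat \<lceil>?N\<rceil>" by linarith
  next
    fix X assume "X \<subseteq> E" "finite X" "\<And>x y. x \<in> X \<Longrightarrow> y \<in> X \<Longrightarrow> x \<noteq> y \<Longrightarrow> \<not> ?R x y"
      "\<And>x. x \<in> E \<Longrightarrow> \<exists>y\<in>X. ?R x y"
    then show thesis by (rule that)
  qed
  show thesis
  proof (rule that[OF X(1,2)])
    show "\<delta> < mat_norm (x - y)" if "x \<in> X" "y \<in> X" "x \<noteq> y" for x y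
      using X(3)[OF that] that X(1) E by force
    show "E \<subseteq> (\<Union>c\<in>X. {x \<in> Phi d m. mat_norm (x - c) \<le> \<delta>})" using X(4) by fast
  qed
qed

lemma finite_cover_attained:
  fixes E :: "'a mat set"
  assumes E: "E \<subseteq> Phi d m" and m: "0 < m" and \<delta>: "0 < \<delta>"
    and b: "\<And>x p k. x \<in> E \<Longrightarrow> p \<le> d \<Longrightarrow> k < m \<Longrightarrow> absval (x $$ (p, k)) \<le> b"
  obtains P where "P \<subseteq> Phi d m" "finite P" "card P = covering_number d m \<delta> E"
    "E \<subseteq> (\<Union>c\<in>P. {x \<in> Phi d m. mat_norm (x - c) \<le> \<delta>})"
proof (rule maximal_separated_matrices[OF E m \<delta> b])
  fix X assume X: "X \<subseteq> E" "finite X" "E \<subseteq> (\<Union>c\<in>X. {x \<in> Phi d m. mat_norm (x - c) \<le> \<delta>})"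
  have "X \<subseteq> Phi d m" using X(1) E by blast
  from covering_number_attained[OF this X(2,3)] show thesis using that by blast
qed

text \<open>Bounds the number of \<open>\<delta>\<close>-separated matrices in a ball of radius
  \<open>\<delta>\<close>, and thereby compares packing with covering numbers.\<close>

definition packing_constant :: "nat \<Rightarrow> real" where
  "packing_constant m = (C1 * (2 * real ((d + 1) * m)) powr D) ^ ((d + 1) * m)"

lemma separated_card_le_covering_number:
  fixes E :: "'a mat set"
  assumes E: "E \<subseteq> Phi d m" and m: "0 < m" and \<delta>: "0 < \<delta>"
    and b: "\<And>x p k. x \<in> E \<Longrightarrow> p \<le> d \<Longrightarrow> k < m \<Longrightarrow> absval (x $$ (p, k)) \<le> b"
    and X: "X \<subseteq> E" "finite X" "\<And>x y. x \<in> X \<Longrightarrow> y \<in> X \<Longrightarrow> x \<noteq> y \<Longrightarrow> \<delta> < mat_norm (x - y)"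
  shows "real (card X) \<le> packing_constant m * real (covering_number d m \<delta> E)"
proof -
  obtain P where P: "P \<subseteq> Phi d m" "finite P" "card P = covering_number d m \<delta> E"
    "E \<subseteq> (\<Union>c\<in>P. {x \<in> Phi d m. mat_norm (x - c) \<le> \<delta>})"
    by (rule finite_cover_attained[OF E m \<delta> b])
  let ?X = "\<lambda>c. {x \<in> X. mat_norm (x - c) \<le> \<delta>}"
  have fibre: "real (card (?X c)) \<le> packing_constant m" if c: "c \<in> P" for c
  proof -
    have "real (card (?X c)) \<le> (C1 * (2 * \<delta> / (\<delta> / real ((d + 1) * m))) powr D) ^ ((d + 1) * m)"
    proof (rule packing_matrices[where ?x0.0 = c, OF _ _ m \<delta>])
      have "1 * \<delta> \<le> real ((d + 1) * m) * \<delta>"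
        using dimension_ge_1[OF m] \<delta> by (intro mult_right_mono) (auto simp del: of_nat_mult)
      then show "\<delta> \<le> real ((d + 1) * m) * \<delta>" by simp
      fix x p k assume x: "x \<in> ?X c" and pk: "p \<le> d" "k < m"
      have car: "x \<in> carrier_mat (d + 1) m" "c \<in> carrier_mat (d + 1) m"
        using x X E c P by (auto simp: Phi_def)
      have "absval ((x - c) $$ (p, k)) \<le> mat_norm (x - c)"
        using car pk by (intro entry_le_mat_norm[of _ "d + 1" m]) auto
      then show "absval (x $$ (p, k) - c $$ (p, k)) \<le> \<delta>" using x car pk by auto
    qed (use X E in auto)
    then show ?thesis using \<delta> by (simp add: packing_constant_def)
  qed
  have "X \<subseteq> (\<Union>c\<in>P. ?X c)" using X(1) P(4) by blast
  then have "card X \<le> card (\<Union>c\<in>P. ?X c)" using P(2) X(2) by (intro card_mono) auto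
  also have "\<dots> \<le> (\<Sum>c\<in>P. card (?X c))" using P(2) by (rule card_UN_le)
  finally have "real (card X) \<le> (\<Sum>c\<in>P. real (card (?X c)))" by (simp flip: of_nat_sum)
  also have "\<dots> \<le> real (card P) * packing_constant m" using fibre by (rule sum_bounded_above)
  finally show ?thesis using P(3) by (simp add: mult.commute)
qed

lemma packing_constant_pos: "0 < m \<Longrightarrow> 0 < packing_constant m"
  using C1_ge_1 dimension_ge_1[of m d] unfolding packing_constant_def by (intro zero_less_power mult_pos_pos) (auto simp del: of_nat_mult)

lemma covering_number_ge_1:
  fixes E :: "'a mat set"
  assumes E: "E \<subseteq> Phi d m" "E \<noteq> {}" and m: "0 < m" and \<delta>: "0 < \<delta>"
    and b: "\<And>x p k. x \<in> E \<Longrightarrow> p \<le> d \<Longrightarrow> k < m \<Longrightarrow> absval (x $$ (p, k)) \<le> b"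
  shows "1 \<le> covering_number d m \<delta> E"
proof -
  obtain P where P: "P \<subseteq> Phi d m" "finite P" "card P = covering_number d m \<delta> E"
    "E \<subseteq> (\<Union>c\<in>P. {x \<in> Phi d m. mat_norm (x - c) \<le> \<delta>})"
    by (rule finite_cover_attained[OF E(1) m \<delta> b])
  have "P \<noteq> {}" using P(4) E(2) by blast
  then show ?thesis using P(2,3) by (simp add: Suc_le_eq card_gt_0_iff flip: P(3))
qed

text \<open>\<open>K\<close> is chosen before the scale and the set, which rests on the uniform
  constant of \<open>orthogonal_box\<close>. The good points lie in the translated box itself, so
  any positive \<open>\<eta>\<close> is allowed; \<open>E\<close> will be the original set of which
  \<open>\<Theta>\<close> is a separated subset.\<close>

lemma representation_box_of_box_concl:
  assumes m: "0 < m"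
  shows "\<exists>K>0. \<forall>\<delta> M \<Theta> n. 0 < \<delta> \<longrightarrow> 0 < M \<longrightarrow> finite \<Theta> \<longrightarrow> \<Theta> \<subseteq> Phi d m \<longrightarrow>
    (\<forall>x\<in>\<Theta>. \<forall>y\<in>\<Theta>. x \<noteq> y \<longrightarrow> \<delta> < mat_norm (x - y)) \<longrightarrow>
    box_concl {..<m} (\<delta> / real ((d + 1) * m)) M (entries ` \<Theta>) n \<longrightarrow>
    (\<exists>v V. representation_box d m v V \<and>
      n ^ Suc d \<le> K * M * real (covering_number d m \<delta> V) \<and>
      real (covering_number d m \<delta> V) \<le> K * M * n ^ Suc d \<and>
      (\<forall>\<eta> b. \<forall>E \<subseteq> Phi d m. 0 < \<eta> \<longrightarrow> \<Theta> \<subseteq> E \<longrightarrow>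
        (\<forall>x\<in>E. \<forall>p\<le>d. \<forall>k<m. absval (x $$ (p, k)) \<le> b) \<longrightarrow>
        n ^ Suc d \<le> K * M * real (covering_number d m \<delta> (E \<inter> Nhd d m \<eta> ((\<lambda>x. v + x) ` V)))))"
proof -
  obtain A where A: "1 \<le> A" and box: "\<And>(f :: nat \<Rightarrow> nat \<Rightarrow> 'a) \<rho>. quasi_orthonormal {..<m} f \<Longrightarrow> \<forall>j<m. 0 < \<rho> j \<Longrightarrow>
    \<exists>\<sigma> x h. bij_betw \<sigma> {..<m} {..<m} \<and> (\<forall>j<m. absval (x j) \<le> A * \<rho> (\<sigma> j)) \<and>
      (\<forall>j<m. \<forall>l<m. absval (h j l) \<le> A) \<and>
      orthogonal_family m (m - 1) (\<lambda>j. vec m (\<lambda>l. x j * h j l)) \<and>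
      (\<forall>y. (\<forall>j<m. absval (y j) \<le> \<rho> j) \<longrightarrow>
        (\<exists>r. (\<forall>j<m. absval (r j) \<le> 1) \<and> (\<forall>l<m. (\<Sum>j<m. y j * f j l) = (\<Sum>j<m. r j * (x j * h j l)))))"
    using orthogonal_box[of m, where 'a = 'a] m by auto
  define K1 where "K1 = ((C1 * (2 * A * (real m * A)) powr D) ^ m) ^ Suc d"
  define K where "K = K1 + packing_constant m"
  have K1: "0 < K1" using C1_ge_1 A m by (simp add: K1_def)
  have K: "0 < K" "K1 \<le> K" "packing_constant m \<le> K" using K1 packing_constant_pos[OF m] by (auto simp: K_def)
  show ?thesis
  proof (intro exI[of _ K] conjI allI impI K(1))
    fix \<delta> M \<Theta> n
    assume \<delta>: "(0::real) < \<delta>" and M: "(0::real) < M" and \<Theta>: "finite \<Theta>" "\<Theta> \<subseteq> Phi d m"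
      and sep: "\<forall>x\<in>\<Theta>. \<forall>y\<in>\<Theta>. x \<noteq> y \<longrightarrow> \<delta> < mat_norm (x - y)"
      and bc: "box_concl {..<m} (\<delta> / real ((d + 1) * m)) M (entries ` \<Theta>) n"
    define \<kappa> where "\<kappa> = real ((d + 1) * m)"
    have \<kappa>: "0 < \<kappa>" using dimension_ge_1[OF m, of d] unfolding \<kappa>_def by linarith
    obtain f \<rho> v0 where f: "quasi_orthonormal {..<m} f" and \<rho>: "\<And>j. j < m \<Longrightarrow> \<delta> / \<kappa> \<le> \<rho> j"
      and vol: "(\<Prod>j<m. (\<rho> j / (\<delta> / \<kappa>)) powr D) ^ Suc d \<le> M * n ^ Suc d"
      and many: "n ^ Suc d \<le> M * real (card {\<theta> \<in> entries ` \<Theta>. inbox {..<m} f \<rho> v0 \<theta>})"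
      using bc unfolding box_concl_def \<kappa>_def[symmetric] by blast
    have \<rho>pos: "\<forall>j<m. 0 < \<rho> j" using \<rho> divide_pos_pos[OF \<delta> \<kappa>] by (meson less_le_trans)
    obtain \<sigma> x h where \<sigma>: "bij_betw \<sigma> {..<m} {..<m}" and x: "\<forall>j<m. absval (x j) \<le> A * \<rho> (\<sigma> j)"
      and h: "\<forall>j<m. \<forall>l<m. absval (h j l) \<le> A"
      and orth: "orthogonal_family m (m - 1) (\<lambda>j. vec m (\<lambda>l. x j * h j l))"
      and rep: "\<forall>y. (\<forall>j<m. absval (y j) \<le> \<rho> j) \<longrightarrow>
        (\<exists>r. (\<forall>j<m. absval (r j) \<le> 1) \<and> (\<forall>l<m. (\<Sum>j<m. y j * f j l) = (\<Sum>j<m. r j * (x j * h j l))))"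
      using box[OF f \<rho>pos] by (elim exE conjE) (rule that)
    note x = x[rule_format] and h = h[rule_format] and rep = rep[THEN spec, THEN mp]
    define w where "w j = vec m (\<lambda>l. x j * h j l)" for j
    define v where "v = mat (d + 1) m (\<lambda>(p, k). v0 p k)"
    define V where "V = box_at_zero d m (m - 1) w"
    have mm: "{..m - 1} = {..<m}" "{..m - Suc 0} = {..<m}" using m by auto
    have vcar: "v \<in> carrier_mat (d + 1) m" by (simp add: v_def)
    have Vcar: "V \<subseteq> Phi d m" by (auto simp: V_def box_at_zero_def Phi_def)
    have V_entry: "\<exists>r. (\<forall>p\<le>d. \<forall>j<m. absval (r p j) \<le> 1) \<and> (\<forall>p\<le>d. \<forall>k<m. z $$ (p, k) = (\<Sum>j<m. r p j * (x j * h j k)))"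
      if "z \<in> V" for z
    proof -
      obtain r where z: "z = mat (d + 1) m (\<lambda>pq. \<Sum>i\<le>d. \<Sum>j\<le>m - 1. r i j * tensor (unit_vec (d + 1) i) (w j) $$ pq)"
        and r: "\<forall>i\<le>d. \<forall>j\<le>m - 1. r i j \<in> unit_ball_F"
        using \<open>z \<in> V\<close> unfolding V_def box_at_zero_def by blast
      have "z $$ (p, k) = (\<Sum>j<m. r p j * (x j * h j k))" if "p \<le> d" "k < m" for p k
        using box_entry[of p d k m "m - 1" w r] that by (simp add: z w_def mm)
      moreover have "absval (r p j) \<le> 1" if "p \<le> d" "j < m" for p j
        using r that by (auto simp: unit_ball_F_def)
      ultimately show ?thesis by blast
    qed
    have in_V: "z \<in> V" if z: "z \<in> carrier_mat (d + 1) m" and r: "\<And>p j. p \<le> d \<Longrightarrow> j < m \<Longrightarrow> absval (r p j) \<le> 1"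
      and e: "\<And>p k. p \<le> d \<Longrightarrow> k < m \<Longrightarrow> z $$ (p, k) = (\<Sum>j<m. r p j * (x j * h j k))" for z r
    proof -
      have "z = mat (d + 1) m (\<lambda>pq. \<Sum>i\<le>d. \<Sum>j\<le>m - 1. r i j * tensor (unit_vec (d + 1) i) (w j) $$ pq)"
      proof (rule eq_matI)
        fix p k assume "p < dim_row (mat (d + 1) m (\<lambda>pq. \<Sum>i\<le>d. \<Sum>j\<le>m - 1. r i j * tensor (unit_vec (d + 1) i) (w j) $$ pq))"
          "k < dim_col (mat (d + 1) m (\<lambda>pq. \<Sum>i\<le>d. \<Sum>j\<le>m - 1. r i j * tensor (unit_vec (d + 1) i) (w j) $$ pq))"
        then have pk: "p \<le> d" "k < m" by auto
        then show "z $$ (p, k) = mat (d + 1) m (\<lambda>pq. \<Sum>i\<le>d. \<Sum>j\<le>m - 1. r i j * tensor (unit_vec (d + 1) i) (w j) $$ pq) $$ (p, k)"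
          using box_entry[of p d k m "m - 1" w r] e[OF pk] by (simp add: w_def mm)
      qed (use z in auto)
      moreover have "\<forall>i\<le>d. \<forall>j\<le>m - 1. r i j \<in> unit_ball_F"
        using r m by (auto simp: unit_ball_F_def)
      ultimately show ?thesis unfolding V_def box_at_zero_def by blast
    qed
    define b where "b = A * (\<Sum>j<m. absval (x j))"
    have Vb: "absval (z $$ (p, k)) \<le> real (card {..<m}) * b" if z: "z \<in> V" and pk: "p \<le> d" "k < m" for z p k
    proof -
      obtain r where r: "\<forall>p\<le>d. \<forall>j<m. absval (r p j) \<le> 1" "\<forall>p\<le>d. \<forall>k<m. z $$ (p, k) = (\<Sum>j<m. r p j * (x j * h j k))"
        using V_entry[OF z] by blast
      have "absval (\<Sum>j<m. r p j * (x j * h j k)) \<le> real (card {..<m}) * b"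
      proof (rule absval_sum_bound)
        fix j assume j: "j \<in> {..<m}"
        have "absval (x j) \<le> (\<Sum>j<m. absval (x j))" using j by (intro member_le_sum) auto
        then have "absval (r p j) * (absval (x j) * absval (h j k)) \<le> 1 * ((\<Sum>j<m. absval (x j)) * A)"
          using r(1) pk j h A by (intro mult_mono) (auto intro: sum_nonneg)
        then show "absval (r p j * (x j * h j k)) \<le> b" by (simp add: absval_mult b_def mult.commute)
      qed
      then show ?thesis using r(2) pk by simp
    qed
    define G where "G = {\<theta> \<in> \<Theta>. inbox {..<m} f \<rho> v0 (entries \<theta>)}"
    have G: "finite G" "G \<subseteq> \<Theta>" using \<Theta>(1) by (auto simp: G_def)
    have "{\<theta> \<in> entries ` \<Theta>. inbox {..<m} f \<rho> v0 \<theta>} = entries ` G" by (auto simp: G_def)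
    then have "card {\<theta> \<in> entries ` \<Theta>. inbox {..<m} f \<rho> v0 \<theta>} \<le> card G"
      using card_image_le[OF G(1)] by simp
    then have "M * real (card {\<theta> \<in> entries ` \<Theta>. inbox {..<m} f \<rho> v0 \<theta>}) \<le> M * real (card G)"
      using M by (intro mult_left_mono) auto
    with many have nG: "n ^ Suc d \<le> M * real (card G)" by (rule order_trans)
    have lower: "n ^ Suc d \<le> K * M * real N" if "real (card G) \<le> packing_constant m * real N" for N :: nat
    proof -
      have "real (card G) \<le> K * real N" using that K(3) by (meson mult_right_mono of_nat_0_le_iff order_trans)
      then have "M * real (card G) \<le> M * (K * real N)" using M by (intro mult_left_mono) auto
      then show ?thesis using nG by (simp add: mult_ac)
    qed
    have GV: "\<theta> - v \<in> V" if "\<theta> \<in> G" for \<theta>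
    proof -
      have car: "\<theta> \<in> carrier_mat (d + 1) m" using that G \<Theta> by (auto simp: Phi_def)
      obtain y where y: "\<forall>p\<le>d. \<forall>j\<in>{..<m}. absval (y p j) \<le> \<rho> j"
        "\<forall>p\<le>d. \<forall>k\<in>{..<m}. \<theta> $$ (p, k) = v0 p k + (\<Sum>j<m. y p j * f j k)"
        using \<open>\<theta> \<in> G\<close> unfolding G_def inbox_def by blast
      have "\<forall>p\<in>{..d}. \<exists>r. (\<forall>j<m. absval (r j) \<le> 1) \<and> (\<forall>l<m. (\<Sum>j<m. y p j * f j l) = (\<Sum>j<m. r j * (x j * h j l)))"
        using rep y(1) by auto
      from bchoice[OF this] obtain r where r: "\<forall>p\<in>{..d}. (\<forall>j<m. absval (r p j) \<le> 1) \<and>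
        (\<forall>l<m. (\<Sum>j<m. y p j * f j l) = (\<Sum>j<m. r p j * (x j * h j l)))" by blast
      show ?thesis
      proof (rule in_V[where r = r])
        show "absval (r p j) \<le> 1" if "p \<le> d" "j < m" for p j using r that by auto
        show "(\<theta> - v) $$ (p, k) = (\<Sum>j<m. r p j * (x j * h j k))" if pk: "p \<le> d" "k < m" for p k
          using r y(2) pk car vcar by (simp add: v_def)
      qed (use car vcar in auto)
    qed
    have repbox: "representation_box d m v V"
    proof -
      have "w = (\<lambda>j. vec m (\<lambda>l. x j * h j l))" by (rule ext) (simp add: w_def)
      then show ?thesis
        unfolding representation_box_def V_def using vcar orth
        by (intro conjI exI[of _ "m - 1"] exI[of _ w]) (auto simp: Phi_def)
    qed
    have diff: "(\<theta> - v) - (\<theta>' - v) = \<theta> - \<theta>'" if "\<theta> \<in> G" "\<theta>' \<in> G" for \<theta> \<theta>'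
      using that G \<Theta> vcar by (intro eq_matI) (auto simp: Phi_def)
    have back_v: "v + (\<theta> - v) = \<theta>" if "\<theta> \<in> G" for \<theta>
    proof -
      have "\<theta> \<in> carrier_mat (d + 1) m" using that G \<Theta> by (auto simp: Phi_def)
      then show ?thesis using vcar by (intro eq_matI) auto
    qed
    have "real (card ((\<lambda>\<theta>. \<theta> - v) ` G)) \<le> packing_constant m * real (covering_number d m \<delta> V)"
    proof (rule separated_card_le_covering_number[OF Vcar m \<delta> Vb])
      fix x y assume "x \<in> (\<lambda>\<theta>. \<theta> - v) ` G" "y \<in> (\<lambda>\<theta>. \<theta> - v) ` G" "x \<noteq> y"
      then obtain \<theta> \<theta>' where \<theta>: "\<theta> \<in> G" "\<theta>' \<in> G" "x = \<theta> - v" "y = \<theta>' - v" "\<theta> \<noteq> \<theta>'" by blast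
      then show "\<delta> < mat_norm (x - y)" using sep G(2) diff[OF \<theta>(1,2)] by auto
    qed (use GV G in auto)
    moreover have "inj_on (\<lambda>\<theta>. \<theta> - v) G" by (rule inj_on_inverseI[of _ "\<lambda>x. v + x"]) (rule back_v)
    ultimately have low: "n ^ Suc d \<le> K * M * real (covering_number d m \<delta> V)"
      by (intro lower) (simp add: card_image)
    have up: "real (covering_number d m \<delta> V) \<le> K * M * n ^ Suc d"
    proof -
      obtain X where X: "X \<subseteq> V" "finite X" "\<And>x y. x \<in> X \<Longrightarrow> y \<in> X \<Longrightarrow> x \<noteq> y \<Longrightarrow> \<delta> < mat_norm (x - y)"
        "V \<subseteq> (\<Union>c\<in>X. {x \<in> Phi d m. mat_norm (x - c) \<le> \<delta>})"
      proof (rule maximal_separated_matrices[OF Vcar m \<delta> Vb])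
        fix X assume "X \<subseteq> V" "finite X" "\<And>x y. x \<in> X \<Longrightarrow> y \<in> X \<Longrightarrow> x \<noteq> y \<Longrightarrow> \<delta> < mat_norm (x - y)"
          "V \<subseteq> (\<Union>c\<in>X. {x \<in> Phi d m. mat_norm (x - c) \<le> \<delta>})"
        then show thesis by (rule that)
      qed
      have "\<forall>z\<in>X. \<exists>r. (\<forall>p\<le>d. \<forall>j<m. absval (r p j) \<le> 1) \<and> (\<forall>p\<le>d. \<forall>k<m. z $$ (p, k) = (\<Sum>j<m. r p j * (x j * h j k)))"
        using V_entry X(1) by blast
      from bchoice[OF this] obtain r where r: "\<forall>z\<in>X. (\<forall>p\<le>d. \<forall>j<m. absval (r z p j) \<le> 1) \<and>
        (\<forall>p\<le>d. \<forall>k<m. z $$ (p, k) = (\<Sum>j<m. r z p j * (x j * h j k)))" by blast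
      \<comment> \<open>If the coordinates of two elements of \<open>V\<close> along the box differ
        by at most \<open>e\<close>, the elements are at most \<open>\<delta>\<close> apart:
        \<open>real m * A\<close> bounds the passage to entries and \<open>\<kappa>\<close> the
        passage to the norm.\<close>
      define e where "e = \<delta> / \<kappa> / (real m * A)"
      have mA: "1 \<le> real m * A" using m A mult_mono[of 1 "real m" 1 A] by simp
      have e: "0 < e" "e \<le> \<delta> / \<kappa>" using \<delta> \<kappa> mA by (auto simp: e_def divide_le_eq mult_left_mono[of 1, simplified] intro!: divide_pos_pos)
      have "real (card X) \<le> (\<Prod>(p, j)\<in>{..d} \<times> {..<m}. C1 * (2 * (A * \<rho> (\<sigma> j)) / e) powr D)"
        unfolding case_prod_unfold
      proof (rule packing_family[where co = "\<lambda>z j. r z (fst j) (snd j) * x (snd j)" and ?x0.0 = "\<lambda>_. 0"])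
        fix j :: "nat \<times> nat" assume j: "j \<in> {..d} \<times> {..<m}"
        have \<sigma>j: "\<sigma> (snd j) < m" using \<sigma> j by (auto simp: bij_betw_def)
        have "1 * \<rho> (\<sigma> (snd j)) \<le> A * \<rho> (\<sigma> (snd j))" using A \<rho>pos \<sigma>j by (intro mult_right_mono) (auto intro: less_imp_le)
        then show "e \<le> A * \<rho> (\<sigma> (snd j))" using e(2) \<rho>[OF \<sigma>j] by linarith
        show "absval (r z (fst j) (snd j) * x (snd j) - 0) \<le> A * \<rho> (\<sigma> (snd j))" if "z \<in> X" for z
        proof -
          have "absval (r z (fst j) (snd j)) * absval (x (snd j)) \<le> 1 * (A * \<rho> (\<sigma> (snd j)))"
            using r that j x[of "snd j"] by (intro mult_mono) auto
          then show ?thesis by (simp add: absval_mult)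
        qed
      next
        fix z z' assume z: "z \<in> X" "z' \<in> X" "z \<noteq> z'"
        show "\<exists>j\<in>{..d} \<times> {..<m}. e < absval (r z (fst j) (snd j) * x (snd j) - r z' (fst j) (snd j) * x (snd j))"
        proof (rule ccontr)
          assume "\<not> ?thesis"
          then have *: "absval (r z p j * x j - r z' p j * x j) \<le> e" if "p \<le> d" "j < m" for p j
            using that by (force simp: not_less)
          have car: "z \<in> carrier_mat (d + 1) m" "z' \<in> carrier_mat (d + 1) m" using z X(1) Vcar by (auto simp: Phi_def)
          have "mat_norm (z - z') \<le> real ((d + 1) * m) * (real (card {..<m}) * (e * A))"
          proof (rule mat_norm_le)
            fix p k assume pk: "p < d + 1" "k < m"
            have "(z - z') $$ (p, k) = (\<Sum>j<m. r z p j * (x j * h j k)) - (\<Sum>j<m. r z' p j * (x j * h j k))"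
              using r z pk car by simp
            also have "\<dots> = (\<Sum>j<m. (r z p j * x j - r z' p j * x j) * h j k)"
              unfolding sum_subtractf[symmetric] by (intro sum.cong) (auto simp: algebra_simps)
            finally have eq: "(z - z') $$ (p, k) = (\<Sum>j<m. (r z p j * x j - r z' p j * x j) * h j k)" .
            show "absval ((z - z') $$ (p, k)) \<le> real (card {..<m}) * (e * A)"
              unfolding eq
            proof (rule absval_sum_bound)
              fix j assume j: "j \<in> {..<m}"
              show "absval ((r z p j * x j - r z' p j * x j) * h j k) \<le> e * A"
                unfolding absval_mult[of "r z p j * x j - r z' p j * x j"]
                using *[of p j] h[of j k] j pk e(1) by (intro mult_mono) auto
            qed
          qed (use car m in auto)
          also have "\<dots> = \<kappa> * (real m * A * e)" by (simp add: \<kappa>_def)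
          also have "\<dots> = \<delta>"
          proof -
            have "A \<noteq> 0" "m \<noteq> 0" "\<kappa> \<noteq> 0" using A m \<kappa> by auto
            then show ?thesis by (simp add: e_def)
          qed
          finally show False using X(3)[OF z] by simp
        qed
      qed (use X(2) e in auto)
      also have "(\<Prod>(p, j)\<in>{..d} \<times> {..<m}. C1 * (2 * (A * \<rho> (\<sigma> j)) / e) powr D)
          = (\<Prod>j<m. C1 * (2 * (A * \<rho> (\<sigma> j)) / e) powr D) ^ Suc d"
        unfolding prod.cartesian_product[symmetric] by simp
      also have "(\<Prod>j<m. C1 * (2 * (A * \<rho> (\<sigma> j)) / e) powr D)
          = (\<Prod>j<m. (C1 * (2 * A * (real m * A)) powr D) * (\<rho> (\<sigma> j) / (\<delta> / \<kappa>)) powr D)"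
      proof (rule prod.cong[OF refl])
        fix j assume "j \<in> {..<m}"
        have "2 * (A * \<rho> (\<sigma> j)) / e = (2 * A * (real m * A)) * (\<rho> (\<sigma> j) / (\<delta> / \<kappa>))"
          by (simp add: e_def)
        then show "C1 * (2 * (A * \<rho> (\<sigma> j)) / e) powr D = (C1 * (2 * A * (real m * A)) powr D) * (\<rho> (\<sigma> j) / (\<delta> / \<kappa>)) powr D"
          by (simp only: powr_mult mult.assoc)
      qed
      also have "\<dots> = (C1 * (2 * A * (real m * A)) powr D) ^ m * (\<Prod>j<m. (\<rho> (\<sigma> j) / (\<delta> / \<kappa>)) powr D)"
        by (simp only: prod.distrib prod_constant card_lessThan power_mult_distrib)
      also have "(\<Prod>j<m. (\<rho> (\<sigma> j) / (\<delta> / \<kappa>)) powr D) = (\<Prod>j<m. (\<rho> j / (\<delta> / \<kappa>)) powr D)"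
        by (rule prod.reindex_bij_betw[OF \<sigma>])
      also have "((C1 * (2 * A * (real m * A)) powr D) ^ m * (\<Prod>j<m. (\<rho> j / (\<delta> / \<kappa>)) powr D)) ^ Suc d
          = K1 * (\<Prod>j<m. (\<rho> j / (\<delta> / \<kappa>)) powr D) ^ Suc d"
        by (simp only: power_mult_distrib K1_def)
      also have "\<dots> \<le> K1 * (M * n ^ Suc d)" using vol K1 by (intro mult_left_mono) auto
      also have "\<dots> \<le> K * (M * n ^ Suc d)"
        proof -
          have "0 \<le> (\<Prod>j<m. (\<rho> j / (\<delta> / \<kappa>)) powr D) ^ Suc d" by (intro zero_le_power prod_nonneg) simp
          with vol have "0 \<le> M * n ^ Suc d" by (rule order_trans[rotated])
          with K(2) show ?thesis by (rule mult_right_mono)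
        qed
      finally have "real (card X) \<le> K * M * n ^ Suc d" by (simp only: mult.assoc)
      moreover have "X \<subseteq> Phi d m" using X(1) Vcar by blast
      then have "covering_number d m \<delta> V \<le> card X" using covering_number_le[OF _ X(2,4)] by blast
      ultimately show ?thesis by linarith
    qed
    have third: "n ^ Suc d \<le> K * M * real (covering_number d m \<delta> (E \<inter> Nhd d m \<eta> ((\<lambda>x. v + x) ` V)))"
      if E: "E \<subseteq> Phi d m" "0 < \<eta>" "\<Theta> \<subseteq> E" "\<forall>x\<in>E. \<forall>p\<le>d. \<forall>k<m. absval (x $$ (p, k)) \<le> b" for E \<eta> b
    proof (rule lower, rule separated_card_le_covering_number[where b = b, OF _ m \<delta>])
      show "G \<subseteq> E \<inter> Nhd d m \<eta> ((\<lambda>x. v + x) ` V)"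
      proof
        fix \<theta> assume \<theta>: "\<theta> \<in> G"
        have "\<theta> \<in> (\<lambda>x. v + x) ` V" using GV[OF \<theta>] back_v[OF \<theta>] by (metis imageI)
        moreover have "mat_norm (\<theta> - \<theta>) < \<eta>"
          using mat_norm_diff_self[of \<theta> "d + 1" m] m \<theta> G \<Theta> E(2) by (force simp: Phi_def)
        ultimately show "\<theta> \<in> E \<inter> Nhd d m \<eta> ((\<lambda>x. v + x) ` V)"
          using \<theta> G \<Theta> E(3) unfolding Nhd_def by blast
      qed
      show "\<delta> < mat_norm (x - y)" if "x \<in> G" "y \<in> G" "x \<noteq> y" for x y using that sep G(2) by blast
    qed (use E G in auto)
    show "\<exists>v V. representation_box d m v V \<and>
      n ^ Suc d \<le> K * M * real (covering_number d m \<delta> V) \<and>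
      real (covering_number d m \<delta> V) \<le> K * M * n ^ Suc d \<and>
      (\<forall>\<eta> b. \<forall>E \<subseteq> Phi d m. 0 < \<eta> \<longrightarrow> \<Theta> \<subseteq> E \<longrightarrow>
        (\<forall>x\<in>E. \<forall>p\<le>d. \<forall>k<m. absval (x $$ (p, k)) \<le> b) \<longrightarrow>
        n ^ Suc d \<le> K * M * real (covering_number d m \<delta> (E \<inter> Nhd d m \<eta> ((\<lambda>x. v + x) ` V))))"
      using repbox low up third by (intro exI[of _ v] exI[of _ V] conjI allI impI) auto
  qed
qed

end

section \<open>The dichotomy\<close>

context moment_curve
begin

lemma pr_bound:
  assumes "\<And>p. p \<le> d \<Longrightarrow> absval (\<theta> p k) \<le> 1" "absval r \<le> 1"
  shows "absval (pr r \<theta> k) \<le> real (Suc d) * C1"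
proof -
  have "absval (\<Sum>p\<le>d. c p * r ^ p * \<theta> p k) \<le> real (card {..d}) * C1"
  proof (rule absval_sum_bound)
    fix p assume p: "p \<in> {..d}"
    have "absval (c p) * absval r ^ p * absval (\<theta> p k) \<le> C1 * 1 * 1"
      using c_upper[of p] p assms C1_ge_1 by (intro mult_mono power_le_one) auto
    then show "absval (c p * r ^ p * \<theta> p k) \<le> C1" by (simp add: absval_mult absval_power)
  qed
  then show ?thesis by (simp add: pr_def)
qed

text \<open>Covers of the projected set have arbitrary centres, while \<open>config\<close> asks for
  representatives in the set. Choosing one point per ball that is met doubles the radius; the
  premise \<open>2 * real ((d + 1) * m) \<le> L\<close> absorbs this and the passage to the smaller
  scale.\<close>

lemma config_of_bad_set:
  fixes \<Theta> :: "'a mat set" and F :: "'a \<Rightarrow> 'a mat \<Rightarrow> 'a mat"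
  assumes m: "0 < m" and \<delta>: "0 < \<delta>" "\<delta> \<le> 1"
    and L: "C1 \<le> L" "6 \<le> L" "real (Suc d) \<le> L" "2 * real ((d + 1) * m) \<le> L"
      "real ((d + 1) * m) / \<delta> \<le> 2 powr L"
    and n: "0 < n" "n ^ Suc d \<le> real (card \<Theta>)"
    and R: "finite R" "\<And>r. r \<in> R \<Longrightarrow> absval r \<le> 1"
      "\<And>r s. r \<in> R \<Longrightarrow> s \<in> R \<Longrightarrow> r \<noteq> s \<Longrightarrow> \<delta> / real ((d + 1) * m) < absval (r - s)"
      "(\<delta> / real ((d + 1) * m)) powr (- D) \<le> L * real (card R)"
    and \<Theta>: "finite \<Theta>" "\<Theta> \<subseteq> Phi d m" "\<And>x p k. x \<in> \<Theta> \<Longrightarrow> p \<le> d \<Longrightarrow> k < m \<Longrightarrow> absval (x $$ (p, k)) \<le> 1"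
      "\<And>x y. x \<in> \<Theta> \<Longrightarrow> y \<in> \<Theta> \<Longrightarrow> x \<noteq> y \<Longrightarrow> \<delta> < mat_norm (x - y)"
    and F: "\<And>r x k. x \<in> \<Theta> \<Longrightarrow> k < m \<Longrightarrow> F r x $$ (0, k) = pr r (entries x) k"
    and F_Phi: "\<And>r x. F r x \<in> Phi d m"
    and bad: "\<And>r. r \<in> R \<Longrightarrow> \<exists>P. P \<subseteq> Phi d m \<and> finite P \<and> real (card P) \<le> L * n \<and>
      F r ` \<Theta> \<subseteq> (\<Union>c\<in>P. {x \<in> Phi d m. mat_norm (x - c) \<le> \<delta>})"
  shows "config {..<m} (\<delta> / real ((d + 1) * m)) L R (entries ` \<Theta>) n"
proof -
  define \<kappa> where "\<kappa> = real ((d + 1) * m)"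
  have \<kappa>: "1 \<le> \<kappa>" unfolding \<kappa>_def by (rule dimension_ge_1[OF m])
  have e: "0 < \<delta> / \<kappa>" "\<delta> / \<kappa> \<le> 1" using \<delta> \<kappa> by (auto simp: divide_le_eq)
  have sep: "\<not> pnear {..<m} (\<delta> / \<kappa>) (entries x) (entries y)" if xy: "x \<in> \<Theta>" "y \<in> \<Theta>" "x \<noteq> y" for x y
  proof
    assume *: "pnear {..<m} (\<delta> / \<kappa>) (entries x) (entries y)"
    have car: "x \<in> carrier_mat (d + 1) m" "y \<in> carrier_mat (d + 1) m" using xy \<Theta>(2) by (auto simp: Phi_def)
    have "mat_norm (x - y) \<le> real ((d + 1) * m) * (\<delta> / \<kappa>)"
      using * car m by (intro mat_norm_le) (auto simp: pnear_def near_def)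
    also have "\<dots> = \<delta>" using \<kappa> unfolding \<kappa>_def[symmetric] by simp
    finally show False using \<Theta>(4)[OF xy] by simp
  qed
  have inj: "inj_on entries \<Theta>"
  proof (rule inj_onI)
    fix x y assume xy: "x \<in> \<Theta>" "y \<in> \<Theta>" "entries x = entries y"
    then have "pnear {..<m} (\<delta> / \<kappa>) (entries x) (entries y)" using e(1) pnear_refl[of "\<delta> / \<kappa>"] by simp
    then show "x = y" using sep xy by blast
  qed
  have far: "pnear {..<m} L (entries x) (entries y)" if xy: "x \<in> \<Theta>" "y \<in> \<Theta>" for x y
  proof -
    have "absval (x $$ (p, k) - y $$ (p, k)) \<le> 1 + 1" if "p \<le> d" "k < m" for p k
      using that xy \<Theta>(3) by (intro absval_triangle_diff_le) auto
    then show ?thesis using L(2) by (force simp: pnear_def near_def)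
  qed
  have few: "\<exists>Y\<subseteq>entries ` \<Theta>. real (card Y) \<le> L * n \<and>
    (\<forall>\<theta>\<in>entries ` \<Theta>. \<exists>y\<in>Y. near {..<m} (L * (\<delta> / \<kappa>)) (pr r \<theta>) (pr r y))" if r: "r \<in> R" for r
  proof -
    obtain P where P: "P \<subseteq> Phi d m" "finite P" "real (card P) \<le> L * n"
      "F r ` \<Theta> \<subseteq> (\<Union>c\<in>P. {x \<in> Phi d m. mat_norm (x - c) \<le> \<delta>})"
      using bad[OF r] by blast
    define Q where "Q = {c \<in> P. \<exists>x\<in>\<Theta>. mat_norm (F r x - c) \<le> \<delta>}"
    have "\<forall>c\<in>Q. \<exists>x. x \<in> \<Theta> \<and> mat_norm (F r x - c) \<le> \<delta>" by (auto simp: Q_def)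
    from bchoice[OF this] obtain ch where ch: "\<And>c. c \<in> Q \<Longrightarrow> ch c \<in> \<Theta>" "\<And>c. c \<in> Q \<Longrightarrow> mat_norm (F r (ch c) - c) \<le> \<delta>"
      by blast
    have "finite Q" "card Q \<le> card P" using P(2) by (auto simp: Q_def intro: card_mono)
    then have "card ((\<lambda>c. entries (ch c)) ` Q) \<le> card P" using card_image_le order_trans by blast
    then have "real (card ((\<lambda>c. entries (ch c)) ` Q)) \<le> L * n" using P(3) by linarith
    moreover have "\<exists>y\<in>(\<lambda>c. entries (ch c)) ` Q. near {..<m} (L * (\<delta> / \<kappa>)) (pr r (entries x)) (pr r y)"
      if x: "x \<in> \<Theta>" for x
    proof -
      obtain c where c: "c \<in> P" "mat_norm (F r x - c) \<le> \<delta>" using P(4) x by blast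
      then have cQ: "c \<in> Q" using x by (auto simp: Q_def)
      have car: "c \<in> carrier_mat (d + 1) m" "F r z \<in> carrier_mat (d + 1) m" for z
        using c(1) P(1) F_Phi by (auto simp: Phi_def)
      have entry: "absval (pr r (entries z) k - c $$ (0, k)) \<le> \<delta>"
        if z: "z \<in> \<Theta>" "mat_norm (F r z - c) \<le> \<delta>" "k < m" for z k
      proof -
        have "absval ((F r z - c) $$ (0, k)) \<le> mat_norm (F r z - c)"
          using car that by (intro entry_le_mat_norm[of _ "d + 1" m]) auto
        then show ?thesis using z car F[OF z(1,3)] by simp
      qed
      have "2 * \<delta> \<le> L * (\<delta> / \<kappa>)"
      proof -
        have "2 * \<kappa> * (\<delta> / \<kappa>) \<le> L * (\<delta> / \<kappa>)" using L(4) e(1) unfolding \<kappa>_def[symmetric] by (intro mult_right_mono) auto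
        then show ?thesis using \<kappa> by simp
      qed
      moreover have "absval (pr r (entries x) k - pr r (entries (ch c)) k) \<le> \<delta> + \<delta>" if k: "k < m" for k
        using absval_triangle_diff_le[OF entry[OF x c(2) k] entry[OF ch(1)[OF cQ] ch(2)[OF cQ] k]] by simp
      ultimately have "near {..<m} (L * (\<delta> / \<kappa>)) (pr r (entries x)) (pr r (entries (ch c)))"
        by (force simp: near_def)
      then show ?thesis using cQ by blast
    qed
    moreover have "(\<lambda>c. entries (ch c)) ` Q \<subseteq> entries ` \<Theta>" using ch(1) by blast
    ultimately show ?thesis by (intro exI[of _ "(\<lambda>c. entries (ch c)) ` Q"] conjI) auto
  qed
  have "real (card \<Theta>) \<le> L * real (card \<Theta>)" using L(2) mult_right_mono[of 1 L "real (card \<Theta>)"] by simp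
  then have card: "n ^ Suc d \<le> L * real (card (entries ` \<Theta>))" using n(2) by (simp only: card_image[OF inj])
  have scale: "1 / (\<delta> / \<kappa>) \<le> 2 powr L" using L(5) by (simp add: \<kappa>_def)
  show ?thesis
    unfolding config_def \<kappa>_def[symmetric]
  proof (intro conjI ballI impI)
    fix x y assume "x \<in> entries ` \<Theta>" "y \<in> entries ` \<Theta>" "x \<noteq> y"
    then show "\<not> pnear {..<m} (\<delta> / \<kappa>) x y" using sep by blast
  next
    fix x y assume "x \<in> entries ` \<Theta>" "y \<in> entries ` \<Theta>"
    then show "pnear {..<m} L x y" using far by blast
  qed (use e L n R \<Theta>(1) few card scale in \<open>simp_all only: \<kappa>_def[symmetric] finite_lessThan finite_imageI simp_thms\<close>)
qed

end

section \<open>The one-point box and the entries of the highest weight projection\<close>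

lemma vec_norm_zero: "0 < m \<Longrightarrow> vec_norm (0\<^sub>v m :: 'a::local_field_char_0 vec) = 0"
proof -
  assume m: "0 < m"
  then have "(\<lambda>i. absval ((0\<^sub>v m :: 'a vec) $ i)) ` {..<m} = {0}" by (auto intro!: image_eqI[of _ _ 0])
  then show ?thesis by (simp add: vec_norm_def coord_norm_def L2_set_def)
qed

lemma orthogonal_family_zero:
  assumes "0 < m"
  shows "orthogonal_family m 0 (\<lambda>_. 0\<^sub>v m :: 'a::local_field_char_0 vec)"
proof (cases "nonarchimedean TYPE('a)")
  case True
  have "vec m (\<lambda>l. \<Sum>j\<le>0. c j * (0\<^sub>v m :: 'a vec) $ l) = 0\<^sub>v m" for c :: "nat \<Rightarrow> 'a" by (intro eq_vecI) auto
  then show ?thesis unfolding orthogonal_family_def using True assms by (simp add: vec_norm_zero)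
next
  case False
  then show ?thesis
    unfolding orthogonal_family_def using absval_ultrametric_or_usual[where 'a = 'a] by simp
qed

lemma pi_plus_u_act_entry:
  fixes \<rho> :: "'a::local_field_char_0 mat \<Rightarrow> 'a mat"
  assumes c: "\<And>r p. p \<le> d \<Longrightarrow> \<rho> (upper_unip r) $$ (0, p) = c p * r ^ p"
    and car: "\<rho> (upper_unip r) \<in> carrier_mat (d + 1) (d + 1)"
    and x: "x \<in> Phi d m" "k < m"
  shows "pi_plus d m (u_act \<rho> r x) $$ (0, k) = (\<Sum>p\<le>d. c p * r ^ p * x $$ (p, k))"
proof -
  have "x \<in> carrier_mat (d + 1) m" using x by (simp add: Phi_def)
  then have "pi_plus d m (u_act \<rho> r x) $$ (0, k) = (\<Sum>p<d + 1. \<rho> (upper_unip r) $$ (0, p) * x $$ (p, k))"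
    using car x(2) by (auto simp: pi_plus_def u_act_def scalar_prod_def atLeast0LessThan)
  also have "\<dots> = (\<Sum>p\<le>d. c p * r ^ p * x $$ (p, k))"
    by (intro sum.cong) (auto simp: c)
  finally show ?thesis .
qed

lemma upper_unip_in_SL2:
  fixes r :: "'a::field"
  shows "upper_unip r \<in> SL2"
proof -
  let ?A = "upper_unip r :: 'a mat"
  have car: "?A \<in> carrier_mat 2 2"
    by (intro carrier_matI) (simp_all add: upper_unip_def mat_of_rows_list_def numeral_2_eq_2)
  have e: "?A $$ (0, 0) = 1" "?A $$ (Suc 0, Suc 0) = 1" "?A $$ (Suc 0, 0) = 0"
    by (simp_all add: upper_unip_def mat_of_rows_list_def)
  have "upper_triangular ?A"
    unfolding upper_triangular_def carrier_matD(1)[OF car] using e by (auto simp: numeral_2_eq_2 less_Suc_eq)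
  then have "Determinant.det ?A = prod_list (diag_mat ?A)" using car by (rule det_upper_triangular)
  also have "\<dots> = 1" unfolding diag_mat_def carrier_matD(1)[OF car] using e by (simp add: numeral_2_eq_2)
  finally show ?thesis using car by (simp add: SL2_def)
qed

context moment_curve
begin

text \<open>The zero vector alone is an orthogonal family and spans a box with a single point. It
  settles the scales that are bounded below, where constants decide everything.\<close>

lemma point_box:
  fixes \<Theta> :: "'a mat set"
  assumes m: "0 < m" and \<Theta>: "\<Theta> \<subseteq> Phi d m" "v \<in> \<Theta>" and \<delta>: "0 < \<delta>" "0 < \<eta>"
    and b: "\<And>x p k. x \<in> \<Theta> \<Longrightarrow> p \<le> d \<Longrightarrow> k < m \<Longrightarrow> absval (x $$ (p, k)) \<le> b"
  shows "\<exists>V. representation_box d m v V \<and> covering_number d m \<delta> V = 1 \<and>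
    1 \<le> covering_number d m \<delta> (\<Theta> \<inter> Nhd d m \<eta> ((\<lambda>x. v + x) ` V))"
proof -
  define V where "V = box_at_zero d m 0 (\<lambda>_. 0\<^sub>v m :: 'a vec)"
  have V: "V = {0\<^sub>m (d + 1) m}"
  proof
    have eq: "mat (d + 1) m (\<lambda>pq. \<Sum>i\<le>d. \<Sum>j\<le>0. r i j * tensor (unit_vec (d + 1) i) (0\<^sub>v m :: 'a vec) $$ pq) = 0\<^sub>m (d + 1) m"
      for r :: "nat \<Rightarrow> nat \<Rightarrow> 'a"
      using box_entry[of _ d _ m 0 "\<lambda>_. 0\<^sub>v m" r] by (intro eq_matI) auto
    then show "V \<subseteq> {0\<^sub>m (d + 1) m}" unfolding V_def box_at_zero_def by blast
    have "0\<^sub>m (d + 1) m = mat (d + 1) m (\<lambda>pq. \<Sum>i\<le>d. \<Sum>j\<le>0. (0::'a) * tensor (unit_vec (d + 1) i) (0\<^sub>v m) $$ pq)"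
      by (intro eq_matI) auto
    then show "{0\<^sub>m (d + 1) m} \<subseteq> V"
      unfolding V_def box_at_zero_def by (auto intro!: exI[of _ "\<lambda>_ _. 0"] simp: unit_ball_F_def)
  qed
  have v: "v \<in> carrier_mat (d + 1) m" using \<Theta> by (auto simp: Phi_def)
  have "representation_box d m v V"
    unfolding representation_box_def V_def using \<Theta> orthogonal_family_zero[OF m, where 'a = 'a]
    by (intro conjI exI[of _ 0] exI[of _ "\<lambda>_. 0\<^sub>v m"]) auto
  moreover have "covering_number d m \<delta> V = 1"
  proof (rule antisym)
    show "1 \<le> covering_number d m \<delta> V"
      by (rule covering_number_ge_1[OF _ _ m \<delta>(1), where b = 0]) (auto simp: V Phi_def)
    have "mat_norm (0\<^sub>m (d + 1) m - 0\<^sub>m (d + 1) m :: 'a mat) \<le> \<delta>"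
      using mat_norm_diff_self[of "0\<^sub>m (d + 1) m :: 'a mat" "d + 1" m] m \<delta> by simp
    then have "covering_number d m \<delta> V \<le> card {0\<^sub>m (d + 1) m :: 'a mat}"
      by (intro covering_number_le) (auto simp: V Phi_def)
    then show "covering_number d m \<delta> V \<le> 1" by simp
  qed
  moreover have "1 \<le> covering_number d m \<delta> (\<Theta> \<inter> Nhd d m \<eta> ((\<lambda>x. v + x) ` V))"
  proof (rule covering_number_ge_1[where b = b, OF _ _ m \<delta>(1)])
    have "mat_norm (v - v) < \<eta>" using mat_norm_diff_self[OF v] m \<delta>(2) by simp
    then have "v \<in> Nhd d m \<eta> ((\<lambda>x. v + x) ` V)"
      unfolding Nhd_def using v by (auto simp: V Phi_def)
    then show "\<Theta> \<inter> Nhd d m \<eta> ((\<lambda>x. v + x) ` V) \<noteq> {}" using \<Theta>(2) by blast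
  qed (use \<Theta> b in auto)
  ultimately show ?thesis by blast
qed

text \<open>The scale enters only through \<open>L = \<delta> powr (- 2 * \<epsilon>)\<close>, which dominates all constants once
  \<open>\<delta> powr (- \<epsilon>)\<close> is large; the set of bad parameters has a large separated subset.\<close>

lemma config_at_small_scale:
  fixes \<Theta> :: "'a mat set" and \<mu> :: "'a measure" and F :: "'a \<Rightarrow> 'a mat \<Rightarrow> 'a mat"
  assumes m: "0 < m" and haar: "haar_measure \<mu>"
    and vol: "\<And>\<rho>. 0 < \<rho> \<Longrightarrow> \<rho> \<le> 1 \<Longrightarrow> volume \<mu> \<rho> \<le> C0 * \<rho> powr D"
    and \<epsilon>: "0 < \<epsilon>" and \<delta>: "0 < \<delta>" "\<delta> < 1"
    and big: "C0 \<le> \<delta> powr (- \<epsilon>)" "C1 \<le> \<delta> powr (- \<epsilon>)" "6 \<le> \<delta> powr (- \<epsilon>)" "real (Suc d) \<le> \<delta> powr (- \<epsilon>)"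
      "2 * real ((d + 1) * m) \<le> \<delta> powr (- \<epsilon>)"
      "real ((d + 1) * m) powr \<epsilon> / (\<epsilon> * ln 2) \<le> \<delta> powr (- \<epsilon>)"
    and \<Theta>: "finite \<Theta>" "\<Theta> \<subseteq> E" "E \<subseteq> Phi d m" "\<And>x p k. x \<in> E \<Longrightarrow> p \<le> d \<Longrightarrow> k < m \<Longrightarrow> absval (x $$ (p, k)) \<le> 1"
      "\<And>x y. x \<in> \<Theta> \<Longrightarrow> y \<in> \<Theta> \<Longrightarrow> x \<noteq> y \<Longrightarrow> \<delta> < mat_norm (x - y)"
    and n: "n ^ Suc d \<le> real (card \<Theta>)" "0 < n"
    and F: "\<And>r x k. x \<in> E \<Longrightarrow> k < m \<Longrightarrow> F r x $$ (0, k) = pr r (entries x) k"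
    and F0: "\<And>r x p k. 0 < p \<Longrightarrow> p \<le> d \<Longrightarrow> k < m \<Longrightarrow> F r x $$ (p, k) = 0"
    and F_Phi: "\<And>r x. F r x \<in> Phi d m"
    and no_good: "\<not> (\<exists>B\<in>sets borel. B \<subseteq> unit_ball_F \<and> emeasure \<mu> (unit_ball_F - B) \<le> ennreal (\<delta> powr \<epsilon>) \<and>
      (\<forall>r\<in>B. n * \<delta> powr (- \<epsilon>) \<le> real (covering_number d m \<delta> (F r ` E))))"
  shows "\<exists>R. config {..<m} (\<delta> / real ((d + 1) * m)) (\<delta> powr (- (2 * \<epsilon>))) R (entries ` \<Theta>) n"
proof -
  define \<kappa> where "\<kappa> = real ((d + 1) * m)"
  define q where "q = \<delta> powr (- \<epsilon>)"
  define L where "L = \<delta> powr (- (2 * \<epsilon>))"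
  have \<kappa>: "1 \<le> \<kappa>" unfolding \<kappa>_def by (rule dimension_ge_1[OF m])
  have Lq: "L = q * q" unfolding L_def q_def powr_add[symmetric] by simp
  have q6: "6 \<le> q" using big(3) by (simp add: q_def)
  have qL: "q \<le> L" using q6 mult_right_mono[of 1 q q] by (simp add: Lq)
  define e where "e = \<delta> / \<kappa>"
  have e: "0 < e" "e \<le> 1" using \<delta> \<kappa> by (auto simp: e_def divide_le_eq)
  define Bad where "Bad = {r \<in> unit_ball_F. real (covering_number d m \<delta> (F r ` E)) < n * q}"
  obtain R where R: "R \<subseteq> Bad" "finite R" "\<And>r s. r \<in> R \<Longrightarrow> s \<in> R \<Longrightarrow> r \<noteq> s \<Longrightarrow> \<not> absval (r - s) \<le> e"
    "\<And>r. r \<in> Bad \<Longrightarrow> \<exists>s\<in>R. absval (r - s) \<le> e"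
  proof (rule maximal_separated[of Bad "\<lambda>r s. absval (r - s) \<le> e" "nat \<lceil>C1 * (1 / e) powr D\<rceil>"])
    fix X assume X: "X \<subseteq> Bad" "finite X" "\<forall>r\<in>X. \<forall>s\<in>X. r \<noteq> s \<longrightarrow> \<not> absval (r - s) \<le> e"
    have "real (card X) \<le> C1 * (1 / e) powr D"
    proof (rule packing[where ?x0.0 = 0, OF e X(2)])
      show "absval (x - 0) \<le> 1" if "x \<in> X" for x
        using subsetD[OF X(1) that] by (simp add: Bad_def unit_ball_F_def)
      show "e < absval (x - y)" if "x \<in> X" "y \<in> X" "x \<noteq> y" for x y
      proof -
        have "\<not> absval (x - y) \<le> e" using X(3) that by blast
        then show ?thesis by linarith
      qed
    qed
    then show "card X \<le> nat \<lceil>C1 * (1 / e) powr D\<rceil>" by linarith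
  next
    fix R assume "R \<subseteq> Bad" "finite R" "\<And>r s. r \<in> R \<Longrightarrow> s \<in> R \<Longrightarrow> r \<noteq> s \<Longrightarrow> \<not> absval (r - s) \<le> e"
      "\<And>r. r \<in> Bad \<Longrightarrow> \<exists>s\<in>R. absval (r - s) \<le> e"
    then show thesis by (rule that)
  qed (use e in \<open>auto simp: absval_minus_commute\<close>)
  \<comment> \<open>Removing balls around \<open>R\<close> in place of \<open>Bad\<close> makes the
    good set visibly Borel and bounds the measure of its complement by the size of
    \<open>R\<close>.\<close>
  define B where "B = unit_ball_F - (\<Union>s\<in>R. cball s e)"
  have unit: "unit_ball_F = (fball 1 :: 'a set)" by (simp add: unit_ball_F_def)
  have Bs: "B \<in> sets borel"
    unfolding B_def unit fball_eq_cball using R(2) by (intro sets.Diff sets.finite_UN) auto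
  have good: "\<forall>r\<in>B. n * q \<le> real (covering_number d m \<delta> (F r ` E))"
  proof
    fix r assume r: "r \<in> B"
    show "n * q \<le> real (covering_number d m \<delta> (F r ` E))"
    proof (rule ccontr)
      assume "\<not> ?thesis"
      then have "r \<in> Bad" using r by (auto simp: Bad_def B_def)
      then obtain s where s: "s \<in> R" "absval (r - s) \<le> e" using R(4) by blast
      then have "r \<in> cball s e" by (simp add: dist_absval absval_minus_commute)
      then show False using r s(1) by (auto simp: B_def)
    qed
  qed
  have "\<not> emeasure \<mu> (unit_ball_F - B) \<le> ennreal (\<delta> powr \<epsilon>)"
    using no_good Bs good unfolding q_def by (auto simp: B_def)
  then have "ennreal (\<delta> powr \<epsilon>) < emeasure \<mu> (unit_ball_F - B)" by (simp add: not_le)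
  also have "\<dots> \<le> emeasure \<mu> (\<Union>s\<in>R. cball s e)"
    using R(2) haar by (intro emeasure_mono) (auto simp: B_def haar_measure_def)
  also have "\<dots> \<le> (\<Sum>s\<in>R. emeasure \<mu> (cball s e))"
    using R(2) haar by (intro emeasure_subadditive_finite) (auto simp: haar_measure_def)
  also have "\<dots> = ennreal (real (card R) * volume \<mu> e)"
    by (simp add: emeasure_cball[OF haar] ennreal_mult' ennreal_of_nat_eq_real_of_nat)
  finally have "\<delta> powr \<epsilon> < real (card R) * volume \<mu> e" by (simp add: ennreal_less_iff)
  also have "\<dots> \<le> real (card R) * (q * e powr D)"
  proof -
    have "volume \<mu> e \<le> C0 * e powr D" by (rule vol[OF e])
    also have "\<dots> \<le> q * e powr D" using big(1) unfolding q_def by (rule mult_right_mono) simp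
    finally show ?thesis by (rule mult_left_mono) simp
  qed
  finally have "\<delta> powr \<epsilon> * (q * e powr (- D)) \<le> real (card R) * (q * e powr D) * (q * e powr (- D))"
    using q6 by (intro mult_right_mono) auto
  moreover have "\<delta> powr \<epsilon> * q = 1" using \<delta> by (simp add: q_def powr_minus)
  moreover have "e powr D * e powr (- D) = 1" using e by (simp add: powr_minus)
  ultimately have "e powr (- D) \<le> real (card R) * (q * q)"
    by (metis (no_types, lifting) mult.assoc mult.commute mult.left_neutral)
  then have RL: "e powr (- D) \<le> L * real (card R)" by (simp add: Lq mult.commute)
  \<comment> \<open>The logarithm is at most a small power: one factor \<open>q\<close> of
    \<open>L\<close> is that power of \<open>1 / \<delta>\<close>, the other absorbs the constants
    through the last premise in \<open>big\<close>.\<close>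
  have scale: "\<kappa> / \<delta> \<le> 2 powr L"
  proof -
    have pos: "1 \<le> \<kappa> / \<delta>" using \<kappa> \<delta> by (simp add: le_divide_eq)
    have "ln (\<kappa> / \<delta>) \<le> (\<kappa> / \<delta>) powr \<epsilon> / \<epsilon>" by (rule ln_powr_bound[OF pos \<epsilon>])
    also have "\<dots> = ln 2 * (\<kappa> powr \<epsilon> / (\<epsilon> * ln 2)) * q"
      using \<kappa> \<delta> \<epsilon> by (simp add: q_def powr_divide powr_minus field_simps)
    also have "\<dots> \<le> ln 2 * q * q" using big(6) q6 unfolding \<kappa>_def[symmetric] q_def[symmetric] by (intro mult_right_mono mult_left_mono) auto
    finally have "ln (\<kappa> / \<delta>) \<le> L * ln 2" by (simp add: Lq mult_ac)
    then have "exp (ln (\<kappa> / \<delta>)) \<le> exp (L * ln 2)" by simp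
    then show ?thesis using pos by (simp add: powr_def)
  qed
  have "config {..<m} (\<delta> / real ((d + 1) * m)) L R (entries ` \<Theta>) n"
  proof (rule config_of_bad_set[where F = F, OF m])
    fix r assume r: "r \<in> R"
    have r1: "absval r \<le> 1" using r R(1) by (auto simp: Bad_def unit_ball_F_def)
    obtain P where P: "P \<subseteq> Phi d m" "finite P" "card P = covering_number d m \<delta> (F r ` E)"
      "F r ` E \<subseteq> (\<Union>c\<in>P. {x \<in> Phi d m. mat_norm (x - c) \<le> \<delta>})"
    proof (rule finite_cover_attained[OF _ m \<delta>(1), of "F r ` E" "real (Suc d) * C1"])
      fix x p k assume x: "x \<in> F r ` E" "p \<le> d" "k < m"
      then obtain y where y: "y \<in> E" "x = F r y" by blast
      show "absval (x $$ (p, k)) \<le> real (Suc d) * C1"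
      proof (cases "p = 0")
        case True
        have "absval (pr r (entries y) k) \<le> real (Suc d) * C1"
          using \<Theta>(4)[OF y(1)] x(3) r1 by (intro pr_bound) auto
        then show ?thesis using True F[OF y(1) x(3)] y(2) by simp
      next
        case False
        then show ?thesis using F0[of p k r y] x y C1_ge_1 by simp
      qed
    qed (use F_Phi in auto)
    have "real (card P) < n * q" using r R(1) P(3) by (auto simp: Bad_def)
    also have "n * q \<le> L * n" using qL n(2) by (simp add: mult.commute)
    finally have "real (card P) \<le> L * n" by simp
    moreover have "F r ` \<Theta> \<subseteq> F r ` E" using \<Theta>(2) by blast
    ultimately show "\<exists>P. P \<subseteq> Phi d m \<and> finite P \<and> real (card P) \<le> L * n \<and>
      F r ` \<Theta> \<subseteq> (\<Union>c\<in>P. {x \<in> Phi d m. mat_norm (x - c) \<le> \<delta>})"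
      using P by (intro exI[of _ P]) blast
  next
    show "real ((d + 1) * m) / \<delta> \<le> 2 powr L" using scale unfolding \<kappa>_def .
    show "(\<delta> / real ((d + 1) * m)) powr (- D) \<le> L * real (card R)" using RL unfolding e_def \<kappa>_def .
    show "\<delta> / real ((d + 1) * m) < absval (r - s)" if "r \<in> R" "s \<in> R" "r \<noteq> s" for r s
      using R(3)[OF that] unfolding e_def \<kappa>_def by linarith
    show "C1 \<le> L" "6 \<le> L" "real (Suc d) \<le> L" "2 * real ((d + 1) * m) \<le> L"
      using big qL unfolding q_def[symmetric] by linarith+
    show "absval r \<le> 1" if "r \<in> R" for r using that R(1) by (auto simp: Bad_def unit_ball_F_def)
    show "F r x $$ (0, k) = pr r (entries x) k" if "x \<in> \<Theta>" "k < m" for r x k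
      using F that \<Theta>(2) by blast
    show "absval (x $$ (p, k)) \<le> 1" if "x \<in> \<Theta>" "p \<le> d" "k < m" for x p k using \<Theta>(4) that \<Theta>(2) by blast
    show "\<Theta> \<subseteq> Phi d m" using \<Theta>(2,3) by blast
  qed (use \<delta> n R(2) \<Theta> F_Phi in auto)
  then show ?thesis unfolding L_def by blast
qed

end

section \<open>Assembling the two alternatives\<close>

context moment_curve
begin

text \<open>For \<open>\<delta> powr (- \<epsilon>) < \<Lambda>\<close> the scale is bounded below,
  and a single point is a valid box because \<open>K1\<close> dominates
  \<open>\<Lambda> powr (\<alpha> / \<epsilon>)\<close> and hence
  \<open>\<delta> powr (- \<alpha>)\<close>. For smaller scales, failure of the first alternative
  produces a configuration.\<close>

lemma dichotomy:
  fixes \<mu> :: "'a measure" and F :: "'a \<Rightarrow> 'a mat \<Rightarrow> 'a mat"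
  assumes m: "0 < m" and haar: "haar_measure \<mu>" and C0: "1 \<le> C0"
    and vol: "\<And>\<rho>. 0 < \<rho> \<Longrightarrow> \<rho> \<le> 1 \<Longrightarrow> volume \<mu> \<rho> \<le> C0 * \<rho> powr D"
    and F: "\<And>r x k. x \<in> Phi d m \<Longrightarrow> k < m \<Longrightarrow> F r x $$ (0, k) = pr r (entries x) k"
    and F0: "\<And>r x p k. 0 < p \<Longrightarrow> p \<le> d \<Longrightarrow> k < m \<Longrightarrow> F r x $$ (p, k) = 0"
    and F_Phi: "\<And>r x. F r x \<in> Phi d m"
    and \<alpha>: "0 < \<alpha>"
  shows "\<exists>\<epsilon>\<^sub>0>0. \<exists>C\<^sub>0>0. \<forall>\<epsilon> C. 0 < \<epsilon> \<and> \<epsilon> < \<epsilon>\<^sub>0 \<and> C > C\<^sub>0 \<longrightarrow>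
    (\<exists>K>0. \<forall>\<delta>. \<forall>\<Theta> \<subseteq> (unit_ball_Phi d m :: 'a mat set).
      0 < \<delta> \<and> \<delta> < 1 \<and> real (covering_number d m \<delta> \<Theta>) \<ge> \<delta> powr (- \<alpha>) \<longrightarrow>
      (\<exists>B \<in> sets borel. B \<subseteq> unit_ball_F \<and>
         emeasure \<mu> (unit_ball_F - B) \<le> ennreal (\<delta> powr \<epsilon>) \<and>
         (\<forall>r\<in>B. real (covering_number d m \<delta> (F r ` \<Theta>))
                   \<ge> \<delta> powr (- \<alpha> / real (d + 1) - \<epsilon>)))
      \<or>
      (\<exists>v V. representation_box d m v V \<and>
         \<delta> powr (- \<alpha> + C * \<epsilon>) \<le> K * real (covering_number d m \<delta> V) \<and>
         real (covering_number d m \<delta> V) \<le> K * \<delta> powr (- \<alpha> - C * \<epsilon>) \<and>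
         \<delta> powr (- \<alpha> + C * \<epsilon>)
           \<le> K * real (covering_number d m \<delta> (\<Theta> \<inter> Nhd d m (C * \<delta>) ((\<lambda>x. v + x) ` V)))))"
proof -
  from box_concl_of_config[of m] obtain Ex where Ex: "\<forall>I \<delta> L R \<Theta> n. card I = m \<longrightarrow> config I \<delta> L R \<Theta> n \<longrightarrow> box_concl I \<delta> (L ^ Ex) \<Theta> n"
    by (elim exE) (rule that)
  obtain K where K0: "0 < K" and K: "\<forall>\<delta> M \<Theta> n. 0 < \<delta> \<longrightarrow> 0 < M \<longrightarrow> finite \<Theta> \<longrightarrow> \<Theta> \<subseteq> Phi d m \<longrightarrow>
    (\<forall>x\<in>\<Theta>. \<forall>y\<in>\<Theta>. x \<noteq> y \<longrightarrow> \<delta> < mat_norm (x - y)) \<longrightarrow>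
    box_concl {..<m} (\<delta> / real ((d + 1) * m)) M (entries ` \<Theta>) n \<longrightarrow>
    (\<exists>v V. representation_box d m v V \<and>
      n ^ Suc d \<le> K * M * real (covering_number d m \<delta> V) \<and>
      real (covering_number d m \<delta> V) \<le> K * M * n ^ Suc d \<and>
      (\<forall>\<eta> b. \<forall>E \<subseteq> Phi d m. 0 < \<eta> \<longrightarrow> \<Theta> \<subseteq> E \<longrightarrow>
        (\<forall>x\<in>E. \<forall>p\<le>d. \<forall>k<m. absval (x $$ (p, k)) \<le> b) \<longrightarrow>
        n ^ Suc d \<le> K * M * real (covering_number d m \<delta> (E \<inter> Nhd d m \<eta> ((\<lambda>x. v + x) ` V)))))"
    using representation_box_of_box_concl[OF m] by (elim exE conjE) (rule that)
  \<comment> \<open>A loss of \<open>L ^ Ex\<close> with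
    \<open>L = \<delta> powr (- 2 * \<epsilon>)\<close> amounts to
    \<open>\<delta> powr (- 2 * Ex * \<epsilon>)\<close>; this sets the threshold for
    \<open>C\<close>, and the constants may depend on \<open>\<epsilon>\<close> through
    \<open>\<Lambda>\<close>.\<close>
  show ?thesis
  proof (rule exI[of _ "1::real"], rule conjI, simp, rule exI[of _ "2 * real Ex + 1"], rule conjI, linarith,
      intro allI impI)
    fix \<epsilon> C :: real
    assume eC: "0 < \<epsilon> \<and> \<epsilon> < 1 \<and> 2 * real Ex + 1 < C"
    then have \<epsilon>: "0 < \<epsilon>" and C: "2 * real Ex < C" "0 < C" by auto
    define \<Lambda>1 where "\<Lambda>1 = real ((d + 1) * m) powr \<epsilon> / (\<epsilon> * ln 2)"
    define \<Lambda> where "\<Lambda> = C0 + C1 + 6 + real (Suc d) + 2 * real ((d + 1) * m) + \<Lambda>1"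
    have \<Lambda>1: "0 \<le> \<Lambda>1" unfolding \<Lambda>1_def using \<epsilon> by (intro divide_nonneg_pos mult_pos_pos) auto
    note \<Lambda>s = \<Lambda>1 C0 C1_ge_1 dimension_ge_1[OF m, of d] of_nat_0_le_iff[of "Suc d", where 'a = real]
    have \<Lambda>: "C0 \<le> \<Lambda>" "C1 \<le> \<Lambda>" "6 \<le> \<Lambda>" "real (Suc d) \<le> \<Lambda>" "2 * real ((d + 1) * m) \<le> \<Lambda>" "\<Lambda>1 \<le> \<Lambda>"
      unfolding \<Lambda>_def using \<Lambda>s by linarith+
    define K1 where "K1 = K + \<Lambda> powr (\<alpha> / \<epsilon>)"
    have "1 \<le> \<Lambda> powr (\<alpha> / \<epsilon>)" using \<Lambda>(3) \<alpha> \<epsilon> by (intro ge_one_powr_ge_zero) auto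
    then have K1: "0 < K1" "1 \<le> K1" "K \<le> K1" "\<Lambda> powr (\<alpha> / \<epsilon>) \<le> K1" using K0 by (auto simp: K1_def)
    show "\<exists>K>0. \<forall>\<delta>. \<forall>\<Theta> \<subseteq> (unit_ball_Phi d m :: 'a mat set).
      0 < \<delta> \<and> \<delta> < 1 \<and> real (covering_number d m \<delta> \<Theta>) \<ge> \<delta> powr (- \<alpha>) \<longrightarrow>
      (\<exists>B \<in> sets borel. B \<subseteq> unit_ball_F \<and>
         emeasure \<mu> (unit_ball_F - B) \<le> ennreal (\<delta> powr \<epsilon>) \<and>
         (\<forall>r\<in>B. real (covering_number d m \<delta> (F r ` \<Theta>))
                   \<ge> \<delta> powr (- \<alpha> / real (d + 1) - \<epsilon>)))
      \<or>
      (\<exists>v V. representation_box d m v V \<and>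
         \<delta> powr (- \<alpha> + C * \<epsilon>) \<le> K * real (covering_number d m \<delta> V) \<and>
         real (covering_number d m \<delta> V) \<le> K * \<delta> powr (- \<alpha> - C * \<epsilon>) \<and>
         \<delta> powr (- \<alpha> + C * \<epsilon>)
           \<le> K * real (covering_number d m \<delta> (\<Theta> \<inter> Nhd d m (C * \<delta>) ((\<lambda>x. v + x) ` V))))"
    proof (intro exI[of _ K1] conjI allI impI, goal_cases)
      case 1
      show ?case by (rule K1(1))
    next
      case (2 \<delta> \<Theta>)
      have \<Theta>: "\<Theta> \<subseteq> unit_ball_Phi d m" by (rule 2(1))
      have \<delta>: "0 < \<delta>" "\<delta> < 1" and cov: "\<delta> powr (- \<alpha>) \<le> real (covering_number d m \<delta> \<Theta>)" using 2(2) by auto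
      have \<Theta>_Phi: "\<Theta> \<subseteq> Phi d m" using \<Theta> by (auto simp: unit_ball_Phi_def)
      have entry: "absval (x $$ (p, k)) \<le> 1" if x: "x \<in> \<Theta>" "p \<le> d" "k < m" for x p k
      proof -
        have "x \<in> carrier_mat (d + 1) m" "mat_norm x \<le> 1" using x(1) \<Theta> by (auto simp: unit_ball_Phi_def Phi_def)
        moreover from this(1) have "absval (x $$ (p, k)) \<le> mat_norm x" using x by (intro entry_le_mat_norm) auto
        ultimately show ?thesis by linarith
      qed
      have pos: "0 < \<delta> powr a" for a using \<delta> by simp
      have mono: "\<delta> powr b \<le> \<delta> powr a" if "a \<le> b" for a b using that \<delta> by (intro powr_mono') auto
      have C\<delta>: "0 < C * \<delta>" using C \<delta> by simp
      have "\<Theta> \<noteq> {}"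
      proof
        assume "\<Theta> = {}"
        then have "covering_number d m \<delta> \<Theta> \<le> card ({} :: 'a mat set)" by (intro covering_number_le) auto
        then show False using cov pos[of "- \<alpha>"] by simp
      qed
      then obtain v where v: "v \<in> \<Theta>" by blast
      show ?case
      proof (cases "\<delta> powr (- \<epsilon>) < \<Lambda>")
        case True
        obtain V where V: "representation_box d m v V" "covering_number d m \<delta> V = 1"
          "1 \<le> covering_number d m \<delta> (\<Theta> \<inter> Nhd d m (C * \<delta>) ((\<lambda>x. v + x) ` V))"
          using point_box[OF m \<Theta>_Phi v \<delta>(1) C\<delta> entry] by blast
        have "\<delta> powr (- \<alpha> + C * \<epsilon>) \<le> \<delta> powr (- \<alpha>)" using C \<epsilon> by (intro mono) auto
        also have "\<dots> = (\<delta> powr (- \<epsilon>)) powr (\<alpha> / \<epsilon>)" using \<epsilon> by (simp add: powr_powr)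
        also have "\<dots> \<le> \<Lambda> powr (\<alpha> / \<epsilon>)" using True \<alpha> \<epsilon> pos by (intro powr_mono2) auto
        also note K1(4)
        finally have 1: "\<delta> powr (- \<alpha> + C * \<epsilon>) \<le> K1" .
        have a2: "\<delta> powr (- \<alpha> + C * \<epsilon>) \<le> K1 * real (covering_number d m \<delta> V)" using 1 V(2) by simp
        have "0 < C * \<epsilon>" using C(2) \<epsilon> by simp
        then have "- \<alpha> - C * \<epsilon> \<le> 0" using \<alpha> by linarith
        then have "\<delta> powr 0 \<le> \<delta> powr (- \<alpha> - C * \<epsilon>)" by (rule mono)
        then have "1 * 1 \<le> K1 * \<delta> powr (- \<alpha> - C * \<epsilon>)" using K1 \<delta> by (intro mult_mono) auto
        then have a3: "real (covering_number d m \<delta> V) \<le> K1 * \<delta> powr (- \<alpha> - C * \<epsilon>)" using V(2) by simp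
        have "1 \<le> real (covering_number d m \<delta> (\<Theta> \<inter> Nhd d m (C * \<delta>) ((\<lambda>x. v + x) ` V)))" using V(3) by linarith
        then have "K1 * 1 \<le> K1 * real (covering_number d m \<delta> (\<Theta> \<inter> Nhd d m (C * \<delta>) ((\<lambda>x. v + x) ` V)))"
          using K1(1) by (intro mult_left_mono) simp_all
        then have a4: "\<delta> powr (- \<alpha> + C * \<epsilon>) \<le> K1 * real (covering_number d m \<delta> (\<Theta> \<inter> Nhd d m (C * \<delta>) ((\<lambda>x. v + x) ` V)))"
          using 1 by linarith
        show ?thesis by (rule disjI2, rule exI[of _ v], rule exI[of _ V]) (intro conjI V(1) a2 a3 a4)
      next
        case False
        then have big: "\<Lambda> \<le> \<delta> powr (- \<epsilon>)" by simp
        \<comment> \<open>The borderline size of a projection: its power \<open>d + 1\<close> is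
          \<open>\<delta> powr (- \<alpha>)\<close>, and the first alternative asks for the gain
          \<open>\<delta> powr (- \<epsilon>)\<close> over it.\<close>
        define n where "n = \<delta> powr (- \<alpha> / real (d + 1))"
        have n0: "0 < n" unfolding n_def by (rule pos)
        have "n ^ Suc d = n powr real (Suc d)" by (rule powr_realpow[OF n0, symmetric])
        also have "\<dots> = \<delta> powr (- \<alpha>)" unfolding n_def powr_powr by simp
        finally have n: "n ^ Suc d = \<delta> powr (- \<alpha>)" .
        have n\<epsilon>: "n * \<delta> powr (- \<epsilon>) = \<delta> powr (- \<alpha> / real (d + 1) - \<epsilon>)"
          unfolding n_def powr_add[symmetric] by simp
        show ?thesis
        proof (cases "\<exists>B \<in> sets borel. B \<subseteq> unit_ball_F \<and>
            emeasure \<mu> (unit_ball_F - B) \<le> ennreal (\<delta> powr \<epsilon>) \<and>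
            (\<forall>r\<in>B. real (covering_number d m \<delta> (F r ` \<Theta>)) \<ge> \<delta> powr (- \<alpha> / real (d + 1) - \<epsilon>))")
          case True
          then show ?thesis by (rule disjI1)
        next
          case no_good: False
          obtain X where X: "X \<subseteq> \<Theta>" "finite X" "\<And>x y. x \<in> X \<Longrightarrow> y \<in> X \<Longrightarrow> x \<noteq> y \<Longrightarrow> \<delta> < mat_norm (x - y)"
            "\<Theta> \<subseteq> (\<Union>c\<in>X. {x \<in> Phi d m. mat_norm (x - c) \<le> \<delta>})"
          proof (rule maximal_separated_matrices[OF \<Theta>_Phi m \<delta>(1) entry])
            fix X assume "X \<subseteq> \<Theta>" "finite X" "\<And>x y. x \<in> X \<Longrightarrow> y \<in> X \<Longrightarrow> x \<noteq> y \<Longrightarrow> \<delta> < mat_norm (x - y)"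
              "\<Theta> \<subseteq> (\<Union>c\<in>X. {x \<in> Phi d m. mat_norm (x - c) \<le> \<delta>})"
            then show thesis by (rule that)
          qed
          have X_Phi: "X \<subseteq> Phi d m" using X(1) \<Theta>_Phi by blast
          have "covering_number d m \<delta> \<Theta> \<le> card X" by (rule covering_number_le[OF X_Phi X(2,4)])
          then have nX: "n ^ Suc d \<le> real (card X)" using cov unfolding n by linarith
          have "\<exists>R. config {..<m} (\<delta> / real ((d + 1) * m)) (\<delta> powr (- (2 * \<epsilon>))) R (entries ` X) n"
          proof (rule config_at_small_scale[OF m haar vol \<epsilon> \<delta>, where F = F and E = \<Theta>])
            show "C0 \<le> \<delta> powr (- \<epsilon>)" "C1 \<le> \<delta> powr (- \<epsilon>)" "6 \<le> \<delta> powr (- \<epsilon>)" "real (Suc d) \<le> \<delta> powr (- \<epsilon>)"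
              "2 * real ((d + 1) * m) \<le> \<delta> powr (- \<epsilon>)"
              using \<Lambda>(1-5) big by linarith+
            show "real ((d + 1) * m) powr \<epsilon> / (\<epsilon> * ln 2) \<le> \<delta> powr (- \<epsilon>)"
              using \<Lambda>(6) big unfolding \<Lambda>1_def by (rule order_trans)
            show "F r x $$ (0, k) = pr r (entries x) k" if "x \<in> \<Theta>" "k < m" for r x k
              using F[of x k r] that \<Theta>_Phi by blast
            show "\<not> (\<exists>B\<in>sets borel. B \<subseteq> unit_ball_F \<and> emeasure \<mu> (unit_ball_F - B) \<le> ennreal (\<delta> powr \<epsilon>) \<and>
                (\<forall>r\<in>B. n * \<delta> powr (- \<epsilon>) \<le> real (covering_number d m \<delta> (F r ` \<Theta>))))"
              unfolding n\<epsilon> by (rule no_good)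
          qed (fact X(2) X(1) \<Theta>_Phi entry X(3) nX n0 F0 F_Phi | assumption)+
          then obtain R where "config {..<m} (\<delta> / real ((d + 1) * m)) (\<delta> powr (- (2 * \<epsilon>))) R (entries ` X) n" by blast
          then have bc: "box_concl {..<m} (\<delta> / real ((d + 1) * m)) ((\<delta> powr (- (2 * \<epsilon>))) ^ Ex) (entries ` X) n"
            using Ex by (metis card_lessThan)
          define M where "M = \<delta> powr (- (2 * real Ex * \<epsilon>))"
          have M0: "0 < M" unfolding M_def by (rule pos)
          have "(\<delta> powr (- (2 * \<epsilon>))) ^ Ex = (\<delta> powr (- (2 * \<epsilon>))) powr real Ex" by (rule powr_realpow[OF pos, symmetric])
          also have "\<dots> = M" unfolding M_def powr_powr by (simp add: mult_ac)
          finally have M: "(\<delta> powr (- (2 * \<epsilon>))) ^ Ex = M" .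
          have sepX: "\<forall>x\<in>X. \<forall>y\<in>X. x \<noteq> y \<longrightarrow> \<delta> < mat_norm (x - y)" using X(3) by blast
          have "\<exists>v V. representation_box d m v V \<and>
            n ^ Suc d \<le> K * M * real (covering_number d m \<delta> V) \<and>
            real (covering_number d m \<delta> V) \<le> K * M * n ^ Suc d \<and>
            (\<forall>\<eta> b. \<forall>E \<subseteq> Phi d m. 0 < \<eta> \<longrightarrow> X \<subseteq> E \<longrightarrow>
              (\<forall>x\<in>E. \<forall>p\<le>d. \<forall>k<m. absval (x $$ (p, k)) \<le> b) \<longrightarrow>
              n ^ Suc d \<le> K * M * real (covering_number d m \<delta> (E \<inter> Nhd d m \<eta> ((\<lambda>x. v + x) ` V))))"
            by (rule K[THEN spec, THEN spec, THEN spec, THEN spec, THEN mp, THEN mp, THEN mp, THEN mp, THEN mp, THEN mp,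
                OF \<delta>(1) M0 X(2) X_Phi sepX bc[unfolded M]])
          then obtain v V where V: "representation_box d m v V"
            "n ^ Suc d \<le> K * M * real (covering_number d m \<delta> V)"
            "real (covering_number d m \<delta> V) \<le> K * M * n ^ Suc d"
            "\<forall>\<eta> b. \<forall>E \<subseteq> Phi d m. 0 < \<eta> \<longrightarrow> X \<subseteq> E \<longrightarrow>
              (\<forall>x\<in>E. \<forall>p\<le>d. \<forall>k<m. absval (x $$ (p, k)) \<le> b) \<longrightarrow>
              n ^ Suc d \<le> K * M * real (covering_number d m \<delta> (E \<inter> Nhd d m \<eta> ((\<lambda>x. v + x) ` V)))"
            by (elim exE conjE) (rule that)
          have entries1: "\<forall>x\<in>\<Theta>. \<forall>p\<le>d. \<forall>k<m. absval (x $$ (p, k)) \<le> 1" using entry by blast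
          have V4: "n ^ Suc d \<le> K * M * real (covering_number d m \<delta> (\<Theta> \<inter> Nhd d m (C * \<delta>) ((\<lambda>x. v + x) ` V)))"
            by (rule V(4)[THEN spec, THEN spec, THEN spec, THEN mp, THEN mp, THEN mp, THEN mp, OF \<Theta>_Phi C\<delta> X(1) entries1])
          have CE: "2 * real Ex * \<epsilon> \<le> C * \<epsilon>" using C \<epsilon> by (intro mult_right_mono) auto
          have low: "\<delta> powr (- \<alpha> + C * \<epsilon>) \<le> K1 * real N" if N: "n ^ Suc d \<le> K * M * real N" for N
          proof -
            have "\<delta> powr (- \<alpha> + C * \<epsilon>) \<le> \<delta> powr (- \<alpha> + 2 * real Ex * \<epsilon>)" using CE by (intro mono) simp
            also have "\<dots> = n ^ Suc d * \<delta> powr (2 * real Ex * \<epsilon>)" unfolding n by (rule powr_add)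
            also have "\<dots> \<le> (K * M * real N) * \<delta> powr (2 * real Ex * \<epsilon>)" using N pos[of "2 * real Ex * \<epsilon>"] by (intro mult_right_mono) auto
            also have "\<dots> = K * real N * (M * \<delta> powr (2 * real Ex * \<epsilon>))" by (simp only: mult_ac)
            also have "M * \<delta> powr (2 * real Ex * \<epsilon>) = 1" unfolding M_def powr_add[symmetric] using \<delta> by simp
            also have "K * real N * 1 \<le> K1 * real N" using K1(3) by (simp add: mult_right_mono)
            finally show ?thesis .
          qed
          have "K * M * n ^ Suc d = K * \<delta> powr (- (2 * real Ex * \<epsilon>) + - \<alpha>)"
            unfolding n M_def powr_add by (simp only: mult_ac)
          also have "\<dots> \<le> K1 * \<delta> powr (- \<alpha> - C * \<epsilon>)"
            using K1 CE K0 pos by (intro mult_mono mono) (auto intro: less_imp_le)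
          finally have a3: "real (covering_number d m \<delta> V) \<le> K1 * \<delta> powr (- \<alpha> - C * \<epsilon>)" using V(3) by linarith
          show ?thesis by (rule disjI2, rule exI[of _ v], rule exI[of _ V]) (intro conjI V(1) low[OF V(2)] a3 low[OF V4])
        qed
      qed
    qed
  qed
qed

end

theorem theorem2p1:
  fixes d m :: nat
    and \<alpha> :: real
    and \<mu> :: "'a::local_field_char_0 measure"
    and \<rho> :: "'a mat \<Rightarrow> 'a mat"
  assumes "d \<ge> 1" and "m \<ge> 1"
    and "haar_measure \<mu>"
    and "standard_irrep d \<rho>"
    and "0 < \<alpha>" and "\<alpha> < real (m * (d + 1))"
  shows "\<exists>\<epsilon>\<^sub>0>0. \<exists>C\<^sub>0>0. \<forall>\<epsilon> C. 0 < \<epsilon> \<and> \<epsilon> < \<epsilon>\<^sub>0 \<and> C > C\<^sub>0 \<longrightarrow>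
    (\<exists>K>0. \<forall>\<delta>. \<forall>\<Theta> \<subseteq> (unit_ball_Phi d m :: 'a mat set).
      0 < \<delta> \<and> \<delta> < 1 \<and> real (covering_number d m \<delta> \<Theta>) \<ge> \<delta> powr (- \<alpha>) \<longrightarrow>
      (\<exists>B \<in> sets borel. B \<subseteq> unit_ball_F \<and>
         emeasure \<mu> (unit_ball_F - B) \<le> ennreal (\<delta> powr \<epsilon>) \<and>
         (\<forall>r\<in>B. real (covering_number d m \<delta> (pi_plus d m ` u_act \<rho> r ` \<Theta>))
                   \<ge> \<delta> powr (- \<alpha> / real (d + 1) - \<epsilon>)))
      \<or>
      (\<exists>v V. representation_box d m v V \<and>
         \<delta> powr (- \<alpha> + C * \<epsilon>) \<le> K * real (covering_number d m \<delta> V) \<and>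
         real (covering_number d m \<delta> V) \<le> K * \<delta> powr (- \<alpha> - C * \<epsilon>) \<and>
         \<delta> powr (- \<alpha> + C * \<epsilon>)
           \<le> K * real (covering_number d m \<delta> (\<Theta> \<inter> Nhd d m (C * \<delta>) ((\<lambda>x. v + x) ` V)))))"
proof -
  have m: "0 < m" using assms(2) by simp
  obtain D C0 where D: "0 < D" and C0: "1 \<le> C0"
    and vol: "\<forall>\<sigma>. 0 < \<sigma> \<and> \<sigma> \<le> 1 \<longrightarrow> \<sigma> powr D / C0 \<le> volume \<mu> \<sigma> \<and> volume \<mu> \<sigma> \<le> C0 * \<sigma> powr D"
    using volume_growth[OF assms(3)] by (elim exE conjE) (rule that)
  obtain c where c0: "\<forall>p\<le>d. c p \<noteq> 0" and c: "\<forall>r. \<forall>p\<le>d. \<rho> (upper_unip r) $$ (0, p) = c p * r ^ p"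
    using standard_irrep_first_row[OF assms(4)] by (elim exE conjE) (rule that)
  define S1 where "S1 = (\<Sum>p\<le>d. absval (c p))"
  define S2 where "S2 = (\<Sum>p\<le>d. 1 / absval (c p))"
  \<comment> \<open>One constant for three purposes: the packing bound, and the upper and lower
    bounds for the coefficients \<open>c p\<close>.\<close>
  define C1 where "C1 = C0\<^sup>2 * 3 powr D + S1 + S2"
  have S: "0 \<le> S1" "0 \<le> S2" unfolding S1_def S2_def by (auto intro!: sum_nonneg)
  have "1 \<le> 3 powr D" using D by (intro ge_one_powr_ge_zero) auto
  then have "1 * 1 \<le> C0\<^sup>2 * 3 powr D" using C0 one_le_power[OF C0, of 2] by (intro mult_mono) auto
  then have C1: "1 \<le> C1" "C0\<^sup>2 * 3 powr D \<le> C1" "S1 \<le> C1" "S2 \<le> C1" using S by (auto simp: C1_def)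
  have cpos: "0 < absval (c p)" if "p \<le> d" for p
  proof -
    have "absval (c p) \<noteq> 0" using c0 that by (simp add: absval_eq_0_iff)
    then show ?thesis using absval_nonneg[of "c p"] by linarith
  qed
  have "moment_curve D C1 (nat \<lceil>D\<rceil>) (nat \<lceil>5 / D\<rceil>) d c"
  proof
    show "0 < D" by (rule D)
    show "D \<le> real (nat \<lceil>D\<rceil>)" by (rule real_nat_ceiling_ge)
    show "5 \<le> real (nat \<lceil>5 / D\<rceil>) * D"
      using real_nat_ceiling_ge[of "5 / D"] unfolding pos_divide_le_eq[OF D] .
    show "1 \<le> C1" by (rule C1(1))
    show "1 \<le> d" by (rule assms(1))
    show "absval (c p) \<le> C1" if "p \<le> d" for p
      using member_le_sum[of p "{..d}" "\<lambda>p. absval (c p)"] that C1(3) by (simp add: S1_def)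
    show "1 \<le> C1 * absval (c p)" if "p \<le> d" for p
    proof -
      have "1 / absval (c p) \<le> C1"
        using member_le_sum[of p "{..d}" "\<lambda>p. 1 / absval (c p)"] that C1(4) by (simp add: S2_def)
      then show ?thesis using cpos[OF that] by (simp add: divide_le_eq)
    qed
    fix e \<sigma> x0 and E :: "'a set"
    assume E: "0 < e" "e \<le> \<sigma>" "finite E" "\<And>x. x \<in> E \<Longrightarrow> absval (x - x0) \<le> \<sigma>"
      "\<And>x y. x \<in> E \<Longrightarrow> y \<in> E \<Longrightarrow> x \<noteq> y \<Longrightarrow> e < absval (x - y)"
    have "real (card E) \<le> C0\<^sup>2 * 3 powr D * (\<sigma> / e) powr D"
    proof (rule packing_growth[where ?x0.0 = x0, OF assms(3) D C0])
      show "\<tau> powr D / C0 \<le> volume \<mu> \<tau> \<and> volume \<mu> \<tau> \<le> C0 * \<tau> powr D" if "0 < \<tau>" "\<tau> \<le> 1" for \<tau>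
        using vol that by blast
    qed (use E in blast)+
    also have "\<dots> \<le> C1 * (\<sigma> / e) powr D" using C1(2) by (intro mult_right_mono) auto
    finally show "real (card E) \<le> C1 * (\<sigma> / e) powr D" .
  qed
  then interpret moment_curve D C1 "nat \<lceil>D\<rceil>" "nat \<lceil>5 / D\<rceil>" d c .
  let ?F = "\<lambda>r x. pi_plus d m (u_act \<rho> r x)"
  have car: "\<rho> (upper_unip r) \<in> carrier_mat (d + 1) (d + 1)" for r
  proof -
    have "SL2_representation (d + 1) \<rho>"
      using assms(4) unfolding standard_irrep_def irreducible_SL2_representation_def by (elim conjE)
    then have "\<forall>g\<in>SL2. \<rho> g \<in> carrier_mat (d + 1) (d + 1)"
      unfolding SL2_representation_def by (elim conjE)
    then show ?thesis using upper_unip_in_SL2 by (rule bspec)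
  qed
  have vol': "volume \<mu> \<sigma> \<le> C0 * \<sigma> powr D" if "0 < \<sigma>" "\<sigma> \<le> 1" for \<sigma> using vol that by blast
  have F: "?F r x $$ (0, k) = pr r (entries x) k" if x: "x \<in> Phi d m" "k < m" for r x k
    unfolding pr_def by (rule pi_plus_u_act_entry[where c = c and \<rho> = \<rho>, OF _ car x]) (use c in blast)
  have F0: "?F r x $$ (p, k) = 0" if "0 < p" "p \<le> d" "k < m" for r x p k
    using that by (simp add: pi_plus_def)
  have F_Phi: "?F r x \<in> Phi d m" for r x by (simp add: pi_plus_def Phi_def)
  show ?thesis
    using dichotomy[OF m assms(3) C0 vol' F F0 F_Phi assms(5)] unfolding image_image .
qed

end
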